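(* The algebra $(U(\mathfrak{g})\otimes C(\mathfrak{p}))^{K}$ of $K$-invariants in $U(\mathfrak{g})\otimes C(\mathfrak{p})$, for $G=SO_e(4,1)$, is generated (as a unital associative $\mathbb{C}$-algebra) by the elements $\rho(a_1)$, $\rho(a_2)$, $\rho(i)\in C(\mathfrak{p})^{K}$ (identified with $1\otimes C(\mathfrak{p})^K$), $D$ and $D_{\mathfrak{k}}$.
   Context: Setting. Let $\gamma=\mathrm{diag}(1,1,1,1,-1)$, let $G=SO_e(4,1)$ be the identity component of $\{g\in GL(5,\mathbb{R}) : \det g=1,\ g^{\tau}\gamma g=\gamma\}$ ($\tau$ on matrices denotes transpose), with maximal compact subgroup $K=S(O(4)\times O(1))_e\cong SO(4)$. Let $\mathfrak{g}_0=\mathfrak{so}(4,1)=\{x\in\mathfrak{gl}(5,\mathbb{R}) : x^{\tau}=-\gamma x\gamma\}$, and $\mathfrak{g}=\mathfrak{so}(5,\mathbb{C})$ its complexification. Let $e_{jk}$ be the $5\times5$ matrix units and $\mathbf{i}=\sqrt{-1}$. A basis of $\mathfrak{g}$ is: $H_1=\mathbf{i}e_{12}-\mathbf{i}e_{21}$, $H_2=\mathbf{i}e_{34}-\mathbf{i}e_{43}$, $E_1=\frac12(e_{13}-e_{24}-\mathbf{i}e_{23}-\mathbf{i}e_{14}-e_{31}+e_{42}+\mathbf{i}e_{32}+\mathbf{i}e_{41})$, $E_2=\frac12(e_{13}+e_{24}-\mathbf{i}e_{23}+\mathbf{i}e_{14}-e_{31}-e_{42}+\mathbf{i}e_{32}-\mathbf{i}e_{41})$,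 $F_1=-\frac12(e_{13}-e_{24}+\mathbf{i}e_{23}+\mathbf{i}e_{14}-e_{31}+e_{42}-\mathbf{i}e_{32}-\mathbf{i}e_{41})$, $F_2=-\frac12(e_{13}+e_{24}+\mathbf{i}e_{23}-\mathbf{i}e_{14}-e_{31}-e_{42}-\mathbf{i}e_{32}+\mathbf{i}e_{41})$, $E_3=e_{15}-\mathbf{i}e_{25}+e_{51}-\mathbf{i}e_{52}$, $E_4=e_{35}-\mathbf{i}e_{45}+e_{53}-\mathbf{i}e_{54}$, $F_3=e_{15}+\mathbf{i}e_{25}+e_{51}+\mathbf{i}e_{52}$, $F_4=e_{35}+\mathbf{i}e_{45}+e_{53}+\mathbf{i}e_{54}$. The Cartan decomposition with respect to $\theta(X)=-X^{\tau}$ is $\mathfrak{g}=\mathfrak{k}\oplus\mathfrak{p}$ with $\mathfrak{k}=\mathrm{span}\{H_1,H_2,E_1,E_2,F_1,F_2\}$ and $\mathfrak{p}=\mathrm{span}\{E_3,E_4,F_3,F_4\}$. Algebras. $U(\mathfrak{g})$ is the universal enveloping algebra and $S(\mathfrak{g})$ the symmetric algebra of $\mathfrak{g}$. $B(X,Y)=\mathrm{tr}(XY)$ is the trace form, and $C(\mathfrak{p})$ is the (complex) Clifford algebra of $\mathfrak{p}$ with respect to $B$, with relations $vw+wv=-2B(v,w)$ for $v,w\in\mathfrak{p}$. $K$ acts on $U(\mathfrak{g})\otimes C(\mathfrak{p})$ and $S(\mathfrak{g})\otimes\bigwedge(\mathfrak{p})$ by the adjoint action on both factors; a superscript $K$ denotes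 invariants. Maps. $\sigma:S(\mathfrak{g})\to U(\mathfrak{g})$ is the symmetrization map $\sigma(x_1\cdots x_n)=\frac1{n!}\sum_{\alpha\in S_n}x_{\alpha(1)}\cdots x_{\alpha(n)}$; $\tau:\bigwedge(\mathfrak{p})\to C(\mathfrak{p})$ is the Chevalley map $\tau(v_1\wedge\cdots\wedge v_n)=\frac1{n!}\sum_{\alpha\in S_n}\mathrm{sgn}(\alpha)v_{\alpha(1)}\cdots v_{\alpha(n)}$; $\rho=\sigma\otimes\tau$. Elements. In $S(\mathfrak{g})\otimes\bigwedge(\mathfrak{p})$ (with $S(\mathfrak{g})$ identified with $S(\mathfrak{g})\otimes1$): $a_1=(H_1+H_2)^2+4E_1F_1$, $a_2=(H_1-H_2)^2+4E_2F_2$, and $i=1\otimes E_3\wedge E_4\wedge F_3\wedge F_4$. The Dirac operator is $D=E_3\otimes F_3+E_4\otimes F_4+F_3\otimes E_3+F_4\otimes E_4\in U(\mathfrak{g})\otimes C(\mathfrak{p})$. Let $\alpha:\mathfrak{k}\to C(\mathfrak{p})$ be the composition of $\mathrm{ad}:\mathfrak{k}\to\mathfrak{so}(\mathfrak{p})$ with the standard embedding $\mathfrak{so}(\mathfrak{p})\cong\tau(\bigwedge^2\mathfrak{p})\subset C(\mathfrak{p})$; that is, $\alpha(X)$ is the unique element of $\tau(\bigwedge^2\mathfrak{p})$ with $\alpha(X)v-v\alpha(X)=[X,v]$ for all $v\in\mathfrak{p}$. The $\mathfrak{k}$-Dirac operator is $$D_{\mathfrak{k}}=E_1\otimes\alpha(2F_1)+E_2\otimes\alpha(2F_2)+F_1\otimes\alpha(2E_1)+F_2\otimes\alpha(2E_2)+(H_1-H_2)\otimes\alpha(H_1-H_2)+(H_1+H_2)\otimes\alpha(H_1+H_2)\in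 U(\mathfrak{g})\otimes C(\mathfrak{p}).$$ *)

theory Defs
  imports "HOL-Analysis.Analysis" "HOL-Library.Poly_Mapping"
begin

section \<open>Complex vector spaces and algebras\<close>

class complex_space = ab_group_add +
  fixes scaleC :: "complex \<Rightarrow> 'a \<Rightarrow> 'a"  (infixr \<open>*\<^sub>C\<close> 75)
  assumes scaleC_add_right: "c *\<^sub>C (x + y) = c *\<^sub>C x + c *\<^sub>C y"
    and scaleC_add_left: "(c + d) *\<^sub>C x = c *\<^sub>C x + d *\<^sub>C x"
    and scaleC_scaleC: "c *\<^sub>C d *\<^sub>C x = (c * d) *\<^sub>C x"
    and scaleC_one: "1 *\<^sub>C x = x"

global_interpretation complex_space: vector_space "scaleC :: complex \<Rightarrow> 'a \<Rightarrow> 'a::complex_space"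
  by unfold_locales (simp_all add: scaleC_add_right scaleC_add_left scaleC_scaleC scaleC_one)

abbreviation clinear :: "('a::complex_space \<Rightarrow> 'b::complex_space) \<Rightarrow> bool" where
  "clinear \<equiv> Vector_Spaces.linear scaleC scaleC"

lemma clinearI:
  assumes "\<And>x y. f (x + y) = f x + f y" and "\<And>c x. f (c *\<^sub>C x) = c *\<^sub>C f x"
  shows "clinear f"
  using assms by unfold_locales auto

lemma clinear_add: "clinear f \<Longrightarrow> f (x + y) = f x + f y"
  by (simp add: Vector_Spaces.linear_iff)

lemma clinear_scaleC: "clinear f \<Longrightarrow> f (c *\<^sub>C x) = c *\<^sub>C f x"
  by (simp add: Vector_Spaces.linear_iff)

text \<open>Unital associative algebras. The library class \<^class>\<open>ring_1\<close> is not used because it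
  would require \<open>0 \<noteq> 1\<close>, which is not part of the definition.\<close>

class complex_alg = complex_space + ring + monoid_mult +
  assumes scaleC_mult_left: "(c *\<^sub>C x) * y = c *\<^sub>C (x * y)"
    and scaleC_mult_right: "x * (c *\<^sub>C y) = c *\<^sub>C (x * y)"

definition unital_subalgebra :: "'a::complex_alg set \<Rightarrow> bool" where
  "unital_subalgebra A \<longleftrightarrow> 1 \<in> A \<and>
     (\<forall>x\<in>A. \<forall>y\<in>A. x + y \<in> A \<and> x * y \<in> A) \<and> (\<forall>c. \<forall>x\<in>A. c *\<^sub>C x \<in> A)"

abbreviation generated_subalgebra :: "'a::complex_alg set \<Rightarrow> 'a set" where
  "generated_subalgebra S \<equiv> unital_subalgebra hull S"

class complex_lie_alg = complex_space +
  fixes lie_bracket :: "'a \<Rightarrow> 'a \<Rightarrow> 'a"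
  assumes lie_bracket_add_left: "lie_bracket (x + y) z = lie_bracket x z + lie_bracket y z"
    and lie_bracket_scaleC_left: "lie_bracket (c *\<^sub>C x) z = c *\<^sub>C lie_bracket x z"
    and lie_bracket_add_right: "lie_bracket z (x + y) = lie_bracket z x + lie_bracket z y"
    and lie_bracket_scaleC_right: "lie_bracket z (c *\<^sub>C x) = c *\<^sub>C lie_bracket z x"
    and lie_bracket_self: "lie_bracket x x = 0"
    and lie_bracket_jacobi: "lie_bracket x (lie_bracket y z) + lie_bracket y (lie_bracket z x)
           + lie_bracket z (lie_bracket x y) = 0"

class complex_bilinear_space = complex_space +
  fixes bform :: "'a \<Rightarrow> 'a \<Rightarrow> complex"
  assumes bform_add_left: "bform (x + y) z = bform x z + bform y z"
    and bform_scaleC_left: "bform (c *\<^sub>C x) z = c * bform x z"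
    and bform_sym: "bform x y = bform y x"


section \<open>Presented algebras\<close>

text \<open>The algebras below are quotients of monoid algebras: for a monoid \<open>M\<close> the type
  \<open>M \<Rightarrow>\<^sub>0 complex\<close> of finitely supported functions, with convolution, is the algebra
  \<open>\<complex>[M]\<close>; \<^term>\<open>Poly_Mapping.single m 1\<close> is the basis element \<open>m\<close>, and
  \<^term>\<open>Poly_Mapping.single 0 c\<close> is the scalar \<open>c\<close>. The library writes the monoid operation
  additively, although the monoids used here are not commutative.\<close>

abbreviation basis :: "'m \<Rightarrow> ('m \<Rightarrow>\<^sub>0 complex)" where
  "basis m \<equiv> Poly_Mapping.single m 1"

abbreviation scalar :: "complex \<Rightarrow> ('m::monoid_add \<Rightarrow>\<^sub>0 complex)" where
  "scalar c \<equiv> Poly_Mapping.single 0 c"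

definition two_sided_ideal :: "'r::ring_1 set \<Rightarrow> bool" where
  "two_sided_ideal I \<longleftrightarrow> 0 \<in> I \<and> (\<forall>x\<in>I. \<forall>y\<in>I. x + y \<in> I) \<and>
     (\<forall>x\<in>I. \<forall>a. a * x \<in> I \<and> x * a \<in> I)"

definition ideal_cong :: "'r::ring_1 set \<Rightarrow> 'r \<Rightarrow> 'r \<Rightarrow> bool" where
  "ideal_cong R x y \<longleftrightarrow> x - y \<in> two_sided_ideal hull R"

lemma two_sided_ideal_hull: "two_sided_ideal (two_sided_ideal hull R)"
  by (rule hull_in) (auto simp: two_sided_ideal_def)

lemma hull_ideal:
  shows hull_ideal_0: "0 \<in> two_sided_ideal hull R"
    and hull_ideal_add: "x \<in> two_sided_ideal hull R \<Longrightarrow> y \<in> two_sided_ideal hull R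
           \<Longrightarrow> x + y \<in> two_sided_ideal hull R"
    and hull_ideal_mult_left: "x \<in> two_sided_ideal hull R \<Longrightarrow> a * x \<in> two_sided_ideal hull R"
    and hull_ideal_mult_right: "x \<in> two_sided_ideal hull R \<Longrightarrow> x * a \<in> two_sided_ideal hull R"
  using two_sided_ideal_hull[of R] by (auto simp: two_sided_ideal_def)

lemma hull_ideal_uminus: "x \<in> two_sided_ideal hull R \<Longrightarrow> - x \<in> two_sided_ideal hull R"
  using hull_ideal_mult_left[of x R "-1"] by simp

lemma ideal_cong_refl: "ideal_cong R x x"
  by (simp add: ideal_cong_def hull_ideal_0)

lemma ideal_cong_rel: "x - y \<in> R \<Longrightarrow> ideal_cong R x y"
  by (simp add: ideal_cong_def hull_inc)

lemma ideal_cong_uminus: "ideal_cong R x y \<Longrightarrow> ideal_cong R (- x) (- y)"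
  unfolding ideal_cong_def using hull_ideal_uminus[of "x - y" R] by (simp add: algebra_simps)

lemma ideal_cong_add: "ideal_cong R x y \<Longrightarrow> ideal_cong R x' y' \<Longrightarrow> ideal_cong R (x + x') (y + y')"
  unfolding ideal_cong_def using hull_ideal_add[of "x - y" R "x' - y'"] by (simp add: algebra_simps)

lemma ideal_cong_diff: "ideal_cong R x y \<Longrightarrow> ideal_cong R x' y' \<Longrightarrow> ideal_cong R (x - x') (y - y')"
  using ideal_cong_add[OF _ ideal_cong_uminus, of R x y x' y'] by simp

lemma ideal_cong_mult:
  assumes "ideal_cong R x y" "ideal_cong R x' y'"
  shows "ideal_cong R (x * x') (y * y')"
proof -
  have "x * x' - y * y' = (x - y) * x' + y * (x' - y')" by (simp add: algebra_simps)
  then show ?thesis using assms unfolding ideal_cong_def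
    by (simp add: hull_ideal_add hull_ideal_mult_left hull_ideal_mult_right)
qed

lemma ideal_cong_mult_left: "ideal_cong R x y \<Longrightarrow> ideal_cong R (a * x) (a * y)"
  by (rule ideal_cong_mult[OF ideal_cong_refl])

lemma equivp_ideal_cong: "equivp (ideal_cong R)"
proof (rule equivpI)
  show "reflp (ideal_cong R)" by (simp add: reflp_def ideal_cong_refl)
  show "symp (ideal_cong R)"
    unfolding symp_def ideal_cong_def using hull_ideal_uminus by fastforce
  show "transp (ideal_cong R)"
    unfolding transp_def ideal_cong_def using hull_ideal_add by fastforce
qed

lemma scalar_add: "scalar (c + d) = scalar c + scalar d"
  by (simp add: single_add)

lemma scalar_mult: "scalar c * (scalar d * x) = scalar (c * d) * x"
  by (simp add: mult.assoc[symmetric] mult_single)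

lemma poly_mapping_sum: "(x :: 'm \<Rightarrow>\<^sub>0 complex) = (\<Sum>m\<in>Poly_Mapping.keys x. Poly_Mapping.single m (Poly_Mapping.lookup x m))"
  by (rule poly_mapping_eqI) (simp add: lookup_sum lookup_single when_def in_keys_iff)

lemma scalar_central: "x * scalar c = scalar c * (x :: 'm::monoid_add \<Rightarrow>\<^sub>0 complex)"
proof -
  have "(\<Sum>m\<in>Poly_Mapping.keys x. Poly_Mapping.single m (Poly_Mapping.lookup x m)) * scalar c =
        scalar c * (\<Sum>m\<in>Poly_Mapping.keys x. Poly_Mapping.single m (Poly_Mapping.lookup x m))"
    by (simp add: sum_distrib_left sum_distrib_right mult_single mult.commute)
  then show ?thesis by (simp flip: poly_mapping_sum)
qed

lemma scalar_mult_right: "x * (scalar c * y) = scalar c * (x * (y :: 'm::monoid_add \<Rightarrow>\<^sub>0 complex))"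
  by (metis mult.assoc scalar_central)

lemma lookup_scalar_mult: "Poly_Mapping.lookup (scalar c * x) m = c * Poly_Mapping.lookup (x :: 'm::monoid_add \<Rightarrow>\<^sub>0 complex) m"
  by (simp add: mult_map_scale_conv_mult[symmetric] Poly_Mapping.map.rep_eq when_def)

lemmas presented_simps = algebra_simps scalar_add scalar_mult ideal_cong_refl

text \<open>Linear extension of a function on the monoid.\<close>

definition lin_ext :: "('m \<Rightarrow> 'a::complex_space) \<Rightarrow> ('m \<Rightarrow>\<^sub>0 complex) \<Rightarrow> 'a" where
  "lin_ext h x = (\<Sum>m\<in>Poly_Mapping.keys x. Poly_Mapping.lookup x m *\<^sub>C h m)"

lemma lin_ext_superset:
  assumes "finite A" "Poly_Mapping.keys x \<subseteq> A"
  shows "lin_ext h x = (\<Sum>m\<in>A. Poly_Mapping.lookup x m *\<^sub>C h m)"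
  unfolding lin_ext_def using assms by (intro sum.mono_neutral_left) (auto simp: in_keys_iff)

lemma lin_ext_0: "lin_ext h 0 = 0"
  by (simp add: lin_ext_def)

lemma lin_ext_single: "lin_ext h (Poly_Mapping.single m c) = c *\<^sub>C h m"
  by (subst lin_ext_superset[where A = "{m}"]) auto

lemma lin_ext_one: "lin_ext h 1 = h 0"
  by (simp add: lin_ext_single scaleC_one flip: single_one)

lemma lin_ext_add: "lin_ext h (x + y) = lin_ext h x + lin_ext h y"
proof -
  let ?A = "Poly_Mapping.keys x \<union> Poly_Mapping.keys y"
  have "lin_ext h (x + y) = (\<Sum>m\<in>?A. Poly_Mapping.lookup (x + y) m *\<^sub>C h m)"
    using Poly_Mapping.keys_add[of x y] by (intro lin_ext_superset) auto
  also have "\<dots> = (\<Sum>m\<in>?A. Poly_Mapping.lookup x m *\<^sub>C h m) + (\<Sum>m\<in>?A. Poly_Mapping.lookup y m *\<^sub>C h m)"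
    by (simp add: lookup_add scaleC_add_left sum.distrib)
  also have "\<dots> = lin_ext h x + lin_ext h y"
    by (subst (1 2) lin_ext_superset[where A = ?A]) auto
  finally show ?thesis .
qed

lemma lin_ext_scalar: "lin_ext h (scalar c * x) = c *\<^sub>C lin_ext h (x :: 'm::monoid_add \<Rightarrow>\<^sub>0 complex)"
proof -
  have "Poly_Mapping.keys (scalar c * x) \<subseteq> Poly_Mapping.keys x" by (auto simp: in_keys_iff lookup_scalar_mult)
  then have "lin_ext h (scalar c * x) = (\<Sum>m\<in>Poly_Mapping.keys x. Poly_Mapping.lookup (scalar c * x) m *\<^sub>C h m)"
    by (intro lin_ext_superset) auto
  then show ?thesis
    by (simp add: lookup_scalar_mult lin_ext_def complex_space.scale_sum_right)
qed

lemma lin_ext_uminus: "lin_ext h (- x) = - lin_ext h x"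
  using lin_ext_add[of h x "- x"] by (simp add: lin_ext_0 eq_neg_iff_add_eq_0 add.commute)

lemma lin_ext_diff: "lin_ext h (x - y) = lin_ext h x - lin_ext h y"
  using lin_ext_add[of h x "- y"] by (simp add: lin_ext_uminus)

lemma lin_ext_sum: "lin_ext h (sum f A) = (\<Sum>a\<in>A. lin_ext h (f a))"
  by (induction A rule: infinite_finite_induct) (auto simp: lin_ext_0 lin_ext_add)

text \<open>A linear map that kills all \<open>u r v\<close> with \<open>r\<close> a relator and \<open>u\<close>, \<open>v\<close> monoid
  elements descends to the quotient.\<close>

lemma lin_ext_hull_eq_0:
  assumes R: "\<And>u v r. r \<in> R \<Longrightarrow> lin_ext h (basis u * r * basis v) = 0"
    and x: "x \<in> two_sided_ideal hull R"
  shows "lin_ext h x = 0"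
proof -
  let ?I = "{x. \<forall>u v. lin_ext h (basis u * x * basis v) = 0}"
  have "a * y \<in> ?I \<and> y * a \<in> ?I" if y: "y \<in> ?I" for y a
  proof -
    have "lin_ext h (basis u * (a * y) * basis v) = 0" for u v
    proof -
      have "basis u * a = (\<Sum>m\<in>Poly_Mapping.keys a. scalar (Poly_Mapping.lookup a m) * basis (u + m))"
        by (subst poly_mapping_sum[of a]) (simp add: sum_distrib_left mult_single)
      then have "basis u * (a * y) * basis v =
          (\<Sum>m\<in>Poly_Mapping.keys a. scalar (Poly_Mapping.lookup a m) * (basis (u + m) * y * basis v))"
        by (simp only: mult.assoc[symmetric] sum_distrib_right)
      then show ?thesis using y by (simp add: lin_ext_sum lin_ext_scalar)
    qed
    moreover have "lin_ext h (basis u * (y * a) * basis v) = 0" for u v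
    proof -
      have "a * basis v = (\<Sum>m\<in>Poly_Mapping.keys a. scalar (Poly_Mapping.lookup a m) * basis (m + v))"
        by (subst poly_mapping_sum[of a]) (simp add: sum_distrib_right mult_single)
      then have "basis u * (y * a) * basis v = basis u * y *
          (\<Sum>m\<in>Poly_Mapping.keys a. scalar (Poly_Mapping.lookup a m) * basis (m + v))"
        by (simp only: mult.assoc)
      then have "basis u * (y * a) * basis v =
          (\<Sum>m\<in>Poly_Mapping.keys a. scalar (Poly_Mapping.lookup a m) * (basis u * y * basis (m + v)))"
        by (simp only: sum_distrib_left scalar_mult_right)
      then show ?thesis using y by (simp add: lin_ext_sum lin_ext_scalar)
    qed
    ultimately show ?thesis by blast
  qed
  then have "two_sided_ideal ?I"
    by (auto simp: two_sided_ideal_def lin_ext_0 lin_ext_add distrib_left distrib_right)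
  with R have "two_sided_ideal hull R \<subseteq> ?I" by (intro hull_minimal) auto
  with x have "lin_ext h (basis 0 * x * basis 0) = 0" by blast
  then show ?thesis by simp
qed

lemma lin_ext_cong:
  assumes "\<And>u v r. r \<in> R \<Longrightarrow> lin_ext h (basis u * r * basis v) = 0" and "ideal_cong R x y"
  shows "lin_ext h x = lin_ext h y"
  using lin_ext_hull_eq_0[of R h "x - y"] assms by (simp add: ideal_cong_def lin_ext_diff)


section \<open>Algebras presented by the vectors of a vector space\<close>

text \<open>Words in a set of letters, i.e. the free monoid with concatenation as \<open>+\<close>.\<close>

datatype 'v word = Word (letters: "'v list")

instantiation word :: (type) monoid_add
begin
definition zero_word :: "'a word" where "0 = Word []"
definition plus_word :: "'a word \<Rightarrow> 'a word \<Rightarrow> 'a word" where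
  "u + v = Word (letters u @ letters v)"
instance by intro_classes (simp_all add: zero_word_def plus_word_def)
end

lemma letters_simps [simp]: "letters 0 = []" "letters (u + v) = letters u @ letters v"
  by (simp_all add: zero_word_def plus_word_def)

abbreviation letter :: "'v \<Rightarrow> ('v word \<Rightarrow>\<^sub>0 complex)" where
  "letter v \<equiv> basis (Word [v])"

text \<open>Modulo these relators alone, the free algebra on the set of vectors is the tensor algebra.\<close>

definition linear_relators :: "('v::complex_space word \<Rightarrow>\<^sub>0 complex) set" where
  "linear_relators = {letter (x + y) - letter x - letter y |x y. True} \<union>
     {letter (c *\<^sub>C x) - scalar c * letter x |c x. True}"

lemma lin_ext_linear_relator:
  assumes r: "r \<in> linear_relators"
    and add: "\<And>us vs x y. h (Word (us @ (x + y) # vs)) = h (Word (us @ x # vs)) + h (Word (us @ y # vs))"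
    and scale: "\<And>us vs c x. h (Word (us @ (c *\<^sub>C x) # vs)) = c *\<^sub>C h (Word (us @ x # vs))"
  shows "lin_ext h (basis u * r * basis v) = 0"
  using r unfolding linear_relators_def
  by (auto simp: left_diff_distrib right_diff_distrib mult_single lin_ext_diff lin_ext_single
      plus_word_def add scale scaleC_one)

lemma prod_list_linear:
  fixes f :: "'v::complex_space \<Rightarrow> 'a::complex_alg"
  assumes "clinear f"
  shows "prod_list (map f (us @ (x + y) # vs)) = prod_list (map f (us @ x # vs)) + prod_list (map f (us @ y # vs))"
    and "prod_list (map f (us @ (c *\<^sub>C x) # vs)) = c *\<^sub>C prod_list (map f (us @ x # vs))"
  using assms
  by (simp_all add: clinear_add clinear_scaleC algebra_simps scaleC_mult_left scaleC_mult_right)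

subsection \<open>The universal enveloping algebra\<close>

definition uea_relators :: "('v::complex_lie_alg word \<Rightarrow>\<^sub>0 complex) set" where
  "uea_relators = linear_relators \<union>
     {letter x * letter y - letter y * letter x - letter (lie_bracket x y) |x y. True}"

quotient_type (overloaded) 'v uea = "'v::complex_lie_alg word \<Rightarrow>\<^sub>0 complex" / "ideal_cong uea_relators"
  by (rule equivp_ideal_cong)

instantiation uea :: (complex_lie_alg) complex_alg
begin
lift_definition zero_uea :: "'a uea" is 0 .
lift_definition one_uea :: "'a uea" is 1 .
lift_definition plus_uea :: "'a uea \<Rightarrow> 'a uea \<Rightarrow> 'a uea" is "(+)" by (rule ideal_cong_add)
lift_definition minus_uea :: "'a uea \<Rightarrow> 'a uea \<Rightarrow> 'a uea" is "(-)" by (rule ideal_cong_diff)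
lift_definition uminus_uea :: "'a uea \<Rightarrow> 'a uea" is "uminus" by (rule ideal_cong_uminus)
lift_definition times_uea :: "'a uea \<Rightarrow> 'a uea \<Rightarrow> 'a uea" is "(*)" by (rule ideal_cong_mult)
lift_definition scaleC_uea :: "complex \<Rightarrow> 'a uea \<Rightarrow> 'a uea" is "\<lambda>c x. scalar c * x"
  by (rule ideal_cong_mult_left)
instance by intro_classes
  (transfer, (simp add: presented_simps; fail | simp add: scalar_mult_right ideal_cong_refl))+
end

lift_definition uea_of :: "'v::complex_lie_alg \<Rightarrow> 'v uea" is letter .

subsection \<open>The symmetric algebra\<close>

definition sym_relators :: "('v::complex_space word \<Rightarrow>\<^sub>0 complex) set" where
  "sym_relators = linear_relators \<union> {letter x * letter y - letter y * letter x |x y. True}"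

quotient_type (overloaded) 'v sym_alg = "'v::complex_space word \<Rightarrow>\<^sub>0 complex" / "ideal_cong sym_relators"
  by (rule equivp_ideal_cong)

instantiation sym_alg :: (complex_space) complex_alg
begin
lift_definition zero_sym_alg :: "'a sym_alg" is 0 .
lift_definition one_sym_alg :: "'a sym_alg" is 1 .
lift_definition plus_sym_alg :: "'a sym_alg \<Rightarrow> 'a sym_alg \<Rightarrow> 'a sym_alg" is "(+)"
  by (rule ideal_cong_add)
lift_definition minus_sym_alg :: "'a sym_alg \<Rightarrow> 'a sym_alg \<Rightarrow> 'a sym_alg" is "(-)"
  by (rule ideal_cong_diff)
lift_definition uminus_sym_alg :: "'a sym_alg \<Rightarrow> 'a sym_alg" is "uminus"
  by (rule ideal_cong_uminus)
lift_definition times_sym_alg :: "'a sym_alg \<Rightarrow> 'a sym_alg \<Rightarrow> 'a sym_alg" is "(*)"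
  by (rule ideal_cong_mult)
lift_definition scaleC_sym_alg :: "complex \<Rightarrow> 'a sym_alg \<Rightarrow> 'a sym_alg" is "\<lambda>c x. scalar c * x"
  by (rule ideal_cong_mult_left)
instance by intro_classes
  (transfer, (simp add: presented_simps; fail | simp add: scalar_mult_right ideal_cong_refl))+
end

lift_definition sym_of :: "'v::complex_space \<Rightarrow> 'v sym_alg" is letter .

subsection \<open>The exterior algebra\<close>

definition ext_relators :: "('v::complex_space word \<Rightarrow>\<^sub>0 complex) set" where
  "ext_relators = linear_relators \<union> {letter x * letter x |x. True}"

quotient_type (overloaded) 'v ext_alg = "'v::complex_space word \<Rightarrow>\<^sub>0 complex" / "ideal_cong ext_relators"
  by (rule equivp_ideal_cong)

instantiation ext_alg :: (complex_space) complex_alg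
begin
lift_definition zero_ext_alg :: "'a ext_alg" is 0 .
lift_definition one_ext_alg :: "'a ext_alg" is 1 .
lift_definition plus_ext_alg :: "'a ext_alg \<Rightarrow> 'a ext_alg \<Rightarrow> 'a ext_alg" is "(+)"
  by (rule ideal_cong_add)
lift_definition minus_ext_alg :: "'a ext_alg \<Rightarrow> 'a ext_alg \<Rightarrow> 'a ext_alg" is "(-)"
  by (rule ideal_cong_diff)
lift_definition uminus_ext_alg :: "'a ext_alg \<Rightarrow> 'a ext_alg" is "uminus"
  by (rule ideal_cong_uminus)
lift_definition times_ext_alg :: "'a ext_alg \<Rightarrow> 'a ext_alg \<Rightarrow> 'a ext_alg" is "(*)"
  by (rule ideal_cong_mult)
lift_definition scaleC_ext_alg :: "complex \<Rightarrow> 'a ext_alg \<Rightarrow> 'a ext_alg" is "\<lambda>c x. scalar c * x"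
  by (rule ideal_cong_mult_left)
instance by intro_classes
  (transfer, (simp add: presented_simps; fail | simp add: scalar_mult_right ideal_cong_refl))+
end

lift_definition ext_of :: "'v::complex_space \<Rightarrow> 'v ext_alg" is letter .

subsection \<open>The Clifford algebra\<close>

definition clifford_relators :: "('v::complex_bilinear_space word \<Rightarrow>\<^sub>0 complex) set" where
  "clifford_relators = linear_relators \<union>
     {letter v * letter w + letter w * letter v - scalar (- 2 * bform v w) |v w. True}"

quotient_type (overloaded) 'v clifford =
  "'v::complex_bilinear_space word \<Rightarrow>\<^sub>0 complex" / "ideal_cong clifford_relators"
  by (rule equivp_ideal_cong)

instantiation clifford :: (complex_bilinear_space) complex_alg
begin
lift_definition zero_clifford :: "'a clifford" is 0 .
lift_definition one_clifford :: "'a clifford" is 1 .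
lift_definition plus_clifford :: "'a clifford \<Rightarrow> 'a clifford \<Rightarrow> 'a clifford" is "(+)"
  by (rule ideal_cong_add)
lift_definition minus_clifford :: "'a clifford \<Rightarrow> 'a clifford \<Rightarrow> 'a clifford" is "(-)"
  by (rule ideal_cong_diff)
lift_definition uminus_clifford :: "'a clifford \<Rightarrow> 'a clifford" is "uminus"
  by (rule ideal_cong_uminus)
lift_definition times_clifford :: "'a clifford \<Rightarrow> 'a clifford \<Rightarrow> 'a clifford" is "(*)"
  by (rule ideal_cong_mult)
lift_definition scaleC_clifford :: "complex \<Rightarrow> 'a clifford \<Rightarrow> 'a clifford" is "\<lambda>c x. scalar c * x"
  by (rule ideal_cong_mult_left)
instance by intro_classes
  (transfer, (simp add: presented_simps; fail | simp add: scalar_mult_right ideal_cong_refl))+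
end

lift_definition clifford_of :: "'v::complex_bilinear_space \<Rightarrow> 'v clifford" is letter .

subsection \<open>The generators\<close>

lemma clinear_uea_of: "clinear (uea_of :: 'v::complex_lie_alg \<Rightarrow> 'v uea)"
proof (rule clinearI)
  show "uea_of (x + y) = uea_of x + uea_of y" for x y :: 'v
    by transfer (auto intro!: ideal_cong_rel simp: uea_relators_def linear_relators_def diff_diff_eq)
  show "uea_of (c *\<^sub>C x) = c *\<^sub>C uea_of x" for c and x :: 'v
    by transfer (auto intro!: ideal_cong_rel simp: uea_relators_def linear_relators_def)
qed

lemma clinear_sym_of: "clinear (sym_of :: 'v::complex_space \<Rightarrow> 'v sym_alg)"
proof (rule clinearI)
  show "sym_of (x + y) = sym_of x + sym_of y" for x y :: 'v
    by transfer (auto intro!: ideal_cong_rel simp: sym_relators_def linear_relators_def diff_diff_eq)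
  show "sym_of (c *\<^sub>C x) = c *\<^sub>C sym_of x" for c and x :: 'v
    by transfer (auto intro!: ideal_cong_rel simp: sym_relators_def linear_relators_def)
qed

lemma clinear_ext_of: "clinear (ext_of :: 'v::complex_space \<Rightarrow> 'v ext_alg)"
proof (rule clinearI)
  show "ext_of (x + y) = ext_of x + ext_of y" for x y :: 'v
    by transfer (auto intro!: ideal_cong_rel simp: ext_relators_def linear_relators_def diff_diff_eq)
  show "ext_of (c *\<^sub>C x) = c *\<^sub>C ext_of x" for c and x :: 'v
    by transfer (auto intro!: ideal_cong_rel simp: ext_relators_def linear_relators_def)
qed

lemma clinear_clifford_of: "clinear (clifford_of :: 'v::complex_bilinear_space \<Rightarrow> 'v clifford)"
proof (rule clinearI)
  show "clifford_of (x + y) = clifford_of x + clifford_of y" for x y :: 'v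
    by transfer (auto intro!: ideal_cong_rel simp: clifford_relators_def linear_relators_def diff_diff_eq)
  show "clifford_of (c *\<^sub>C x) = c *\<^sub>C clifford_of x" for c and x :: 'v
    by transfer (auto intro!: ideal_cong_rel simp: clifford_relators_def linear_relators_def)
qed

lemma uea_of_bracket: "uea_of x * uea_of y - uea_of y * uea_of x = uea_of (lie_bracket x y)"
  by transfer (auto intro!: ideal_cong_rel simp: uea_relators_def)

lemma sym_of_commute: "sym_of x * sym_of y = sym_of y * sym_of x"
  by transfer (auto intro!: ideal_cong_rel simp: sym_relators_def)

lemma ext_of_square: "ext_of x * ext_of x = 0"
  by transfer (auto intro!: ideal_cong_rel simp: ext_relators_def)

lemma clifford_of_relation:
  "clifford_of v * clifford_of w + clifford_of w * clifford_of v = (- 2 * bform v w) *\<^sub>C 1"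
  by transfer (auto intro!: ideal_cong_rel simp: clifford_relators_def)

lemma prod_list_letter: "prod_list (map letter xs) = basis (Word xs)"
  by (induction xs) (simp_all add: mult_single plus_word_def flip: zero_word_def)


section \<open>Functoriality\<close>

text \<open>A map of vectors, extended multiplicatively. It is meant for a Lie algebra homomorphism
  (respectively a linear isometry); then the value does not depend on the chosen
  representative, see \<open>uea_map_abs\<close> and \<open>clifford_map_abs\<close>.\<close>

definition uea_map :: "('v::complex_lie_alg \<Rightarrow> 'w::complex_lie_alg) \<Rightarrow> 'v uea \<Rightarrow> 'w uea" where
  "uea_map f x = lin_ext (\<lambda>m. prod_list (map (\<lambda>v. uea_of (f v)) (letters m))) (rep_uea x)"

definition clifford_map ::
    "('v::complex_bilinear_space \<Rightarrow> 'w::complex_bilinear_space) \<Rightarrow> 'v clifford \<Rightarrow> 'w clifford" where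
  "clifford_map f x = lin_ext (\<lambda>m. prod_list (map (\<lambda>v. clifford_of (f v)) (letters m))) (rep_clifford x)"

lemma uea_map_abs:
  fixes f :: "'v::complex_lie_alg \<Rightarrow> 'w::complex_lie_alg"
  assumes lin: "clinear f" and br: "\<And>x y. f (lie_bracket x y) = lie_bracket (f x) (f y)"
  shows "uea_map f (abs_uea x) = lin_ext (\<lambda>m. prod_list (map (\<lambda>v. uea_of (f v)) (letters m))) x"
  unfolding uea_map_def
proof (rule lin_ext_cong[where R = uea_relators])
  show "ideal_cong uea_relators (rep_uea (abs_uea x)) x"
    by (rule Quotient_rep_abs[OF Quotient_uea ideal_cong_refl])
next
  fix u v :: "'v word" and r :: "'v word \<Rightarrow>\<^sub>0 complex"
  have lin': "clinear (\<lambda>v. uea_of (f v))"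
    by (rule clinearI) (simp_all add: clinear_add[OF lin] clinear_scaleC[OF lin]
        clinear_add[OF clinear_uea_of] clinear_scaleC[OF clinear_uea_of])
  let ?h = "\<lambda>m. prod_list (map (\<lambda>v. uea_of (f v)) (letters m))"
  assume "r \<in> uea_relators"
  then consider "r \<in> linear_relators"
    | x y where "r = letter x * letter y - letter y * letter x - letter (lie_bracket x y)"
    by (auto simp: uea_relators_def)
  then show "lin_ext ?h (basis u * r * basis v) = 0"
  proof cases
    case 1
    then show ?thesis
      by (rule lin_ext_linear_relator) (simp_all only: word.sel prod_list_linear[OF lin'])
  next
    case 2
    show ?thesis unfolding 2
      by (simp add: left_diff_distrib right_diff_distrib mult_single lin_ext_diff lin_ext_single
          scaleC_one br mult.assoc flip: uea_of_bracket)
  qed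
qed

lemma clifford_map_abs:
  fixes f :: "'v::complex_bilinear_space \<Rightarrow> 'w::complex_bilinear_space"
  assumes lin: "clinear f" and iso: "\<And>x y. bform (f x) (f y) = bform x y"
  shows "clifford_map f (abs_clifford x) =
    lin_ext (\<lambda>m. prod_list (map (\<lambda>v. clifford_of (f v)) (letters m))) x"
  unfolding clifford_map_def
proof (rule lin_ext_cong[where R = clifford_relators])
  show "ideal_cong clifford_relators (rep_clifford (abs_clifford x)) x"
    by (rule Quotient_rep_abs[OF Quotient_clifford ideal_cong_refl])
next
  fix u v :: "'v word" and r :: "'v word \<Rightarrow>\<^sub>0 complex"
  have lin': "clinear (\<lambda>v. clifford_of (f v))"
    by (rule clinearI) (simp_all add: clinear_add[OF lin] clinear_scaleC[OF lin]
        clinear_add[OF clinear_clifford_of] clinear_scaleC[OF clinear_clifford_of])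
  let ?h = "\<lambda>m. prod_list (map (\<lambda>v. clifford_of (f v)) (letters m))"
  assume "r \<in> clifford_relators"
  then consider "r \<in> linear_relators"
    | x y where "r = letter x * letter y + letter y * letter x - scalar (- 2 * bform x y)"
    by (auto simp: clifford_relators_def)
  then show "lin_ext ?h (basis u * r * basis v) = 0"
  proof cases
    case 1
    then show ?thesis
      by (rule lin_ext_linear_relator) (simp_all only: word.sel prod_list_linear[OF lin'])
  next
    case (2 x y)
    let ?U = "prod_list (map (\<lambda>v. clifford_of (f v)) (letters u))"
    let ?V = "prod_list (map (\<lambda>v. clifford_of (f v)) (letters v))"
    have "lin_ext ?h (basis u * r * basis v) =
       ?U * (clifford_of (f x) * clifford_of (f y) + clifford_of (f y) * clifford_of (f x)) * ?V
       - (- 2 * bform x y) *\<^sub>C (?U * ?V)"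
      unfolding 2
      by (simp add: left_diff_distrib right_diff_distrib distrib_left distrib_right mult_single
          lin_ext_diff lin_ext_add lin_ext_single scaleC_one mult.assoc del: mult_minus_left)
    also have "\<dots> = 0"
      unfolding clifford_of_relation iso by (simp add: scaleC_mult_left scaleC_mult_right)
    finally show ?thesis .
  qed
qed


section \<open>Symmetrization and the Chevalley map\<close>

definition symmetrize :: "'v::complex_lie_alg list \<Rightarrow> 'v uea" where
  "symmetrize xs = (1 / fact (length xs)) *\<^sub>C
     (\<Sum>\<alpha> | \<alpha> permutes {..<length xs}. prod_list (map uea_of (permute_list \<alpha> xs)))"

definition antisymmetrize :: "'v::complex_bilinear_space list \<Rightarrow> 'v clifford" where
  "antisymmetrize vs = (1 / fact (length vs)) *\<^sub>C
     (\<Sum>\<alpha> | \<alpha> permutes {..<length vs}.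
        of_int (sign \<alpha>) *\<^sub>C prod_list (map clifford_of (permute_list \<alpha> vs)))"


lemma permute_list_one_slot:
  assumes "\<alpha> permutes {..<length us + Suc (length vs)}"
  obtains us' vs' where "\<And>x. permute_list \<alpha> (us @ x # vs) = us' @ x # vs'"
proof -
  let ?k = "length us" and ?n = "length us + Suc (length vs)"
  define j where "j = inv \<alpha> ?k"
  have inj: "inj \<alpha>" and j: "\<alpha> j = ?k"
    using permutes_inj[OF assms] permutes_inverses[OF assms] by (auto simp: j_def)
  have jn: "j < ?n"
    using permutes_in_image[OF assms, of j] j by simp
  define f where "f x = permute_list \<alpha> (us @ x # vs)" for x
  have len: "length (f x) = ?n" for x by (simp add: f_def)
  have nth: "i < ?n \<Longrightarrow> f x ! i = (if \<alpha> i = ?k then x else (us @ undefined # vs) ! \<alpha> i)" for i x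
    by (auto simp: f_def permute_list_def nth_append nth_Cons' simp del: upt_Suc)
  have upd: "f x = (f undefined)[j := x]" for x
  proof (rule nth_equalityI)
    fix i assume "i < length (f x)"
    then have i: "i < ?n" by (simp add: len)
    have "\<alpha> i = ?k \<longleftrightarrow> i = j" using inj j by (metis injD)
    then show "f x ! i = (f undefined)[j := x] ! i"
      using i by (simp add: nth nth_list_update len)
  qed (simp add: len)
  have "f x = take j (f undefined) @ x # drop (Suc j) (f undefined)" for x
    unfolding upd[of x] by (rule upd_conv_take_nth_drop) (simp only: len jn)
  then have "permute_list \<alpha> (us @ x # vs) = take j (f undefined) @ x # drop (Suc j) (f undefined)" for x
    unfolding f_def[symmetric] .
  then show ?thesis by (rule that)
qed

lemma prod_list_permute_linear:
  fixes f :: "'v::complex_space \<Rightarrow> 'a::complex_alg"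
  assumes "clinear f" "\<alpha> permutes {..<length us + Suc (length vs)}"
  shows "prod_list (map f (permute_list \<alpha> (us @ (x + y) # vs))) =
      prod_list (map f (permute_list \<alpha> (us @ x # vs))) + prod_list (map f (permute_list \<alpha> (us @ y # vs)))"
    and "prod_list (map f (permute_list \<alpha> (us @ (c *\<^sub>C x) # vs))) =
      c *\<^sub>C prod_list (map f (permute_list \<alpha> (us @ x # vs)))"
proof -
  obtain us' vs' where *: "\<And>x. permute_list \<alpha> (us @ x # vs) = us' @ x # vs'"
    using permute_list_one_slot[OF assms(2)] by blast
  show "prod_list (map f (permute_list \<alpha> (us @ (x + y) # vs))) =
      prod_list (map f (permute_list \<alpha> (us @ x # vs))) + prod_list (map f (permute_list \<alpha> (us @ y # vs)))"
    and "prod_list (map f (permute_list \<alpha> (us @ (c *\<^sub>C x) # vs))) =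
      c *\<^sub>C prod_list (map f (permute_list \<alpha> (us @ x # vs)))"
    unfolding * by (rule prod_list_linear[OF assms(1)])+
qed

lemma symmetrize_linear:
  "symmetrize (us @ (x + y) # vs) = symmetrize (us @ x # vs) + symmetrize (us @ y # vs)"
  "symmetrize (us @ (c *\<^sub>C x) # vs) = c *\<^sub>C symmetrize (us @ x # vs)"
  by (simp_all add: symmetrize_def prod_list_permute_linear[OF clinear_uea_of] sum.distrib
      scaleC_add_right scaleC_scaleC mult.commute flip: complex_space.scale_sum_right)

lemma antisymmetrize_linear:
  "antisymmetrize (us @ (x + y) # vs) = antisymmetrize (us @ x # vs) + antisymmetrize (us @ y # vs)"
  "antisymmetrize (us @ (c *\<^sub>C x) # vs) = c *\<^sub>C antisymmetrize (us @ x # vs)"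
  by (simp_all add: antisymmetrize_def prod_list_permute_linear[OF clinear_clifford_of] sum.distrib
      scaleC_add_right scaleC_scaleC mult.commute complex_space.scale_sum_right)

lemma permute_list_swap:
  "permute_list (Transposition.transpose (length us) (Suc (length us))) (us @ x # y # vs) = us @ y # x # vs"
  by (rule nth_equalityI)
    (auto simp: permute_list_def nth_append nth_Cons' Transposition.transpose_def simp del: upt_Suc)

lemma symmetrize_swap: "symmetrize (us @ x # y # vs) = symmetrize (us @ y # x # vs)"
proof -
  let ?t = "Transposition.transpose (length us) (Suc (length us))"
  let ?zs = "us @ x # y # vs"
  let ?P = "\<lambda>\<alpha>. prod_list (map uea_of (permute_list \<alpha> ?zs))"
  have t: "?t permutes {..<length ?zs}" by (intro permutes_swap_id) auto
  have "(\<Sum>\<alpha> | \<alpha> permutes {..<length ?zs}. ?P \<alpha>) = (\<Sum>\<alpha> | \<alpha> permutes {..<length ?zs}. ?P (?t \<circ> \<alpha>))"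
    by (rule setum_permutations_compose_left[OF t])
  also have "\<dots> = (\<Sum>\<alpha> | \<alpha> permutes {..<length ?zs}.
      prod_list (map uea_of (permute_list \<alpha> (us @ y # x # vs))))"
    by (rule sum.cong) (simp_all only: mem_Collect_eq permute_list_compose permute_list_swap)
  finally show ?thesis by (simp add: symmetrize_def)
qed

lemma antisymmetrize_repeat: "antisymmetrize (us @ x # x # vs) = 0"
proof -
  let ?t = "Transposition.transpose (length us) (Suc (length us))"
  let ?zs = "us @ x # x # vs"
  let ?P = "\<lambda>\<alpha>. prod_list (map clifford_of (permute_list \<alpha> ?zs))"
  define S where "S = (\<Sum>\<alpha> | \<alpha> permutes {..<length ?zs}. of_int (sign \<alpha>) *\<^sub>C ?P \<alpha>)"
  have t: "?t permutes {..<length ?zs}" by (intro permutes_swap_id) auto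
  have "S = (\<Sum>\<alpha> | \<alpha> permutes {..<length ?zs}. of_int (sign (?t \<circ> \<alpha>)) *\<^sub>C ?P (?t \<circ> \<alpha>))"
    unfolding S_def by (rule setum_permutations_compose_left[OF t])
  also have "\<dots> = (\<Sum>\<alpha> | \<alpha> permutes {..<length ?zs}. - (of_int (sign \<alpha>) *\<^sub>C ?P \<alpha>))"
  proof (rule sum.cong[OF refl])
    fix \<alpha> assume "\<alpha> \<in> {\<alpha>. \<alpha> permutes {..<length ?zs}}"
    then have a: "\<alpha> permutes {..<length ?zs}" by simp
    have "permutation \<alpha>" "permutation ?t"
      using permutes_imp_permutation[OF _ a] permutes_imp_permutation[OF _ t] by simp_all
    then have "sign (?t \<circ> \<alpha>) = - sign \<alpha>" by (simp only: sign_compose sign_swap_id) simp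
    moreover have "permute_list (?t \<circ> \<alpha>) ?zs = permute_list \<alpha> ?zs"
      by (simp only: permute_list_compose[OF a] permute_list_swap)
    ultimately show "of_int (sign (?t \<circ> \<alpha>)) *\<^sub>C ?P (?t \<circ> \<alpha>) = - (of_int (sign \<alpha>) *\<^sub>C ?P \<alpha>)"
      by (simp only: of_int_minus complex_space.scale_minus_left)
  qed
  also have "\<dots> = - S" unfolding S_def by (rule sum_negf)
  finally have "S + S = 0" by (simp add: eq_neg_iff_add_eq_0)
  then have "2 *\<^sub>C S = 0" using scaleC_add_left[of 1 1 S] by (simp add: scaleC_one)
  then have "S = 0" by simp
  then show ?thesis by (simp only: antisymmetrize_def S_def complex_space.scale_zero_right)
qed

lift_definition symmetrization :: "'v::complex_lie_alg sym_alg \<Rightarrow> 'v uea"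
  is "lin_ext (\<lambda>m. symmetrize (letters m))"
proof (rule lin_ext_cong[where R = sym_relators])
  fix u v :: "'v word" and r :: "'v word \<Rightarrow>\<^sub>0 complex"
  let ?h = "\<lambda>m. symmetrize (letters m)"
  assume "r \<in> sym_relators"
  then consider "r \<in> linear_relators" | x y where "r = letter x * letter y - letter y * letter x"
    by (auto simp: sym_relators_def)
  then show "lin_ext ?h (basis u * r * basis v) = 0"
  proof cases
    case 1
    then show ?thesis by (rule lin_ext_linear_relator) (simp_all only: word.sel symmetrize_linear)
  next
    case (2 x y)
    show ?thesis unfolding 2
      using symmetrize_swap[of "letters u" x y "letters v"]
      by (simp add: left_diff_distrib right_diff_distrib mult_single lin_ext_diff lin_ext_single)
  qed
qed

lift_definition chevalley :: "'v::complex_bilinear_space ext_alg \<Rightarrow> 'v clifford"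
  is "lin_ext (\<lambda>m. antisymmetrize (letters m))"
proof (rule lin_ext_cong[where R = ext_relators])
  fix u v :: "'v word" and r :: "'v word \<Rightarrow>\<^sub>0 complex"
  let ?h = "\<lambda>m. antisymmetrize (letters m)"
  assume "r \<in> ext_relators"
  then consider "r \<in> linear_relators" | x where "r = letter x * letter x"
    by (auto simp: ext_relators_def)
  then show "lin_ext ?h (basis u * r * basis v) = 0"
  proof cases
    case 1
    then show ?thesis by (rule lin_ext_linear_relator) (simp_all only: word.sel antisymmetrize_linear)
  next
    case (2 x)
    show ?thesis unfolding 2
      using antisymmetrize_repeat[of "letters u" x "letters v"]
      by (simp add: mult_single lin_ext_single)
  qed
qed

lemma clinear_symmetrization: "clinear symmetrization"
proof (rule clinearI)
  show "symmetrization (x + y) = symmetrization x + symmetrization y" for x y :: "'v::complex_lie_alg sym_alg"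
    by transfer (simp add: lin_ext_add ideal_cong_refl)
  show "symmetrization (c *\<^sub>C x) = c *\<^sub>C symmetrization x" for c and x :: "'v::complex_lie_alg sym_alg"
    by transfer (simp add: lin_ext_scalar ideal_cong_refl)
qed

lemma clinear_chevalley: "clinear chevalley"
proof (rule clinearI)
  show "chevalley (x + y) = chevalley x + chevalley y" for x y :: "'v::complex_bilinear_space ext_alg"
    by transfer (simp add: lin_ext_add ideal_cong_refl)
  show "chevalley (c *\<^sub>C x) = c *\<^sub>C chevalley x" for c and x :: "'v::complex_bilinear_space ext_alg"
    by transfer (simp add: lin_ext_scalar ideal_cong_refl)
qed

lemma prod_list_sym_of: "prod_list (map sym_of xs) = abs_sym_alg (basis (Word xs))"
proof (induction xs)
  case Nil
  then show ?case by (simp add: one_sym_alg.abs_eq flip: zero_word_def)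
next
  case (Cons x xs)
  then show ?case
    by (simp add: sym_of.abs_eq times_sym_alg.abs_eq mult_single plus_word_def)
qed

lemma prod_list_ext_of: "prod_list (map ext_of xs) = abs_ext_alg (basis (Word xs))"
proof (induction xs)
  case Nil
  then show ?case by (simp add: one_ext_alg.abs_eq flip: zero_word_def)
next
  case (Cons x xs)
  then show ?case
    by (simp add: ext_of.abs_eq times_ext_alg.abs_eq mult_single plus_word_def)
qed

lemma symmetrization_prod_list: "symmetrization (prod_list (map sym_of xs)) = symmetrize xs"
  by (simp add: prod_list_sym_of symmetrization.abs_eq lin_ext_single scaleC_one)

lemma chevalley_prod_list: "chevalley (prod_list (map ext_of vs)) = antisymmetrize vs"
  by (simp add: prod_list_ext_of chevalley.abs_eq lin_ext_single scaleC_one)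


section \<open>Tensor products of algebras\<close>

text \<open>Pairs \<open>(a, b)\<close> with componentwise multiplication, again written additively.\<close>

datatype ('a, 'b) tensor_pair = Tensor_Pair 'a 'b

instantiation tensor_pair :: (monoid_mult, monoid_mult) monoid_add
begin
definition zero_tensor_pair :: "('a, 'b) tensor_pair" where "0 = Tensor_Pair 1 1"
fun plus_tensor_pair :: "('a, 'b) tensor_pair \<Rightarrow> ('a, 'b) tensor_pair \<Rightarrow> ('a, 'b) tensor_pair" where
  "Tensor_Pair a b + Tensor_Pair a' b' = Tensor_Pair (a * a') (b * b')"
instance
proof
  fix x y z :: "('a, 'b) tensor_pair"
  show "x + y + z = x + (y + z)" by (cases x; cases y; cases z) (simp add: mult.assoc)
  show "0 + x = x" "x + 0 = x" by (cases x; simp add: zero_tensor_pair_def)+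
qed
end

text \<open>The linear span of these relators is already a two-sided ideal of the monoid algebra, so
  the quotient is the usual tensor product of vector spaces.\<close>

definition tensor_relators :: "(('a::complex_alg, 'b::complex_alg) tensor_pair \<Rightarrow>\<^sub>0 complex) set" where
  "tensor_relators =
     {basis (Tensor_Pair (a + a') b) - basis (Tensor_Pair a b) - basis (Tensor_Pair a' b) |a a' b. True} \<union>
     {basis (Tensor_Pair a (b + b')) - basis (Tensor_Pair a b) - basis (Tensor_Pair a b') |a b b'. True} \<union>
     {basis (Tensor_Pair (c *\<^sub>C a) b) - scalar c * basis (Tensor_Pair a b) |c a b. True} \<union>
     {basis (Tensor_Pair a (c *\<^sub>C b)) - scalar c * basis (Tensor_Pair a b) |c a b. True}"

quotient_type (overloaded) ('a, 'b) tensor =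
  "('a::complex_alg, 'b::complex_alg) tensor_pair \<Rightarrow>\<^sub>0 complex" / "ideal_cong tensor_relators"
  by (rule equivp_ideal_cong)

instantiation tensor :: (complex_alg, complex_alg) complex_alg
begin
lift_definition zero_tensor :: "('a, 'b) tensor" is 0 .
lift_definition one_tensor :: "('a, 'b) tensor" is 1 .
lift_definition plus_tensor :: "('a, 'b) tensor \<Rightarrow> ('a, 'b) tensor \<Rightarrow> ('a, 'b) tensor" is "(+)"
  by (rule ideal_cong_add)
lift_definition minus_tensor :: "('a, 'b) tensor \<Rightarrow> ('a, 'b) tensor \<Rightarrow> ('a, 'b) tensor" is "(-)"
  by (rule ideal_cong_diff)
lift_definition uminus_tensor :: "('a, 'b) tensor \<Rightarrow> ('a, 'b) tensor" is "uminus"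
  by (rule ideal_cong_uminus)
lift_definition times_tensor :: "('a, 'b) tensor \<Rightarrow> ('a, 'b) tensor \<Rightarrow> ('a, 'b) tensor" is "(*)"
  by (rule ideal_cong_mult)
lift_definition scaleC_tensor :: "complex \<Rightarrow> ('a, 'b) tensor \<Rightarrow> ('a, 'b) tensor" is "\<lambda>c x. scalar c * x"
  by (rule ideal_cong_mult_left)
instance by intro_classes
  (transfer, (simp add: presented_simps; fail | simp add: scalar_mult_right ideal_cong_refl))+
end

lift_definition tensor :: "'a::complex_alg \<Rightarrow> 'b::complex_alg \<Rightarrow> ('a, 'b) tensor"  (infixr \<open>\<otimes>\<^sub>C\<close> 72)
  is "\<lambda>a b. basis (Tensor_Pair a b)" .

lemma tensor_add_left: "(a + a') \<otimes>\<^sub>C b = a \<otimes>\<^sub>C b + a' \<otimes>\<^sub>C b"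
  by transfer (rule ideal_cong_rel, unfold tensor_relators_def diff_diff_eq[symmetric], blast)

lemma tensor_add_right: "a \<otimes>\<^sub>C (b + b') = a \<otimes>\<^sub>C b + a \<otimes>\<^sub>C b'"
  by transfer (rule ideal_cong_rel, unfold tensor_relators_def diff_diff_eq[symmetric], blast)

lemma tensor_scaleC_left: "(c *\<^sub>C a) \<otimes>\<^sub>C b = c *\<^sub>C (a \<otimes>\<^sub>C b)"
  by transfer (rule ideal_cong_rel, unfold tensor_relators_def, blast)

lemma tensor_scaleC_right: "a \<otimes>\<^sub>C (c *\<^sub>C b) = c *\<^sub>C (a \<otimes>\<^sub>C b)"
  by transfer (rule ideal_cong_rel, unfold tensor_relators_def, blast)

lemma tensor_mult: "(a \<otimes>\<^sub>C b) * (a' \<otimes>\<^sub>C b') = (a * a') \<otimes>\<^sub>C (b * b')"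
  by transfer (simp add: mult_single ideal_cong_refl)

lemma tensor_one: "1 \<otimes>\<^sub>C 1 = 1"
  by transfer (simp add: ideal_cong_refl flip: zero_tensor_pair_def)

text \<open>The tensor product \<open>f \<otimes> g\<close> of linear maps; see \<open>tensor_map_abs\<close> and \<open>tensor_map_tensor\<close>.\<close>

definition tensor_map :: "('a::complex_alg \<Rightarrow> 'c::complex_alg) \<Rightarrow> ('b::complex_alg \<Rightarrow> 'd::complex_alg)
    \<Rightarrow> ('a, 'b) tensor \<Rightarrow> ('c, 'd) tensor" where
  "tensor_map f g x = lin_ext (\<lambda>m. case m of Tensor_Pair a b \<Rightarrow> f a \<otimes>\<^sub>C g b) (rep_tensor x)"

lemma tensor_map_abs:
  fixes f :: "'a::complex_alg \<Rightarrow> 'c::complex_alg" and g :: "'b::complex_alg \<Rightarrow> 'd::complex_alg"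
  assumes f: "clinear f" and g: "clinear g"
  shows "tensor_map f g (abs_tensor x) = lin_ext (\<lambda>m. case m of Tensor_Pair a b \<Rightarrow> f a \<otimes>\<^sub>C g b) x"
  unfolding tensor_map_def
proof (rule lin_ext_cong[where R = tensor_relators])
  show "ideal_cong tensor_relators (rep_tensor (abs_tensor x)) x"
    by (rule Quotient_rep_abs[OF Quotient_tensor ideal_cong_refl])
next
  fix u v and r :: "('a, 'b) tensor_pair \<Rightarrow>\<^sub>0 complex"
  assume "r \<in> tensor_relators"
  then show "lin_ext (\<lambda>m. case m of Tensor_Pair a b \<Rightarrow> f a \<otimes>\<^sub>C g b) (basis u * r * basis v) = 0"
    by (cases u; cases v)
      (auto simp: tensor_relators_def left_diff_distrib right_diff_distrib mult_single
        lin_ext_diff lin_ext_single distrib_left distrib_right scaleC_mult_left scaleC_mult_right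
        clinear_add[OF f] clinear_add[OF g] clinear_scaleC[OF f] clinear_scaleC[OF g]
        tensor_add_left tensor_add_right tensor_scaleC_left tensor_scaleC_right scaleC_one)
qed

lemma tensor_map_tensor: "clinear f \<Longrightarrow> clinear g \<Longrightarrow> tensor_map f g (a \<otimes>\<^sub>C b) = f a \<otimes>\<^sub>C g b"
  by (simp add: tensor.abs_eq tensor_map_abs lin_ext_single scaleC_one)


section \<open>The group and its Lie algebra\<close>

lemma matrix_algebra:
  fixes A B C :: "'a::comm_ring_1^5^5"
  shows "(A + B) ** C = A ** C + B ** C" "A ** (B + C) = A ** B + A ** C"
    "(A - B) ** C = A ** C - B ** C" "A ** (B - C) = A ** B - A ** C"
    "(- A) ** C = - (A ** C)" "A ** (- C) = - (A ** C)"
    "map_matrix ((*) c) A ** C = map_matrix ((*) c) (A ** C)"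
    "A ** map_matrix ((*) c) C = map_matrix ((*) c) (A ** C)"
  by (simp_all add: vec_eq_iff matrix_matrix_mult_def distrib_left distrib_right sum.distrib
      left_diff_distrib right_diff_distrib sum_subtractf sum_negf sum_distrib_left mult.assoc
      mult.left_commute)

lemma transpose_uminus: "transpose (- A) = - transpose (A :: 'a::ab_group_add^5^5)"
  by (simp add: vec_eq_iff transpose_def)

definition gamma41 :: "'a::ring_1^5^5" where
  "gamma41 = (\<chi> i j. if i \<noteq> j then 0 else if i = 5 then - 1 else 1)"

definition SO41 :: "(real^5^5) set" where
  "SO41 = {g. det g = 1 \<and> transpose g ** gamma41 ** g = gamma41}"

definition SOe41 :: "(real^5^5) set" where
  "SOe41 = connected_component_set SO41 (mat 1)"

text \<open>\<open>S(O(4) \<times> O(1))\<close>: block diagonal orthogonal matrices of determinant 1.\<close>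

definition SO4xO1 :: "(real^5^5) set" where
  "SO4xO1 = {g. orthogonal_matrix g \<and> (\<forall>i. i \<noteq> 5 \<longrightarrow> g $ i $ 5 = 0 \<and> g $ 5 $ i = 0) \<and> det g = 1}"

definition K41 :: "(real^5^5) set" where
  "K41 = connected_component_set SO4xO1 (mat 1)"

definition so41 :: "(real^5^5) set" where
  "so41 = {x. transpose x = - (gamma41 ** x ** gamma41)}"

abbreviation complex_matrix :: "real^5^5 \<Rightarrow> complex^5^5" where
  "complex_matrix \<equiv> map_matrix complex_of_real"

abbreviation cscale :: "complex \<Rightarrow> complex^5^5 \<Rightarrow> complex^5^5"  (infixr \<open>*\<^sub>M\<close> 75) where
  "c *\<^sub>M X \<equiv> map_matrix ((*) c) X"

definition so41_complexified :: "(complex^5^5) set" where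
  "so41_complexified = {complex_matrix A + \<i> *\<^sub>M complex_matrix B |A B. A \<in> so41 \<and> B \<in> so41}"

lemma gamma41_conj_nth:
  "(gamma41 ** x ** gamma41) $ i $ j =
     (if (i = 5) = (j = 5) then x $ i $ j else - (x $ i $ j :: 'a::comm_ring_1))"
proof -
  have l: "(gamma41 ** y) $ i $ j = (if i = 5 then - y $ i $ j else y $ i $ j)" for y :: "'a^5^5" and i j
  proof -
    have "(gamma41 ** y) $ i $ j = (\<Sum>k\<in>UNIV. if k = i then (if i = 5 then - y $ i $ j else y $ i $ j) else 0)"
      unfolding matrix_matrix_mult_def vec_lambda_beta by (rule sum.cong) (auto simp: gamma41_def)
    then show ?thesis by simp
  qed
  have r: "(y ** gamma41) $ i $ j = (if j = 5 then - y $ i $ j else y $ i $ j)" for y :: "'a^5^5" and i j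
  proof -
    have "(y ** gamma41) $ i $ j = (\<Sum>k\<in>UNIV. if k = j then (if j = 5 then - y $ i $ j else y $ i $ j) else 0)"
      unfolding matrix_matrix_mult_def vec_lambda_beta by (rule sum.cong) (auto simp: gamma41_def)
    then show ?thesis by simp
  qed
  show ?thesis by (simp add: l r)
qed

lemma conj_eq_iff:
  "transpose x = - (gamma41 ** x ** gamma41) \<longleftrightarrow>
    (\<forall>i j. x $ j $ i = (if (i = 5) = (j = 5) then - x $ i $ j else (x $ i $ j :: 'a::comm_ring_1)))"
proof -
  have "transpose x $ i $ j = (- (gamma41 ** x ** gamma41)) $ i $ j \<longleftrightarrow>
      x $ j $ i = (if (i = 5) = (j = 5) then - x $ i $ j else x $ i $ j)" for i j
    by (simp add: transpose_def gamma41_conj_nth)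
  then show ?thesis by (simp only: vec_eq_iff)
qed

lemma so41_iff: "x \<in> so41 \<longleftrightarrow>
    (\<forall>i j. x $ j $ i = (if (i = 5) = (j = 5) then - x $ i $ j else x $ i $ j))"
  by (simp add: so41_def conj_eq_iff)

lemma so41_complexified_nth: "X \<in> so41_complexified \<longleftrightarrow>
    (\<forall>i j. X $ j $ i = (if (i = 5) = (j = 5) then - X $ i $ j else X $ i $ j))" (is "_ \<longleftrightarrow> ?R X")
proof
  assume "X \<in> so41_complexified"
  then obtain A B where X: "X = complex_matrix A + \<i> *\<^sub>M complex_matrix B"
    and AB: "A \<in> so41" "B \<in> so41"
    unfolding so41_complexified_def by blast
  show "?R X"
  proof (intro allI)
    fix i j
    show "X $ j $ i = (if (i = 5) = (j = 5) then - X $ i $ j else X $ i $ j)"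
      using AB(1)[unfolded so41_iff, rule_format, of j i] AB(2)[unfolded so41_iff, rule_format, of j i]
      by (simp add: X)
  qed
next
  assume X: "?R X"
  let ?A = "map_matrix Re X" and ?B = "map_matrix Im X"
  have "X = complex_matrix ?A + \<i> *\<^sub>M complex_matrix ?B"
    by (simp add: vec_eq_iff complex_eq_iff)
  moreover have "?A \<in> so41"
    unfolding so41_iff
  proof (intro allI)
    fix i j
    show "?A $ j $ i = (if (i = 5) = (j = 5) then - ?A $ i $ j else ?A $ i $ j)"
      using X[rule_format, of j i] by simp
  qed
  moreover have "?B \<in> so41"
    unfolding so41_iff
  proof (intro allI)
    fix i j
    show "?B $ j $ i = (if (i = 5) = (j = 5) then - ?B $ i $ j else ?B $ i $ j)"
      using X[rule_format, of j i] by simp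
  qed
  ultimately show "X \<in> so41_complexified" unfolding so41_complexified_def by blast
qed

lemma so41_complexified_iff: "X \<in> so41_complexified \<longleftrightarrow> transpose X = - (gamma41 ** X ** gamma41)"
  by (simp only: so41_complexified_nth conj_eq_iff)

lemma so41_complexified_closed:
  assumes X: "X \<in> so41_complexified" and Y: "Y \<in> so41_complexified"
  shows "X + Y \<in> so41_complexified" "X - Y \<in> so41_complexified" "c *\<^sub>M X \<in> so41_complexified"
    "- X \<in> so41_complexified" "- transpose X \<in> so41_complexified"
proof -
  note nth = X[unfolded so41_complexified_nth, rule_format] Y[unfolded so41_complexified_nth, rule_format]
  show "X + Y \<in> so41_complexified"
    unfolding so41_complexified_nth vector_add_component by (subst nth, subst nth(2)) simp
  show "X - Y \<in> so41_complexified"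
    unfolding so41_complexified_nth vector_minus_component by (subst nth, subst nth(2)) simp
  show "c *\<^sub>M X \<in> so41_complexified"
    unfolding so41_complexified_nth nth_map_matrix by (subst nth) simp
  show "- X \<in> so41_complexified"
    unfolding so41_complexified_nth vector_uminus_component by (subst nth) simp
  show "- transpose X \<in> so41_complexified"
    unfolding so41_complexified_nth vector_uminus_component transpose_def vec_lambda_beta
  proof (intro allI)
    fix i j
    show "- X $ i $ j = (if (i = 5) = (j = 5) then - (- X $ j $ i) else - X $ j $ i)"
      by (subst nth(1)) simp
  qed
qed

lemma transpose_matrix_mult_neg_conj:
  fixes X Y :: "'a::comm_ring_1^5^5"
  assumes "transpose X = - (gamma41 ** X ** gamma41)" "transpose Y = - (gamma41 ** Y ** gamma41)"
  shows "transpose (X ** Y - Y ** X) = - (gamma41 ** (X ** Y - Y ** X) ** gamma41)"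
proof -
  have X: "X $ j $ i = (if (i = 5) = (j = 5) then - X $ i $ j else X $ i $ j)" for i j
    using assms(1) by (auto simp: conj_eq_iff)
  have Y: "Y $ j $ i = (if (i = 5) = (j = 5) then - Y $ i $ j else Y $ i $ j)" for i j
    using assms(2) by (auto simp: conj_eq_iff)
  have "(X ** Y) $ j $ i = (if (i = 5) = (j = 5) then (Y ** X) $ i $ j else - (Y ** X) $ i $ j)" for i j
  proof -
    have "X $ j $ k * Y $ k $ i = (if (i = 5) = (j = 5) then Y $ i $ k * X $ k $ j
        else - (Y $ i $ k * X $ k $ j))" for k
      by (subst X, subst Y) (simp add: mult.commute)
    then show ?thesis
      unfolding matrix_matrix_mult_def vec_lambda_beta by (simp add: sum_negf)
  qed
  note XY = this
  have "(Y ** X) $ j $ i = (if (i = 5) = (j = 5) then (X ** Y) $ i $ j else - (X ** Y) $ i $ j)" for i j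
  proof -
    have "Y $ j $ k * X $ k $ i = (if (i = 5) = (j = 5) then X $ i $ k * Y $ k $ j
        else - (X $ i $ k * Y $ k $ j))" for k
      by (subst X, subst Y) (simp add: mult.commute)
    then show ?thesis
      unfolding matrix_matrix_mult_def vec_lambda_beta by (simp add: sum_negf)
  qed
  with XY show ?thesis
    unfolding conj_eq_iff vector_minus_component by (intro allI) (simp only:; simp)
qed

typedef so41C = so41_complexified
  by (rule exI[of _ 0]) (simp add: so41_complexified_nth)

setup_lifting type_definition_so41C

instantiation so41C :: complex_lie_alg
begin
lift_definition zero_so41C :: so41C is 0 by (simp add: so41_complexified_nth)
lift_definition plus_so41C :: "so41C \<Rightarrow> so41C \<Rightarrow> so41C" is "(+)"
  by (rule so41_complexified_closed)
lift_definition minus_so41C :: "so41C \<Rightarrow> so41C \<Rightarrow> so41C" is "(-)"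
  by (rule so41_complexified_closed)
lift_definition uminus_so41C :: "so41C \<Rightarrow> so41C" is uminus
  by (rule so41_complexified_closed)
lift_definition scaleC_so41C :: "complex \<Rightarrow> so41C \<Rightarrow> so41C" is cscale
  by (rule so41_complexified_closed)
lift_definition lie_bracket_so41C :: "so41C \<Rightarrow> so41C \<Rightarrow> so41C" is "\<lambda>X Y. X ** Y - Y ** X"
proof -
  fix X Y assume "X \<in> so41_complexified" "Y \<in> so41_complexified"
  then show "X ** Y - Y ** X \<in> so41_complexified"
    by (simp add: so41_complexified_iff transpose_matrix_mult_neg_conj)
qed
instance
proof
  fix x y z :: so41C and c d :: complex
  show "x + y + z = x + (y + z)" "x + y = y + x" "0 + x = x" "- x + x = 0" "x - y = x + - y"
    by (transfer; simp)+
  show "c *\<^sub>C (x + y) = c *\<^sub>C x + c *\<^sub>C y" "(c + d) *\<^sub>C x = c *\<^sub>C x + d *\<^sub>C x"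
    "c *\<^sub>C d *\<^sub>C x = (c * d) *\<^sub>C x" "1 *\<^sub>C x = x"
    by (transfer; simp add: vec_eq_iff algebra_simps)+
  show "lie_bracket (x + y) z = lie_bracket x z + lie_bracket y z"
    "lie_bracket z (x + y) = lie_bracket z x + lie_bracket z y"
    by (transfer; simp add: matrix_algebra)+
  show "lie_bracket (c *\<^sub>C x) z = c *\<^sub>C lie_bracket x z"
    "lie_bracket z (c *\<^sub>C x) = c *\<^sub>C lie_bracket z x"
    by (transfer; simp add: matrix_algebra; simp add: vec_eq_iff right_diff_distrib)+
  show "lie_bracket x x = 0" by transfer simp
  show "lie_bracket x (lie_bracket y z) + lie_bracket y (lie_bracket z x)
           + lie_bracket z (lie_bracket x y) = 0"
    by transfer (simp add: matrix_algebra matrix_mul_assoc)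
qed
end

text \<open>The adjoint action \<open>Ad(g) X = g X g\<^sup>-\<^sup>1\<close>, meant for \<open>g \<in> SO(4,1)\<close>.\<close>

definition Ad41 :: "real^5^5 \<Rightarrow> so41C \<Rightarrow> so41C" where
  "Ad41 g X = Abs_so41C (complex_matrix g ** Rep_so41C X ** complex_matrix (matrix_inv g))"

lemma complex_matrix_mult: "complex_matrix (A ** B) = complex_matrix A ** complex_matrix B"
  by (simp add: vec_eq_iff matrix_matrix_mult_def)

lemma complex_matrix_mat_1: "complex_matrix (mat 1) = mat 1"
  by (simp add: vec_eq_iff mat_def)

lemma complex_matrix_gamma41: "complex_matrix gamma41 = gamma41"
  by (simp add: vec_eq_iff gamma41_def)

lemma complex_matrix_transpose: "complex_matrix (transpose A) = transpose (complex_matrix A)"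
  by (simp add: vec_eq_iff transpose_def)

lemma gamma41_square: "gamma41 ** gamma41 = (mat 1 :: 'a::comm_ring_1^5^5)"
proof -
  have "(gamma41 ** mat 1 ** gamma41 :: 'a^5^5) = mat 1"
    by (simp only: vec_eq_iff gamma41_conj_nth) (simp add: mat_def)
  then show ?thesis by simp
qed

lemma transpose_gamma41: "transpose gamma41 = gamma41"
  by (auto simp: vec_eq_iff gamma41_def transpose_def)

lemma SO41_inverse:
  assumes "g \<in> SO41"
  shows "complex_matrix g ** complex_matrix (matrix_inv g) = mat 1"
    and "complex_matrix (matrix_inv g) ** complex_matrix g = mat 1"
proof -
  have "invertible g" using assms by (simp add: SO41_def invertible_det_nz)
  then have "g ** matrix_inv g = mat 1" "matrix_inv g ** g = mat 1"
    unfolding invertible_def matrix_inv_def by (metis (mono_tags, lifting) someI_ex)+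
  then show "complex_matrix g ** complex_matrix (matrix_inv g) = mat 1"
    and "complex_matrix (matrix_inv g) ** complex_matrix g = mat 1"
    by (metis complex_matrix_mult complex_matrix_mat_1)+
qed

lemma Rep_Ad41:
  assumes g: "g \<in> SO41"
  shows "Rep_so41C (Ad41 g X) = complex_matrix g ** Rep_so41C X ** complex_matrix (matrix_inv g)"
proof -
  let ?A = "complex_matrix g" and ?B = "complex_matrix (matrix_inv g)" and ?X = "Rep_so41C X"
  let ?g = "gamma41 :: complex^5^5"
  note AB = SO41_inverse[OF g]
  have "complex_matrix (transpose g ** gamma41 ** g) = ?g"
    using g by (simp add: SO41_def complex_matrix_gamma41)
  then have 1: "transpose ?A ** ?g ** ?A = ?g"
    by (simp add: complex_matrix_mult complex_matrix_gamma41 complex_matrix_transpose)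
  have BA: "transpose ?B ** transpose ?A = mat 1"
    using AB(1) by (simp only: matrix_transpose_mul[symmetric] transpose_mat)
  have "transpose ?B ** (transpose ?A ** ?g ** ?A) = transpose ?B ** transpose ?A ** ?g ** ?A"
    by (simp only: matrix_mul_assoc)
  then have 2: "transpose ?B ** ?g = ?g ** ?A"
    by (simp only: 1 BA matrix_mul_lid)
  have "?g ** ?B = transpose ?A ** ?g"
    using arg_cong[OF 2, of transpose]
    by (simp only: matrix_transpose_mul transpose_gamma41 transpose_transpose)
  then have "?g ** (?g ** ?B) ** ?g = ?g ** (transpose ?A ** ?g) ** ?g" by (simp only:)
  then have "(?g ** ?g) ** ?B ** ?g = ?g ** transpose ?A ** (?g ** ?g)"
    by (simp only: matrix_mul_assoc)
  then have 3: "?g ** transpose ?A = ?B ** ?g"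
    by (simp only: gamma41_square matrix_mul_lid matrix_mul_rid)
  have "transpose (?A ** ?X ** ?B) = transpose ?B ** (transpose ?X ** transpose ?A)"
    by (simp only: matrix_transpose_mul)
  also have "transpose ?X = - (?g ** ?X ** ?g)"
    using Rep_so41C[of X] by (simp only: so41_complexified_iff)
  also have "transpose ?B ** (- (?g ** ?X ** ?g) ** transpose ?A)
      = - ((transpose ?B ** ?g) ** ?X ** (?g ** transpose ?A))"
    by (simp only: matrix_algebra matrix_mul_assoc)
  also have "\<dots> = - (?g ** (?A ** ?X ** ?B) ** ?g)"
    unfolding 2 3 by (simp only: matrix_mul_assoc)
  finally show ?thesis
    unfolding Ad41_def by (intro Abs_so41C_inverse) (simp only: so41_complexified_iff)
qed

lemma clinear_Ad41: "g \<in> SO41 \<Longrightarrow> clinear (Ad41 g)"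
  by (rule clinearI)
    (simp_all add: Rep_so41C_inject[symmetric] Rep_Ad41 plus_so41C.rep_eq scaleC_so41C.rep_eq
      matrix_algebra)

lemma Ad41_bracket:
  assumes "g \<in> SO41"
  shows "Ad41 g (lie_bracket X Y) = lie_bracket (Ad41 g X) (Ad41 g Y)"
proof -
  let ?A = "complex_matrix g" and ?B = "complex_matrix (matrix_inv g)"
  have "?A ** U ** ?B ** (?A ** V ** ?B) = ?A ** (U ** V) ** ?B" for U V
  proof -
    have "?A ** U ** ?B ** (?A ** V ** ?B) = ?A ** U ** (?B ** ?A) ** V ** ?B"
      by (simp only: matrix_mul_assoc)
    then show ?thesis by (simp only: SO41_inverse(2)[OF assms] matrix_mul_rid matrix_mul_assoc)
  qed
  then show ?thesis
    by (simp add: Rep_so41C_inject[symmetric] Rep_Ad41[OF assms] lie_bracket_so41C.rep_eq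
        matrix_algebra)
qed


section \<open>The Cartan decomposition\<close>

lift_definition cartan_inv :: "so41C \<Rightarrow> so41C" is "\<lambda>X. - transpose X"
  by (rule so41_complexified_closed)

definition k41 :: "so41C set" where
  "k41 = {X. cartan_inv X = X}"

typedef p41 = "{X. cartan_inv X = - X}"
  by (rule exI[of _ 0]) (simp add: Rep_so41C_inject[symmetric] cartan_inv.rep_eq
      uminus_so41C.rep_eq zero_so41C.rep_eq transpose_def vec_eq_iff)

setup_lifting type_definition_p41

lemma cartan_inv_add: "cartan_inv (X + Y) = cartan_inv X + cartan_inv Y"
  by transfer (simp add: vec_eq_iff transpose_def)

lemma cartan_inv_uminus: "cartan_inv (- X) = - cartan_inv X"
  by transfer (simp add: vec_eq_iff transpose_def)

lemma cartan_inv_diff: "cartan_inv (X - Y) = cartan_inv X - cartan_inv Y"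
  by (metis cartan_inv_add cartan_inv_uminus uminus_add_conv_diff add.commute)

lemma cartan_inv_scaleC: "cartan_inv (c *\<^sub>C X) = c *\<^sub>C cartan_inv X"
  by transfer (simp add: vec_eq_iff transpose_def)

lemma cartan_inv_bracket: "cartan_inv (lie_bracket X Y) = lie_bracket (cartan_inv X) (cartan_inv Y)"
  by transfer (simp add: vec_eq_iff transpose_def matrix_matrix_mult_def mult.commute sum_negf)

instantiation p41 :: complex_bilinear_space
begin
lift_definition zero_p41 :: p41 is 0
  by (simp add: Rep_so41C_inject[symmetric] cartan_inv.rep_eq
      uminus_so41C.rep_eq zero_so41C.rep_eq transpose_def vec_eq_iff)
lift_definition plus_p41 :: "p41 \<Rightarrow> p41 \<Rightarrow> p41" is "(+)" by (simp add: cartan_inv_add)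
lift_definition minus_p41 :: "p41 \<Rightarrow> p41 \<Rightarrow> p41" is "(-)" by (simp add: cartan_inv_diff)
lift_definition uminus_p41 :: "p41 \<Rightarrow> p41" is uminus by (simp add: cartan_inv_uminus)
lift_definition scaleC_p41 :: "complex \<Rightarrow> p41 \<Rightarrow> p41" is "scaleC" by (simp add: cartan_inv_scaleC)
definition bform_p41 :: "p41 \<Rightarrow> p41 \<Rightarrow> complex" where
  "bform v w = trace (Rep_so41C (Rep_p41 v) ** Rep_so41C (Rep_p41 w))"
instance
proof
  fix x y z :: p41 and c d :: complex
  note rep = Rep_p41_inject[symmetric] zero_p41.rep_eq plus_p41.rep_eq minus_p41.rep_eq
    uminus_p41.rep_eq scaleC_p41.rep_eq
  show "x + y + z = x + (y + z)" "0 + x = x" "- x + x = 0" "x - y = x + - y"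
    by (simp_all add: rep add.assoc)
  show "x + y = y + x" by (simp add: rep add.commute)
  show "c *\<^sub>C (x + y) = c *\<^sub>C x + c *\<^sub>C y" "(c + d) *\<^sub>C x = c *\<^sub>C x + d *\<^sub>C x"
    "c *\<^sub>C d *\<^sub>C x = (c * d) *\<^sub>C x" "1 *\<^sub>C x = x"
    by (simp_all add: rep scaleC_add_left scaleC_add_right scaleC_scaleC scaleC_one)
  show "bform (x + y) z = bform x z + bform y z"
    by (simp add: bform_p41_def plus_p41.rep_eq plus_so41C.rep_eq matrix_algebra trace_add)
  show "bform (c *\<^sub>C x) z = c * bform x z"
    by (simp add: bform_p41_def scaleC_p41.rep_eq scaleC_so41C.rep_eq matrix_algebra)
      (simp add: trace_def sum_distrib_left)
  show "bform x y = bform y x"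
    unfolding bform_p41_def by (rule trace_mul_sym)
qed
end

lemma bracket_k_p:
  assumes "X \<in> k41"
  shows "cartan_inv (lie_bracket X (Rep_p41 v)) = - lie_bracket X (Rep_p41 v)"
proof -
  have "lie_bracket X (- Y) = - lie_bracket X Y" for Y
    using lie_bracket_scaleC_right[of X "-1" Y] by simp
  then show ?thesis
    using assms Rep_p41[of v] by (simp add: k41_def cartan_inv_bracket)
qed

definition Ad_p41 :: "real^5^5 \<Rightarrow> p41 \<Rightarrow> p41" where
  "Ad_p41 k v = Abs_p41 (Ad41 k (Rep_p41 v))"

lemma SO4xO1_subset: "SO4xO1 \<subseteq> SO41"
proof
  fix g assume g: "g \<in> SO4xO1"
  then have gg: "transpose g ** g = mat 1" "det g = 1"
    and z: "\<And>i. i \<noteq> 5 \<Longrightarrow> g $ i $ 5 = 0 \<and> g $ 5 $ i = 0"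
    by (auto simp: SO4xO1_def orthogonal_matrix_def)
  have "gamma41 ** g = g ** gamma41"
  proof -
    have "gamma41 ** g ** gamma41 = g"
      unfolding vec_eq_iff gamma41_conj_nth using z by (auto simp: eq_neg_iff_add_eq_0)
    then have "gamma41 ** g ** (gamma41 ** gamma41) = g ** gamma41"
      by (simp only: matrix_mul_assoc)
    then show ?thesis by (simp only: gamma41_square matrix_mul_rid)
  qed
  then have "transpose g ** (gamma41 ** g) = (transpose g ** g) ** gamma41"
    by (simp only: matrix_mul_assoc)
  then have "transpose g ** gamma41 ** g = gamma41"
    by (simp only: gg matrix_mul_lid matrix_mul_assoc)
  with gg show "g \<in> SO41" by (simp add: SO41_def)
qed

lemma K41_subset: "K41 \<subseteq> SO4xO1"
  by (simp add: K41_def connected_component_subset)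

lemma K41_SO41: "k \<in> K41 \<Longrightarrow> k \<in> SO41"
  using K41_subset SO4xO1_subset by blast

lemma K41_subset_SOe41: "K41 \<subseteq> SOe41"
  unfolding K41_def SOe41_def by (rule connected_component_mono[OF SO4xO1_subset])

lemma matrix_inverse_unique:
  fixes A :: "real^5^5"
  assumes "B ** A = mat 1" "A ** C = mat 1"
  shows "C = B"
proof -
  have "B ** (A ** C) = B ** A ** C" by (simp only: matrix_mul_assoc)
  then show ?thesis by (simp only: assms matrix_mul_lid matrix_mul_rid)
qed

lemma Ad41_cartan_inv:
  assumes "k \<in> K41"
  shows "cartan_inv (Ad41 k X) = Ad41 k (cartan_inv X)"
proof -
  have "orthogonal_matrix k" using assms K41_subset by (auto simp: SO4xO1_def)
  then have inv: "matrix_inv k = transpose k"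
    unfolding orthogonal_matrix_def matrix_inv_def
    by (intro some_equality) (auto intro: matrix_inverse_unique)
  show ?thesis
    by (simp add: Rep_so41C_inject[symmetric] Rep_Ad41[OF K41_SO41[OF assms]] cartan_inv.rep_eq
        inv complex_matrix_transpose matrix_transpose_mul matrix_algebra matrix_mul_assoc)
qed

lemma Rep_Ad_p41:
  assumes "k \<in> K41"
  shows "Rep_p41 (Ad_p41 k v) = Ad41 k (Rep_p41 v)"
proof -
  have "Ad41 k (- X) = - Ad41 k X" for X
    using clinear_scaleC[OF clinear_Ad41[OF K41_SO41[OF assms]], of "-1" X] by simp
  then show ?thesis
    unfolding Ad_p41_def using Rep_p41[of v]
    by (subst Abs_p41_inverse) (simp_all add: Ad41_cartan_inv[OF assms])
qed

lemma clinear_Ad_p41: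
  assumes "k \<in> K41"
  shows "clinear (Ad_p41 k)"
proof -
  note lin = clinear_Ad41[OF K41_SO41[OF assms]]
  have "Rep_p41 (Ad_p41 k (x + y)) = Rep_p41 (Ad_p41 k x + Ad_p41 k y)" for x y
    by (simp only: Rep_Ad_p41[OF assms] plus_p41.rep_eq clinear_add[OF lin])
  moreover have "Rep_p41 (Ad_p41 k (c *\<^sub>C x)) = Rep_p41 (c *\<^sub>C Ad_p41 k x)" for c x
    by (simp only: Rep_Ad_p41[OF assms] scaleC_p41.rep_eq clinear_scaleC[OF lin])
  ultimately show ?thesis by (intro clinearI) (simp_all only: Rep_p41_inject)
qed

lemma Ad_p41_bform:
  assumes "k \<in> K41"
  shows "bform (Ad_p41 k v) (Ad_p41 k w) = bform v w"
proof -
  let ?A = "complex_matrix k" and ?B = "complex_matrix (matrix_inv k)"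
  note inv = SO41_inverse[OF K41_SO41[OF assms]]
  have 1: "?A ** U ** ?B ** (?A ** V ** ?B) = ?A ** (U ** V) ** ?B" for U V
  proof -
    have "?A ** U ** ?B ** (?A ** V ** ?B) = ?A ** U ** (?B ** ?A) ** V ** ?B"
      by (simp only: matrix_mul_assoc)
    then show ?thesis by (simp only: inv(2) matrix_mul_rid matrix_mul_assoc)
  qed
  have 2: "trace (?A ** U ** ?B) = trace U" for U
  proof -
    have "trace (?A ** U ** ?B) = trace (?B ** ?A ** U)"
      by (subst trace_mul_sym) (simp only: matrix_mul_assoc)
    then show ?thesis by (simp only: inv(2) matrix_mul_lid)
  qed
  show ?thesis
    by (simp add: bform_p41_def Rep_Ad_p41[OF assms] Rep_Ad41[OF K41_SO41[OF assms]] 1 2)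
qed


section \<open>The \<open>K\<close>-invariants of \<open>U(\<gg>) \<otimes> C(\<pp>)\<close>\<close>

type_synonym UC41 = "(so41C uea, p41 clifford) tensor"

definition K41_action :: "real^5^5 \<Rightarrow> UC41 \<Rightarrow> UC41" where
  "K41_action k = tensor_map (uea_map (Ad41 k)) (clifford_map (Ad_p41 k))"

definition K41_invariants :: "UC41 set" where
  "K41_invariants = {x. \<forall>k\<in>K41. K41_action k x = x}"

lemma K41_action_tensor:
  assumes "k \<in> K41"
  shows "K41_action k (a \<otimes>\<^sub>C c) = uea_map (Ad41 k) a \<otimes>\<^sub>C clifford_map (Ad_p41 k) c"
proof -
  note U = uea_map_abs[OF clinear_Ad41 Ad41_bracket, OF K41_SO41 K41_SO41, OF assms assms]
  note C = clifford_map_abs[OF clinear_Ad_p41 Ad_p41_bform, OF assms assms]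
  have "clinear (uea_map (Ad41 k))"
  proof (rule clinearI)
    show "uea_map (Ad41 k) (x + y) = uea_map (Ad41 k) x + uea_map (Ad41 k) y" for x y
      by (induct x rule: uea.abs_induct, induct y rule: uea.abs_induct)
        (simp only: plus_uea.abs_eq U lin_ext_add)
    show "uea_map (Ad41 k) (c *\<^sub>C x) = c *\<^sub>C uea_map (Ad41 k) x" for c x
      by (induct x rule: uea.abs_induct) (simp only: scaleC_uea.abs_eq U lin_ext_scalar)
  qed
  moreover have "clinear (clifford_map (Ad_p41 k))"
  proof (rule clinearI)
    show "clifford_map (Ad_p41 k) (x + y) = clifford_map (Ad_p41 k) x + clifford_map (Ad_p41 k) y" for x y
      by (induct x rule: clifford.abs_induct, induct y rule: clifford.abs_induct)
        (simp only: plus_clifford.abs_eq C lin_ext_add)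
    show "clifford_map (Ad_p41 k) (c *\<^sub>C x) = c *\<^sub>C clifford_map (Ad_p41 k) x" for c x
      by (induct x rule: clifford.abs_induct) (simp only: scaleC_clifford.abs_eq C lin_ext_scalar)
  qed
  ultimately show ?thesis unfolding K41_action_def by (rule tensor_map_tensor)
qed


section \<open>The generators\<close>

definition unit_matrix :: "5 \<Rightarrow> 5 \<Rightarrow> complex^5^5"  (\<open>\<e>\<close>) where
  "\<e> j k = (\<chi> a b. if a = j \<and> b = k then 1 else 0)"

definition H\<^sub>1 :: so41C where "H\<^sub>1 = Abs_so41C (\<i> *\<^sub>M \<e> 1 2 - \<i> *\<^sub>M \<e> 2 1)"
definition H\<^sub>2 :: so41C where "H\<^sub>2 = Abs_so41C (\<i> *\<^sub>M \<e> 3 4 - \<i> *\<^sub>M \<e> 4 3)"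
definition E\<^sub>1 :: so41C where
  "E\<^sub>1 = Abs_so41C ((1/2) *\<^sub>M (\<e> 1 3 - \<e> 2 4 - \<i> *\<^sub>M \<e> 2 3 - \<i> *\<^sub>M \<e> 1 4
                         - \<e> 3 1 + \<e> 4 2 + \<i> *\<^sub>M \<e> 3 2 + \<i> *\<^sub>M \<e> 4 1))"
definition E\<^sub>2 :: so41C where
  "E\<^sub>2 = Abs_so41C ((1/2) *\<^sub>M (\<e> 1 3 + \<e> 2 4 - \<i> *\<^sub>M \<e> 2 3 + \<i> *\<^sub>M \<e> 1 4
                         - \<e> 3 1 - \<e> 4 2 + \<i> *\<^sub>M \<e> 3 2 - \<i> *\<^sub>M \<e> 4 1))"
definition F\<^sub>1 :: so41C where
  "F\<^sub>1 = Abs_so41C ((-1/2) *\<^sub>M (\<e> 1 3 - \<e> 2 4 + \<i> *\<^sub>M \<e> 2 3 + \<i> *\<^sub>M \<e> 1 4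
                         - \<e> 3 1 + \<e> 4 2 - \<i> *\<^sub>M \<e> 3 2 - \<i> *\<^sub>M \<e> 4 1))"
definition F\<^sub>2 :: so41C where
  "F\<^sub>2 = Abs_so41C ((-1/2) *\<^sub>M (\<e> 1 3 + \<e> 2 4 + \<i> *\<^sub>M \<e> 2 3 - \<i> *\<^sub>M \<e> 1 4
                         - \<e> 3 1 - \<e> 4 2 - \<i> *\<^sub>M \<e> 3 2 + \<i> *\<^sub>M \<e> 4 1))"
definition E\<^sub>3 :: so41C where
  "E\<^sub>3 = Abs_so41C (\<e> 1 5 - \<i> *\<^sub>M \<e> 2 5 + \<e> 5 1 - \<i> *\<^sub>M \<e> 5 2)"
definition E\<^sub>4 :: so41C where
  "E\<^sub>4 = Abs_so41C (\<e> 3 5 - \<i> *\<^sub>M \<e> 4 5 + \<e> 5 3 - \<i> *\<^sub>M \<e> 5 4)"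
definition F\<^sub>3 :: so41C where
  "F\<^sub>3 = Abs_so41C (\<e> 1 5 + \<i> *\<^sub>M \<e> 2 5 + \<e> 5 1 + \<i> *\<^sub>M \<e> 5 2)"
definition F\<^sub>4 :: so41C where
  "F\<^sub>4 = Abs_so41C (\<e> 3 5 + \<i> *\<^sub>M \<e> 4 5 + \<e> 5 3 + \<i> *\<^sub>M \<e> 5 4)"

lemma all_5: "(\<forall>i::5. P i) \<longleftrightarrow> P 1 \<and> P 2 \<and> P 3 \<and> P 4 \<and> P 5"
proof
  assume P: "P 1 \<and> P 2 \<and> P 3 \<and> P 4 \<and> P 5"
  show "\<forall>i::5. P i"
  proof
    fix i :: 5
    show "P i"
    proof (cases i)
      case (of_int z)
      then have "z = 0 \<or> z = 1 \<or> z = 2 \<or> z = 3 \<or> z = 4" by auto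
      moreover have "(5::5) = 0" by simp
      with P have "P 0" by metis
      ultimately show ?thesis using P of_int by auto
    qed
  qed
qed auto

lemma Rep_generators:
  "Rep_so41C H\<^sub>1 = \<i> *\<^sub>M \<e> 1 2 - \<i> *\<^sub>M \<e> 2 1"
  "Rep_so41C H\<^sub>2 = \<i> *\<^sub>M \<e> 3 4 - \<i> *\<^sub>M \<e> 4 3"
  "Rep_so41C E\<^sub>1 = (1/2) *\<^sub>M (\<e> 1 3 - \<e> 2 4 - \<i> *\<^sub>M \<e> 2 3 - \<i> *\<^sub>M \<e> 1 4
                         - \<e> 3 1 + \<e> 4 2 + \<i> *\<^sub>M \<e> 3 2 + \<i> *\<^sub>M \<e> 4 1)"
  "Rep_so41C E\<^sub>2 = (1/2) *\<^sub>M (\<e> 1 3 + \<e> 2 4 - \<i> *\<^sub>M \<e> 2 3 + \<i> *\<^sub>M \<e> 1 4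
                         - \<e> 3 1 - \<e> 4 2 + \<i> *\<^sub>M \<e> 3 2 - \<i> *\<^sub>M \<e> 4 1)"
  "Rep_so41C F\<^sub>1 = (-1/2) *\<^sub>M (\<e> 1 3 - \<e> 2 4 + \<i> *\<^sub>M \<e> 2 3 + \<i> *\<^sub>M \<e> 1 4
                         - \<e> 3 1 + \<e> 4 2 - \<i> *\<^sub>M \<e> 3 2 - \<i> *\<^sub>M \<e> 4 1)"
  "Rep_so41C F\<^sub>2 = (-1/2) *\<^sub>M (\<e> 1 3 + \<e> 2 4 + \<i> *\<^sub>M \<e> 2 3 - \<i> *\<^sub>M \<e> 1 4
                         - \<e> 3 1 - \<e> 4 2 - \<i> *\<^sub>M \<e> 3 2 + \<i> *\<^sub>M \<e> 4 1)"
  "Rep_so41C E\<^sub>3 = \<e> 1 5 - \<i> *\<^sub>M \<e> 2 5 + \<e> 5 1 - \<i> *\<^sub>M \<e> 5 2"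
  "Rep_so41C E\<^sub>4 = \<e> 3 5 - \<i> *\<^sub>M \<e> 4 5 + \<e> 5 3 - \<i> *\<^sub>M \<e> 5 4"
  "Rep_so41C F\<^sub>3 = \<e> 1 5 + \<i> *\<^sub>M \<e> 2 5 + \<e> 5 1 + \<i> *\<^sub>M \<e> 5 2"
  "Rep_so41C F\<^sub>4 = \<e> 3 5 + \<i> *\<^sub>M \<e> 4 5 + \<e> 5 3 + \<i> *\<^sub>M \<e> 5 4"
  unfolding H\<^sub>1_def H\<^sub>2_def E\<^sub>1_def E\<^sub>2_def F\<^sub>1_def F\<^sub>2_def E\<^sub>3_def E\<^sub>4_def F\<^sub>3_def F\<^sub>4_def
  by (rule Abs_so41C_inverse, simp add: so41_complexified_nth all_5 unit_matrix_def)+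

lemma generators_k41:
  "H\<^sub>1 \<in> k41" "H\<^sub>2 \<in> k41" "E\<^sub>1 \<in> k41" "E\<^sub>2 \<in> k41" "F\<^sub>1 \<in> k41" "F\<^sub>2 \<in> k41"
  by (simp_all add: k41_def Rep_so41C_inject[symmetric] cartan_inv.rep_eq Rep_generators
      vec_eq_iff transpose_def all_5 unit_matrix_def)

lemma generators_p41:
  "cartan_inv E\<^sub>3 = - E\<^sub>3" "cartan_inv E\<^sub>4 = - E\<^sub>4" "cartan_inv F\<^sub>3 = - F\<^sub>3" "cartan_inv F\<^sub>4 = - F\<^sub>4"
  unfolding Rep_so41C_inject[symmetric] cartan_inv.rep_eq uminus_so41C.rep_eq neg_equal_iff_equal
    Rep_generators
  by (simp_all add: vec_eq_iff transpose_def all_5 unit_matrix_def)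

lemma so41C_entries:
  "Rep_so41C X $ j $ i = (if (i = 5) = (j = 5) then - Rep_so41C X $ i $ j else Rep_so41C X $ i $ j)"
  using Rep_so41C[of X, unfolded so41_complexified_nth] by blast

lemma k41_span: "k41 = complex_space.span {H\<^sub>1, H\<^sub>2, E\<^sub>1, E\<^sub>2, F\<^sub>1, F\<^sub>2}"
proof (rule subset_antisym)
  have "complex_space.subspace k41"
    unfolding complex_space.subspace_def k41_def mem_Collect_eq cartan_inv_add cartan_inv_scaleC
    using cartan_inv_scaleC[of 0 0] by simp
  then show "complex_space.span {H\<^sub>1, H\<^sub>2, E\<^sub>1, E\<^sub>2, F\<^sub>1, F\<^sub>2} \<subseteq> k41"
    using generators_k41 by (intro complex_space.span_minimal) simp_all
next
  show "k41 \<subseteq> complex_space.span {H\<^sub>1, H\<^sub>2, E\<^sub>1, E\<^sub>2, F\<^sub>1, F\<^sub>2}"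
  proof
    fix X assume "X \<in> k41"
    then have rep: "(- transpose (Rep_so41C X)) $ i $ j = Rep_so41C X $ i $ j" for i j
      unfolding cartan_inv.rep_eq[symmetric] k41_def by simp
    have c: "Rep_so41C X $ i $ j = - Rep_so41C X $ j $ i" for i j
      by (subst rep[symmetric]) (simp add: transpose_def)
    let ?x = "\<lambda>i j. Rep_so41C X $ i $ j"
    have z: "?x i i = 0" "?x i 5 = 0" "?x 5 i = 0" for i
    proof -
      show z: "?x i i = 0" for i using c[of i i] by simp
      show "?x i 5 = 0" using c[of 5 i] so41C_entries[of X 5 i] z by (cases "i = 5") simp_all
      then show "?x 5 i = 0" using c[of 5 i] by simp
    qed
    have "X = (- \<i> * ?x 1 2) *\<^sub>C H\<^sub>1 + (- \<i> * ?x 3 4) *\<^sub>C H\<^sub>2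
        + ((?x 1 3 + \<i> * ?x 1 4 + \<i> * ?x 2 3 - ?x 2 4) / 2) *\<^sub>C E\<^sub>1
        + ((?x 1 3 - \<i> * ?x 1 4 + \<i> * ?x 2 3 + ?x 2 4) / 2) *\<^sub>C E\<^sub>2
        + (- (?x 1 3 - \<i> * ?x 1 4 - \<i> * ?x 2 3 - ?x 2 4) / 2) *\<^sub>C F\<^sub>1
        + (- (?x 1 3 + \<i> * ?x 1 4 - \<i> * ?x 2 3 + ?x 2 4) / 2) *\<^sub>C F\<^sub>2"
      unfolding Rep_so41C_inject[symmetric] plus_so41C.rep_eq scaleC_so41C.rep_eq Rep_generators
        vec_eq_iff all_5
      by (simp add: z unit_matrix_def c[of 2 1] c[of 3 1] c[of 4 1] c[of 3 2] c[of 4 2] c[of 4 3])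
        (simp add: field_simps)?
    also have "\<dots> \<in> complex_space.span {H\<^sub>1, H\<^sub>2, E\<^sub>1, E\<^sub>2, F\<^sub>1, F\<^sub>2}"
      by (intro complex_space.span_add complex_space.span_scale complex_space.span_base) simp_all
    finally show "X \<in> complex_space.span {H\<^sub>1, H\<^sub>2, E\<^sub>1, E\<^sub>2, F\<^sub>1, F\<^sub>2}" .
  qed
qed

lemma p41_span: "{X. cartan_inv X = - X} = complex_space.span {E\<^sub>3, E\<^sub>4, F\<^sub>3, F\<^sub>4}"
proof (rule subset_antisym)
  have "complex_space.subspace {X. cartan_inv X = - X}"
    unfolding complex_space.subspace_def mem_Collect_eq cartan_inv_add cartan_inv_scaleC
    using cartan_inv_scaleC[of 0 0] by simp
  then show "complex_space.span {E\<^sub>3, E\<^sub>4, F\<^sub>3, F\<^sub>4} \<subseteq> {X. cartan_inv X = - X}"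
    using generators_p41 by (intro complex_space.span_minimal) simp_all
next
  show "{X. cartan_inv X = - X} \<subseteq> complex_space.span {E\<^sub>3, E\<^sub>4, F\<^sub>3, F\<^sub>4}"
  proof
    fix X assume "X \<in> {X. cartan_inv X = - X}"
    then have rep: "(- transpose (Rep_so41C X)) $ i $ j = (- Rep_so41C X) $ i $ j" for i j
      unfolding cartan_inv.rep_eq[symmetric] uminus_so41C.rep_eq[symmetric] by simp
    have c: "Rep_so41C X $ i $ j = Rep_so41C X $ j $ i" for i j
      using rep[of j i, symmetric] by (simp add: transpose_def)
    let ?x = "\<lambda>i j. Rep_so41C X $ i $ j"
    have z: "(i = 5) = (j = 5) \<Longrightarrow> ?x i j = 0" for i j
      using c[of i j] so41C_entries[of X j i] by simp
    have "X = ((?x 1 5 + \<i> * ?x 2 5) / 2) *\<^sub>C E\<^sub>3 + ((?x 3 5 + \<i> * ?x 4 5) / 2) *\<^sub>C E\<^sub>4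
        + ((?x 1 5 - \<i> * ?x 2 5) / 2) *\<^sub>C F\<^sub>3 + ((?x 3 5 - \<i> * ?x 4 5) / 2) *\<^sub>C F\<^sub>4"
      unfolding Rep_so41C_inject[symmetric] plus_so41C.rep_eq scaleC_so41C.rep_eq Rep_generators
        vec_eq_iff all_5
      by (simp add: z unit_matrix_def c[of 5 1] c[of 5 2] c[of 5 3] c[of 5 4])
        (simp add: field_simps)?
    also have "\<dots> \<in> complex_space.span {E\<^sub>3, E\<^sub>4, F\<^sub>3, F\<^sub>4}"
      by (intro complex_space.span_add complex_space.span_scale complex_space.span_base) simp_all
    finally show "X \<in> complex_space.span {E\<^sub>3, E\<^sub>4, F\<^sub>3, F\<^sub>4}" .
  qed
qed

definition ext_square :: "p41 ext_alg set" where
  "ext_square = complex_space.span {ext_of v * ext_of w |v w. True}"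

text \<open>\<open>\<alpha>(X)\<close>, meant for \<open>X \<in> \<kk>\<close>, so that \<open>[X, v] \<in> \<pp>\<close> by \<open>bracket_k_p\<close>.\<close>

definition spin_map :: "so41C \<Rightarrow> p41 clifford" where
  "spin_map X = (THE c. c \<in> chevalley ` ext_square \<and>
     (\<forall>v. c * clifford_of v - clifford_of v * c = clifford_of (Abs_p41 (lie_bracket X (Rep_p41 v)))))"

definition rho :: "(so41C sym_alg, p41 ext_alg) tensor \<Rightarrow> UC41" where
  "rho = tensor_map symmetrization chevalley"

definition a\<^sub>1 :: "(so41C sym_alg, p41 ext_alg) tensor" where
  "a\<^sub>1 = ((sym_of H\<^sub>1 + sym_of H\<^sub>2)\<^sup>2 + 4 *\<^sub>C (sym_of E\<^sub>1 * sym_of F\<^sub>1)) \<otimes>\<^sub>C 1"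

definition a\<^sub>2 :: "(so41C sym_alg, p41 ext_alg) tensor" where
  "a\<^sub>2 = ((sym_of H\<^sub>1 - sym_of H\<^sub>2)\<^sup>2 + 4 *\<^sub>C (sym_of E\<^sub>2 * sym_of F\<^sub>2)) \<otimes>\<^sub>C 1"

definition top_form :: "(so41C sym_alg, p41 ext_alg) tensor" where
  "top_form = 1 \<otimes>\<^sub>C (ext_of (Abs_p41 E\<^sub>3) * ext_of (Abs_p41 E\<^sub>4) *
                    ext_of (Abs_p41 F\<^sub>3) * ext_of (Abs_p41 F\<^sub>4))"

definition Dirac :: UC41 where
  "Dirac = uea_of E\<^sub>3 \<otimes>\<^sub>C clifford_of (Abs_p41 F\<^sub>3) + uea_of E\<^sub>4 \<otimes>\<^sub>C clifford_of (Abs_p41 F\<^sub>4)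
         + uea_of F\<^sub>3 \<otimes>\<^sub>C clifford_of (Abs_p41 E\<^sub>3) + uea_of F\<^sub>4 \<otimes>\<^sub>C clifford_of (Abs_p41 E\<^sub>4)"

definition k_Dirac :: UC41 where
  "k_Dirac = uea_of E\<^sub>1 \<otimes>\<^sub>C spin_map (2 *\<^sub>C F\<^sub>1) + uea_of E\<^sub>2 \<otimes>\<^sub>C spin_map (2 *\<^sub>C F\<^sub>2)
           + uea_of F\<^sub>1 \<otimes>\<^sub>C spin_map (2 *\<^sub>C E\<^sub>1) + uea_of F\<^sub>2 \<otimes>\<^sub>C spin_map (2 *\<^sub>C E\<^sub>2)
           + uea_of (H\<^sub>1 - H\<^sub>2) \<otimes>\<^sub>C spin_map (H\<^sub>1 - H\<^sub>2) + uea_of (H\<^sub>1 + H\<^sub>2) \<otimes>\<^sub>C spin_map (H\<^sub>1 + H\<^sub>2)"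

end

theory Submission imports Defs begin

text \<open>Let \<open>S\<close> be the spin module of \<open>\<pp>\<close>. It is the sum of two chiral planes, with symplectic forms
  invariant under the two factors of \<open>SL\<^sub>2 \<times> SL\<^sub>2\<close>, the complexified cover of \<open>K\<close>. As representations
  \<open>C(\<pp>) = S \<otimes> S\<close>, and \<open>\<gg>\<close> is a quotient of \<open>S \<otimes> S\<close>, namely \<open>Sym\<^sup>2 S\<close>. Hence an invariant of filtration
  degree at most \<open>n\<close> is the image of a tensor of rank \<open>2 n + 2\<close> over \<open>S\<close>, and the lift of least norm is
  again invariant. By the first fundamental theorem for \<open>SL\<^sub>2\<close> it pairs off the slots with the symplectic
  forms. Modulo lower degree, a pairing between the Clifford factor and a letter of \<open>\<gg>\<close> splits off a
  generator. A Clifford factor paired with itself is reconnected to any slot of its chirality by the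
  Pluecker relation. If all other slots have the other chirality, then pairing two letters splits off a Casimir
  element, while a letter paired with itself vanishes. Induction on \<open>n\<close> finishes the proof.\<close>

section \<open>Invariants of \<open>SL\<^sub>2 \<times> SL\<^sub>2\<close> on tensors of spinors\<close>

text \<open>The elements \<open>letter_vec\<close> and \<open>cmat\<close> serve only as spanning
  sets. Relations between words are never excluded (no Poincare-Birkhoff-Witt basis, no dimension of
  C(p)), so an invariant cannot be split by degree and its coefficients need not be invariant. This
  is why all degrees up to n are lifted together, and why the lift has to be corrected afterwards.
  Index tuples carry the standard Hermitian product, for which \<open>rotation\<close> acts
  unitarily; orthogonality to the kernel replaces averaging over K. For the lift, invariance is used
  only under six circles \<open>rot5\<close>, whose derivatives span both copies of sl2 over the
  complex numbers. Connectedness of K is needed to fix two signs, that of the action on the volume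
  form and that of the corner entry. The induction works because C(p) multiplies like matrix units:
  \<open>gen_X\<close>, which combines D, D_k and the chirality projections, attaches one letter to
  the left index of the Clifford factor. Products of generators are thus chains of letters between
  the two Clifford indices.\<close>

type_synonym spinor = "bool \<times> bool"

definition eps :: "bool \<Rightarrow> bool \<Rightarrow> complex" where
  "eps a b = (if a = b then 0 else if a then - 1 else 1)"

definition spin_form :: "spinor \<Rightarrow> spinor \<Rightarrow> complex" where
  "spin_form \<alpha> \<beta> = (if fst \<alpha> = fst \<beta> then eps (snd \<alpha>) (snd \<beta>) else 0)"

definition half_form :: "bool \<Rightarrow> spinor \<Rightarrow> spinor \<Rightarrow> complex" where
  "half_form c \<alpha> \<beta> = (if fst \<alpha> = c \<and> fst \<beta> = c then eps (snd \<alpha>) (snd \<beta>) else 0)"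

text \<open>Tuples indexed by I are total functions with a default value off I. They form a finite
  set when I is finite, and a further slot is filled by a function update without a change of
  type.\<close>

definition assignments :: "nat set \<Rightarrow> (nat \<Rightarrow> spinor) set" where
  "assignments I = {w. \<forall>i. i \<notin> I \<longrightarrow> w i = (False, False)}"

lemma UNIV_spinor: "(UNIV :: spinor set) = {(False, False), (False, True), (True, False), (True, True)}"
  by auto

lemma sum_spinor: "(\<Sum>\<alpha>\<in>UNIV. f (\<alpha> :: spinor)) =
    f (False, False) + f (False, True) + f (True, False) + (f (True, True) :: 'a::comm_monoid_add)"
  unfolding UNIV_spinor by (simp add: add.assoc)

lemma assignments_empty: "assignments {} = {\<lambda>_. (False, False)}"
  by (auto simp: assignments_def)

lemma assignments_insert:
  "assignments (insert i I) = (\<lambda>(\<alpha>, w). w(i := \<alpha>)) ` (UNIV \<times> assignments I)"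
proof
  show "assignments (insert i I) \<subseteq> (\<lambda>(\<alpha>, w). w(i := \<alpha>)) ` (UNIV \<times> assignments I)"
  proof
    fix w assume w: "w \<in> assignments (insert i I)"
    show "w \<in> (\<lambda>(\<alpha>, w). w(i := \<alpha>)) ` (UNIV \<times> assignments I)"
    proof (rule image_eqI[where x = "(w i, if i \<in> I then w else w(i := (False, False)))"])
      show "(w i, if i \<in> I then w else w(i := (False, False))) \<in> UNIV \<times> assignments I"
        using w by (auto simp: assignments_def)
    qed auto
  qed
qed (auto simp: assignments_def)

lemma finite_assignments: "finite I \<Longrightarrow> finite (assignments I)"
  by (induction I rule: finite_induct) (simp_all add: assignments_empty assignments_insert)

lemma sum_assignments_insert:
  assumes "i \<notin> I"
  shows "(\<Sum>w\<in>assignments (insert i I). f w) = (\<Sum>\<alpha>\<in>UNIV. \<Sum>w\<in>assignments I. f (w(i := \<alpha>)))"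
proof -
  have inj: "inj_on (\<lambda>(\<alpha>, w). w(i := \<alpha>)) (UNIV \<times> assignments I)"
  proof (rule inj_onI, clarsimp)
    fix a b a' b' w w'
    assume w: "w \<in> assignments I" "w' \<in> assignments I" and eq: "w(i := (a, b)) = w'(i := (a', b'))"
    have "w j = w' j" for j
      using fun_cong[OF eq, of j] w assms by (cases "j = i") (auto simp: assignments_def)
    then show "a = a' \<and> b = b' \<and> w = w'" using fun_cong[OF eq, of i] by auto
  qed
  have "(\<Sum>w\<in>assignments (insert i I). f w) = (\<Sum>x\<in>UNIV \<times> assignments I. f ((\<lambda>(\<alpha>, w). w(i := \<alpha>)) x))"
    unfolding assignments_insert by (subst sum.reindex[OF inj]) simp
  also have "\<dots> = (\<Sum>\<alpha>\<in>UNIV. \<Sum>w\<in>assignments I. f (w(i := \<alpha>)))"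
    by (simp add: sum.cartesian_product case_prod_beta)
  finally show ?thesis .
qed

text \<open>Invariance under both copies of \<open>\<ss>\<ll>\<^sub>2\<close>, expressed through the matrix units of \<open>\<gg>\<ll>\<^sub>2\<close>; the right-hand
  side is the action of their trace parts.\<close>

definition spin_inv :: "nat set \<Rightarrow> ((nat \<Rightarrow> spinor) \<Rightarrow> complex) \<Rightarrow> bool" where
  "spin_inv I t \<longleftrightarrow> (\<forall>c a b w. (\<Sum>i\<in>I. if w i = (c, a) then t (w(i := (c, b))) else 0) =
     (if a = b then of_nat (card {i\<in>I. fst (w i) = c}) / 2 * t w else 0))"

text \<open>The sum of \<open>half_form c\<close> times t over the entries of the slots i and j,
  written out with \<open>eps False True = 1\<close>.\<close>

definition contract :: "bool \<Rightarrow> nat \<Rightarrow> nat \<Rightarrow> ((nat \<Rightarrow> spinor) \<Rightarrow> complex) \<Rightarrow> (nat \<Rightarrow> spinor) \<Rightarrow> complex" where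
  "contract c i j t w = t (w(i := (c, False), j := (c, True))) - t (w(i := (c, True), j := (c, False)))"

lemma sum_remove2:
  assumes "finite I" "i \<in> I" "j \<in> I" "i \<noteq> j"
  shows "(\<Sum>k\<in>I. f k) = f i + f j + (\<Sum>k\<in>I - {i, j}. f k :: complex)"
proof -
  have "I - {i} - {j} = I - {i, j}" by auto
  then show ?thesis
    using assms sum.remove[of I i f] sum.remove[of "I - {i}" j f] by (simp add: add.assoc)
qed

text \<open>On an antisymmetric pair of slots of one chirality a matrix unit acts by its trace. That
  is exactly what these two slots add to the count on the right-hand side of
  \<open>spin_inv\<close>, so both contributions drop out together.\<close>

lemma spin_inv_contract:
  assumes t: "spin_inv I t" and I: "finite I" "i \<in> I" "j \<in> I" "i \<noteq> j"
  shows "spin_inv (I - {i, j}) (contract c i j t)"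
  unfolding spin_inv_def
proof (intro allI)
  fix c' a b w
  define u where "u x y = (w(i := (c, x), j := (c, y)) :: nat \<Rightarrow> spinor)" for x y
  let ?S = "\<lambda>x y. (\<Sum>k\<in>I - {i, j}. if w k = (c', a) then t ((u x y)(k := (c', b))) else 0)"
  let ?n = "card {k\<in>I - {i, j}. fst (w k) = c'}"
  have card: "card {k\<in>I. fst (u x y k) = c'} = (if c = c' then 2 else 0) + ?n" for x y
  proof -
    have "{k\<in>I. fst (u x y k) = c'} = (if c = c' then {i, j} else {}) \<union> {k\<in>I - {i, j}. fst (w k) = c'}"
      using I by (auto simp: u_def)
    then show ?thesis using I by (simp add: card_Un_disjoint)
  qed
  have upd: "(u x y)(i := (c, z)) = u z y" "(u x y)(j := (c, z)) = u x z" for x y z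
    using I by (auto simp: u_def)
  have main: "(if c = c' \<and> x = a then t (u b y) else 0) + (if c = c' \<and> y = a then t (u x b) else 0) + ?S x y
      = (if a = b then of_nat ((if c = c' then 2 else 0) + ?n) / 2 * t (u x y) else 0)" for x y
  proof -
    have "(\<Sum>k\<in>I. if u x y k = (c', a) then t ((u x y)(k := (c', b))) else 0)
        = (if c = c' \<and> x = a then t (u b y) else 0) + (if c = c' \<and> y = a then t (u x b) else 0) + ?S x y"
    proof (subst sum_remove2[OF I], intro arg_cong2[where f = "(+)"])
      show "(if u x y i = (c', a) then t ((u x y)(i := (c', b))) else 0) = (if c = c' \<and> x = a then t (u b y) else 0)"
        using I upd by (auto simp: u_def)
      show "(if u x y j = (c', a) then t ((u x y)(j := (c', b))) else 0) = (if c = c' \<and> y = a then t (u x b) else 0)"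
        using I upd by (auto simp: u_def)
      show "(\<Sum>k\<in>I - {i, j}. if u x y k = (c', a) then t ((u x y)(k := (c', b))) else 0) = ?S x y"
        by (rule sum.cong) (auto simp: u_def)
    qed
    then show ?thesis
      using t[unfolded spin_inv_def, rule_format, where c = c' and a = a and b = b and w = "u x y"]
      unfolding card by (rule trans[OF sym])
  qed
  have "(\<Sum>k\<in>I - {i, j}. if w k = (c', a) then contract c i j t (w(k := (c', b))) else 0) = ?S False True - ?S True False"
    unfolding sum_subtractf[symmetric]
  proof (rule sum.cong[OF refl])
    fix k assume k: "k \<in> I - {i, j}"
    then have "w(k := (c', b), i := x, j := y) = w(i := x, j := y, k := (c', b))" for x y
      by (simp add: fun_upd_twist)
    then show "(if w k = (c', a) then contract c i j t (w(k := (c', b))) else 0) =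
      (if w k = (c', a) then t ((u False True)(k := (c', b))) else 0) -
      (if w k = (c', a) then t ((u True False)(k := (c', b))) else 0)"
      by (simp add: contract_def u_def)
  qed
  also have "\<dots> = (if a = b then of_nat ?n / 2 * (t (u False True) - t (u True False)) else 0)"
  proof -
    define S where "S = ?S"
    note main[unfolded fun_cong[OF fun_cong[OF S_def[symmetric]]]]
    from this[of False True] this[of True False] have "S False True - S True False =
        (if a = b then of_nat ?n / 2 * (t (u False True) - t (u True False)) else 0)"
      by (cases a; cases b; cases "c = c'") (auto simp: field_simps eq_neg_iff_add_eq_0[symmetric] add.commute)
    then show ?thesis by (simp only: S_def)
  qed
  finally show "(\<Sum>k\<in>I - {i, j}. if w k = (c', a) then contract c i j t (w(k := (c', b))) else 0) =
    (if a = b then of_nat ?n / 2 * contract c i j t w else 0)"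
    by (simp add: contract_def u_def)
qed

text \<open>The quadratic Casimir element of \<open>\<ss>\<ll>\<^sub>2\<close> acts on one slot by a scalar, and moving one of its
  factors to the other slots by invariance turns it into a sum of swaps; a swap of two slots is
  the identity minus a contraction.\<close>

lemma spin_inv_expand:
  assumes t: "spin_inv I t" and I: "finite I" "p \<in> I" and c: "fst (w p) = c"
  shows "(of_nat (card {i\<in>I. fst (w i) = c}) / 2 + 1) * t w =
    (\<Sum>j\<in>I - {p}. half_form c (w p) (w j) * contract c p j t w)"
proof -
  obtain a where a: "w p = (c, a)" using c by (cases "w p") auto
  let ?n = "card {i\<in>I. fst (w i) = c}"
  have card: "card {i\<in>I. fst ((w(p := (c, b))) i) = c} = ?n" for b
    by (rule arg_cong[where f = card]) (use c in auto)
  let ?A = "\<lambda>b. \<Sum>j\<in>I - {p}. if w j = (c, b) then t (w(p := (c, b), j := (c, a))) else 0"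
  have wa: "w(p := (c, a)) = w" using a by auto
  \<comment> \<open>Invariance at the assignment with b in slot p, for the matrix unit that carries
    b back to a: slot p contributes t w, every other slot j the swap of p and j.\<close>
  have b: "t w + (\<Sum>j\<in>I - {p}. if w j = (c, b) then t (w(p := (c, b), j := (c, a))) else 0)
      = (if a = b then of_nat ?n / 2 * t w else 0)" for b
  proof -
    have "(\<Sum>i\<in>I. if (w(p := (c, b))) i = (c, b) then t ((w(p := (c, b)))(i := (c, a))) else 0)
      = t w + (\<Sum>j\<in>I - {p}. if w j = (c, b) then t (w(p := (c, b), j := (c, a))) else 0)"
      using I by (subst sum.remove[of _ p]) (auto simp: wa intro!: sum.cong)
    moreover have "a = b \<Longrightarrow> w(p := (c, b)) = w" using wa by simp
    ultimately show ?thesis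
      using t[unfolded spin_inv_def, rule_format, of "w(p := (c, b))" c b a] card[of b] by auto
  qed
  have "(\<Sum>j\<in>I - {p}. half_form c (w p) (w j) * contract c p j t w) =
     (\<Sum>j\<in>I - {p}. (if fst (w j) = c then t w else 0) -
       ((if w j = (c, False) then t (w(p := (c, False), j := (c, a))) else 0) +
       (if w j = (c, True) then t (w(p := (c, True), j := (c, a))) else 0)))"
  proof (rule sum.cong[OF refl])
    fix j assume "j \<in> I - {p}"
    then have jp: "j \<noteq> p" by simp
    obtain d b where d: "w j = (d, b)" by (cases "w j")
    have wab: "d = c \<Longrightarrow> w(p := (c, a), j := (c, b)) = w"
      using a d by auto
    show "half_form c (w p) (w j) * contract c p j t w = (if fst (w j) = c then t w else 0) -
       ((if w j = (c, False) then t (w(p := (c, False), j := (c, a))) else 0) +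
       (if w j = (c, True) then t (w(p := (c, True), j := (c, a))) else 0))"
      using jp wab unfolding half_form_def eps_def a d contract_def
      by (cases "d = c"; cases a; cases b) auto
  qed
  also have "\<dots> = (\<Sum>j\<in>I - {p}. if fst (w j) = c then t w else 0) -
      ((\<Sum>j\<in>I - {p}. if w j = (c, False) then t (w(p := (c, False), j := (c, a))) else 0) +
       (\<Sum>j\<in>I - {p}. if w j = (c, True) then t (w(p := (c, True), j := (c, a))) else 0))"
    by (simp add: sum_subtractf sum.distrib)
  also have "(\<Sum>j\<in>I - {p}. if fst (w j) = c then t w else 0) = (of_nat ?n - 1) * t w"
  proof -
    have "(\<Sum>j\<in>I. if fst (w j) = c then t w else 0) = of_nat ?n * t w"
      using I by (simp add: sum.If_cases Int_def)
    then show ?thesis using I c by (subst (asm) sum.remove[of _ p]) (auto simp: algebra_simps)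
  qed
  \<comment> \<open>The identity parts of the swaps give n - 1, and the two sums \<open>?A\<close>
    together give n/2 - 2, which leaves n/2 + 1.\<close>
  finally have "(\<Sum>j\<in>I - {p}. half_form c (w p) (w j) * contract c p j t w) = (of_nat ?n - 1) * t w - (?A False + ?A True)" .
  moreover have "?A b = (if a = b then of_nat ?n / 2 * t w else 0) - t w" for b
    using b[of b] by (simp add: algebra_simps)
  ultimately show ?thesis by (cases a) (simp_all add: field_simps)
qed

text \<open>Dependence on the chiralities alone. The scalar in \<open>spin_inv_expand\<close> counts
  slots of chirality c, so it is constant only on each chirality pattern; such factors commute with
  the action, which preserves patterns.\<close>

definition chiral_fun :: "nat set \<Rightarrow> ((nat \<Rightarrow> spinor) \<Rightarrow> complex) \<Rightarrow> bool" where
  "chiral_fun I f \<longleftrightarrow> (\<forall>w. \<forall>i\<in>I. \<forall>\<beta>. fst \<beta> = fst (w i) \<longrightarrow> f (w(i := \<beta>)) = f w)"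

lemma spin_inv_chiral_mult:
  assumes "spin_inv I t" "chiral_fun I f"
  shows "spin_inv I (\<lambda>w. f w * t w)"
  unfolding spin_inv_def
proof (intro allI)
  fix c a b w
  have "(\<Sum>i\<in>I. if w i = (c, a) then f (w(i := (c, b))) * t (w(i := (c, b))) else 0) =
      f w * (\<Sum>i\<in>I. if w i = (c, a) then t (w(i := (c, b))) else 0)"
    unfolding sum_distrib_left
  proof (rule sum.cong[OF refl])
    fix i assume "i \<in> I"
    then have "w i = (c, a) \<Longrightarrow> f (w(i := (c, b))) = f w"
      using assms(2) unfolding chiral_fun_def by (metis fst_conv)
    then show "(if w i = (c, a) then f (w(i := (c, b))) * t (w(i := (c, b))) else 0) =
        f w * (if w i = (c, a) then t (w(i := (c, b))) else 0)" by simp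
  qed
  then show "(\<Sum>i\<in>I. if w i = (c, a) then f (w(i := (c, b))) * t (w(i := (c, b))) else 0) =
     (if a = b then of_nat (card {i\<in>I. fst (w i) = c}) / 2 * (f w * t w) else 0)"
    using assms(1)[unfolded spin_inv_def, rule_format, where c = c and a = a and b = b and w = w] by simp
qed

text \<open>The converse operation to contraction: a matrix unit acts on the symplectic form by its
  trace, and where the form is nonzero both new slots are counted.\<close>

lemma spin_inv_half_form_mult:
  assumes t: "spin_inv I t" and I: "finite I" "p \<notin> I" "q \<notin> I" "p \<noteq> q"
    and indep: "\<And>w x. t (w(p := x)) = t w" "\<And>w x. t (w(q := x)) = t w"
  shows "spin_inv (insert p (insert q I)) (\<lambda>w. half_form c (w p) (w q) * t w)"
  unfolding spin_inv_def
proof (intro allI)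
  fix c' a b and w :: "nat \<Rightarrow> spinor"
  let ?t = "\<lambda>w. half_form c (w p) (w q) * t w"
  let ?n = "card {i\<in>I. fst (w i) = c'}"
  have "(\<Sum>i\<in>insert p (insert q I). if w i = (c', a) then ?t (w(i := (c', b))) else 0)
     = (if w p = (c', a) then half_form c (c', b) (w q) * t w else 0)
     + (if w q = (c', a) then half_form c (w p) (c', b) * t w else 0)
     + half_form c (w p) (w q) * (\<Sum>i\<in>I. if w i = (c', a) then t (w(i := (c', b))) else 0)"
    using I by (auto simp: indep sum_distrib_left intro!: sum.cong)
  also have "(\<Sum>i\<in>I. if w i = (c', a) then t (w(i := (c', b))) else 0) =
      (if a = b then of_nat ?n / 2 * t w else 0)"
    using t by (simp add: spin_inv_def)
  also have "(if w p = (c', a) then half_form c (c', b) (w q) * t w else 0)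
     + (if w q = (c', a) then half_form c (w p) (c', b) * t w else 0)
     = (if a = b \<and> c = c' then half_form c (w p) (w q) * t w else 0)"
    unfolding half_form_def eps_def
    by (cases "w p"; cases "w q"; cases a; cases b; cases "c = c'") auto
  finally have 1: "(\<Sum>i\<in>insert p (insert q I). if w i = (c', a) then ?t (w(i := (c', b))) else 0) =
     (if a = b \<and> c = c' then ?t w else 0) + half_form c (w p) (w q) * (if a = b then of_nat ?n / 2 * t w else 0)" .
  have 2: "card {i\<in>insert p (insert q I). fst (w i) = c'} = (if c = c' then 2 else 0) + ?n"
    if "half_form c (w p) (w q) \<noteq> 0"
  proof -
    have "fst (w p) = c" "fst (w q) = c" using that by (auto simp: half_form_def split: if_splits)
    then have "{i\<in>insert p (insert q I). fst (w i) = c'} = (if c = c' then {p, q} else {}) \<union> {i\<in>I. fst (w i) = c'}"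
      by auto
    then show ?thesis using I by (simp add: card_Un_disjoint)
  qed
  show "(\<Sum>i\<in>insert p (insert q I). if w i = (c', a) then ?t (w(i := (c', b))) else 0) =
     (if a = b then of_nat (card {i\<in>insert p (insert q I). fst (w i) = c'}) / 2 * ?t w else 0)"
  proof (cases "half_form c (w p) (w q) = 0")
    case True
    then show ?thesis unfolding 1 by auto
  next
    case False
    show ?thesis unfolding 1 2[OF False] by (simp add: field_simps)
  qed
qed

lemma contract_indep: "i \<noteq> j \<Longrightarrow> contract c i j t (w(i := x)) = contract c i j t w"
    "contract c i j t (w(j := x)) = contract c i j t w"
  by (simp_all add: contract_def fun_upd_twist)

lemma contract_indep_other:
  assumes "\<And>w x. t (w(k := x)) = t w"
  shows "contract c i j t (w(k := x)) = contract c i j t w"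
proof -
  have "t (w(k := x, i := y, j := z)) = t (w(i := y, j := z))" for y z
    using assms[of "w(i := y, j := z)" x] assms
    by (metis fun_upd_twist fun_upd_upd)
  then show ?thesis by (simp add: contract_def)
qed

text \<open>Divide \<open>spin_inv_expand\<close> by its scalar, which is never zero. The last three
  conclusions record which slots the coefficients ignore; tensors are functions of all slots, so
  this is how a smaller slot set is expressed.\<close>

lemma spin_inv_first_fundamental:
  assumes t: "spin_inv I t" and I: "finite I" "p \<in> I"
  obtains \<tau> where "\<And>j. j \<in> I - {p} \<Longrightarrow> spin_inv (I - {p, j}) (\<tau> j)"
    and "\<And>w. (if fst (w p) = c then t w else 0) = (\<Sum>j\<in>I - {p}. half_form c (w p) (w j) * \<tau> j w)"
    and "\<And>j w x. j \<noteq> p \<Longrightarrow> \<tau> j (w(p := x)) = \<tau> j w"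
    and "\<And>j w x. \<tau> j (w(j := x)) = \<tau> j w"
    and "\<And>j k w x. (\<And>w x. t (w(k := x)) = t w) \<Longrightarrow> k \<notin> I \<Longrightarrow> \<tau> j (w(k := x)) = \<tau> j w"
proof
  \<comment> \<open>Wherever the form on p and j is nonzero, both slots have chirality c, so n/2 + 1
    equals m/2 + 2 with m counted off p and j. In this form the scalar ignores p and j and can be
    absorbed into the coefficient.\<close>
  define f where "f j w = 1 / (of_nat (card {i\<in>I - {p, j}. fst (w i :: spinor) = c}) / 2 + 2 :: complex)" for j w
  let ?\<tau> = "\<lambda>j w. f j w * contract c p j t w"
  have f_cong: "f j w = f j w'" if "\<And>i. i \<in> I - {p, j} \<Longrightarrow> fst (w i) = fst (w' i)" for j w w'
    unfolding f_def by (rule arg_cong[where f = "\<lambda>A. 1 / (of_nat (card A) / 2 + 2)"]) (use that in auto)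
  show "spin_inv (I - {p, j}) (?\<tau> j)" if "j \<in> I - {p}" for j
  proof (rule spin_inv_chiral_mult)
    show "spin_inv (I - {p, j}) (contract c p j t)"
      using that I by (intro spin_inv_contract[OF t]) auto
    show "chiral_fun (I - {p, j}) (f j)"
      unfolding chiral_fun_def by (intro allI ballI impI f_cong) (simp add: fun_upd_def)
  qed
  show "?\<tau> j (w(p := x)) = ?\<tau> j w" if "j \<noteq> p" for j w x
  proof -
    have "f j (w(p := x)) = f j w" by (rule f_cong) auto
    then show ?thesis using that by (simp add: contract_indep)
  qed
  show "?\<tau> j (w(j := x)) = ?\<tau> j w" for j w x
  proof -
    have "f j (w(j := x)) = f j w" by (rule f_cong) auto
    then show ?thesis by (simp add: contract_indep)
  qed
  show "?\<tau> j (w(k := x)) = ?\<tau> j w" if "\<And>w x. t (w(k := x)) = t w" "k \<notin> I" for j k w x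
  proof -
    have "f j (w(k := x)) = f j w" by (rule f_cong) (use that in auto)
    then show ?thesis using contract_indep_other[where t = t, OF that(1)] by simp
  qed
  show "(if fst (w p) = c then t w else 0) = (\<Sum>j\<in>I - {p}. half_form c (w p) (w j) * ?\<tau> j w)" for w
  proof (cases "fst (w p) = c")
    case False
    then show ?thesis by (simp add: half_form_def)
  next
    case True
    let ?n = "card {i\<in>I. fst (w i) = c}"
    have "(\<Sum>j\<in>I - {p}. half_form c (w p) (w j) * ?\<tau> j w) =
      (\<Sum>j\<in>I - {p}. half_form c (w p) (w j) * contract c p j t w / (of_nat ?n / 2 + 1))"
    proof (rule sum.cong[OF refl])
      fix j assume j: "j \<in> I - {p}"
      show "half_form c (w p) (w j) * ?\<tau> j w = half_form c (w p) (w j) * contract c p j t w / (of_nat ?n / 2 + 1)"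
      proof (cases "fst (w j) = c")
        case False
        then show ?thesis by (simp add: half_form_def)
      next
        case jc: True
        have "{i\<in>I. fst (w i) = c} = {p, j} \<union> {i\<in>I - {p, j}. fst (w i) = c}"
          using I j True jc by auto
        then have "?n = 2 + card {i\<in>I - {p, j}. fst (w i) = c}"
          using I j by (simp add: card_Un_disjoint)
        then have n: "of_nat ?n / 2 + 1 = (of_nat (card {i\<in>I - {p, j}. fst (w i) = c}) / 2 + 2 :: complex)"
          by (simp only: of_nat_add) (simp add: field_simps)
        show ?thesis unfolding n f_def by simp
      qed
    qed
    also have "\<dots> = (of_nat ?n / 2 + 1) * t w / (of_nat ?n / 2 + 1)"
      unfolding sum_divide_distrib[symmetric] spin_inv_expand[where w = w and c = c, OF t I True, symmetric] by simp
    also have "\<dots> = t w"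
    proof -
      have "of_nat ?n / 2 + 1 = (complex_of_real (of_nat ?n / 2 + 1))" by simp
      moreover have "(of_nat ?n / 2 + 1 :: real) \<noteq> 0"
        by (metis add_nonneg_pos divide_nonneg_pos less_irrefl of_nat_0_le_iff zero_less_numeral zero_less_one)
      ultimately have "of_nat ?n / 2 + 1 \<noteq> (0::complex)" by (metis of_real_eq_0_iff)
      then show ?thesis by simp
    qed
    finally show ?thesis using True by simp
  qed
qed

section \<open>Unitary groups and invariant lifts\<close>

text \<open>Orthogonal projection onto N, built one coordinate at a time: N is the orthogonal sum of
  its vectors vanishing at j0 and of at most one line, and the induction hypothesis projects onto
  the former.\<close>

lemma orthogonal_decomposition:
  fixes J :: "'j set"
  assumes "finite J"
    and "\<And>x y. x \<in> N \<Longrightarrow> y \<in> N \<Longrightarrow> (\<lambda>j. x j + y j) \<in> N"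
    and "\<And>c x. x \<in> N \<Longrightarrow> (\<lambda>j. c * x j) \<in> N"
    and "(\<lambda>j. 0) \<in> N"
  shows "\<exists>n\<in>N. \<forall>y\<in>N. (\<Sum>j\<in>J. (s j - n j) * cnj (y j)) = (0 :: complex)"
  using assms
proof (induction J arbitrary: N s rule: finite_induct)
  case empty
  then show ?case by auto
next
  case (insert j0 J)
  let ?N0 = "{y\<in>N. y j0 = 0}"
  have IH: "\<exists>n\<in>?N0. \<forall>y\<in>?N0. (\<Sum>j\<in>J. (s j - n j) * cnj (y j)) = 0" for s
    using insert.prems by (intro insert.IH) auto
  note sum = sum.insert[OF insert.hyps(1,2)]
  show ?case
  proof (cases "\<forall>y\<in>N. y j0 = 0")
    case True
    then have "?N0 = N" by auto
    then obtain n where "n \<in> N" "\<forall>y\<in>N. (\<Sum>j\<in>J. (s j - n j) * cnj (y j)) = 0"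
      using IH[of s] by auto
    then show ?thesis using True unfolding sum by (intro bexI[of _ n]) auto
  next
    case False
    then obtain y0 where y0: "y0 \<in> N" "y0 j0 \<noteq> 0" by auto
    define y1 where "y1 j = inverse (y0 j0) * y0 j" for j
    have y1: "y1 \<in> N" "y1 j0 = 1"
      using insert.prems(2)[OF y0(1)] y0(2) by (simp_all add: y1_def[abs_def])
    obtain n1 where n1: "n1 \<in> N" "n1 j0 = 0" and n1': "\<And>y. y \<in> ?N0 \<Longrightarrow> (\<Sum>j\<in>J. (y1 j - n1 j) * cnj (y j)) = 0"
      using IH[of y1] by auto
    \<comment> \<open>The component of y1 orthogonal to \<open>?N0\<close>. Its coordinate at j0
      stays 1, so that z has nonzero norm and y - (y j0) z always falls into
      \<open>?N0\<close>.\<close>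
    define z where "z j = y1 j + (-1) * n1 j" for j
    have z: "z \<in> N" "z j0 = 1"
      unfolding z_def[abs_def] using insert.prems(1)[OF y1(1) insert.prems(2)[OF n1(1), of "-1"]] y1 n1
      by simp_all
    have z': "(\<Sum>j\<in>J. z j * cnj (y j)) = 0" if "y \<in> ?N0" for y
      using n1'[OF that] by (simp add: z_def)
    obtain n2 where n2: "n2 \<in> N" "n2 j0 = 0" and n2': "\<And>y. y \<in> ?N0 \<Longrightarrow> (\<Sum>j\<in>J. (s j - n2 j) * cnj (y j)) = 0"
      using IH[of s] by auto
    define d where "d = (\<Sum>j\<in>insert j0 J. z j * cnj (z j))"
    define r where "r = (\<Sum>j\<in>insert j0 J. (cmod (z j))\<^sup>2)"
    have "d = complex_of_real r"
      unfolding d_def r_def of_real_sum by (intro sum.cong) (simp_all only: complex_norm_square)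
    moreover have "r \<ge> 1"
      unfolding r_def sum using z(2) by (simp add: sum_nonneg)
    ultimately have d: "d \<noteq> 0" by auto
    define a where "a = (\<Sum>j\<in>insert j0 J. (s j - n2 j) * cnj (z j)) / d"
    define n where "n j = n2 j + a * z j" for j
    have n: "n \<in> N"
      unfolding n_def[abs_def] using insert.prems(1)[OF n2(1) insert.prems(2)[OF z(1), of a]] .
    have "(\<Sum>j\<in>insert j0 J. (s j - n j) * cnj (y j)) = 0" if y: "y \<in> N" for y
    proof -
      define y' where "y' j = y j + (- y j0) * z j" for j
      have y': "y' \<in> ?N0"
        unfolding y'_def[abs_def] using insert.prems(1)[OF y insert.prems(2)[OF z(1), of "- y j0"]] z(2)
        by simp
      have zero: "y' j0 = 0" using y' by simp
      have "(\<Sum>j\<in>insert j0 J. (s j - n j) * cnj (y j)) =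
          (\<Sum>j\<in>insert j0 J. (s j - n2 j) * cnj (y' j)) - a * (\<Sum>j\<in>insert j0 J. z j * cnj (y' j))
          + cnj (y j0) * ((\<Sum>j\<in>insert j0 J. (s j - n2 j) * cnj (z j)) - a * d)"
        unfolding d_def sum_distrib_left sum_subtractf[symmetric] sum.distrib[symmetric]
        by (rule sum.cong) (simp_all add: n_def y'_def algebra_simps)
      also have "(\<Sum>j\<in>insert j0 J. (s j - n2 j) * cnj (y' j)) = 0"
        unfolding sum using n2'[OF y'] zero by simp
      also have "(\<Sum>j\<in>insert j0 J. z j * cnj (y' j)) = 0"
        unfolding sum using z'[OF y'] zero by simp
      also have "a * d = (\<Sum>j\<in>insert j0 J. (s j - n2 j) * cnj (z j))"
        using d by (simp add: a_def)
      finally show ?thesis by simp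
    qed
    then show ?thesis using n by blast
  qed
qed

lemma clinear_zero: "clinear f \<Longrightarrow> f 0 = 0"
  using clinear_scaleC[of f 0 0] by simp

lemma clinear_sum: "clinear f \<Longrightarrow> f (sum g A) = (\<Sum>a\<in>A. f (g a))"
  by (induction A rule: infinite_finite_induct) (simp_all add: clinear_zero clinear_add)

text \<open>The lift of least norm is fixed by a unitary group action, because it is orthogonal to the
  kernel and the kernel is stable.\<close>

lemma invariant_lift:
  fixes b :: "'j \<Rightarrow> 'a::complex_space"
  assumes J: "finite J"
    and x: "x = (\<Sum>j\<in>J. s j *\<^sub>C b j)"
    and lin: "\<And>g. g \<in> G \<Longrightarrow> clinear (\<kappa> g)"
    and act: "\<And>g j. g \<in> G \<Longrightarrow> j \<in> J \<Longrightarrow> \<kappa> g (b j) = (\<Sum>i\<in>J. M g i j *\<^sub>C b i)"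
    and adj: "\<And>g. g \<in> G \<Longrightarrow> \<exists>h\<in>G. \<forall>i\<in>J. \<forall>j\<in>J. M h i j = cnj (M g j i)"
    and fixed: "\<And>g. g \<in> G \<Longrightarrow> \<kappa> g x = x"
  obtains t where "x = (\<Sum>j\<in>J. t j *\<^sub>C b j)"
    and "\<And>g j. g \<in> G \<Longrightarrow> j \<in> J \<Longrightarrow> (\<Sum>i\<in>J. M g j i * t i) = t j"
proof -
  define \<Phi> where "\<Phi> t = (\<Sum>j\<in>J. t j *\<^sub>C b j)" for t
  define A where "A g t j = (\<Sum>i\<in>J. M g j i * t i)" for g t j
  have diff: "\<Phi> (\<lambda>j. t j - u j) = \<Phi> t - \<Phi> u" for t u
    by (simp add: \<Phi>_def complex_space.scale_left_diff_distrib sum_subtractf)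
  have equiv: "\<kappa> g (\<Phi> t) = \<Phi> (A g t)" if g: "g \<in> G" for g t
  proof -
    have "\<kappa> g (\<Phi> t) = (\<Sum>j\<in>J. t j *\<^sub>C (\<Sum>i\<in>J. M g i j *\<^sub>C b i))"
      unfolding \<Phi>_def using lin[OF g] act[OF g]
      by (simp add: clinear_sum clinear_scaleC)
    also have "\<dots> = (\<Sum>i\<in>J. \<Sum>j\<in>J. (M g i j * t j) *\<^sub>C b i)"
      by (subst sum.swap) (simp add: complex_space.scale_sum_right scaleC_scaleC mult.commute)
    finally show ?thesis by (simp add: \<Phi>_def A_def complex_space.scale_sum_left)
  qed
  let ?N = "{y. \<Phi> y = 0}"
  have "\<exists>n\<in>?N. \<forall>y\<in>?N. (\<Sum>j\<in>J. (s j - n j) * cnj (y j)) = 0"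
  proof (rule orthogonal_decomposition[OF J])
    show "x \<in> ?N \<Longrightarrow> y \<in> ?N \<Longrightarrow> (\<lambda>j. x j + y j) \<in> ?N" for x y
      by (simp add: \<Phi>_def scaleC_add_left sum.distrib)
    show "x \<in> ?N \<Longrightarrow> (\<lambda>j. c * x j) \<in> ?N" for c x
    proof -
      assume "x \<in> ?N"
      moreover have "\<Phi> (\<lambda>j. c * x j) = c *\<^sub>C \<Phi> x"
        by (simp add: \<Phi>_def complex_space.scale_sum_right scaleC_scaleC)
      ultimately show ?thesis by simp
    qed
  qed (simp add: \<Phi>_def)
  then obtain n where n: "\<Phi> n = 0" and orth: "\<And>y. \<Phi> y = 0 \<Longrightarrow> (\<Sum>j\<in>J. (s j - n j) * cnj (y j)) = 0"
    by auto
  define t where "t j = s j - n j" for j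
  have t: "\<Phi> t = x" using diff[of s n] n by (simp add: t_def[abs_def] x \<Phi>_def)
  have "A g t j = t j" if g: "g \<in> G" and j: "j \<in> J" for g j
  proof -
    obtain h where h: "h \<in> G" "\<And>i j. i \<in> J \<Longrightarrow> j \<in> J \<Longrightarrow> M h i j = cnj (M g j i)"
      using adj[OF g] by blast
    \<comment> \<open>Because g fixes x, y lies in the kernel. Both t and \<open>A g t\<close> are
      orthogonal to the kernel, the latter by passing to the adjoint h, which also preserves the
      kernel. Hence y is orthogonal to itself.\<close>
    define y where "y j = A g t j - t j" for j
    have y: "\<Phi> y = 0"
      using equiv[OF g, of t] fixed[OF g] by (simp add: y_def[abs_def] diff t)
    have hy: "\<Phi> (A h y) = 0"
      using equiv[OF h(1), of y] clinear_scaleC[OF lin[OF h(1)], of 0 0] by (simp add: y)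
    have "(\<Sum>j\<in>J. A g t j * cnj (y j)) = (\<Sum>j\<in>J. \<Sum>i\<in>J. M g j i * t i * cnj (y j))"
      by (simp add: A_def sum_distrib_right)
    also have "\<dots> = (\<Sum>i\<in>J. \<Sum>j\<in>J. t i * cnj (M h i j * y j))"
      by (subst sum.swap, intro sum.cong refl) (simp add: h)
    also have "\<dots> = (\<Sum>i\<in>J. t i * cnj (A h y i))"
      by (simp add: A_def sum_distrib_left)
    also have "\<dots> = 0" using orth[OF hy] by (simp add: t_def)
    finally have "(\<Sum>j\<in>J. y j * cnj (y j)) = 0"
      using orth[OF y] by (simp add: y_def t_def left_diff_distrib sum_subtractf)
    then have "(\<Sum>j\<in>J. complex_of_real ((cmod (y j))\<^sup>2)) = 0"
      by (simp only: complex_norm_square)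
    then have "(\<Sum>j\<in>J. (cmod (y j))\<^sup>2) = 0"
      by (simp only: of_real_sum[symmetric] of_real_eq_0_iff)
    then have "y j = 0"
      using J j by (subst (asm) sum_nonneg_eq_0_iff) auto
    then show ?thesis by (simp add: y_def)
  qed
  then show ?thesis using that[of t] t by (simp add: \<Phi>_def A_def)
qed

text \<open>A matrix acts on spinors by acting on the spin component within one chirality.\<close>

definition chiral_matrix :: "bool \<Rightarrow> (bool \<Rightarrow> bool \<Rightarrow> complex) \<Rightarrow> spinor \<Rightarrow> spinor \<Rightarrow> complex" where
  "chiral_matrix c g \<alpha> \<beta> = (if fst \<alpha> = fst \<beta> then
     (if fst \<alpha> = c then g (snd \<alpha>) (snd \<beta>) else if \<alpha> = \<beta> then 1 else 0) else 0)"

text \<open>The exponential of \<theta> J whenever J squares to -1, as the three matrices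
  \<open>pauli\<close> do.\<close>

definition rotation :: "(bool \<Rightarrow> bool \<Rightarrow> complex) \<Rightarrow> real \<Rightarrow> bool \<Rightarrow> bool \<Rightarrow> complex" where
  "rotation J \<theta> a b = (if a = b then of_real (cos \<theta>) else 0) + of_real (sin \<theta>) * J a b"

lemma sum_assignments_slot:
  assumes I: "finite I" "i \<in> I" and w: "w \<in> assignments I"
  shows "(\<Sum>v\<in>assignments I. f (v i) * (\<Prod>k\<in>I - {i}. if w k = v k then 1 else 0) * t v) =
    (\<Sum>\<beta>\<in>UNIV. f \<beta> * t (w(i := \<beta>)) :: complex)"
proof -
  have "(\<Sum>v\<in>assignments I. f (v i) * (\<Prod>k\<in>I - {i}. if w k = v k then 1 else 0) * t v) =
     (\<Sum>v\<in>(\<lambda>\<beta>. w(i := \<beta>)) ` UNIV. f (v i) * t v)"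
  proof (rule sum.mono_neutral_cong_right)
    show "(\<lambda>\<beta>. w(i := \<beta>)) ` UNIV \<subseteq> assignments I" using I w by (auto simp: assignments_def)
    show "\<forall>v\<in>assignments I - (\<lambda>\<beta>. w(i := \<beta>)) ` UNIV.
       f (v i) * (\<Prod>k\<in>I - {i}. if w k = v k then 1 else 0) * t v = 0"
    proof
      fix v assume v: "v \<in> assignments I - (\<lambda>\<beta>. w(i := \<beta>)) ` UNIV"
      have "v = w(i := v i)" if "\<And>k. k \<in> I - {i} \<Longrightarrow> w k = v k"
      proof
        fix k show "v k = (w(i := v i)) k"
          using that[of k] v w by (cases "k \<in> I") (auto simp: assignments_def)
      qed
      then obtain k where "k \<in> I - {i}" "w k \<noteq> v k" using v by (metis DiffE rangeI)
      then have "(\<Prod>k\<in>I - {i}. if w k = v k then 1 else 0 :: complex) = 0"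
        using I by (intro prod_zero) auto
      then show "f (v i) * (\<Prod>k\<in>I - {i}. if w k = v k then 1 else 0) * t v = 0" by simp
    qed
    fix v assume "v \<in> (\<lambda>\<beta>. w(i := \<beta>)) ` UNIV"
    then obtain \<beta> where "v = w(i := \<beta>)" by blast
    then have "(\<Prod>k\<in>I - {i}. if w k = v k then 1 else 0 :: complex) = 1"
      by (intro prod.neutral) simp
    then show "f (v i) * (\<Prod>k\<in>I - {i}. if w k = v k then 1 else 0) * t v = f (v i) * t v" by simp
  qed (use I in \<open>simp add: finite_assignments\<close>)
  also have "\<dots> = (\<Sum>\<beta>\<in>UNIV. f \<beta> * t (w(i := \<beta>)))"
    by (subst sum.reindex) (auto simp: inj_on_def dest: fun_upd_eqD)
  finally show ?thesis .
qed

text \<open>Differentiate at \<theta> = 0. By the product rule each term has J in one slot and the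
  identity in all others, and the Kronecker deltas of these collapse the sum over assignments to
  that slot.\<close>

lemma rotation_invariant_derivative:
  assumes I: "finite I" and w: "w \<in> assignments I"
    and fixed: "\<And>\<theta>. (\<Sum>v\<in>assignments I. (\<Prod>i\<in>I. chiral_matrix c (rotation J \<theta>) (w i) (v i)) * t v) = t w"
  shows "(\<Sum>i\<in>I. \<Sum>b\<in>UNIV. if fst (w i) = c then J (snd (w i)) b * t (w(i := (c, b))) else 0) = (0 :: complex)"
proof -
  let ?m = "\<lambda>\<theta> \<alpha> \<beta>. chiral_matrix c (rotation J \<theta>) \<alpha> \<beta>"
  define m' where "m' \<alpha> \<beta> = (if fst \<alpha> = c \<and> fst \<beta> = c then J (snd \<alpha>) (snd \<beta>) else 0)" for \<alpha> \<beta> :: spinor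
  have m0: "?m 0 \<alpha> \<beta> = (if \<alpha> = \<beta> then 1 else 0)" for \<alpha> \<beta>
    by (cases \<alpha>; cases \<beta>) (auto simp: chiral_matrix_def rotation_def)
  have deriv: "((\<lambda>\<theta>. ?m \<theta> \<alpha> \<beta>) has_vector_derivative m' \<alpha> \<beta>) (at 0)" for \<alpha> \<beta>
  proof -
    have r: "((\<lambda>\<theta>. rotation J \<theta> a b) has_vector_derivative J a b) (at 0)" for a b
      unfolding rotation_def
      by (cases "a = b") (auto intro!: derivative_eq_intros has_vector_derivative_of_real
          simp: has_vector_derivative_def scaleR_conv_of_real)
    show ?thesis
      by (cases "fst \<alpha> = fst \<beta>"; cases "fst \<alpha> = c") (simp_all add: chiral_matrix_def m'_def r)
  qed
  have prod_deriv: "((\<lambda>\<theta>. \<Prod>i\<in>K. ?m \<theta> (w i) (v i)) has_vector_derivative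
      (\<Sum>i\<in>K. m' (w i) (v i) * (\<Prod>k\<in>K - {i}. ?m 0 (w k) (v k)))) (at 0)" if "finite K" for K v
    using that
  proof (induction K rule: finite_induct)
    case empty
    then show ?case by simp
  next
    case (insert j K)
    have "((\<lambda>\<theta>. ?m \<theta> (w j) (v j) * (\<Prod>i\<in>K. ?m \<theta> (w i) (v i))) has_vector_derivative
        ?m 0 (w j) (v j) * (\<Sum>i\<in>K. m' (w i) (v i) * (\<Prod>k\<in>K - {i}. ?m 0 (w k) (v k)))
        + m' (w j) (v j) * (\<Prod>i\<in>K. ?m 0 (w i) (v i))) (at 0)"
      by (rule has_vector_derivative_mult[OF deriv insert.IH])
    moreover have "(\<Prod>k\<in>insert j K - {i}. ?m 0 (w k) (v k)) = ?m 0 (w j) (v j) * (\<Prod>k\<in>K - {i}. ?m 0 (w k) (v k))"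
      if "i \<in> K" for i
    proof -
      have "insert j K - {i} = insert j (K - {i})" using that insert.hyps by auto
      then show ?thesis using insert.hyps by simp
    qed
    ultimately show ?case
      using insert.hyps by (simp add: sum_distrib_left mult.left_commute add.commute cong: sum.cong)
  qed
  have "((\<lambda>\<theta>. \<Sum>v\<in>assignments I. (\<Prod>i\<in>I. ?m \<theta> (w i) (v i)) * t v) has_vector_derivative
      (\<Sum>v\<in>assignments I. (\<Sum>i\<in>I. m' (w i) (v i) * (\<Prod>k\<in>I - {i}. ?m 0 (w k) (v k))) * t v)) (at 0)"
    by (intro has_vector_derivative_sum has_vector_derivative_mult_left prod_deriv I)
  moreover have "((\<lambda>\<theta>. \<Sum>v\<in>assignments I. (\<Prod>i\<in>I. ?m \<theta> (w i) (v i)) * t v) has_vector_derivative 0) (at 0)"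
    unfolding fixed by simp
  ultimately have "(\<Sum>v\<in>assignments I. (\<Sum>i\<in>I. m' (w i) (v i) * (\<Prod>k\<in>I - {i}. ?m 0 (w k) (v k))) * t v) = 0"
    by (rule vector_derivative_unique_at)
  then have "(\<Sum>i\<in>I. \<Sum>v\<in>assignments I. m' (w i) (v i) * (\<Prod>k\<in>I - {i}. if w k = v k then 1 else 0) * t v) = 0"
    unfolding sum_distrib_right m0 by (subst (asm) sum.swap)
  then have "(\<Sum>i\<in>I. \<Sum>\<beta>\<in>UNIV. m' (w i) \<beta> * t (w(i := \<beta>))) = 0"
    using sum_assignments_slot[OF I _ w] by (simp cong: sum.cong)
  moreover have "(\<Sum>\<beta>\<in>UNIV. m' (w i) \<beta> * t (w(i := \<beta>))) =
      (\<Sum>b\<in>UNIV. if fst (w i) = c then J (snd (w i)) b * t (w(i := (c, b))) else 0)" for i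
    by (cases c) (simp_all add: sum_spinor m'_def UNIV_bool)
  ultimately show ?thesis by simp
qed

text \<open>Up to signs, the Pauli matrices times the imaginary unit: a real basis of su(2), hence a
  complex basis of sl2.\<close>

definition pauli :: "nat \<Rightarrow> bool \<Rightarrow> bool \<Rightarrow> complex" where
  "pauli n a b = (if n = 0 then (if a = b then (if a then - \<i> else \<i>) else 0)
     else if n = 1 then (if a = b then 0 else if a then 1 else - 1)
     else (if a = b then 0 else \<i>))"

definition restrict_slots :: "nat set \<Rightarrow> (nat \<Rightarrow> spinor) \<Rightarrow> nat \<Rightarrow> spinor" where
  "restrict_slots I w i = (if i \<in> I then w i else (False, False))"

lemma rotation_invariant_spin_inv:
  assumes I: "finite I"
    and fixed: "\<And>c n \<theta> w. n \<in> {0, 1, 2} \<Longrightarrow> w \<in> assignments I \<Longrightarrow>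
      (\<Sum>v\<in>assignments I. (\<Prod>i\<in>I. chiral_matrix c (rotation (pauli n) \<theta>) (w i) (v i)) * t v) = t w"
  shows "spin_inv I (\<lambda>w. t (restrict_slots I w))"
  unfolding spin_inv_def
proof (intro allI)
  fix c a b and w0 :: "nat \<Rightarrow> spinor"
  define w where "w = restrict_slots I w0"
  have w: "w \<in> assignments I" by (auto simp: w_def restrict_slots_def assignments_def)
  have upd: "restrict_slots I (w0(i := \<beta>)) = w(i := \<beta>)" if "i \<in> I" for i \<beta>
    using that by (auto simp: w_def restrict_slots_def)
  have w0: "i \<in> I \<Longrightarrow> w0 i = w i" for i by (simp add: w_def restrict_slots_def)
  define S where "S a b = (\<Sum>i\<in>I. if w i = (c, a) then t (w(i := (c, b))) else 0)" for a b
  have J: "(\<Sum>a\<in>UNIV. \<Sum>b\<in>UNIV. pauli n a b * S a b) = 0" if n: "n \<in> {0, 1, 2}" for n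
  proof -
    have "(\<Sum>a\<in>UNIV. \<Sum>b\<in>UNIV. pauli n a b * S a b) =
      (\<Sum>i\<in>I. \<Sum>b\<in>UNIV. if fst (w i) = c then pauli n (snd (w i)) b * t (w(i := (c, b))) else 0)"
      unfolding S_def sum_distrib_left
      unfolding sum.swap[where B = I]
    proof (rule sum.cong[OF refl])
      fix i
      show "(\<Sum>a\<in>UNIV. \<Sum>b\<in>UNIV. pauli n a b * (if w i = (c, a) then t (w(i := (c, b))) else 0)) =
        (\<Sum>b\<in>UNIV. if fst (w i) = c then pauli n (snd (w i)) b * t (w(i := (c, b))) else 0)"
        by (cases "w i", cases "snd (w i)") (auto simp: UNIV_bool)
    qed
    also have "\<dots> = 0"
      by (rule rotation_invariant_derivative[OF I w]) (rule fixed[OF n w])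
    finally show ?thesis .
  qed
  \<comment> \<open>Three linear equations for the four sums \<open>S a b\<close>; the missing one
    is the sum of the diagonal terms, which counts the slots of chirality c.\<close>
  have "S False False = S True True" "S False True = 0" "S True False = 0"
    using J[of 0] J[of 1] J[of 2] by (auto simp: UNIV_bool pauli_def algebra_simps)
  moreover have "S False False + S True True = of_nat (card {i\<in>I. fst (w i) = c}) * t w"
  proof -
    have "S False False + S True True = (\<Sum>i\<in>I. if fst (w i) = c then t w else 0)"
      unfolding S_def sum.distrib[symmetric]
    proof (rule sum.cong[OF refl])
      fix i show "(if w i = (c, False) then t (w(i := (c, False))) else 0) +
          (if w i = (c, True) then t (w(i := (c, True))) else 0) = (if fst (w i) = c then t w else 0)"
        by (cases "w i", cases "snd (w i)") (auto simp: fun_upd_idem)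
    qed
    also have "\<dots> = of_nat (card {i\<in>I. fst (w i) = c}) * t w"
      using I by (simp add: sum.If_cases Int_def)
    finally show ?thesis .
  qed
  ultimately have S: "S a b = (if a = b then of_nat (card {i\<in>I. fst (w i) = c}) / 2 * t w else 0)"
    by (cases a; cases b) (auto simp: field_simps)
  have "{i\<in>I. fst (w0 i) = c} = {i\<in>I. fst (w i) = c}" using w0 by auto
  moreover have "(\<Sum>i\<in>I. if w0 i = (c, a) then t (restrict_slots I (w0(i := (c, b)))) else 0) = S a b"
    unfolding S_def by (rule sum.cong) (simp_all add: w0 upd)
  ultimately show "(\<Sum>i\<in>I. if w0 i = (c, a) then t (restrict_slots I (w0(i := (c, b)))) else 0) =
     (if a = b then of_nat (card {i\<in>I. fst (w0 i) = c}) / 2 * t (restrict_slots I w0) else 0)"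
    using S by (simp add: w_def)
qed

section \<open>Complex linear maps, spans and bilinearity of the tensor product\<close>

abbreviation cspan :: "'a::complex_space set \<Rightarrow> 'a set" where
  "cspan \<equiv> complex_space.span"

lemma clinear_span_image:
  assumes "clinear f" "\<And>x. x \<in> S \<Longrightarrow> f x \<in> cspan T" "x \<in> cspan S"
  shows "f x \<in> cspan T"
  using assms(3)
proof (induction rule: complex_space.span_induct_alt)
  case base
  then show ?case by (simp add: clinear_zero[OF assms(1)] complex_space.span_zero)
next
  case (step c x y)
  then show ?case
    using assms(2)
    by (simp add: clinear_add[OF assms(1)] clinear_scaleC[OF assms(1)] complex_space.span_add complex_space.span_scale)
qed

lemma clinear_eq_on_span:
  assumes "clinear f" "clinear g" "\<And>x. x \<in> S \<Longrightarrow> f x = g x" "x \<in> cspan S"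
  shows "f x = g x"
  using assms(4)
proof (induction rule: complex_space.span_induct_alt)
  case base
  then show ?case by (simp add: clinear_zero assms)
next
  case (step c x y)
  then show ?case by (simp add: clinear_add assms clinear_scaleC)
qed

lemma clinear_ident: "clinear (\<lambda>x. x)"
  by (rule clinearI) simp_all

lemma clinear_compose: "clinear f \<Longrightarrow> clinear g \<Longrightarrow> clinear (\<lambda>x. f (g x))"
  by (rule clinearI) (simp_all add: clinear_add clinear_scaleC)

lemma clinear_plus: "clinear f \<Longrightarrow> clinear g \<Longrightarrow> clinear (\<lambda>x. f x + g x)"
  by (rule clinearI) (simp_all add: clinear_add clinear_scaleC scaleC_add_right)

lemma clinear_minus: "clinear f \<Longrightarrow> clinear g \<Longrightarrow> clinear (\<lambda>x. f x - g x)"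
  by (rule clinearI) (simp_all add: clinear_add clinear_scaleC complex_space.scale_right_diff_distrib)

lemma clinear_scale: "clinear f \<Longrightarrow> clinear (\<lambda>x. c *\<^sub>C f x)"
  by (rule clinearI) (simp_all add: clinear_add clinear_scaleC scaleC_add_right mult.commute)

lemma clinear_mult_right: "clinear f \<Longrightarrow> clinear (\<lambda>x. f x * (a :: 'a::complex_alg))"
  by (rule clinearI) (simp_all add: clinear_add clinear_scaleC distrib_right scaleC_mult_left)

lemma clinear_mult_left: "clinear f \<Longrightarrow> clinear (\<lambda>x. (a :: 'a::complex_alg) * f x)"
  by (rule clinearI) (simp_all add: clinear_add clinear_scaleC distrib_left scaleC_mult_right)

lemma clinear_tensor_left: "clinear f \<Longrightarrow> clinear (\<lambda>x. f x \<otimes>\<^sub>C b)"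
  by (rule clinearI) (simp_all add: clinear_add clinear_scaleC tensor_add_left tensor_scaleC_left)

lemma clinear_tensor_right: "clinear f \<Longrightarrow> clinear (\<lambda>x. a \<otimes>\<^sub>C f x)"
  by (rule clinearI) (simp_all add: clinear_add clinear_scaleC tensor_add_right tensor_scaleC_right)

lemmas clinear_intros = clinear_ident clinear_plus clinear_minus clinear_scale clinear_mult_right
  clinear_mult_left clinear_tensor_left clinear_tensor_right

lemma tensor_zero: "0 \<otimes>\<^sub>C b = 0" "a \<otimes>\<^sub>C 0 = 0"
  using tensor_scaleC_left[of 0 0 b] tensor_scaleC_right[of a 0 0] by simp_all

lemma tensor_minus: "(- a) \<otimes>\<^sub>C b = - (a \<otimes>\<^sub>C b)" "a \<otimes>\<^sub>C (- b) = - (a \<otimes>\<^sub>C b)"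
  using tensor_scaleC_left[of "-1" a b] tensor_scaleC_right[of a "-1" b] by simp_all

lemma tensor_diff_left: "(a - a') \<otimes>\<^sub>C b = a \<otimes>\<^sub>C b - a' \<otimes>\<^sub>C b"
  using tensor_add_left[of a "- a'" b] by (simp add: tensor_minus)

lemma tensor_diff_right: "a \<otimes>\<^sub>C (b - b') = a \<otimes>\<^sub>C b - a \<otimes>\<^sub>C b'"
  using tensor_add_right[of a b "- b'"] by (simp add: tensor_minus)

section \<open>Multiplicative extensions\<close>

lemma lin_ext_mult:
  fixes h :: "'m::monoid_add \<Rightarrow> 'a::complex_alg"
  assumes h: "\<And>u v. h (u + v) = h u * h v"
  shows "lin_ext h (x * y) = lin_ext h x * lin_ext h y"
proof -
  have "x * y = (\<Sum>m\<in>Poly_Mapping.keys x. \<Sum>n\<in>Poly_Mapping.keys y.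
      Poly_Mapping.single (m + n) (Poly_Mapping.lookup x m * Poly_Mapping.lookup y n))"
    by (subst poly_mapping_sum[of x], subst poly_mapping_sum[of y])
      (simp add: sum_product mult_single)
  then have "lin_ext h (x * y) = (\<Sum>m\<in>Poly_Mapping.keys x. \<Sum>n\<in>Poly_Mapping.keys y.
      (Poly_Mapping.lookup x m *\<^sub>C h m) * (Poly_Mapping.lookup y n *\<^sub>C h n))"
    by (simp add: lin_ext_sum lin_ext_single h scaleC_mult_left scaleC_mult_right mult.commute)
  then show ?thesis by (simp add: lin_ext_def sum_product)
qed

definition alg_hom :: "('a::complex_alg \<Rightarrow> 'b::complex_alg) \<Rightarrow> bool" where
  "alg_hom f \<longleftrightarrow> clinear f \<and> f 1 = 1 \<and> (\<forall>x y. f (x * y) = f x * f y)"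

lemma alg_homD:
  assumes "alg_hom f"
  shows "clinear f" "f 1 = 1" "f (x * y) = f x * f y" "f (x + y) = f x + f y" "f (c *\<^sub>C x) = c *\<^sub>C f x"
    "f 0 = 0" "f (- x) = - f x" "f (x - y) = f x - f y" "f (sum g A) = (\<Sum>a\<in>A. f (g a))"
proof -
  show lin: "clinear f" using assms by (simp add: alg_hom_def)
  show "f 1 = 1" "f (x * y) = f x * f y" using assms by (simp_all add: alg_hom_def)
  note l = clinear_add[OF lin] clinear_scaleC[OF lin]
  show "f (x + y) = f x + f y" "f (c *\<^sub>C x) = c *\<^sub>C f x" by (rule l)+
  show "f 0 = 0" by (rule clinear_zero[OF lin])
  show m: "f (- x) = - f x" for x using l(2)[of "-1" x] by simp
  show "f (x - y) = f x - f y" using l(1)[of x "- y"] by (simp add: m)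
  show "f (sum g A) = (\<Sum>a\<in>A. f (g a))" by (rule clinear_sum[OF lin])
qed

lemma alg_hom_uea_map:
  fixes f :: "'v::complex_lie_alg \<Rightarrow> 'w::complex_lie_alg"
  assumes "clinear f" "\<And>x y. f (lie_bracket x y) = lie_bracket (f x) (f y)"
  shows "alg_hom (uea_map f)" and "uea_map f (uea_of v) = uea_of (f v)"
proof -
  note abs = uea_map_abs[OF assms]
  have "uea_map f (x * y) = uea_map f x * uea_map f y" for x y
    by (induct x rule: uea.abs_induct, induct y rule: uea.abs_induct)
      (simp only: times_uea.abs_eq abs lin_ext_mult letters_simps map_append prod_list.append)
  moreover have "uea_map f (x + y) = uea_map f x + uea_map f y" for x y
    by (induct x rule: uea.abs_induct, induct y rule: uea.abs_induct)
      (simp only: plus_uea.abs_eq abs lin_ext_add)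
  moreover have "uea_map f (c *\<^sub>C x) = c *\<^sub>C uea_map f x" for c x
    by (induct x rule: uea.abs_induct) (simp only: scaleC_uea.abs_eq abs lin_ext_scalar)
  moreover have "uea_map f 1 = 1"
    by (simp add: one_uea.abs_eq abs lin_ext_one)
  ultimately show "alg_hom (uea_map f)" by (simp add: alg_hom_def clinearI)
  show "uea_map f (uea_of v) = uea_of (f v)"
    by (simp add: uea_of.abs_eq abs lin_ext_single scaleC_one)
qed

lemma alg_hom_clifford_map:
  fixes f :: "'v::complex_bilinear_space \<Rightarrow> 'w::complex_bilinear_space"
  assumes "clinear f" "\<And>x y. bform (f x) (f y) = bform x y"
  shows "alg_hom (clifford_map f)" and "clifford_map f (clifford_of v) = clifford_of (f v)"
proof -
  note abs = clifford_map_abs[OF assms]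
  have "clifford_map f (x * y) = clifford_map f x * clifford_map f y" for x y
    by (induct x rule: clifford.abs_induct, induct y rule: clifford.abs_induct)
      (simp only: times_clifford.abs_eq abs lin_ext_mult letters_simps map_append prod_list.append)
  moreover have "clifford_map f (x + y) = clifford_map f x + clifford_map f y" for x y
    by (induct x rule: clifford.abs_induct, induct y rule: clifford.abs_induct)
      (simp only: plus_clifford.abs_eq abs lin_ext_add)
  moreover have "clifford_map f (c *\<^sub>C x) = c *\<^sub>C clifford_map f x" for c x
    by (induct x rule: clifford.abs_induct) (simp only: scaleC_clifford.abs_eq abs lin_ext_scalar)
  moreover have "clifford_map f 1 = 1"
    by (simp add: one_clifford.abs_eq abs lin_ext_one)
  ultimately show "alg_hom (clifford_map f)" by (simp add: alg_hom_def clinearI)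
  show "clifford_map f (clifford_of v) = clifford_of (f v)"
    by (simp add: clifford_of.abs_eq abs lin_ext_single scaleC_one)
qed

lemma alg_hom_tensor_map:
  assumes f: "alg_hom f" and g: "alg_hom g"
  shows "alg_hom (tensor_map f g)"
proof -
  note abs = tensor_map_abs[OF alg_homD(1)[OF f] alg_homD(1)[OF g]]
  let ?h = "\<lambda>m. case m of Tensor_Pair a b \<Rightarrow> f a \<otimes>\<^sub>C g b"
  have h: "?h (u + v) = ?h u * ?h v" for u v
    by (cases u; cases v) (simp add: alg_homD(3)[OF f] alg_homD(3)[OF g] tensor_mult)
  have "tensor_map f g (x * y) = tensor_map f g x * tensor_map f g y" for x y
    by (induct x rule: tensor.abs_induct, induct y rule: tensor.abs_induct)
      (simp only: times_tensor.abs_eq abs lin_ext_mult[OF h])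
  moreover have "tensor_map f g (x + y) = tensor_map f g x + tensor_map f g y" for x y
    by (induct x rule: tensor.abs_induct, induct y rule: tensor.abs_induct)
      (simp only: plus_tensor.abs_eq abs lin_ext_add)
  moreover have "tensor_map f g (c *\<^sub>C x) = c *\<^sub>C tensor_map f g x" for c x
    by (induct x rule: tensor.abs_induct) (simp only: scaleC_tensor.abs_eq abs lin_ext_scalar)
  moreover have "tensor_map f g 1 = 1"
    using tensor_map_tensor[OF alg_homD(1)[OF f] alg_homD(1)[OF g], of 1 1]
    by (simp add: tensor_one alg_homD(2)[OF f] alg_homD(2)[OF g])
  ultimately show ?thesis by (simp add: alg_hom_def clinearI)
qed

text \<open>Common source of the spanning sets for the enveloping algebra, the Clifford algebra and
  the tensor product, all of them quotients of monoid algebras.\<close>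

lemma abs_sum_span:
  fixes abs' :: "('m::monoid_add \<Rightarrow>\<^sub>0 complex) \<Rightarrow> 'a::complex_space"
  assumes add: "\<And>x y. abs' (x + y) = abs' x + abs' y"
    and scale: "\<And>c x. abs' (scalar c * x) = c *\<^sub>C abs' x"
  shows "abs' x \<in> cspan (range (\<lambda>m. abs' (basis m)))"
proof -
  have zero: "abs' 0 = 0" using add[of 0 0] by simp
  have sums: "abs' (sum f A) = (\<Sum>a\<in>A. abs' (f a))" for f :: "'m \<Rightarrow> ('m \<Rightarrow>\<^sub>0 complex)" and A
    by (induction A rule: infinite_finite_induct) (simp_all add: zero add)
  have single: "abs' (Poly_Mapping.single m c) = c *\<^sub>C abs' (basis m)" for m :: 'm and c
    using scale[of c "basis m"] by (simp add: mult_single)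
  have "abs' (\<Sum>m\<in>Poly_Mapping.keys x. Poly_Mapping.single m (Poly_Mapping.lookup x m))
      = (\<Sum>m\<in>Poly_Mapping.keys x. Poly_Mapping.lookup x m *\<^sub>C abs' (basis m))"
    unfolding sums by (rule sum.cong[OF refl single])
  then have "abs' x = (\<Sum>m\<in>Poly_Mapping.keys x. Poly_Mapping.lookup x m *\<^sub>C abs' (basis m))"
    unfolding poly_mapping_sum[of x, symmetric] .
  moreover have "\<dots> \<in> cspan (range (\<lambda>m. abs' (basis m)))"
    by (intro complex_space.span_sum complex_space.span_scale complex_space.span_base rangeI)
  ultimately show ?thesis by (simp only:)
qed

lemma prod_list_uea_of: "prod_list (map uea_of xs) = abs_uea (basis (Word xs))"
proof (induction xs)
  case Nil
  then show ?case by (simp add: one_uea.abs_eq flip: zero_word_def)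
next
  case (Cons x xs)
  then show ?case
    by (simp add: uea_of.abs_eq times_uea.abs_eq mult_single plus_word_def)
qed

lemma prod_list_clifford_of: "prod_list (map clifford_of xs) = abs_clifford (basis (Word xs))"
proof (induction xs)
  case Nil
  then show ?case by (simp add: one_clifford.abs_eq flip: zero_word_def)
next
  case (Cons x xs)
  then show ?case
    by (simp add: clifford_of.abs_eq times_clifford.abs_eq mult_single plus_word_def)
qed

lemma uea_span: "x \<in> cspan (range (\<lambda>xs. prod_list (map uea_of xs)))"
proof -
  have sub: "range (\<lambda>m. abs_uea (basis m)) \<subseteq> range (\<lambda>xs :: 'a list. prod_list (map uea_of xs))"
    by (auto simp: prod_list_uea_of) (metis rangeI word.exhaust)
  have all: "abs_uea y \<in> cspan (range (\<lambda>m. abs_uea (basis m)))" for y :: "'a word \<Rightarrow>\<^sub>0 complex"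
    by (rule abs_sum_span) (simp_all add: plus_uea.abs_eq scaleC_uea.abs_eq)
  show ?thesis
    by (induct x rule: uea.abs_induct) (rule subsetD[OF complex_space.span_mono[OF sub] all])
qed

lemma clifford_span: "x \<in> cspan (range (\<lambda>xs. prod_list (map clifford_of xs)))"
proof -
  have sub: "range (\<lambda>m. abs_clifford (basis m)) \<subseteq> range (\<lambda>xs :: 'a list. prod_list (map clifford_of xs))"
    by (auto simp: prod_list_clifford_of) (metis rangeI word.exhaust)
  have all: "abs_clifford y \<in> cspan (range (\<lambda>m. abs_clifford (basis m)))" for y :: "'a word \<Rightarrow>\<^sub>0 complex"
    by (rule abs_sum_span) (simp_all add: plus_clifford.abs_eq scaleC_clifford.abs_eq)
  show ?thesis
    by (induct x rule: clifford.abs_induct) (rule subsetD[OF complex_space.span_mono[OF sub] all])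
qed

lemma tensor_span: "x \<in> cspan {a \<otimes>\<^sub>C b |a b. True}"
proof -
  have sub: "range (\<lambda>m. abs_tensor (basis m)) \<subseteq> {a \<otimes>\<^sub>C b |(a::'a) (b::'b). True}"
    by (auto simp: tensor.abs_eq) (metis tensor_pair.exhaust)
  have all: "abs_tensor y \<in> cspan (range (\<lambda>m. abs_tensor (basis m)))" for y :: "('a, 'b) tensor_pair \<Rightarrow>\<^sub>0 complex"
    by (rule abs_sum_span) (simp_all add: plus_tensor.abs_eq scaleC_tensor.abs_eq)
  show ?thesis
    by (induct x rule: tensor.abs_induct) (rule subsetD[OF complex_space.span_mono[OF sub] all])
qed

section \<open>The filtration by degree in the enveloping algebra\<close>

text \<open>Products of fewer than \<open>n\<close> Lie algebra elements, so that the step \<open>0\<close> is the zero space.\<close>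

definition uea_filt :: "nat \<Rightarrow> 'v::complex_lie_alg uea set" where
  "uea_filt n = cspan {prod_list (map uea_of xs) |xs. length xs < n}"

definition tensor_filt :: "nat \<Rightarrow> ('v::complex_lie_alg uea, 'b::complex_alg) tensor set" where
  "tensor_filt n = cspan {u \<otimes>\<^sub>C c |u c. u \<in> uea_filt n}"

lemma uea_filt_base: "length xs < n \<Longrightarrow> prod_list (map uea_of xs) \<in> uea_filt n"
  unfolding uea_filt_def by (rule complex_space.span_base) blast

lemma uea_filt_mono: "m \<le> n \<Longrightarrow> uea_filt m \<subseteq> uea_filt n"
  unfolding uea_filt_def by (rule complex_space.span_mono) auto

lemma uea_filt_add: "x \<in> uea_filt n \<Longrightarrow> y \<in> uea_filt n \<Longrightarrow> x + y \<in> uea_filt n"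
  unfolding uea_filt_def by (rule complex_space.span_add)

lemma uea_filt_diff: "x \<in> uea_filt n \<Longrightarrow> y \<in> uea_filt n \<Longrightarrow> x - y \<in> uea_filt n"
  unfolding uea_filt_def by (rule complex_space.span_diff)

lemma uea_filt_mult:
  fixes x :: "'v::complex_lie_alg"
  assumes "u \<in> uea_filt n"
  shows "uea_of x * u \<in> uea_filt (Suc n)"
  using assms unfolding uea_filt_def
proof (rule clinear_span_image[rotated -1])
  fix u :: "'v uea" assume "u \<in> {prod_list (map uea_of xs) |xs. length xs < n}"
  then obtain xs where "u = prod_list (map uea_of xs)" "length xs < n" by auto
  then show "uea_of x * u \<in> cspan {prod_list (map uea_of xs) |xs. length xs < Suc n}"
    by (intro complex_space.span_base CollectI exI[of _ "x # xs"]) simp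
qed (intro clinear_intros)

lemma uea_prod_move:
  "prod_list (map uea_of (us @ x # vs)) - prod_list (map uea_of (x # us @ vs)) \<in> uea_filt (Suc (length us + length vs))"
proof (induction us)
  case Nil
  then show ?case by (simp add: uea_filt_def complex_space.span_zero)
next
  case (Cons y us)
  let ?r = "prod_list (map uea_of (us @ vs))"
  have "prod_list (map uea_of ((y # us) @ x # vs)) - prod_list (map uea_of (x # (y # us) @ vs))
      = uea_of y * (prod_list (map uea_of (us @ x # vs)) - prod_list (map uea_of (x # us @ vs)))
        + uea_of (lie_bracket y x) * ?r"
    by (simp add: uea_of_bracket[symmetric] algebra_simps)
  moreover have "uea_of (lie_bracket y x) * ?r \<in> uea_filt (Suc (Suc (length us + length vs)))"
    using uea_filt_base[of "lie_bracket y x # us @ vs"] by simp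
  ultimately show ?case
    using uea_filt_add[OF uea_filt_mult[OF Cons.IH, of y]]
    by (simp only: list.size add_Suc add_Suc_right add_0_right)
qed

text \<open>Each exchange of neighbours costs a bracket, that is, a word with one letter less. This
  is the commutativity of the associated graded algebra.\<close>

lemma uea_prod_mset_eq:
  assumes "mset xs = mset ys"
  shows "prod_list (map uea_of xs) - prod_list (map uea_of ys) \<in> uea_filt (length xs)"
  using assms
proof (induction xs arbitrary: ys)
  case Nil
  then show ?case by (simp add: uea_filt_def complex_space.span_zero)
next
  case (Cons x xs)
  then have "x \<in> set ys" by (metis list.set_intros(1) set_mset_mset)
  then obtain us vs where ys: "ys = us @ x # vs" by (meson split_list)
  then have m: "mset xs = mset (us @ vs)" using Cons.prems by simp
  then have len: "length xs = length us + length vs" by (metis length_append size_mset)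
  have "prod_list (map uea_of (x # xs)) - prod_list (map uea_of ys) =
      uea_of x * (prod_list (map uea_of xs) - prod_list (map uea_of (us @ vs)))
      - (prod_list (map uea_of ys) - prod_list (map uea_of (x # us @ vs)))"
    by (simp add: algebra_simps)
  moreover have "prod_list (map uea_of ys) - prod_list (map uea_of (x # us @ vs)) \<in> uea_filt (Suc (length xs))"
    unfolding ys len by (rule uea_prod_move)
  ultimately show ?case
    using uea_filt_diff[OF uea_filt_mult[OF Cons.IH[OF m], of x]]
    by (simp only: list.size add_Suc add_Suc_right add_0_right)
qed

lemma tensor_filt_base: "u \<in> uea_filt n \<Longrightarrow> u \<otimes>\<^sub>C c \<in> tensor_filt n"
  unfolding tensor_filt_def by (rule complex_space.span_base) blast

lemma tensor_filt_closed:
  "0 \<in> tensor_filt n"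
  "x \<in> tensor_filt n \<Longrightarrow> y \<in> tensor_filt n \<Longrightarrow> x + y \<in> tensor_filt n"
  "x \<in> tensor_filt n \<Longrightarrow> y \<in> tensor_filt n \<Longrightarrow> x - y \<in> tensor_filt n"
  "x \<in> tensor_filt n \<Longrightarrow> a *\<^sub>C x \<in> tensor_filt n"
  unfolding tensor_filt_def
  by (auto intro: complex_space.span_zero complex_space.span_add complex_space.span_diff complex_space.span_scale)

lemma tensor_filt_sum: "(\<And>a. a \<in> A \<Longrightarrow> f a \<in> tensor_filt n) \<Longrightarrow> sum f A \<in> tensor_filt n"
  unfolding tensor_filt_def by (rule complex_space.span_sum)

lemma tensor_filt_0:
  fixes x :: "('v::complex_lie_alg uea, 'b::complex_alg) tensor"
  assumes "x \<in> tensor_filt 0"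
  shows "x = 0"
proof -
  have "uea_filt 0 = {0 :: 'v uea}" by (simp add: uea_filt_def)
  then have "{u \<otimes>\<^sub>C c |(u :: 'v uea) (c :: 'b). u \<in> uea_filt 0} = {0}"
    by (auto simp: tensor_zero)
  with assms show ?thesis
    by (simp add: tensor_filt_def complex_space.span_insert_0)
qed

lemma tensor_filt_mono: "m \<le> n \<Longrightarrow> tensor_filt m \<subseteq> tensor_filt n"
  unfolding tensor_filt_def by (rule complex_space.span_mono) (use uea_filt_mono in blast)

lemma tensor_filt_mult:
  fixes x :: "'v::complex_lie_alg" and c :: "'b::complex_alg"
  assumes "y \<in> tensor_filt n"
  shows "(uea_of x \<otimes>\<^sub>C c) * y \<in> tensor_filt (Suc n)"
  using assms unfolding tensor_filt_def
proof (rule clinear_span_image[rotated -1])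
  fix y :: "('v uea, 'b) tensor"
  show "(uea_of x \<otimes>\<^sub>C c) * y \<in> cspan {u \<otimes>\<^sub>C c |u c. u \<in> uea_filt (Suc n)}"
    if "y \<in> {u \<otimes>\<^sub>C c |u c. u \<in> uea_filt n}"
  proof -
    from that obtain u d where y: "y = u \<otimes>\<^sub>C d" and u: "u \<in> uea_filt n" by blast
    show ?thesis
      unfolding y tensor_mult by (rule complex_space.span_base) (use uea_filt_mult[OF u, of x] in blast)
  qed
qed (intro clinear_intros)

lemma tensor_filt_exhaustive:
  fixes x :: "('v::complex_lie_alg uea, 'b::complex_alg) tensor"
  shows "\<exists>n. x \<in> tensor_filt n"
proof -
  have u: "\<exists>n. u \<in> uea_filt n" for u :: "'v uea"
    using uea_span[of u]
  proof (induction rule: complex_space.span_induct_alt)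
    case base
    then show ?case by (auto simp: uea_filt_def intro: complex_space.span_zero)
  next
    case (step c x y)
    then obtain n xs where n: "y \<in> uea_filt n" "x = prod_list (map uea_of xs)" by auto
    then have "x \<in> uea_filt (max n (Suc (length xs)))" by (auto intro!: uea_filt_base)
    moreover have "y \<in> uea_filt (max n (Suc (length xs)))" 
      using n(1) uea_filt_mono[of n "max n (Suc (length xs))"] by auto
    ultimately have "c *\<^sub>C x + y \<in> uea_filt (max n (Suc (length xs)))"
      unfolding uea_filt_def by (intro complex_space.span_add complex_space.span_scale)
    then show ?case by blast
  qed
  show ?thesis
    using tensor_span[of x]
  proof (induction rule: complex_space.span_induct_alt)
    case base
    then show ?case by (auto intro: tensor_filt_closed)
  next
    case (step c x y)
    then obtain n u b where n: "y \<in> tensor_filt n" "x = u \<otimes>\<^sub>C b" by auto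
    obtain m where "u \<in> uea_filt m" using u by blast
    then have "x \<in> tensor_filt m" unfolding n(2) by (rule tensor_filt_base)
    then have "x \<in> tensor_filt (max n m)" "y \<in> tensor_filt (max n m)"
      using n(1) tensor_filt_mono[of m "max n m"] tensor_filt_mono[of n "max n m"] by auto
    then have "c *\<^sub>C x + y \<in> tensor_filt (max n m)" by (intro tensor_filt_closed)
    then show ?case by blast
  qed
qed

text \<open>Takes the place of the associated graded algebra, which is not constructed: x agrees
  with an element of A modulo words of fewer than n letters.\<close>

definition congruent_to :: "('v::complex_lie_alg uea, 'b::complex_alg) tensor set \<Rightarrow> nat \<Rightarrow> ('v uea, 'b) tensor \<Rightarrow> bool" where
  "congruent_to A n x \<longleftrightarrow> (\<exists>a\<in>A. x - a \<in> tensor_filt n)"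

lemma unital_subalgebraD:
  assumes "unital_subalgebra A"
  shows "1 \<in> A" "0 \<in> A" "x \<in> A \<Longrightarrow> y \<in> A \<Longrightarrow> x + y \<in> A" "x \<in> A \<Longrightarrow> y \<in> A \<Longrightarrow> x * y \<in> A"
    "x \<in> A \<Longrightarrow> c *\<^sub>C x \<in> A" "x \<in> A \<Longrightarrow> - x \<in> A" "x \<in> A \<Longrightarrow> y \<in> A \<Longrightarrow> x - y \<in> A"
proof -
  note A = assms[unfolded unital_subalgebra_def]
  show "1 \<in> A" "x \<in> A \<Longrightarrow> y \<in> A \<Longrightarrow> x + y \<in> A" "x \<in> A \<Longrightarrow> y \<in> A \<Longrightarrow> x * y \<in> A"
    "x \<in> A \<Longrightarrow> c *\<^sub>C x \<in> A" using A by blast+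
  have "0 *\<^sub>C 1 \<in> A" using A by blast
  then show "0 \<in> A" by simp
  have m: "(-1) *\<^sub>C x \<in> A" if "x \<in> A" for x using A that by blast
  then show "x \<in> A \<Longrightarrow> - x \<in> A" by simp
  show "x - y \<in> A" if "x \<in> A" "y \<in> A"
  proof -
    have "x + (-1) *\<^sub>C y \<in> A" using A that m by blast
    then show ?thesis by simp
  qed
qed

lemma congruent_to_closed:
  assumes A: "unital_subalgebra A"
  shows "x \<in> tensor_filt n \<Longrightarrow> congruent_to A n x"
    and "x \<in> A \<Longrightarrow> congruent_to A n x"
    and "congruent_to A n x \<Longrightarrow> congruent_to A n y \<Longrightarrow> congruent_to A n (x + y)"
    and "congruent_to A n x \<Longrightarrow> congruent_to A n y \<Longrightarrow> congruent_to A n (x - y)"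
    and "congruent_to A n x \<Longrightarrow> congruent_to A n (c *\<^sub>C x)"
proof -
  note A = unital_subalgebraD[OF A]
  show "congruent_to A n x" if "x \<in> tensor_filt n"
    using that A(2) unfolding congruent_to_def by (intro bexI[of _ 0]) auto
  show "congruent_to A n x" if "x \<in> A"
    using that tensor_filt_closed(1) unfolding congruent_to_def by (intro bexI[of _ x]) auto
  assume "congruent_to A n x"
  then obtain a where a: "a \<in> A" "x - a \<in> tensor_filt n" by (auto simp: congruent_to_def)
  have "c *\<^sub>C x - c *\<^sub>C a \<in> tensor_filt n"
    using tensor_filt_closed(4)[OF a(2), of c] by (simp add: complex_space.scale_right_diff_distrib)
  then show "congruent_to A n (c *\<^sub>C x)" using a A(5) by (auto simp: congruent_to_def)
  assume "congruent_to A n y"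
  then obtain b where b: "b \<in> A" "y - b \<in> tensor_filt n" by (auto simp: congruent_to_def)
  have "x + y - (a + b) = (x - a) + (y - b)" "x - y - (a - b) = (x - a) - (y - b)" by simp_all
  then have "x + y - (a + b) \<in> tensor_filt n" "x - y - (a - b) \<in> tensor_filt n"
    using a b by (metis tensor_filt_closed(2), metis tensor_filt_closed(3))
  then show "congruent_to A n (x + y)" "congruent_to A n (x - y)"
    using a b A by (auto simp: congruent_to_def)
qed

lemma congruent_to_sum:
  assumes A: "unital_subalgebra A" and "\<And>i. i \<in> S \<Longrightarrow> congruent_to A n (f i)"
  shows "congruent_to A n (sum f S)"
  using assms(2)
  by (induction S rule: infinite_finite_induct)
    (auto intro: congruent_to_closed[OF A] unital_subalgebraD(2)[OF A])

lemma congruent_to_mult: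
  assumes A: "unital_subalgebra A" and "z \<in> A" and "\<And>y. y \<in> tensor_filt n \<Longrightarrow> z * y \<in> tensor_filt m"
    and "congruent_to A n x"
  shows "congruent_to A m (z * x)"
proof -
  obtain a where a: "a \<in> A" "x - a \<in> tensor_filt n" using assms(4) by (auto simp: congruent_to_def)
  then have "z * x - z * a \<in> tensor_filt m" using assms(3)[OF a(2)] by (simp add: right_diff_distrib)
  then show ?thesis using a assms(2) unital_subalgebraD(4)[OF A] by (auto simp: congruent_to_def)
qed

section \<open>The Clifford algebra of \<open>\<pp>\<close> as an algebra of spinor matrices\<close>

text \<open>The signs make the trace form a multiple of the product of the two symplectic forms.\<close>

definition p_vec :: "bool \<Rightarrow> bool \<Rightarrow> so41C" where
  "p_vec a b = (if a then (if b then F\<^sub>3 else - F\<^sub>4) else (if b then E\<^sub>4 else E\<^sub>3))"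

definition p_basis :: "bool \<Rightarrow> bool \<Rightarrow> p41" where
  "p_basis a b = Abs_p41 (p_vec a b)"

lemma sum_5: "(\<Sum>i\<in>UNIV. f (i::5)) = f 1 + f 2 + f 3 + f 4 + (f 5 :: 'a::comm_monoid_add)"
proof -
  have univ: "(UNIV :: 5 set) = {1, 2, 3, 4, 5}"
    using all_5[of "\<lambda>i. i \<in> {1, 2, 3, 4, 5}"] by auto
  show ?thesis unfolding univ by (simp add: add.assoc)
qed

lemma Rep_p_basis: "Rep_p41 (p_basis a b) = p_vec a b"
  unfolding p_basis_def
  by (rule Abs_p41_inverse) (simp add: p_vec_def generators_p41 cartan_inv_uminus)

lemma p_basis_Abs:
  "p_basis False False = Abs_p41 E\<^sub>3" "p_basis False True = Abs_p41 E\<^sub>4"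
  "p_basis True True = Abs_p41 F\<^sub>3" "p_basis True False = - Abs_p41 F\<^sub>4"
proof -
  show "p_basis True False = - Abs_p41 F\<^sub>4"
    unfolding Rep_p41_inject[symmetric] Rep_p_basis uminus_p41.rep_eq
    by (subst Abs_p41_inverse) (simp_all add: p_vec_def generators_p41)
qed (simp_all add: p_basis_def p_vec_def)

lemma bform_p_basis: "bform (p_basis a a') (p_basis b b') = 4 * eps a b * eps a' b'"
  unfolding bform_p41_def Rep_p_basis trace_def matrix_matrix_mult_def vec_lambda_beta sum_5
  by (cases a; cases a'; cases b; cases b')
    (simp_all add: p_vec_def uminus_so41C.rep_eq Rep_generators unit_matrix_def eps_def)

definition gam :: "bool \<Rightarrow> bool \<Rightarrow> p41 clifford" where
  "gam a b = clifford_of (p_basis a b)"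

lemma gam_anticommute: "gam a a' * gam b b' = (- 8 * eps a b * eps a' b') *\<^sub>C 1 - gam b b' * gam a a'"
  using clifford_of_relation[of "p_basis a a'" "p_basis b b'"]
  by (simp add: gam_def bform_p_basis algebra_simps)

lemma gam_sq: "gam a b * gam a b = 0"
proof -
  have "2 *\<^sub>C (gam a b * gam a b) = 0"
    using gam_anticommute[of a b a b] scaleC_add_left[of 1 1 "gam a b * gam a b"]
    by (simp add: eps_def eq_neg_iff_add_eq_0)
  then show ?thesis by simp
qed

text \<open>Occupation numbers of the two fermionic modes of \<open>C(\<pp>)\<close>, and their complements.\<close>

definition num1 :: "p41 clifford" where "num1 = (-1/8) *\<^sub>C (gam False False * gam True True)"
definition num1' :: "p41 clifford" where "num1' = (-1/8) *\<^sub>C (gam True True * gam False False)"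
definition num2 :: "p41 clifford" where "num2 = (1/8) *\<^sub>C (gam False True * gam True False)"
definition num2' :: "p41 clifford" where "num2' = (1/8) *\<^sub>C (gam True False * gam False True)"

lemma num_add: "num1 + num1' = 1" "num2 + num2' = 1"
  unfolding num1_def num1'_def num2_def num2'_def
    gam_anticommute[of True True False False] gam_anticommute[of True False False True]
  by (simp_all add: eps_def complex_space.scale_right_diff_distrib scaleC_scaleC)

lemma gam_pair:
  "gam False False * gam True True = (-8) *\<^sub>C num1" "gam True True * gam False False = (-8) *\<^sub>C num1'"
  "gam False True * gam True False = 8 *\<^sub>C num2" "gam True False * gam False True = 8 *\<^sub>C num2'"
  by (simp_all add: num1_def num1'_def num2_def num2'_def scaleC_scaleC)

lemma gam_swap:
  "gam False True * gam False False = - (gam False False * gam False True)"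
  "gam True False * gam False False = - (gam False False * gam True False)"
  "gam False True * gam True True = - (gam True True * gam False True)"
  "gam True False * gam True True = - (gam True True * gam True False)"
  by (subst gam_anticommute, simp add: eps_def)+

lemma num_gam:
  "num1 * gam False False = gam False False" "num1' * gam False False = 0"
  "num1 * gam True True = 0" "num1' * gam True True = gam True True"
  "num2 * gam False True = gam False True" "num2' * gam False True = 0"
  "num2 * gam True False = 0" "num2' * gam True False = gam True False"
  "gam False False * num1 = 0" "gam False False * num1' = gam False False"
  "gam True True * num1 = gam True True" "gam True True * num1' = 0"
  "gam False True * num2 = 0" "gam False True * num2' = gam False True"
  "gam True False * num2 = gam True False" "gam True False * num2' = 0"
proof -
  have sq: "gam a b * (gam a b * z) = 0" for a b z
    by (simp add: mult.assoc[symmetric] gam_sq)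
  show 1: "num1' * gam False False = 0" "num1 * gam True True = 0" "num2' * gam False True = 0"
    "num2 * gam True False = 0" "gam False False * num1 = 0" "gam True True * num1' = 0"
    "gam False True * num2 = 0" "gam True False * num2' = 0"
    by (simp_all add: num1_def num1'_def num2_def num2'_def scaleC_mult_left scaleC_mult_right
        mult.assoc gam_sq sq)
  have n: "num1 = 1 - num1'" "num1' = 1 - num1" "num2 = 1 - num2'" "num2' = 1 - num2"
    using num_add by (simp_all add: eq_diff_eq add.commute)
  show "num1 * gam False False = gam False False" using 1 by (subst n) (simp add: left_diff_distrib)
  show "num1' * gam True True = gam True True" using 1 by (subst n) (simp add: left_diff_distrib)
  show "num2 * gam False True = gam False True" using 1 by (subst n) (simp add: left_diff_distrib)
  show "num2' * gam True False = gam True False" using 1 by (subst n) (simp add: left_diff_distrib)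
  show "gam False False * num1' = gam False False" using 1 by (subst n) (simp add: right_diff_distrib)
  show "gam True True * num1 = gam True True" using 1 by (subst n) (simp add: right_diff_distrib)
  show "gam False True * num2' = gam False True" using 1 by (subst n) (simp add: right_diff_distrib)
  show "gam True False * num2 = gam True False" using 1 by (subst n) (simp add: right_diff_distrib)
qed

lemma assoc_rule: "(a :: 'a::semigroup_mult) * b = c \<Longrightarrow> a * (b * z) = c * z"
  by (simp add: mult.assoc[symmetric])

lemmas gam_swap_assoc = gam_swap[THEN assoc_rule]

lemma num_gam_commute:
  "gam False True * num1 = num1 * gam False True" "gam True False * num1 = num1 * gam True False"
  "gam False True * num1' = num1' * gam False True" "gam True False * num1' = num1' * gam True False"
  "num2 * gam False False = gam False False * num2" "num2 * gam True True = gam True True * num2"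
  "num2' * gam False False = gam False False * num2'" "num2' * gam True True = gam True True * num2'"
  by (simp_all add: num1_def num1'_def num2_def num2'_def scaleC_mult_left scaleC_mult_right
      mult.assoc gam_swap gam_swap_assoc)

lemma num_num:
  "num1 * num1 = num1" "num1 * num1' = 0" "num1' * num1 = 0" "num1' * num1' = num1'"
  "num2 * num2 = num2" "num2 * num2' = 0" "num2' * num2 = 0" "num2' * num2' = num2'"
proof -
  have 1: "num1 * num1' = 0" "num1' * num1 = 0" "num2 * num2' = 0" "num2' * num2 = 0"
  proof -
    show "num1 * num1' = 0" by (simp add: num1'_def scaleC_mult_right mult.assoc[symmetric] num_gam)
    show "num1' * num1 = 0" by (simp add: num1_def scaleC_mult_right mult.assoc[symmetric] num_gam)
    show "num2 * num2' = 0" by (simp add: num2'_def scaleC_mult_right mult.assoc[symmetric] num_gam)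
    show "num2' * num2 = 0" by (simp add: num2_def scaleC_mult_right mult.assoc[symmetric] num_gam)
  qed
  then show "num1 * num1' = 0" "num1' * num1 = 0" "num2 * num2' = 0" "num2' * num2 = 0" by -
  have "num1 * (num1 + num1') = num1" "num1' * (num1 + num1') = num1'"
    "num2 * (num2 + num2') = num2" "num2' * (num2 + num2') = num2'"
    unfolding num_add by simp_all
  then show "num1 * num1 = num1" "num1' * num1' = num1'" "num2 * num2 = num2" "num2' * num2' = num2'"
    by (simp_all add: distrib_left 1)
qed

lemma num_commute:
  "num2 * num1 = num1 * num2" "num2 * num1' = num1' * num2"
  "num2' * num1 = num1 * num2'" "num2' * num1' = num1' * num2'"
  by (simp_all add: num1_def num1'_def scaleC_mult_right scaleC_mult_left mult.assoc
      num_gam_commute num_gam_commute[THEN assoc_rule])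

text \<open>A rewrite system for C(p): factors of the first mode move to the left of those of the
  second, and opposite generators merge into occupation numbers. With the reassociated copies below,
  simplification decides most product identities.\<close>

lemmas fock = gam_sq gam_pair gam_swap num_gam num_gam_commute num_num num_commute
lemmas fock_simps = fock fock[THEN assoc_rule]

text \<open>The half-spin spaces are the two parities of the number of occupied modes;
  \<open>True\<close> is the even one.\<close>

definition chir_proj :: "bool \<Rightarrow> p41 clifford" where
  "chir_proj c = (if c then num1 * num2 + num1' * num2' else num1 * num2' + num1' * num2)"

text \<open>Matrix units of \<open>C(\<pp>)\<close> acting on \<open>S\<close>, with one index lowered by the symplectic form.\<close>

definition cmat :: "spinor \<Rightarrow> spinor \<Rightarrow> p41 clifford" where
  "cmat \<alpha> \<beta> = (if fst \<alpha> then
     (if fst \<beta> then (1/8) *\<^sub>C (gam (snd \<alpha>) False * gam (snd \<beta>) True * chir_proj True)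
      else gam (snd \<alpha>) (snd \<beta>) * chir_proj False)
    else
     (if fst \<beta> then (1/8) *\<^sub>C (gam (snd \<beta>) (snd \<alpha>) * chir_proj True)
      else (1/8) *\<^sub>C (gam False (snd \<alpha>) * gam True (snd \<beta>) * chir_proj False)))"

lemma chir_proj_add: "chir_proj True + chir_proj False = 1"
proof -
  have "chir_proj True + chir_proj False = (num1 + num1') * (num2 + num2')"
    by (simp add: chir_proj_def algebra_simps)
  then show ?thesis by (simp add: num_add)
qed

lemma chir_proj_gam: "gam a b * chir_proj c = chir_proj (\<not> c) * gam a b"
  by (cases a; cases b; cases c) (simp_all add: chir_proj_def distrib_left distrib_right mult.assoc fock_simps)

lemma chir_proj_mult: "chir_proj c * chir_proj d = (if c = d then chir_proj c else 0)"
  by (cases c; cases d) (simp_all add: chir_proj_def distrib_left distrib_right mult.assoc fock_simps)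

lemma cmat_values:
  "cmat (True, False) (True, False) = (1/8) *\<^sub>C (gam False False * gam False True)"
  "cmat (True, False) (True, True) = - (num1 * num2)"
  "cmat (True, True) (True, False) = num1' * num2'"
  "cmat (True, True) (True, True) = - (1/8) *\<^sub>C (gam True True * gam True False)"
  "cmat (True, False) (False, False) = gam False False * num2"
  "cmat (True, False) (False, True) = num1 * gam False True"
  "cmat (True, True) (False, False) = num1' * gam True False"
  "cmat (True, True) (False, True) = gam True True * num2'"
  "cmat (False, False) (True, False) = (1/8) *\<^sub>C (gam False False * num2')"
  "cmat (False, True) (True, False) = (1/8) *\<^sub>C (num1' * gam False True)"
  "cmat (False, False) (True, True) = (1/8) *\<^sub>C (num1 * gam True False)"
  "cmat (False, True) (True, True) = (1/8) *\<^sub>C (gam True True * num2)"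
  "cmat (False, False) (False, False) = (1/8) *\<^sub>C (gam False False * gam True False)"
  "cmat (False, False) (False, True) = - (num1 * num2')"
  "cmat (False, True) (False, False) = num1' * num2"
  "cmat (False, True) (False, True) = - (1/8) *\<^sub>C (gam True True * gam False True)"
  by (simp_all add: cmat_def chir_proj_def distrib_left distrib_right mult.assoc fock_simps
      scaleC_mult_left scaleC_mult_right scaleC_scaleC)

text \<open>The inner indices of a product are contracted by the symplectic forms. This is what lets
  multiplication by a generator be read as joining slots.\<close>

lemma cmat_mult: "cmat \<alpha> \<beta> * cmat \<gamma> \<delta> = spin_form \<beta> \<gamma> *\<^sub>C cmat \<alpha> \<delta>"
proof -
  obtain c1 a1 c2 a2 c3 a3 c4 a4
    where "\<alpha> = (c1, a1)" "\<beta> = (c2, a2)" "\<gamma> = (c3, a3)" "\<delta> = (c4, a4)"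
    by (metis surj_pair)
  then show ?thesis
    by (cases c1; cases a1; cases c2; cases a2; cases c3; cases a3; cases c4; cases a4;
      simp only: cmat_values; simp add: spin_form_def eps_def mult.assoc fock_simps
        scaleC_mult_left scaleC_mult_right)
qed

lemma chir_proj_cmat: "chir_proj c = cmat (c, True) (c, False) - cmat (c, False) (c, True)"
  by (cases c) (simp_all add: cmat_values chir_proj_def add.commute)

text \<open>A vector exchanges the two chiralities. Placing the whole factor 8 on one of the two
  blocks avoids the square roots of a symmetric normalisation.\<close>

lemma gam_cmat: "gam a b = 8 *\<^sub>C cmat (False, b) (True, a) + cmat (True, a) (False, b)"
proof -
  have "gam a b = gam a b * (chir_proj True + chir_proj False)" by (simp add: chir_proj_add)
  then show ?thesis by (simp add: cmat_def distrib_left scaleC_scaleC)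
qed

lemma p_basis_span: "cspan (range (\<lambda>(a, b). p_basis a b)) = UNIV"
proof -
  have "v \<in> cspan (range (\<lambda>(a, b). p_basis a b))" for v
  proof -
    have "Rep_p41 v \<in> cspan {E\<^sub>3, E\<^sub>4, F\<^sub>3, F\<^sub>4}"
      using Rep_p41[of v] p41_span by simp
    then obtain a b c d where "Rep_p41 v = a *\<^sub>C E\<^sub>3 + b *\<^sub>C E\<^sub>4 + c *\<^sub>C F\<^sub>3 + d *\<^sub>C F\<^sub>4"
      by (auto simp: complex_space.span_insert complex_space.span_empty) (metis add.assoc diff_add_cancel diff_eq_eq add.commute)
    then have "v = a *\<^sub>C p_basis False False + b *\<^sub>C p_basis False True + c *\<^sub>C p_basis True True + (- d) *\<^sub>C p_basis True False"
      unfolding Rep_p41_inject[symmetric] plus_p41.rep_eq scaleC_p41.rep_eq Rep_p_basis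
      by (simp add: p_vec_def)
    also have "\<dots> \<in> cspan (range (\<lambda>(a, b). p_basis a b))"
      by (intro complex_space.span_add complex_space.span_scale complex_space.span_base) (auto intro: rev_image_eqI)
    finally show ?thesis .
  qed
  then show ?thesis by auto
qed

text \<open>The span contains 1, as the sum of the chirality projections, and is stable under left
  multiplication by vectors, so it contains all Clifford words.\<close>

lemma clifford_cmat_span: "x \<in> cspan (range (\<lambda>(\<alpha>, \<beta>). cmat \<alpha> \<beta>))"
proof -
  let ?S = "cspan (range (\<lambda>(\<alpha>, \<beta>). cmat \<alpha> \<beta>))"
  have base: "cmat \<alpha> \<beta> \<in> ?S" for \<alpha> \<beta>
    by (rule complex_space.span_base) (auto intro: rev_image_eqI)
  have chir: "chir_proj c \<in> ?S" for c
    unfolding chir_proj_cmat by (auto intro: complex_space.span_diff base)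
  have one: "1 \<in> ?S"
    unfolding chir_proj_add[symmetric] by (intro complex_space.span_add chir)
  have gam: "gam a b * y \<in> ?S" if "y \<in> ?S" for a b y
    using that
  proof (rule clinear_span_image[rotated -1])
    fix y assume "y \<in> range (\<lambda>(\<alpha>, \<beta>). cmat \<alpha> \<beta>)"
    then obtain \<gamma> \<delta> where "y = cmat \<gamma> \<delta>" by auto
    then show "gam a b * y \<in> ?S"
      unfolding gam_cmat
      by (auto simp: distrib_right scaleC_mult_left cmat_mult
          intro!: complex_space.span_add complex_space.span_scale base)
  qed (intro clinear_intros)
  have mult: "clifford_of v * y \<in> ?S" if y: "y \<in> ?S" for v y
  proof (rule clinear_span_image[where S = "range (\<lambda>(a, b). p_basis a b)"])
    show "clinear (\<lambda>v. clifford_of v * y)" by (rule clinear_mult_right[OF clinear_clifford_of])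
    show "v \<in> cspan (range (\<lambda>(a, b). p_basis a b))" by (simp add: p_basis_span)
    show "clifford_of v * y \<in> ?S" if "v \<in> range (\<lambda>(a, b). p_basis a b)" for v
      using that gam[OF y] by (auto simp: gam_def)
  qed
  have "prod_list (map clifford_of vs) \<in> ?S" for vs :: "p41 list"
    by (induction vs) (simp_all add: one mult)
  then have "range (\<lambda>vs :: p41 list. prod_list (map clifford_of vs)) \<subseteq> ?S" by auto
  then have "cspan (range (\<lambda>vs :: p41 list. prod_list (map clifford_of vs))) \<subseteq> ?S"
    by (intro complex_space.span_minimal complex_space.subspace_span)
  then show ?thesis using clifford_span[of x] by auto
qed

section \<open>Spinor coordinates on the Lie algebra\<close>

lemma bracket_antisym: "lie_bracket y x = - lie_bracket x (y :: 'a::complex_lie_alg)"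
proof -
  have "lie_bracket (x + y) (x + y) = 0" by (rule lie_bracket_self)
  then have "lie_bracket x y + lie_bracket y x = 0"
    by (simp add: lie_bracket_add_left lie_bracket_add_right lie_bracket_self[of x] lie_bracket_self[of y] add.commute)
  then show ?thesis by (simp add: eq_neg_iff_add_eq_0 add.commute)
qed

lemma bracket_minus: "lie_bracket (- x) y = - lie_bracket x y" "lie_bracket x (- y) = - lie_bracket x (y :: 'a::complex_lie_alg)"
  using lie_bracket_scaleC_left[of "-1" x y] lie_bracket_scaleC_right[of x "-1" y] by simp_all

text \<open>The projection of \<open>S \<otimes> S\<close> onto \<open>\<gg>\<close>, which factors through \<open>Sym\<^sup>2 S\<close>.\<close>

definition letter_vec :: "spinor \<Rightarrow> spinor \<Rightarrow> so41C" where
  "letter_vec \<alpha> \<beta> = (let a = snd \<alpha>; b = snd \<beta> in if fst \<alpha> then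
     (if fst \<beta> then lie_bracket (p_vec a False) (p_vec b True) - lie_bracket (p_vec a True) (p_vec b False)
      else p_vec a b)
    else
     (if fst \<beta> then p_vec b a
      else lie_bracket (p_vec False a) (p_vec True b) - lie_bracket (p_vec True a) (p_vec False b)))"

text \<open>For equal chiralities two signs cancel: the bracket is antisymmetric, and so is the form
  contracting the two remaining indices of the vectors in p.\<close>

lemma letter_vec_sym: "letter_vec \<alpha> \<beta> = letter_vec \<beta> \<alpha>"
  unfolding letter_vec_def Let_def
  using bracket_antisym[of "p_vec (snd \<alpha>) True" "p_vec (snd \<beta>) False"]
    bracket_antisym[of "p_vec (snd \<alpha>) False" "p_vec (snd \<beta>) True"]
    bracket_antisym[of "p_vec True (snd \<alpha>)" "p_vec False (snd \<beta>)"]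
    bracket_antisym[of "p_vec False (snd \<alpha>)" "p_vec True (snd \<beta>)"]
  by auto

lemma Rep_lie: "Rep_so41C (lie_bracket X Y) $ i $ j =
    (\<Sum>k\<in>UNIV. Rep_so41C X $ i $ k * Rep_so41C Y $ k $ j) - (\<Sum>k\<in>UNIV. Rep_so41C Y $ i $ k * Rep_so41C X $ k $ j)"
  by (simp add: lie_bracket_so41C.rep_eq matrix_matrix_mult_def)

lemma so41C_eq_iff: "X = Y \<longleftrightarrow> (\<forall>i j. Rep_so41C X $ i $ j = Rep_so41C Y $ i $ j)"
  by (simp add: Rep_so41C_inject[symmetric] vec_eq_iff)

lemma p_entries:
  "Rep_so41C E\<^sub>3 $ i $ j = (if i = 1 \<and> j = 5 \<or> i = 5 \<and> j = 1 then 1 else if i = 2 \<and> j = 5 \<or> i = 5 \<and> j = 2 then - \<i> else 0)"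
  "Rep_so41C E\<^sub>4 $ i $ j = (if i = 3 \<and> j = 5 \<or> i = 5 \<and> j = 3 then 1 else if i = 4 \<and> j = 5 \<or> i = 5 \<and> j = 4 then - \<i> else 0)"
  "Rep_so41C F\<^sub>3 $ i $ j = (if i = 1 \<and> j = 5 \<or> i = 5 \<and> j = 1 then 1 else if i = 2 \<and> j = 5 \<or> i = 5 \<and> j = 2 then \<i> else 0)"
  "Rep_so41C F\<^sub>4 $ i $ j = (if i = 3 \<and> j = 5 \<or> i = 5 \<and> j = 3 then 1 else if i = 4 \<and> j = 5 \<or> i = 5 \<and> j = 4 then \<i> else 0)"
  unfolding Rep_generators by (auto simp: unit_matrix_def)

lemma brackets_p:
  "lie_bracket E\<^sub>3 E\<^sub>4 = 2 *\<^sub>C E\<^sub>1" "lie_bracket F\<^sub>3 F\<^sub>4 = (-2) *\<^sub>C F\<^sub>1"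
  "lie_bracket E\<^sub>3 F\<^sub>4 = 2 *\<^sub>C E\<^sub>2" "lie_bracket F\<^sub>3 E\<^sub>4 = (-2) *\<^sub>C F\<^sub>2"
  "lie_bracket E\<^sub>3 F\<^sub>3 = 2 *\<^sub>C H\<^sub>1" "lie_bracket E\<^sub>4 F\<^sub>4 = 2 *\<^sub>C H\<^sub>2"
  unfolding so41C_eq_iff all_5 Rep_lie sum_5 p_entries
  by (simp_all add: scaleC_so41C.rep_eq uminus_so41C.rep_eq Rep_generators unit_matrix_def)

lemma brackets_p':
  "lie_bracket E\<^sub>4 E\<^sub>3 = (-2) *\<^sub>C E\<^sub>1" "lie_bracket F\<^sub>4 F\<^sub>3 = 2 *\<^sub>C F\<^sub>1"
  "lie_bracket F\<^sub>4 E\<^sub>3 = (-2) *\<^sub>C E\<^sub>2" "lie_bracket E\<^sub>4 F\<^sub>3 = 2 *\<^sub>C F\<^sub>2"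
  "lie_bracket F\<^sub>3 E\<^sub>3 = (-2) *\<^sub>C H\<^sub>1" "lie_bracket F\<^sub>4 E\<^sub>4 = (-2) *\<^sub>C H\<^sub>2"
  by (subst bracket_antisym, simp add: brackets_p)+

lemma letter_vec_values:
  "letter_vec (True, False) (True, False) = 4 *\<^sub>C E\<^sub>1" "letter_vec (True, True) (True, True) = (-4) *\<^sub>C F\<^sub>1"
  "letter_vec (True, False) (True, True) = 2 *\<^sub>C (H\<^sub>1 + H\<^sub>2)" "letter_vec (True, True) (True, False) = 2 *\<^sub>C (H\<^sub>1 + H\<^sub>2)"
  "letter_vec (False, False) (False, False) = (-4) *\<^sub>C E\<^sub>2" "letter_vec (False, True) (False, True) = 4 *\<^sub>C F\<^sub>2"
  "letter_vec (False, False) (False, True) = 2 *\<^sub>C (H\<^sub>1 - H\<^sub>2)" "letter_vec (False, True) (False, False) = 2 *\<^sub>C (H\<^sub>1 - H\<^sub>2)"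
  "letter_vec (True, a) (False, b) = p_vec a b" "letter_vec (False, b) (True, a) = p_vec a b"
proof -
  have four: "2 *\<^sub>C X + 2 *\<^sub>C X = 4 *\<^sub>C X" for X :: so41C
    using scaleC_add_left[of 2 2 X] by simp
  have four': "- (2 *\<^sub>C X) - 2 *\<^sub>C X = - (4 *\<^sub>C X)" for X :: so41C
    using scaleC_add_left[of "-2" "-2" X] by simp
  show "letter_vec (True, False) (True, False) = 4 *\<^sub>C E\<^sub>1" "letter_vec (True, True) (True, True) = (-4) *\<^sub>C F\<^sub>1"
    "letter_vec (True, False) (True, True) = 2 *\<^sub>C (H\<^sub>1 + H\<^sub>2)" "letter_vec (True, True) (True, False) = 2 *\<^sub>C (H\<^sub>1 + H\<^sub>2)"
    "letter_vec (False, False) (False, False) = (-4) *\<^sub>C E\<^sub>2" "letter_vec (False, True) (False, True) = 4 *\<^sub>C F\<^sub>2"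
    "letter_vec (False, False) (False, True) = 2 *\<^sub>C (H\<^sub>1 - H\<^sub>2)" "letter_vec (False, True) (False, False) = 2 *\<^sub>C (H\<^sub>1 - H\<^sub>2)"
    by (simp_all add: letter_vec_def p_vec_def bracket_minus brackets_p brackets_p' four four'
        scaleC_add_right complex_space.scale_right_diff_distrib)
qed (simp_all add: letter_vec_def)

lemma letter_vec_span: "X \<in> cspan (range (\<lambda>(\<alpha>, \<beta>). letter_vec \<alpha> \<beta>))"
proof -
  let ?S = "cspan (range (\<lambda>(\<alpha>, \<beta>). letter_vec \<alpha> \<beta>))"
  have base: "letter_vec \<alpha> \<beta> \<in> ?S" for \<alpha> \<beta>
    by (rule complex_space.span_base) (auto intro: rev_image_eqI)
  have half: "Y \<in> ?S" if "c *\<^sub>C Y \<in> ?S" "c \<noteq> 0" for c Y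
    using complex_space.span_scale[OF that(1), of "inverse c"] that(2) by (simp add: scaleC_scaleC)
  note b = base[of "(True, False)" "(True, False)"] base[of "(True, True)" "(True, True)"]
    base[of "(True, False)" "(True, True)"] base[of "(False, False)" "(False, False)"]
    base[of "(False, True)" "(False, True)"] base[of "(False, False)" "(False, True)"]
  have ef: "E\<^sub>1 \<in> ?S" "F\<^sub>1 \<in> ?S" "E\<^sub>2 \<in> ?S" "F\<^sub>2 \<in> ?S" "H\<^sub>1 + H\<^sub>2 \<in> ?S" "H\<^sub>1 - H\<^sub>2 \<in> ?S"
    by (rule half[OF b(1)[unfolded letter_vec_values]] half[OF b(2)[unfolded letter_vec_values]]
        half[OF b(3)[unfolded letter_vec_values]] half[OF b(4)[unfolded letter_vec_values]]
        half[OF b(5)[unfolded letter_vec_values]] half[OF b(6)[unfolded letter_vec_values]], simp)+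
  have "2 *\<^sub>C H\<^sub>1 = (H\<^sub>1 + H\<^sub>2) + (H\<^sub>1 - H\<^sub>2)" "2 *\<^sub>C H\<^sub>2 = (H\<^sub>1 + H\<^sub>2) - (H\<^sub>1 - H\<^sub>2)"
    using scaleC_add_left[of 1 1 H\<^sub>1] scaleC_add_left[of 1 1 H\<^sub>2] by simp_all
  then have "2 *\<^sub>C H\<^sub>1 \<in> ?S" "2 *\<^sub>C H\<^sub>2 \<in> ?S"
    using complex_space.span_add[OF ef(5,6)] complex_space.span_diff[OF ef(5,6)] by simp_all
  then have h: "H\<^sub>1 \<in> ?S" "H\<^sub>2 \<in> ?S" using half by force+
  have p: "E\<^sub>3 \<in> ?S" "E\<^sub>4 \<in> ?S" "F\<^sub>3 \<in> ?S" "F\<^sub>4 \<in> ?S"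
    using base[of "(True, False)" "(False, False)"] base[of "(True, False)" "(False, True)"]
      base[of "(True, True)" "(False, True)"] complex_space.span_neg[OF base[of "(True, True)" "(False, False)"]]
    by (simp_all add: letter_vec_values p_vec_def)
  have "cspan {H\<^sub>1, H\<^sub>2, E\<^sub>1, E\<^sub>2, F\<^sub>1, F\<^sub>2} \<subseteq> ?S" "cspan {E\<^sub>3, E\<^sub>4, F\<^sub>3, F\<^sub>4} \<subseteq> ?S"
    using ef h p by (intro complex_space.span_minimal complex_space.subspace_span, simp)+
  moreover have "X + cartan_inv X \<in> k41" "X - cartan_inv X \<in> {X. cartan_inv X = - X}"
  proof -
    have "cartan_inv (cartan_inv X) = X" by transfer (simp add: transpose_uminus transpose_transpose)
    then show "X + cartan_inv X \<in> k41" "X - cartan_inv X \<in> {X. cartan_inv X = - X}"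
      by (simp_all add: k41_def cartan_inv_add cartan_inv_diff add.commute)
  qed
  ultimately have "(X + cartan_inv X) + (X - cartan_inv X) \<in> ?S"
    unfolding k41_span p41_span by (blast intro: complex_space.span_add)
  moreover have "(X + cartan_inv X) + (X - cartan_inv X) = 2 *\<^sub>C X"
    using scaleC_add_left[of 1 1 X] by simp
  ultimately show ?thesis using half[of 2 X] by simp
qed

section \<open>Bilinear invariants and the spin map\<close>

text \<open>Four times the contraction of f with the inverse of the trace form: the dual vectors of
  \<open>p_basis\<close> are basis vectors divided by 4 or -4.\<close>

definition dual_sum :: "(p41 \<Rightarrow> p41 \<Rightarrow> 'a) \<Rightarrow> 'a::ab_group_add" where
  "dual_sum f = f (p_basis False False) (p_basis True True) + f (p_basis True True) (p_basis False False)
     - f (p_basis False True) (p_basis True False) - f (p_basis True False) (p_basis False True)"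

lemma p41_entries:
  fixes v :: p41 and i j :: 5
  defines "V \<equiv> Rep_so41C (Rep_p41 v)"
  shows "(i = 5) = (j = 5) \<Longrightarrow> V $ i $ j = 0" and "V $ i $ j = V $ j $ i"
proof -
  have "Rep_so41C (cartan_inv (Rep_p41 v)) $ i $ j = Rep_so41C (- Rep_p41 v) $ i $ j" for i j
    using Rep_p41[of v] by simp
  then have c: "V $ i $ j = V $ j $ i" for i j
    unfolding cartan_inv.rep_eq uminus_so41C.rep_eq V_def by (simp add: transpose_def)
  then show "V $ i $ j = V $ j $ i" .
  show "(i = 5) = (j = 5) \<Longrightarrow> V $ i $ j = 0"
    using c[of i j] so41C_entries[of "Rep_p41 v" j i] by (simp add: V_def)
qed

text \<open>The curvature tensor of hyperbolic space. As k is spanned by brackets of elements of p,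
  this one formula yields the action of k on p and later the spin map.\<close>

lemma double_bracket_p:
  "lie_bracket (lie_bracket (Rep_p41 v) (Rep_p41 w)) (Rep_p41 u) =
    (bform w u / 2) *\<^sub>C Rep_p41 v - (bform v u / 2) *\<^sub>C Rep_p41 w"
proof -
  note ne = p41_entries(1)
  have z: "Rep_so41C (Rep_p41 v) $ 1 $ 1 = 0" "Rep_so41C (Rep_p41 v) $ 2 $ 2 = 0" "Rep_so41C (Rep_p41 v) $ 3 $ 3 = 0"
    "Rep_so41C (Rep_p41 v) $ 4 $ 4 = 0" "Rep_so41C (Rep_p41 v) $ 5 $ 5 = 0"
    "Rep_so41C (Rep_p41 v) $ 1 $ 2 = 0" "Rep_so41C (Rep_p41 v) $ 1 $ 3 = 0" "Rep_so41C (Rep_p41 v) $ 1 $ 4 = 0"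
    "Rep_so41C (Rep_p41 v) $ 2 $ 1 = 0" "Rep_so41C (Rep_p41 v) $ 2 $ 3 = 0" "Rep_so41C (Rep_p41 v) $ 2 $ 4 = 0"
    "Rep_so41C (Rep_p41 v) $ 3 $ 1 = 0" "Rep_so41C (Rep_p41 v) $ 3 $ 2 = 0" "Rep_so41C (Rep_p41 v) $ 3 $ 4 = 0"
    "Rep_so41C (Rep_p41 v) $ 4 $ 1 = 0" "Rep_so41C (Rep_p41 v) $ 4 $ 2 = 0" "Rep_so41C (Rep_p41 v) $ 4 $ 3 = 0" for v
    by (rule ne; simp)+
  have s: "Rep_so41C (Rep_p41 v) $ 5 $ 1 = Rep_so41C (Rep_p41 v) $ 1 $ 5" "Rep_so41C (Rep_p41 v) $ 5 $ 2 = Rep_so41C (Rep_p41 v) $ 2 $ 5"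
    "Rep_so41C (Rep_p41 v) $ 5 $ 3 = Rep_so41C (Rep_p41 v) $ 3 $ 5" "Rep_so41C (Rep_p41 v) $ 5 $ 4 = Rep_so41C (Rep_p41 v) $ 4 $ 5" for v
    by (rule p41_entries)+
  have b: "bform v u = 2 * (Rep_so41C (Rep_p41 v) $ 1 $ 5 * Rep_so41C (Rep_p41 u) $ 1 $ 5
    + Rep_so41C (Rep_p41 v) $ 2 $ 5 * Rep_so41C (Rep_p41 u) $ 2 $ 5 + Rep_so41C (Rep_p41 v) $ 3 $ 5 * Rep_so41C (Rep_p41 u) $ 3 $ 5
    + Rep_so41C (Rep_p41 v) $ 4 $ 5 * Rep_so41C (Rep_p41 u) $ 4 $ 5)" for v u
    unfolding bform_p41_def trace_def matrix_matrix_mult_def vec_lambda_beta sum_5 by (simp add: z s)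
  show ?thesis
    unfolding so41C_eq_iff all_5 Rep_lie sum_5 minus_so41C.rep_eq scaleC_so41C.rep_eq b
    by (simp add: z s algebra_simps)
qed

lemma bracket_derivation:
  "lie_bracket x (lie_bracket y z) = lie_bracket (lie_bracket x y) z + lie_bracket y (lie_bracket x (z :: 'a::complex_lie_alg))"
  using lie_bracket_jacobi[of x y z] bracket_antisym[of y "lie_bracket z x"] bracket_antisym[of z "lie_bracket x y"]
    bracket_antisym[of z x]
  by (simp add: bracket_minus algebra_simps)

lemma double_bracket_p_vec:
  "lie_bracket (lie_bracket (p_vec a a') (p_vec b b')) (p_vec c c') =
    (2 * eps b c * eps b' c') *\<^sub>C p_vec a a' - (2 * eps a c * eps a' c') *\<^sub>C p_vec b b'"
  using double_bracket_p[of "p_basis a a'" "p_basis b b'" "p_basis c c'"]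
  by (simp add: Rep_p_basis bform_p_basis mult.assoc)

lemma brackets_k_p:
  "lie_bracket E\<^sub>1 E\<^sub>3 = 0"
  "lie_bracket E\<^sub>1 E\<^sub>4 = 0"
  "lie_bracket E\<^sub>1 F\<^sub>3 = - E\<^sub>4"
  "lie_bracket E\<^sub>1 F\<^sub>4 = E\<^sub>3"
  "lie_bracket F\<^sub>1 F\<^sub>3 = 0"
  "lie_bracket F\<^sub>1 F\<^sub>4 = 0"
  "lie_bracket E\<^sub>2 E\<^sub>3 = 0"
  "lie_bracket E\<^sub>2 F\<^sub>4 = 0"
  "lie_bracket E\<^sub>2 F\<^sub>3 = - F\<^sub>4"
  "lie_bracket E\<^sub>2 E\<^sub>4 = E\<^sub>3"
  "lie_bracket H\<^sub>1 E\<^sub>3 = E\<^sub>3"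
  "lie_bracket H\<^sub>1 F\<^sub>3 = - F\<^sub>3"
  "lie_bracket H\<^sub>1 E\<^sub>4 = 0"
  "lie_bracket H\<^sub>1 F\<^sub>4 = 0"
  "lie_bracket H\<^sub>2 E\<^sub>3 = 0"
  "lie_bracket H\<^sub>2 F\<^sub>3 = 0"
  "lie_bracket H\<^sub>2 E\<^sub>4 = E\<^sub>4"
  "lie_bracket H\<^sub>2 F\<^sub>4 = - F\<^sub>4"
proof -
  have cancel: "c *\<^sub>C x = c *\<^sub>C y \<Longrightarrow> c \<noteq> 0 \<Longrightarrow> x = y" for c and x y :: so41C by simp
  note simps = p_vec_def eps_def bracket_minus brackets_p lie_bracket_scaleC_left
  show "lie_bracket E\<^sub>1 E\<^sub>3 = 0"
    by (rule cancel[of 2]) (use double_bracket_p_vec[of False False False True False False] in \<open>simp_all add: simps\<close>)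
  show "lie_bracket E\<^sub>1 E\<^sub>4 = 0"
    by (rule cancel[of 2]) (use double_bracket_p_vec[of False False False True False True] in \<open>simp_all add: simps\<close>)
  show "lie_bracket E\<^sub>1 F\<^sub>3 = - E\<^sub>4"
    by (rule cancel[of 2]) (use double_bracket_p_vec[of False False False True True True] in \<open>simp_all add: simps\<close>)
  show "lie_bracket E\<^sub>1 F\<^sub>4 = E\<^sub>3"
    by (rule cancel[of 2]) (use double_bracket_p_vec[of False False False True True False] in \<open>simp_all add: simps\<close>)
  show "lie_bracket F\<^sub>1 F\<^sub>3 = 0"
    by (rule cancel[of 2]) (use double_bracket_p_vec[of True True True False True True] in \<open>simp_all add: simps\<close>)
  show "lie_bracket F\<^sub>1 F\<^sub>4 = 0"
    by (rule cancel[of 2]) (use double_bracket_p_vec[of True True True False True False] in \<open>simp_all add: simps\<close>)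
  show "lie_bracket E\<^sub>2 E\<^sub>3 = 0"
    by (rule cancel[of 2]) (use double_bracket_p_vec[of False False True False False False] in \<open>simp_all add: simps\<close>)
  show "lie_bracket E\<^sub>2 F\<^sub>4 = 0"
    by (rule cancel[of 2]) (use double_bracket_p_vec[of False False True False True False] in \<open>simp_all add: simps\<close>)
  show "lie_bracket E\<^sub>2 F\<^sub>3 = - F\<^sub>4"
    by (rule cancel[of "-2"]) (use double_bracket_p_vec[of False False True False True True] in \<open>simp_all add: simps\<close>)
  show "lie_bracket E\<^sub>2 E\<^sub>4 = E\<^sub>3"
    by (rule cancel[of 2]) (use double_bracket_p_vec[of False False True False False True] in \<open>simp_all add: simps\<close>)
  show "lie_bracket H\<^sub>1 E\<^sub>3 = E\<^sub>3"
    by (rule cancel[of 2]) (use double_bracket_p_vec[of False False True True False False] in \<open>simp_all add: simps\<close>)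
  show "lie_bracket H\<^sub>1 F\<^sub>3 = - F\<^sub>3"
    by (rule cancel[of 2]) (use double_bracket_p_vec[of False False True True True True] in \<open>simp_all add: simps\<close>)
  show "lie_bracket H\<^sub>1 E\<^sub>4 = 0"
    by (rule cancel[of 2]) (use double_bracket_p_vec[of False False True True False True] in \<open>simp_all add: simps\<close>)
  show "lie_bracket H\<^sub>1 F\<^sub>4 = 0"
    by (rule cancel[of 2]) (use double_bracket_p_vec[of False False True True True False] in \<open>simp_all add: simps\<close>)
  show "lie_bracket H\<^sub>2 E\<^sub>3 = 0"
    by (rule cancel[of 2]) (use double_bracket_p_vec[of False True True False False False] in \<open>simp_all add: simps\<close>)
  show "lie_bracket H\<^sub>2 F\<^sub>3 = 0"
    by (rule cancel[of 2]) (use double_bracket_p_vec[of False True True False True True] in \<open>simp_all add: simps\<close>)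
  show "lie_bracket H\<^sub>2 E\<^sub>4 = E\<^sub>4"
    by (rule cancel[of 2]) (use double_bracket_p_vec[of False True True False False True] in \<open>simp_all add: simps\<close>)
  show "lie_bracket H\<^sub>2 F\<^sub>4 = - F\<^sub>4"
    by (rule cancel[of 2]) (use double_bracket_p_vec[of False True True False True False] in \<open>simp_all add: simps\<close>)
qed

text \<open>The second factor is a multiple of a bracket of two elements of p, so the derivation
  rule reduces everything to the action of k on p. The factors 2 and -2 to be cancelled are those of
  \<open>brackets_p\<close>.\<close>

lemma brackets_k:
  "lie_bracket E\<^sub>1 F\<^sub>1 = H\<^sub>1 + H\<^sub>2" "lie_bracket (H\<^sub>1 + H\<^sub>2) E\<^sub>1 = 2 *\<^sub>C E\<^sub>1" "lie_bracket (H\<^sub>1 + H\<^sub>2) F\<^sub>1 = (-2) *\<^sub>C F\<^sub>1"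
  "lie_bracket E\<^sub>2 F\<^sub>2 = H\<^sub>1 - H\<^sub>2" "lie_bracket (H\<^sub>1 - H\<^sub>2) E\<^sub>2 = 2 *\<^sub>C E\<^sub>2" "lie_bracket (H\<^sub>1 - H\<^sub>2) F\<^sub>2 = (-2) *\<^sub>C F\<^sub>2"
proof -
  have cancel: "c *\<^sub>C x = c *\<^sub>C y \<Longrightarrow> c \<noteq> 0 \<Longrightarrow> x = y" for c and x y :: so41C by simp
  have diff: "lie_bracket (x - y) z = lie_bracket x z - lie_bracket y z" for x y z :: so41C
    using lie_bracket_add_left[of x "- y" z] by (simp add: bracket_minus)
  have four: "2 *\<^sub>C x + 2 *\<^sub>C x = 4 *\<^sub>C x" "- (2 *\<^sub>C x) - 2 *\<^sub>C x = - (4 *\<^sub>C x)" for x :: so41C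
    using scaleC_add_left[of 2 2 x] scaleC_add_left[of "-2" "-2" x] by simp_all
  note simps = brackets_k_p brackets_p brackets_p' bracket_minus lie_bracket_scaleC_right lie_bracket_add_left
    diff scaleC_add_right complex_space.scale_right_diff_distrib scaleC_scaleC four
  show "lie_bracket E\<^sub>1 F\<^sub>1 = H\<^sub>1 + H\<^sub>2"
    by (rule cancel[of "-2"]) (use bracket_derivation[of E\<^sub>1 F\<^sub>3 F\<^sub>4] in \<open>simp_all add: simps\<close>)
  show "lie_bracket E\<^sub>2 F\<^sub>2 = H\<^sub>1 - H\<^sub>2"
    by (rule cancel[of "-2"]) (use bracket_derivation[of E\<^sub>2 F\<^sub>3 E\<^sub>4] in \<open>simp_all add: simps\<close>)
  show "lie_bracket (H\<^sub>1 + H\<^sub>2) E\<^sub>1 = 2 *\<^sub>C E\<^sub>1"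
    by (rule cancel[of 2]) (use bracket_derivation[of "H\<^sub>1 + H\<^sub>2" E\<^sub>3 E\<^sub>4] in \<open>simp_all add: simps\<close>)
  show "lie_bracket (H\<^sub>1 + H\<^sub>2) F\<^sub>1 = (-2) *\<^sub>C F\<^sub>1"
    by (rule cancel[of "-2"]) (use bracket_derivation[of "H\<^sub>1 + H\<^sub>2" F\<^sub>3 F\<^sub>4] in \<open>simp_all add: simps\<close>)
  show "lie_bracket (H\<^sub>1 - H\<^sub>2) E\<^sub>2 = 2 *\<^sub>C E\<^sub>2"
    by (rule cancel[of 2]) (use bracket_derivation[of "H\<^sub>1 - H\<^sub>2" E\<^sub>3 F\<^sub>4] in \<open>simp_all add: simps\<close>)
  show "lie_bracket (H\<^sub>1 - H\<^sub>2) F\<^sub>2 = (-2) *\<^sub>C F\<^sub>2"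
    by (rule cancel[of "-2"]) (use bracket_derivation[of "H\<^sub>1 - H\<^sub>2" F\<^sub>3 E\<^sub>4] in \<open>simp_all add: simps\<close>)
qed

section \<open>The spin map in spinor coordinates\<close>

lemma chevalley_pair: "chevalley (ext_of v * ext_of w) =
    (1/2) *\<^sub>C (clifford_of v * clifford_of w - clifford_of w * clifford_of v)"
proof -
  let ?t = "Transposition.transpose 0 (Suc 0)"
  have set: "{..<Suc (Suc 0)} = {0, Suc 0}" by auto
  have "id \<noteq> ?t" by (metis id_apply transpose_apply_first n_not_Suc_n)
  moreover have "permute_list ?t [v, w] = [w, v]" using permute_list_swap[of "[]" v w "[]"] by simp
  moreover have "sign ?t = - 1" by (subst sign_swap_id) simp
  moreover have "{\<alpha>. \<alpha> permutes {..<Suc (Suc 0)}} = {id, ?t}"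
    unfolding set by (auto simp: permutes_doubleton_iff)
  ultimately have "antisymmetrize [v, w] = (1/2) *\<^sub>C (clifford_of v * clifford_of w - clifford_of w * clifford_of v)"
    by (simp add: antisymmetrize_def sign_id scaleC_one)
  then show ?thesis using chevalley_prod_list[of "[v, w]"] by simp
qed

text \<open>The condition that characterises \<open>spin_map\<close>, stated for any u representing
  the bracket, so that no value of \<open>Abs_p41\<close> has to be justified when sums and
  multiples are formed.\<close>

definition is_spin :: "so41C \<Rightarrow> p41 clifford \<Rightarrow> bool" where
  "is_spin X c \<longleftrightarrow> X \<in> k41 \<and> c \<in> chevalley ` ext_square \<and>
     (\<forall>v u. Rep_p41 u = lie_bracket X (Rep_p41 v) \<longrightarrow> c * clifford_of v - clifford_of v * c = clifford_of u)"

lemma clinear_zero_on_span: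
  assumes "clinear f" "\<And>x. x \<in> S \<Longrightarrow> f x = 0" "x \<in> cspan S"
  shows "f x = 0"
  by (rule clinear_eq_on_span[OF assms(1) _ assms(2,3)]) (auto intro: clinearI)

text \<open>In dimension n, sandwiching an element of exterior degree d between dual bases
  multiplies it by n - 2 d, up to sign and normalisation. For n = 4 this kills bivectors but not
  scalars.\<close>

lemma dual_sum_gam_alternating:
  assumes "c \<in> chevalley ` ext_square"
  shows "dual_sum (\<lambda>x y. clifford_of x * c * clifford_of y) = 0"
proof -
  let ?A = "\<lambda>c. dual_sum (\<lambda>x y. clifford_of x * c * clifford_of y)"
  have A: "clinear ?A" unfolding dual_sum_def by (intro clinear_intros)
  have base: "?A (gam a b * gam a' b' - gam a' b' * gam a b) = 0" for a b a' b'
  proof -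
    have num': "num1' = 1 - num1" "num2' = 1 - num2" using num_add by (simp_all add: eq_diff_eq add.commute)
    show ?thesis
      by (cases a; cases b; cases a'; cases b')
        ((simp_all add: dual_sum_def gam_def[symmetric] left_diff_distrib right_diff_distrib distrib_left
          distrib_right mult.assoc fock_simps scaleC_mult_left scaleC_mult_right scaleC_scaleC),
         (simp_all add: num' right_diff_distrib left_diff_distrib complex_space.scale_right_diff_distrib))
  qed
  have lin: "clinear (\<lambda>v. ?A (clifford_of v * x - x * clifford_of v))"
    "clinear (\<lambda>v. ?A (x * clifford_of v - clifford_of v * x))" for x
    by (rule clinear_compose[OF A], intro clinear_intros clinear_clifford_of)+
  have span: "v \<in> cspan (range (\<lambda>(a, b). p_basis a b))" for v by (simp add: p_basis_span)
  have 1: "?A (clifford_of v * gam a b - gam a b * clifford_of v) = 0" for v a b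
    by (rule clinear_zero_on_span[OF lin(1) _ span]) (auto simp: gam_def[symmetric] base)
  have 2: "?A (clifford_of v * clifford_of w - clifford_of w * clifford_of v) = 0" for v w
    by (rule clinear_zero_on_span[OF lin(2) _ span]) (auto simp: gam_def[symmetric] 1)
  obtain e where e: "e \<in> ext_square" "c = chevalley e" using assms by blast
  have "e \<in> cspan {ext_of v * ext_of w |v w. True}" using e by (simp add: ext_square_def)
  then show ?thesis unfolding e(2)
    by (rule clinear_zero_on_span[OF clinear_compose[OF A clinear_chevalley], rotated])
      (auto simp: chevalley_pair clinear_scaleC[OF A] 2)
qed

lemma chevalley_ext_square_closed:
  assumes "c \<in> chevalley ` ext_square" "d \<in> chevalley ` ext_square"
  shows "c + d \<in> chevalley ` ext_square" "c - d \<in> chevalley ` ext_square" "a *\<^sub>C c \<in> chevalley ` ext_square"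
proof -
  obtain e f where ef: "e \<in> ext_square" "f \<in> ext_square" "c = chevalley e" "d = chevalley f" using assms by blast
  note lin = clinear_chevalley
  have "c + d = chevalley (e + f)" "a *\<^sub>C c = chevalley (a *\<^sub>C e)" "c - d = chevalley (e + (-1) *\<^sub>C f)"
    unfolding ef clinear_add[OF lin] clinear_scaleC[OF lin] by simp_all
  moreover have span: "e + f \<in> ext_square" "a *\<^sub>C e \<in> ext_square" "e + (-1) *\<^sub>C f \<in> ext_square"
    using ef(1,2) complex_space.span_add complex_space.span_scale unfolding ext_square_def by blast+
  ultimately show "c + d \<in> chevalley ` ext_square" "c - d \<in> chevalley ` ext_square" "a *\<^sub>C c \<in> chevalley ` ext_square"
    by (metis imageI)+
qed

lemma dual_sum_clifford: "dual_sum (\<lambda>x y. clifford_of x * clifford_of y) = (-16) *\<^sub>C 1"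
proof -
  have "dual_sum (\<lambda>x y. clifford_of x * clifford_of y) = (-8) *\<^sub>C (num1 + num1') - 8 *\<^sub>C (num2 + num2')"
    unfolding dual_sum_def gam_def[symmetric] by (simp add: fock scaleC_add_right)
  also have "\<dots> = (-16) *\<^sub>C 1"
    unfolding num_add using scaleC_add_left[of "-8" "-8" "1 :: p41 clifford"] by simp
  finally show ?thesis .
qed

text \<open>The difference e of two candidates is a bivector that commutes with all vectors.
  Sandwiching e between dual bases therefore gives both 0 and -16 e. No basis of C(p) is
  required.\<close>

lemma is_spin_unique:
  assumes "is_spin X c" "is_spin X d"
  shows "c = d"
proof -
  define e where "e = c - d"
  have e: "e \<in> chevalley ` ext_square"
    using assms unfolding e_def is_spin_def by (blast intro: chevalley_ext_square_closed)
  have comm: "e * clifford_of v = clifford_of v * e" for v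
  proof -
    have "lie_bracket X (Rep_p41 v) \<in> {X. cartan_inv X = - X}"
      using assms(1) bracket_k_p[of X v] by (simp add: is_spin_def)
    then obtain u where "Rep_p41 u = lie_bracket X (Rep_p41 v)"
      using Abs_p41_inverse by blast
    then have "c * clifford_of v - clifford_of v * c = d * clifford_of v - clifford_of v * d"
      using assms unfolding is_spin_def by metis
    then show ?thesis by (simp add: e_def algebra_simps)
  qed
  have "clifford_of x * e * clifford_of y = e * (clifford_of x * clifford_of y)" for x y
    by (simp add: mult.assoc[symmetric] comm)
  then have "dual_sum (\<lambda>x y. clifford_of x * e * clifford_of y) = e * dual_sum (\<lambda>x y. clifford_of x * clifford_of y)"
    by (simp add: dual_sum_def distrib_left right_diff_distrib)
  then have "e = 0" using dual_sum_gam_alternating[OF e] by (simp add: dual_sum_clifford scaleC_mult_right)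
  then show ?thesis by (simp add: e_def)
qed

lemma spin_map_eqI:
  assumes "is_spin X c"
  shows "spin_map X = c"
proof -
  have *: "is_spin X d \<longleftrightarrow> d \<in> chevalley ` ext_square \<and>
     (\<forall>v. d * clifford_of v - clifford_of v * d = clifford_of (Abs_p41 (lie_bracket X (Rep_p41 v))))" for d
  proof -
    have X: "X \<in> k41" using assms by (simp add: is_spin_def)
    have "Rep_p41 u = lie_bracket X (Rep_p41 v) \<longleftrightarrow> u = Abs_p41 (lie_bracket X (Rep_p41 v))" for u v
    proof -
      have "Rep_p41 (Abs_p41 (lie_bracket X (Rep_p41 v))) = lie_bracket X (Rep_p41 v)"
        using bracket_k_p[OF X, of v] by (intro Abs_p41_inverse) simp
      then show ?thesis by (metis Rep_p41_inverse)
    qed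
    then show ?thesis using X by (simp add: is_spin_def)
  qed
  have "spin_map X = (THE d. is_spin X d)"
    unfolding spin_map_def * ..
  also have "\<dots> = c"
  proof (rule the_equality)
    show "is_spin X d \<Longrightarrow> d = c" for d by (rule is_spin_unique[OF _ assms])
  qed (rule assms)
  finally show ?thesis .
qed

lemma is_spin_add:
  assumes "is_spin X c" "is_spin Y d"
  shows "is_spin (X + Y) (c + d)"
  unfolding is_spin_def
proof (intro conjI allI impI)
  show "X + Y \<in> k41" using assms by (simp add: is_spin_def k41_def cartan_inv_add)
  show "c + d \<in> chevalley ` ext_square" using assms by (simp add: is_spin_def chevalley_ext_square_closed)
  fix v u assume u: "Rep_p41 u = lie_bracket (X + Y) (Rep_p41 v)"
  have "Rep_p41 (Abs_p41 (lie_bracket Z (Rep_p41 v))) = lie_bracket Z (Rep_p41 v)" if "Z \<in> k41" for Z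
    using bracket_k_p[OF that, of v] by (intro Abs_p41_inverse) simp
  then obtain x y where xy: "Rep_p41 x = lie_bracket X (Rep_p41 v)" "Rep_p41 y = lie_bracket Y (Rep_p41 v)"
    using assms by (meson is_spin_def)
  then have "u = x + y"
    using u by (simp add: Rep_p41_inject[symmetric] plus_p41.rep_eq lie_bracket_add_left)
  moreover have "c * clifford_of v - clifford_of v * c = clifford_of x" "d * clifford_of v - clifford_of v * d = clifford_of y"
    using assms xy by (auto simp: is_spin_def)
  ultimately show "(c + d) * clifford_of v - clifford_of v * (c + d) = clifford_of u"
    by (simp add: clinear_add[OF clinear_clifford_of] algebra_simps)
qed

lemma is_spin_scaleC:
  assumes "is_spin X c"
  shows "is_spin (a *\<^sub>C X) (a *\<^sub>C c)"
  unfolding is_spin_def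
proof (intro conjI allI impI)
  show "a *\<^sub>C X \<in> k41" using assms by (simp add: is_spin_def k41_def cartan_inv_scaleC)
  show "a *\<^sub>C c \<in> chevalley ` ext_square"
    using assms chevalley_ext_square_closed(3)[of c c] by (simp add: is_spin_def)
  fix v u assume u: "Rep_p41 u = lie_bracket (a *\<^sub>C X) (Rep_p41 v)"
  have "Rep_p41 (Abs_p41 (lie_bracket X (Rep_p41 v))) = lie_bracket X (Rep_p41 v)"
    using bracket_k_p[of X v] assms by (intro Abs_p41_inverse) (simp add: is_spin_def)
  then obtain x where x: "Rep_p41 x = lie_bracket X (Rep_p41 v)" by blast
  then have "u = a *\<^sub>C x"
    using u by (simp add: Rep_p41_inject[symmetric] scaleC_p41.rep_eq lie_bracket_scaleC_left)
  moreover have "c * clifford_of v - clifford_of v * c = clifford_of x"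
    using assms x by (auto simp: is_spin_def)
  ultimately show "(a *\<^sub>C c) * clifford_of v - clifford_of v * (a *\<^sub>C c) = clifford_of u"
    by (simp add: clinear_scaleC[OF clinear_clifford_of] scaleC_mult_left scaleC_mult_right
        complex_space.scale_right_diff_distrib[symmetric])
qed

lemma bracket_p_k41: "lie_bracket (Rep_p41 v) (Rep_p41 w) \<in> k41"
  using Rep_p41[of v] Rep_p41[of w] by (simp add: k41_def cartan_inv_bracket bracket_minus)

text \<open>The commutator of the two Clifford vectors acts on x with coefficients -4 B(w, x) and 4
  B(v, x), whereas \<open>double_bracket_p\<close> has B/2 and -B/2: hence the factor -1/8.\<close>

lemma is_spin_bracket:
  "is_spin (lie_bracket (Rep_p41 v) (Rep_p41 w)) ((-1/8) *\<^sub>C (clifford_of v * clifford_of w - clifford_of w * clifford_of v))"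
  unfolding is_spin_def
proof (intro conjI allI impI bracket_p_k41)
  let ?g = clifford_of
  have "ext_of v * ext_of w \<in> ext_square"
    unfolding ext_square_def by (rule complex_space.span_base) blast
  then have "(1/2) *\<^sub>C (?g v * ?g w - ?g w * ?g v) \<in> chevalley ` ext_square"
    unfolding chevalley_pair[symmetric] by (rule imageI)
  then have "(-1/4) *\<^sub>C (1/2) *\<^sub>C (?g v * ?g w - ?g w * ?g v) \<in> chevalley ` ext_square"
    using chevalley_ext_square_closed by blast
  then show "(-1/8) *\<^sub>C (?g v * ?g w - ?g w * ?g v) \<in> chevalley ` ext_square"
    by (simp add: scaleC_scaleC)
  fix x u assume u: "Rep_p41 u = lie_bracket (lie_bracket (Rep_p41 v) (Rep_p41 w)) (Rep_p41 x)"
  then have u': "u = (bform w x / 2) *\<^sub>C v - (bform v x / 2) *\<^sub>C w"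
    unfolding double_bracket_p by (simp add: Rep_p41_inject[symmetric] minus_p41.rep_eq scaleC_p41.rep_eq)
  have rel: "?g y * ?g x = (-2 * bform y x) *\<^sub>C 1 - ?g x * ?g y" for y
    using clifford_of_relation[of y x] by (simp add: eq_diff_eq)
  have 1: "?g v * ?g w * ?g x - ?g x * (?g v * ?g w) = (-2 * bform w x) *\<^sub>C ?g v + (2 * bform v x) *\<^sub>C ?g w" for v w
  proof -
    have "?g v * ?g w * ?g x = ?g v * ((-2 * bform w x) *\<^sub>C 1 - ?g x * ?g w)"
      by (simp only: mult.assoc rel)
    also have "\<dots> = (-2 * bform w x) *\<^sub>C ?g v - (?g v * ?g x) * ?g w"
      by (simp add: right_diff_distrib scaleC_mult_right mult.assoc)
    also have "(?g v * ?g x) * ?g w = (-2 * bform v x) *\<^sub>C ?g w - ?g x * (?g v * ?g w)"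
      by (simp add: rel left_diff_distrib scaleC_mult_left mult.assoc)
    finally show ?thesis by simp
  qed
  have "(?g v * ?g w - ?g w * ?g v) * ?g x - ?g x * (?g v * ?g w - ?g w * ?g v)
     = (?g v * ?g w * ?g x - ?g x * (?g v * ?g w)) - (?g w * ?g v * ?g x - ?g x * (?g w * ?g v))"
    by (simp add: algebra_simps)
  also have "\<dots> = (-4 * bform w x) *\<^sub>C ?g v + (4 * bform v x) *\<^sub>C ?g w"
    unfolding 1 using scaleC_add_left[of "-2 * bform w x" "-2 * bform w x" "?g v"]
      scaleC_add_left[of "2 * bform v x" "2 * bform v x" "?g w"] by (simp add: algebra_simps)
  finally have 2: "(?g v * ?g w - ?g w * ?g v) * ?g x - ?g x * (?g v * ?g w - ?g w * ?g v) = \<dots>" .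
  show "((-1/8) *\<^sub>C (?g v * ?g w - ?g w * ?g v)) * ?g x - ?g x * ((-1/8) *\<^sub>C (?g v * ?g w - ?g w * ?g v)) = ?g u"
    unfolding scaleC_mult_left scaleC_mult_right complex_space.scale_right_diff_distrib[symmetric] 2 u'
    using clinear_add[OF clinear_clifford_of, of "(bform w x / 2) *\<^sub>C v" "(- bform v x / 2) *\<^sub>C w"]
    by (simp add: clinear_scaleC[OF clinear_clifford_of] scaleC_add_right scaleC_scaleC
        complex_space.scale_right_diff_distrib clinear_scaleC[OF clinear_clifford_of, of "-1", simplified])
qed

lemma is_spin_p_vec: "is_spin (lie_bracket (p_vec a b) (p_vec c d)) ((-1/8) *\<^sub>C (gam a b * gam c d - gam c d * gam a b))"
  using is_spin_bracket[of "p_basis a b" "p_basis c d"] by (simp add: Rep_p_basis gam_def)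

text \<open>Each copy of sl2 acts on one half-spin space as on its standard module and on the other
  by zero, so only matrix units of one chirality occur.\<close>

lemma spin_values:
  "is_spin E\<^sub>1 (- cmat (True, False) (True, False))" "is_spin F\<^sub>1 (cmat (True, True) (True, True))"
  "is_spin E\<^sub>2 (cmat (False, False) (False, False))" "is_spin F\<^sub>2 (- cmat (False, True) (False, True))"
  "is_spin (H\<^sub>1 + H\<^sub>2) (- (cmat (True, False) (True, True) + cmat (True, True) (True, False)))"
  "is_spin (H\<^sub>1 - H\<^sub>2) (- (cmat (False, False) (False, True) + cmat (False, True) (False, False)))"
proof -
  have half: "is_spin X c" if "is_spin (2 *\<^sub>C X) (2 *\<^sub>C c)" for X c
    using is_spin_scaleC[OF that, of "1/2"] by (simp add: scaleC_scaleC)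
  have two: "x + x = 2 *\<^sub>C x" "- x - x = - (2 *\<^sub>C x)" for x :: "'a::complex_space"
    using scaleC_add_left[of 1 1 x] scaleC_add_left[of "-1" "-1" x] by simp_all
  note simps = p_vec_def bracket_minus brackets_p brackets_p' cmat_values fock scaleC_scaleC two
    complex_space.scale_right_diff_distrib scaleC_add_right
  show "is_spin E\<^sub>1 (- cmat (True, False) (True, False))"
    by (rule half) (use is_spin_p_vec[of False False False True] in \<open>simp add: simps\<close>)
  show "is_spin F\<^sub>1 (cmat (True, True) (True, True))"
    by (rule half) (use is_spin_p_vec[of True True True False] in \<open>simp add: simps\<close>)
  show "is_spin E\<^sub>2 (cmat (False, False) (False, False))"
    by (rule half) (use is_spin_p_vec[of True False False False] in \<open>simp add: simps\<close>)
  show "is_spin F\<^sub>2 (- cmat (False, True) (False, True))"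
    by (rule half) (use is_spin_p_vec[of False True True True] in \<open>simp add: simps\<close>)
  have h1: "is_spin (2 *\<^sub>C H\<^sub>1) (num1 - num1')"
    using is_spin_p_vec[of False False True True] by (simp add: simps)
  have h2: "is_spin (2 *\<^sub>C H\<^sub>2) (num2 - num2')"
    using is_spin_p_vec[of True False False True] by (simp add: simps)
  \<comment> \<open>Multiplying by 1 = \<open>num2 + num2'\<close>, respectively 1 =
    \<open>num1 + num1'\<close>, isolates the part supported on one chirality.\<close>
  have p: "num1 - num1' + (num2 - num2') = 2 *\<^sub>C (num1 * num2 - num1' * num2')"
  proof -
    have "num1 - num1' + (num2 - num2') = (num1 - num1') * (num2 + num2') + (num1 + num1') * (num2 - num2')"
      by (simp add: num_add)
    also have "\<dots> = 2 *\<^sub>C (num1 * num2 - num1' * num2')"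
      using scaleC_add_left[of 1 1 "num1 * num2 - num1' * num2'"] by (simp add: algebra_simps)
    finally show ?thesis .
  qed
  have m: "num1 - num1' - (num2 - num2') = 2 *\<^sub>C (num1 * num2' - num1' * num2)"
  proof -
    have "num1 - num1' - (num2 - num2') = (num1 - num1') * (num2 + num2') - (num1 + num1') * (num2 - num2')"
      by (simp add: num_add)
    also have "\<dots> = 2 *\<^sub>C (num1 * num2' - num1' * num2)"
      using scaleC_add_left[of 1 1 "num1 * num2' - num1' * num2"] by (simp add: algebra_simps)
    finally show ?thesis .
  qed
  have m': "num1 - num1' + (num2' - num2) = 2 *\<^sub>C (num1 * num2') - 2 *\<^sub>C (num1' * num2)"
  proof -
    have "num1 - num1' + (num2' - num2) = num1 - num1' - (num2 - num2')" by simp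
    then show ?thesis unfolding m complex_space.scale_right_diff_distrib .
  qed
  show "is_spin (H\<^sub>1 + H\<^sub>2) (- (cmat (True, False) (True, True) + cmat (True, True) (True, False)))"
    by (rule half) (use is_spin_add[OF h1 h2] in \<open>simp add: p cmat_values scaleC_add_right\<close>)
  show "is_spin (H\<^sub>1 - H\<^sub>2) (- (cmat (False, False) (False, True) + cmat (False, True) (False, False)))"
    by (rule half) (use is_spin_add[OF h1 is_spin_scaleC[OF h2, of "-1"]] in
      \<open>simp add: m' cmat_values complex_space.scale_right_diff_distrib\<close>)
qed

lemma k_Dirac_cmat: "k_Dirac =
   2 *\<^sub>C (uea_of E\<^sub>1 \<otimes>\<^sub>C cmat (True, True) (True, True)) - 2 *\<^sub>C (uea_of F\<^sub>1 \<otimes>\<^sub>C cmat (True, False) (True, False))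
   - uea_of (H\<^sub>1 + H\<^sub>2) \<otimes>\<^sub>C (cmat (True, False) (True, True) + cmat (True, True) (True, False))
   - 2 *\<^sub>C (uea_of E\<^sub>2 \<otimes>\<^sub>C cmat (False, True) (False, True)) + 2 *\<^sub>C (uea_of F\<^sub>2 \<otimes>\<^sub>C cmat (False, False) (False, False))
   - uea_of (H\<^sub>1 - H\<^sub>2) \<otimes>\<^sub>C (cmat (False, False) (False, True) + cmat (False, True) (False, False))"
proof -
  have "spin_map (2 *\<^sub>C X) = 2 *\<^sub>C c" if "is_spin X c" for X c
    by (rule spin_map_eqI[OF is_spin_scaleC[OF that]])
  note s = spin_values(1-4)[THEN this] spin_values(5,6)[THEN spin_map_eqI]
  show ?thesis
    unfolding k_Dirac_def s
    by (simp add: tensor_scaleC_right tensor_minus tensor_add_right tensor_diff_right algebra_simps)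
qed

section \<open>The element that attaches a letter to the Clifford factor\<close>

definition flip :: "spinor \<Rightarrow> spinor" where "flip \<alpha> = (fst \<alpha>, \<not> snd \<alpha>)"

definition spin_sgn :: "spinor \<Rightarrow> complex" where "spin_sgn \<alpha> = (if snd \<alpha> then - 1 else 1)"

text \<open>Both indices of a letter are paired with both indices of a matrix unit;
  \<open>flip\<close> and \<open>spin_sgn\<close> raise an index by the symplectic form.\<close>

definition gen_X :: UC41 where
  "gen_X = (\<Sum>\<alpha>\<in>UNIV. \<Sum>\<beta>\<in>UNIV. (spin_sgn \<alpha> * spin_sgn \<beta>) *\<^sub>C (uea_of (letter_vec \<alpha> \<beta>) \<otimes>\<^sub>C cmat (flip \<alpha>) (flip \<beta>)))"

lemma uea_of_minus: "uea_of (- x) = - uea_of x"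
  using clinear_scaleC[OF clinear_uea_of, of "-1" x] by simp

lemma uea_of_diff: "uea_of (x - y) = uea_of x - uea_of y"
  using clinear_add[OF clinear_uea_of, of x "- y"] by (simp add: uea_of_minus)

text \<open>Indices of equal chirality give the multiple of D_k and mixed ones give D, cut into its
  two chiral halves. The weights 1 and 1/8 of the halves reflect the uneven normalisation of
  \<open>cmat\<close>.\<close>

lemma gen_X_eq: "gen_X = 2 *\<^sub>C k_Dirac + Dirac * (1 \<otimes>\<^sub>C chir_proj False) + (1/8) *\<^sub>C (Dirac * (1 \<otimes>\<^sub>C chir_proj True))"
proof -
  have g: "clifford_of (Abs_p41 E\<^sub>3) = gam False False" "clifford_of (Abs_p41 E\<^sub>4) = gam False True"
    "clifford_of (Abs_p41 F\<^sub>3) = gam True True" "clifford_of (Abs_p41 F\<^sub>4) = - gam True False"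
  proof -
    show "clifford_of (Abs_p41 F\<^sub>4) = - gam True False"
      using clinear_scaleC[OF clinear_clifford_of, of "-1" "Abs_p41 F\<^sub>4"] by (simp add: gam_def p_basis_Abs)
  qed (simp_all add: gam_def p_basis_Abs)
  have c: "gam a b * chir_proj False = cmat (True, a) (False, b)" "(1/8) *\<^sub>C (gam a b * chir_proj True) = cmat (False, b) (True, a)" for a b
    by (simp_all add: cmat_def)
  have 1: "Dirac * (1 \<otimes>\<^sub>C chir_proj False) = uea_of E\<^sub>3 \<otimes>\<^sub>C cmat (True, True) (False, True) - uea_of E\<^sub>4 \<otimes>\<^sub>C cmat (True, True) (False, False)
      + uea_of F\<^sub>3 \<otimes>\<^sub>C cmat (True, False) (False, False) + uea_of F\<^sub>4 \<otimes>\<^sub>C cmat (True, False) (False, True)"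
    by (simp add: Dirac_def g distrib_right tensor_mult c tensor_minus left_diff_distrib)
  have 2: "(1/8) *\<^sub>C (Dirac * (1 \<otimes>\<^sub>C chir_proj True)) = uea_of E\<^sub>3 \<otimes>\<^sub>C cmat (False, True) (True, True) - uea_of E\<^sub>4 \<otimes>\<^sub>C cmat (False, False) (True, True)
      + uea_of F\<^sub>3 \<otimes>\<^sub>C cmat (False, False) (True, False) + uea_of F\<^sub>4 \<otimes>\<^sub>C cmat (False, True) (True, False)"
    by (simp add: Dirac_def g distrib_right tensor_mult tensor_minus left_diff_distrib scaleC_add_right
        complex_space.scale_right_diff_distrib tensor_scaleC_right[symmetric] c del: complex_space.scale_left_commute)
  show ?thesis
    unfolding gen_X_def k_Dirac_cmat sum_spinor 1 2
    by (simp add: spin_sgn_def flip_def letter_vec_values p_vec_def uea_of_minus tensor_minus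
      clinear_scaleC[OF clinear_uea_of] clinear_add[OF clinear_uea_of] uea_of_diff
      tensor_add_left tensor_diff_left tensor_scaleC_left scaleC_add_right complex_space.scale_right_diff_distrib
      scaleC_scaleC tensor_add_right algebra_simps)
qed

lemma chir_proj_cmat_mult: "chir_proj c * cmat \<alpha> \<beta> = (if fst \<alpha> = c then cmat \<alpha> \<beta> else 0)"
  by (cases \<alpha>; cases "snd \<alpha>") (auto simp: chir_proj_cmat left_diff_distrib cmat_mult spin_form_def eps_def)

text \<open>The left index \<gamma> of the Clifford factor becomes the second index of a new letter,
  whose first index is paired with the new left index. The projection selects the chirality of that
  pairing.\<close>

lemma gen_X_apply:
  "(1 \<otimes>\<^sub>C chir_proj c) * gen_X * (u \<otimes>\<^sub>C cmat \<gamma> \<delta>) =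
    (\<Sum>\<alpha>\<in>UNIV. \<Sum>\<beta>\<in>UNIV. half_form c \<alpha> \<beta> *\<^sub>C ((uea_of (letter_vec \<beta> \<gamma>) * u) \<otimes>\<^sub>C cmat \<alpha> \<delta>))"
proof -
  define T where "T \<alpha> \<beta> = (uea_of (letter_vec \<beta> \<gamma>) * u) \<otimes>\<^sub>C cmat \<alpha> \<delta>" for \<alpha> \<beta>
  have 1: "(1 \<otimes>\<^sub>C chir_proj c) * (uea_of (letter_vec \<alpha> \<beta>) \<otimes>\<^sub>C cmat (flip \<alpha>) (flip \<beta>)) * (u \<otimes>\<^sub>C cmat \<gamma> \<delta>)
     = ((if fst \<alpha> = c then 1 else 0) * spin_form (flip \<beta>) \<gamma>) *\<^sub>C T (flip \<alpha>) \<alpha>" if "spin_form (flip \<beta>) \<gamma> \<noteq> 0 \<longrightarrow> \<beta> = \<gamma>" for \<alpha> \<beta>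
    using that
    by (auto simp: tensor_mult chir_proj_cmat_mult cmat_mult tensor_scaleC_right T_def tensor_zero flip_def)
  have 2: "spin_form (flip \<beta>) \<gamma> = (if \<beta> = \<gamma> then - spin_sgn \<gamma> else 0)" for \<beta>
    by (cases \<beta>; cases \<gamma>) (auto simp: spin_form_def flip_def eps_def spin_sgn_def)
  have "(1 \<otimes>\<^sub>C chir_proj c) * gen_X * (u \<otimes>\<^sub>C cmat \<gamma> \<delta>) =
    (\<Sum>\<alpha>\<in>UNIV. \<Sum>\<beta>\<in>UNIV. (spin_sgn \<alpha> * spin_sgn \<beta>) *\<^sub>C
      ((1 \<otimes>\<^sub>C chir_proj c) * (uea_of (letter_vec \<alpha> \<beta>) \<otimes>\<^sub>C cmat (flip \<alpha>) (flip \<beta>)) * (u \<otimes>\<^sub>C cmat \<gamma> \<delta>)))"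
    by (simp add: gen_X_def sum_distrib_left sum_distrib_right scaleC_mult_left scaleC_mult_right)
  also have "\<dots> = (\<Sum>\<alpha>\<in>UNIV. \<Sum>\<beta>\<in>UNIV. (spin_sgn \<alpha> * spin_sgn \<beta> * ((if fst \<alpha> = c then 1 else 0) * spin_form (flip \<beta>) \<gamma>)) *\<^sub>C T (flip \<alpha>) \<alpha>)"
    by (intro sum.cong refl) (subst 1, auto simp: 2 scaleC_scaleC)
  also have "\<dots> = (\<Sum>\<alpha>\<in>UNIV. (if fst \<alpha> = c then - spin_sgn \<alpha> else 0) *\<^sub>C T (flip \<alpha>) \<alpha>)"
  proof (rule sum.cong[OF refl])
    fix \<alpha>
    have "(\<Sum>\<beta>\<in>UNIV. (spin_sgn \<alpha> * spin_sgn \<beta> * ((if fst \<alpha> = c then 1 else 0) * spin_form (flip \<beta>) \<gamma>)) *\<^sub>C T (flip \<alpha>) \<alpha>)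
      = (\<Sum>\<beta>\<in>UNIV. if \<beta> = \<gamma> then (spin_sgn \<alpha> * spin_sgn \<gamma> * ((if fst \<alpha> = c then 1 else 0) * - spin_sgn \<gamma>)) *\<^sub>C T (flip \<alpha>) \<alpha> else 0)"
      by (rule sum.cong) (auto simp: 2)
    then show "(\<Sum>\<beta>\<in>UNIV. (spin_sgn \<alpha> * spin_sgn \<beta> * ((if fst \<alpha> = c then 1 else 0) * spin_form (flip \<beta>) \<gamma>)) *\<^sub>C T (flip \<alpha>) \<alpha>)
      = (if fst \<alpha> = c then - spin_sgn \<alpha> else 0) *\<^sub>C T (flip \<alpha>) \<alpha>"
      by (simp add: spin_sgn_def)
  qed
  also have "\<dots> = (\<Sum>\<alpha>\<in>UNIV. \<Sum>\<beta>\<in>UNIV. half_form c \<alpha> \<beta> *\<^sub>C T \<alpha> \<beta>)"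
    by (cases c) (simp_all add: sum_spinor half_form_def eps_def flip_def spin_sgn_def)
  finally show ?thesis by (simp add: T_def)
qed

section \<open>Contractions of invariant tensors\<close>

text \<open>The symmetrizations of \<open>a\<^sub>1\<close> and \<open>a\<^sub>2\<close>: the term 4
  E F becomes 2 (E F + F E).\<close>

definition casimir :: "bool \<Rightarrow> so41C uea" where
  "casimir c = (if c
     then uea_of (H\<^sub>1 + H\<^sub>2) * uea_of (H\<^sub>1 + H\<^sub>2) + 2 *\<^sub>C (uea_of E\<^sub>1 * uea_of F\<^sub>1 + uea_of F\<^sub>1 * uea_of E\<^sub>1)
     else uea_of (H\<^sub>1 - H\<^sub>2) * uea_of (H\<^sub>1 - H\<^sub>2) + 2 *\<^sub>C (uea_of E\<^sub>2 * uea_of F\<^sub>2 + uea_of F\<^sub>2 * uea_of E\<^sub>2))"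

lemma uea_filt_scaleC: "x \<in> uea_filt n \<Longrightarrow> c *\<^sub>C x \<in> uea_filt n"
  unfolding uea_filt_def by (rule complex_space.span_scale)

lemma uea_commutator_filt: "uea_of x * uea_of y - uea_of y * uea_of x \<in> uea_filt 2"
  unfolding uea_of_bracket using uea_filt_base[of "[lie_bracket x y]" 2] by simp

text \<open>Letters of one chirality form a trace-free two by two matrix. With commuting entries its
  square would be scalar, by Cayley-Hamilton; here a multiple of one commutator is left over, which
  is a single letter. The factor -4 comes from the multiples 4, -4 and 2 in
  \<open>letter_vec_values\<close>.\<close>

lemma pair_contraction:
  assumes "fst \<alpha> = c" "fst \<delta> = c"
  shows "(\<Sum>\<beta>\<in>UNIV. \<Sum>\<gamma>\<in>UNIV. half_form c \<beta> \<gamma> *\<^sub>C (uea_of (letter_vec \<alpha> \<beta>) * uea_of (letter_vec \<gamma> \<delta>)))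
     - (-4 * half_form c \<alpha> \<delta>) *\<^sub>C casimir c \<in> uea_filt 2" (is "?S - ?C \<in> _")
proof -
  have pair: "k *\<^sub>C (uea_of x * uea_of y - uea_of y * uea_of x) \<in> uea_filt 2" for k x y
    by (rule uea_filt_scaleC[OF uea_commutator_filt])
  have four: "8 *\<^sub>C x + 8 *\<^sub>C x = 16 *\<^sub>C x" for x :: "so41C uea"
    using scaleC_add_left[of 8 8 x] by simp
  define h1 h2 where h: "h1 = H\<^sub>1 + H\<^sub>2" "h2 = H\<^sub>1 - H\<^sub>2"
  note simps = sum_spinor half_form_def eps_def letter_vec_values[folded h] casimir_def[folded h] clinear_scaleC[OF clinear_uea_of]
      uea_of_minus scaleC_mult_left scaleC_mult_right scaleC_scaleC scaleC_add_right complex_space.scale_right_diff_distrib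
  obtain a d where ad: "\<alpha> = (c, a)" "\<delta> = (c, d)" using assms by (cases \<alpha>; cases \<delta>) auto
  have "\<exists>k x y. ?S - ?C = k *\<^sub>C (uea_of x * uea_of y - uea_of y * uea_of x)"
  proof (cases c)
    case True
    let ?h = h1
    consider "\<not> a \<and> \<not> d" | "\<not> a \<and> d" | "a \<and> \<not> d" | "a \<and> d" by blast
    then show ?thesis
    proof cases
      case 1
      have "?S - ?C = 8 *\<^sub>C (uea_of E\<^sub>1 * uea_of ?h - uea_of ?h * uea_of E\<^sub>1)"
        using 1 True by (simp add: ad simps)
      then show ?thesis by blast
    next
      case 2
      have "?S - ?C = (-8) *\<^sub>C (uea_of E\<^sub>1 * uea_of F\<^sub>1 - uea_of F\<^sub>1 * uea_of E\<^sub>1)"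
        using 2 True by (simp add: ad simps four[symmetric])
      then show ?thesis by blast
    next
      case 3
      have "?S - ?C = (-8) *\<^sub>C (uea_of E\<^sub>1 * uea_of F\<^sub>1 - uea_of F\<^sub>1 * uea_of E\<^sub>1)"
        using 3 True by (simp add: ad simps four[symmetric])
      then show ?thesis by blast
    next
      case 4
      have "?S - ?C = 8 *\<^sub>C (uea_of F\<^sub>1 * uea_of ?h - uea_of ?h * uea_of F\<^sub>1)"
        using 4 True by (simp add: ad simps)
      then show ?thesis by blast
    qed
  next
    case False
    let ?h = h2
    consider "\<not> a \<and> \<not> d" | "\<not> a \<and> d" | "a \<and> \<not> d" | "a \<and> d" by blast
    then show ?thesis
    proof cases
      case 1
      have "?S - ?C = (-8) *\<^sub>C (uea_of E\<^sub>2 * uea_of ?h - uea_of ?h * uea_of E\<^sub>2)"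
        using 1 False by (simp add: ad simps)
      then show ?thesis by blast
    next
      case 2
      have "?S - ?C = (-8) *\<^sub>C (uea_of E\<^sub>2 * uea_of F\<^sub>2 - uea_of F\<^sub>2 * uea_of E\<^sub>2)"
        using 2 False by (simp add: ad simps four[symmetric])
      then show ?thesis by blast
    next
      case 3
      have "?S - ?C = (-8) *\<^sub>C (uea_of E\<^sub>2 * uea_of F\<^sub>2 - uea_of F\<^sub>2 * uea_of E\<^sub>2)"
        using 3 False by (simp add: ad simps four[symmetric])
      then show ?thesis by blast
    next
      case 4
      have "?S - ?C = (-8) *\<^sub>C (uea_of F\<^sub>2 * uea_of ?h - uea_of ?h * uea_of F\<^sub>2)"
        using 4 False by (simp add: ad simps)
      then show ?thesis by blast
    qed
  qed
  then show ?thesis using pair by auto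
qed

section \<open>Tensors contracted against letters and a Clifford factor\<close>

definition slot_list :: "(nat \<times> nat) list \<Rightarrow> nat list" where
  "slot_list ls = concat (map (\<lambda>(p, q). [p, q]) ls)"

lemma slot_list_simps [simp]:
  "slot_list [] = []" "slot_list ((p, q) # ls) = p # q # slot_list ls"
  "slot_list (ls @ ms) = slot_list ls @ slot_list ms"
  by (simp_all add: slot_list_def)

definition monomial :: "(nat \<times> nat) list \<Rightarrow> (nat \<Rightarrow> spinor) \<Rightarrow> so41C uea" where
  "monomial ls w = prod_list (map uea_of (map (\<lambda>(p, q). letter_vec (w p) (w q)) ls))"

lemma monomial_Nil [simp]: "monomial [] w = 1"
  by (simp add: monomial_def)

lemma monomial_Cons [simp]: "monomial ((p, q) # ls) w = uea_of (letter_vec (w p) (w q)) * monomial ls w"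
  by (simp add: monomial_def)

lemma monomial_upd: "i \<notin> set (slot_list ls) \<Longrightarrow> monomial ls (w(i := \<alpha>)) = monomial ls w"
  by (induction ls) auto

text \<open>The image of the tensor t in the algebra: p and q hold the indices of the Clifford
  factor, and each pair in ls those of one letter.\<close>

definition contraction :: "nat \<Rightarrow> nat \<Rightarrow> (nat \<times> nat) list \<Rightarrow> ((nat \<Rightarrow> spinor) \<Rightarrow> complex) \<Rightarrow> UC41" where
  "contraction p q ls t = (\<Sum>w\<in>assignments (insert p (insert q (set (slot_list ls)))).
     t w *\<^sub>C (monomial ls w \<otimes>\<^sub>C cmat (w p) (w q)))"

lemma contraction_linear:
  "contraction p q ls (\<lambda>w. t w + u w) = contraction p q ls t + contraction p q ls u"
  "contraction p q ls (\<lambda>w. t w - u w) = contraction p q ls t - contraction p q ls u"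
  "contraction p q ls (\<lambda>w. a * t w) = a *\<^sub>C contraction p q ls t"
  by (simp_all add: contraction_def scaleC_add_left complex_space.scale_left_diff_distrib sum.distrib
      sum_subtractf scaleC_scaleC complex_space.scale_sum_right)

lemma contraction_sum:
  "contraction p q ls (\<lambda>w. \<Sum>i\<in>A. t i w) = (\<Sum>i\<in>A. contraction p q ls (t i))"
proof -
  have "contraction p q ls (\<lambda>w. 0) = 0" by (simp add: contraction_def)
  then show ?thesis
    by (induction A rule: infinite_finite_induct) (simp_all add: contraction_linear)
qed

lemma contraction_mset:
  assumes "mset ls = mset ms"
  shows "contraction p q ls t - contraction p q ms t \<in> tensor_filt (length ls)"
proof -
  have set: "set (slot_list ls) = set (slot_list ms)"
    using mset_eq_setD[OF assms] by (simp add: slot_list_def)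
  have "monomial ls w - monomial ms w \<in> uea_filt (length ls)" for w
    using uea_prod_mset_eq[of "map (\<lambda>(p, q). letter_vec (w p) (w q)) ls" "map (\<lambda>(p, q). letter_vec (w p) (w q)) ms"]
    using assms by (simp add: monomial_def)
  then have "(\<Sum>w\<in>assignments (insert p (insert q (set (slot_list ls)))).
     t w *\<^sub>C ((monomial ls w - monomial ms w) \<otimes>\<^sub>C cmat (w p) (w q))) \<in> tensor_filt (length ls)"
    by (intro tensor_filt_sum tensor_filt_closed tensor_filt_base)
  then show ?thesis
    by (simp add: contraction_def set tensor_diff_left complex_space.scale_right_diff_distrib sum_subtractf)
qed

lemma contraction_flip: "contraction p q (pre @ (a, b) # ls) t = contraction p q (pre @ (b, a) # ls) t"
proof -
  have "set (slot_list (pre @ (a, b) # ls)) = set (slot_list (pre @ (b, a) # ls))" by auto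
  moreover have "monomial (pre @ (a, b) # ls) w = monomial (pre @ (b, a) # ls) w" for w
    by (simp add: monomial_def letter_vec_sym[of "w a"])
  ultimately show ?thesis by (simp only: contraction_def)
qed

text \<open>Letters commute modulo lower degree and are symmetric in their indices, so any slot may
  be taken as first index of the first letter. The prefix \<open>pre\<close> keeps a letter in place
  that was already moved to the front.\<close>

lemma slot_to_front:
  assumes "j \<in> set (slot_list ls)"
  obtains s ms where "length ls = Suc (length ms)"
    and "mset (slot_list ls) = mset (slot_list ((j, s) # ms))"
    and "\<And>p q pre t. contraction p q (pre @ ls) t - contraction p q (pre @ (j, s) # ms) t \<in> tensor_filt (length (pre @ ls))"
proof -
  obtain a b where ab: "(a, b) \<in> set ls" "j = a \<or> j = b" using assms by (auto simp: slot_list_def)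
  obtain us vs where ls: "ls = us @ (a, b) # vs" using ab(1) by (meson split_list)
  define s where "s = (if j = a then b else a)"
  have js: "(a, b) = (j, s) \<or> (a, b) = (s, j)" using ab(2) by (auto simp: s_def)
  show ?thesis
  proof (rule that[of "us @ vs" s])
    show "length ls = Suc (length (us @ vs))" by (simp add: ls)
    show "mset (slot_list ls) = mset (slot_list ((j, s) # us @ vs))"
      using js by (auto simp: ls)
    show "contraction p q (pre @ ls) t - contraction p q (pre @ (j, s) # us @ vs) t \<in> tensor_filt (length (pre @ ls))" for p q pre t
    proof -
      have "mset (pre @ ls) = mset (pre @ (a, b) # us @ vs)" by (simp add: ls)
      moreover have "contraction p q (pre @ (a, b) # us @ vs) t = contraction p q (pre @ (j, s) # us @ vs) t"
        using js contraction_flip[of p q pre s j] by auto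
      ultimately show ?thesis using contraction_mset[of "pre @ ls" "pre @ (a, b) # us @ vs" p q t] by simp
    qed
  qed
qed

definition indep :: "((nat \<Rightarrow> spinor) \<Rightarrow> complex) \<Rightarrow> nat \<Rightarrow> bool" where
  "indep t i \<longleftrightarrow> (\<forall>w x. t (w(i := x)) = t w)"

text \<open>\<open>gen_X_apply\<close> read backwards. The identity is exact: once the letter stands
  in front, no lower terms arise, and the other slot s of that letter takes over as Clifford
  index.\<close>

lemma contraction_open:
  assumes d: "distinct (p # q # slot_list ((j, s) # ls))" and \<tau>: "indep \<tau> p" "indep \<tau> j"
  shows "contraction p q ((j, s) # ls) (\<lambda>w. half_form c (w p) (w j) * \<tau> w) =
    (1 \<otimes>\<^sub>C chir_proj c) * gen_X * contraction s q ls \<tau>"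
proof -
  let ?J = "insert s (insert q (set (slot_list ls)))"
  have I: "insert p (insert q (set (slot_list ((j, s) # ls)))) = insert p (insert j ?J)" by auto
  have notin: "p \<notin> insert j ?J" "j \<notin> ?J" using d by auto
  have "contraction p q ((j, s) # ls) (\<lambda>w. half_form c (w p) (w j) * \<tau> w) =
    (\<Sum>\<alpha>\<in>UNIV. \<Sum>\<beta>\<in>UNIV. \<Sum>w\<in>assignments ?J. (half_form c \<alpha> \<beta> * \<tau> w) *\<^sub>C
        ((uea_of (letter_vec \<beta> (w s)) * monomial ls w) \<otimes>\<^sub>C cmat \<alpha> (w q)))"
    unfolding contraction_def I sum_assignments_insert[OF notin(1)] sum_assignments_insert[OF notin(2)]
    using d \<tau> by (intro sum.cong refl) (auto simp: indep_def monomial_upd)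
  also have "\<dots> = (\<Sum>w\<in>assignments ?J. \<Sum>\<alpha>\<in>UNIV. \<Sum>\<beta>\<in>UNIV. (half_form c \<alpha> \<beta> * \<tau> w) *\<^sub>C
        ((uea_of (letter_vec \<beta> (w s)) * monomial ls w) \<otimes>\<^sub>C cmat \<alpha> (w q)))"
    by (simp only: sum.swap[of _ "assignments ?J"])
  also have "\<dots> = (\<Sum>w\<in>assignments ?J. \<tau> w *\<^sub>C ((1 \<otimes>\<^sub>C chir_proj c) * gen_X * (monomial ls w \<otimes>\<^sub>C cmat (w s) (w q))))"
    unfolding gen_X_apply complex_space.scale_sum_right scaleC_scaleC by (simp add: mult.commute)
  also have "\<dots> = (1 \<otimes>\<^sub>C chir_proj c) * gen_X * contraction s q ls \<tau>"
    unfolding contraction_def by (simp add: sum_distrib_left scaleC_mult_right)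
  finally show ?thesis .
qed

text \<open>The symplectic form is antisymmetric while the letter is symmetric in its
  indices.\<close>

lemma contraction_self:
  assumes d: "distinct (p # q # slot_list ((r, s) # ls))" and \<tau>: "indep \<tau> r" "indep \<tau> s"
  shows "contraction p q ((r, s) # ls) (\<lambda>w. half_form c (w s) (w r) * \<tau> w) = 0"
proof -
  let ?J = "insert p (insert q (set (slot_list ls)))"
  have I: "insert p (insert q (set (slot_list ((r, s) # ls)))) = insert s (insert r ?J)" by auto
  have notin: "s \<notin> insert r ?J" "r \<notin> ?J" using d by auto
  have "contraction p q ((r, s) # ls) (\<lambda>w. half_form c (w s) (w r) * \<tau> w) =
    (\<Sum>\<alpha>\<in>UNIV. \<Sum>\<beta>\<in>UNIV. \<Sum>w\<in>assignments ?J. (half_form c \<alpha> \<beta> * \<tau> w) *\<^sub>C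
        ((uea_of (letter_vec \<beta> \<alpha>) * monomial ls w) \<otimes>\<^sub>C cmat (w p) (w q)))"
    unfolding contraction_def I sum_assignments_insert[OF notin(1)] sum_assignments_insert[OF notin(2)]
    using d \<tau> by (intro sum.cong refl) (auto simp: indep_def monomial_upd)
  also have "\<dots> = (\<Sum>w\<in>assignments ?J. \<Sum>\<alpha>\<in>UNIV. \<Sum>\<beta>\<in>UNIV. (half_form c \<alpha> \<beta> * \<tau> w) *\<^sub>C
        ((uea_of (letter_vec \<beta> \<alpha>) * monomial ls w) \<otimes>\<^sub>C cmat (w p) (w q)))"
    by (simp only: sum.swap[of _ "assignments ?J"])
  also have "\<dots> = 0"
    by (rule sum.neutral)
      (cases c; simp add: sum_spinor half_form_def eps_def letter_vec_values)
  finally show ?thesis .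
qed

lemma uea_filt_mult_prod:
  assumes "u \<in> uea_filt m"
  shows "u * prod_list (map uea_of ys) \<in> uea_filt (m + length ys)"
  using assms unfolding uea_filt_def
proof (rule clinear_span_image[rotated -1])
  fix u :: "'a uea"
  show "u * prod_list (map uea_of ys) \<in> cspan {prod_list (map uea_of xs) |xs. length xs < m + length ys}"
    if "u \<in> {prod_list (map uea_of xs) |xs. length xs < m}"
  proof -
    from that obtain xs where "u = prod_list (map uea_of xs)" "length xs < m" by auto
    then show ?thesis by (intro complex_space.span_base CollectI exI[of _ "xs @ ys"]) simp
  qed
qed (intro clinear_intros)

text \<open>Apply \<open>pair_contraction\<close> to the two letters; the form it leaves on r and u
  contracts \<tau> there. The condition on the support is essential: letters with indices of both
  chiralities lie in p, and their product does not reduce to a Casimir element.\<close>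

lemma contraction_pair:
  assumes d: "distinct (p # q # slot_list ((r, s) # (j, u) # ls))" and \<tau>: "indep \<tau> s" "indep \<tau> j"
    and supp: "\<And>w. \<tau> w \<noteq> 0 \<Longrightarrow> fst (w r) = c \<and> fst (w u) = c"
  shows "contraction p q ((r, s) # (j, u) # ls) (\<lambda>w. half_form c (w s) (w j) * \<tau> w)
     - (-4) *\<^sub>C ((casimir c \<otimes>\<^sub>C 1) * contraction p q ls (contract c r u \<tau>)) \<in> tensor_filt (Suc (Suc (length ls)))"
proof -
  let ?J = "insert p (insert q (set (slot_list ls)))"
  let ?K = "insert r (insert u ?J)"
  let ?S = "\<lambda>w. \<Sum>\<beta>\<in>UNIV. \<Sum>\<gamma>\<in>UNIV. half_form c \<beta> \<gamma> *\<^sub>C (uea_of (letter_vec (w r) \<beta>) * uea_of (letter_vec \<gamma> (w u)))"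
  let ?C = "\<lambda>w. (-4 * half_form c (w r) (w u)) *\<^sub>C casimir c"
  have I: "insert p (insert q (set (slot_list ((r, s) # (j, u) # ls)))) = insert s (insert j ?K)" by auto
  have notin: "s \<notin> insert j ?K" "j \<notin> ?K" "r \<notin> insert u ?J" "u \<notin> ?J" using d by auto
  have "contraction p q ((r, s) # (j, u) # ls) (\<lambda>w. half_form c (w s) (w j) * \<tau> w) =
    (\<Sum>\<beta>\<in>UNIV. \<Sum>\<gamma>\<in>UNIV. \<Sum>w\<in>assignments ?K. (half_form c \<beta> \<gamma> * \<tau> w) *\<^sub>C
        ((uea_of (letter_vec (w r) \<beta>) * (uea_of (letter_vec \<gamma> (w u)) * monomial ls w)) \<otimes>\<^sub>C cmat (w p) (w q)))"
    unfolding contraction_def I sum_assignments_insert[OF notin(1)] sum_assignments_insert[OF notin(2)]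
    using d \<tau> by (intro sum.cong refl) (auto simp: indep_def monomial_upd)
  also have "\<dots> = (\<Sum>w\<in>assignments ?K. \<Sum>\<beta>\<in>UNIV. \<Sum>\<gamma>\<in>UNIV. (half_form c \<beta> \<gamma> * \<tau> w) *\<^sub>C
        ((uea_of (letter_vec (w r) \<beta>) * (uea_of (letter_vec \<gamma> (w u)) * monomial ls w)) \<otimes>\<^sub>C cmat (w p) (w q)))"
    by (simp only: sum.swap[of _ "assignments ?K"])
  also have "\<dots> = (\<Sum>w\<in>assignments ?K. \<tau> w *\<^sub>C ((?S w * monomial ls w) \<otimes>\<^sub>C cmat (w p) (w q)))"
  proof (rule sum.cong[OF refl])
    fix w
    have lin: "clinear (\<lambda>x. \<tau> w *\<^sub>C ((x * monomial ls w) \<otimes>\<^sub>C cmat (w p) (w q)))"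
      by (intro clinear_intros)
    show "(\<Sum>\<beta>\<in>UNIV. \<Sum>\<gamma>\<in>UNIV. (half_form c \<beta> \<gamma> * \<tau> w) *\<^sub>C
        ((uea_of (letter_vec (w r) \<beta>) * (uea_of (letter_vec \<gamma> (w u)) * monomial ls w)) \<otimes>\<^sub>C cmat (w p) (w q)))
      = \<tau> w *\<^sub>C ((?S w * monomial ls w) \<otimes>\<^sub>C cmat (w p) (w q))"
      by (simp add: clinear_sum[OF lin] clinear_scaleC[OF lin] scaleC_mult_left tensor_scaleC_left scaleC_scaleC mult.assoc mult.commute[of "\<tau> w"])
  qed
  finally have 1: "contraction p q ((r, s) # (j, u) # ls) (\<lambda>w. half_form c (w s) (w j) * \<tau> w) = \<dots>" .
  have "(\<Sum>w\<in>assignments ?K. \<tau> w *\<^sub>C ((?C w * monomial ls w) \<otimes>\<^sub>C cmat (w p) (w q))) =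
     (\<Sum>\<alpha>\<in>UNIV. \<Sum>\<delta>\<in>UNIV. \<Sum>w\<in>assignments ?J. (\<tau> (w(u := \<delta>, r := \<alpha>)) * (-4 * half_form c \<alpha> \<delta>)) *\<^sub>C
        ((casimir c * monomial ls w) \<otimes>\<^sub>C cmat (w p) (w q)))"
    unfolding sum_assignments_insert[OF notin(3)] sum_assignments_insert[OF notin(4)]
    using d by (intro sum.cong refl) (auto simp: monomial_upd tensor_scaleC_left tensor_minus scaleC_mult_left scaleC_scaleC)
  also have "\<dots> = (\<Sum>w\<in>assignments ?J. (-4 * (\<Sum>\<alpha>\<in>UNIV. \<Sum>\<delta>\<in>UNIV. half_form c \<alpha> \<delta> * \<tau> (w(u := \<delta>, r := \<alpha>)))) *\<^sub>C
        ((casimir c * monomial ls w) \<otimes>\<^sub>C cmat (w p) (w q)))"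
    by (simp only: sum.swap[of _ "assignments ?J"] complex_space.scale_sum_left[symmetric] sum_distrib_left)
      (simp only: mult.commute mult.left_commute)
  also have "\<dots> = (\<Sum>w\<in>assignments ?J. (-4 * contract c r u \<tau> w) *\<^sub>C ((casimir c \<otimes>\<^sub>C 1) * (monomial ls w \<otimes>\<^sub>C cmat (w p) (w q))))"
  proof (rule sum.cong[OF refl])
    fix w :: "nat \<Rightarrow> spinor"
    have "w(u := x, r := y) = w(r := y, u := x)" for x y
      by (rule fun_upd_twist) (use d in auto)
    then have "(\<Sum>\<alpha>\<in>UNIV. \<Sum>\<delta>\<in>UNIV. half_form c \<alpha> \<delta> * \<tau> (w(u := \<delta>, r := \<alpha>))) = contract c r u \<tau> w"
      by (cases c) (simp_all add: sum_spinor half_form_def eps_def contract_def)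
    then show "(-4 * (\<Sum>\<alpha>\<in>UNIV. \<Sum>\<delta>\<in>UNIV. half_form c \<alpha> \<delta> * \<tau> (w(u := \<delta>, r := \<alpha>)))) *\<^sub>C
        ((casimir c * monomial ls w) \<otimes>\<^sub>C cmat (w p) (w q))
      = (-4 * contract c r u \<tau> w) *\<^sub>C ((casimir c \<otimes>\<^sub>C 1) * (monomial ls w \<otimes>\<^sub>C cmat (w p) (w q)))"
      by (simp add: tensor_mult)
  qed
  also have "\<dots> = (-4) *\<^sub>C ((casimir c \<otimes>\<^sub>C 1) * contraction p q ls (contract c r u \<tau>))"
    unfolding contraction_def sum_distrib_left complex_space.scale_sum_right
    by (simp add: scaleC_mult_right scaleC_scaleC)
  finally have 2: "(\<Sum>w\<in>assignments ?K. \<tau> w *\<^sub>C ((?C w * monomial ls w) \<otimes>\<^sub>C cmat (w p) (w q))) = \<dots>" .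
  have "\<tau> w *\<^sub>C (((?S w - ?C w) * monomial ls w) \<otimes>\<^sub>C cmat (w p) (w q)) \<in> tensor_filt (Suc (Suc (length ls)))" for w
  proof (cases "\<tau> w = 0")
    case True
    then show ?thesis by (simp add: tensor_filt_closed)
  next
    case False
    have "?S w - ?C w \<in> uea_filt 2" using supp[OF False] by (intro pair_contraction) auto
    then have "(?S w - ?C w) * monomial ls w \<in> uea_filt (2 + length ls)"
      unfolding monomial_def using uea_filt_mult_prod[of "?S w - ?C w" 2 "map (\<lambda>(p, q). letter_vec (w p) (w q)) ls"] by simp
    then show ?thesis by (intro tensor_filt_closed tensor_filt_base) simp
  qed
  then have "(\<Sum>w\<in>assignments ?K. \<tau> w *\<^sub>C (((?S w - ?C w) * monomial ls w) \<otimes>\<^sub>C cmat (w p) (w q))) \<in> tensor_filt (Suc (Suc (length ls)))"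
    by (rule tensor_filt_sum)
  then show ?thesis
    unfolding 1 2[symmetric] sum_subtractf[symmetric]
    by (simp only: left_diff_distrib tensor_diff_left complex_space.scale_right_diff_distrib)
qed

lemma tensor_filt_gen_X:
  assumes "y \<in> tensor_filt n"
  shows "(1 \<otimes>\<^sub>C chir_proj c) * gen_X * y \<in> tensor_filt (Suc n)"
proof -
  have "(1 \<otimes>\<^sub>C chir_proj c) * gen_X * y = (\<Sum>\<alpha>\<in>UNIV. \<Sum>\<beta>\<in>UNIV. (spin_sgn \<alpha> * spin_sgn \<beta>) *\<^sub>C
      ((uea_of (letter_vec \<alpha> \<beta>) \<otimes>\<^sub>C (chir_proj c * cmat (flip \<alpha>) (flip \<beta>))) * y))"
    by (simp add: gen_X_def sum_distrib_left sum_distrib_right scaleC_mult_left scaleC_mult_right tensor_mult)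
  also have "\<dots> \<in> tensor_filt (Suc n)"
    by (intro tensor_filt_sum tensor_filt_closed(4) tensor_filt_mult assms)
  finally show ?thesis .
qed

lemma tensor_filt_casimir:
  assumes y: "y \<in> tensor_filt n"
  shows "(casimir c \<otimes>\<^sub>C 1) * y \<in> tensor_filt (Suc (Suc n))"
proof -
  have "((uea_of x * uea_of x') \<otimes>\<^sub>C 1) * y \<in> tensor_filt (Suc (Suc n))" for x x'
    using tensor_filt_mult[OF tensor_filt_mult[OF y, of x' 1], of x 1]
    by (simp add: mult.assoc[symmetric] tensor_mult)
  then show ?thesis
    by (cases c) (auto simp: casimir_def tensor_add_left tensor_scaleC_left distrib_right scaleC_mult_left
        intro!: tensor_filt_closed)
qed

text \<open>Allows a coefficient to carry further forms while it still ignores the slots about to be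
  contracted.\<close>

lemma indep_half_form: "i \<noteq> p \<Longrightarrow> i \<noteq> q \<Longrightarrow> indep \<tau> i \<Longrightarrow> indep (\<lambda>w. half_form c (w p) (w q) * \<tau> w) i"
  by (simp add: indep_def)

lemma half_form_plucker:
  "half_form c \<alpha> \<beta> * half_form c \<gamma> \<delta> =
    half_form c \<alpha> \<gamma> * half_form c \<beta> \<delta> - half_form c \<alpha> \<delta> * half_form c \<beta> \<gamma>"
  by (cases \<alpha>; cases \<beta>; cases \<gamma>; cases \<delta>) (auto simp: half_form_def eps_def)

lemma chiral_funI:
  assumes "\<And>w w'. (\<And>i. fst (w i) = fst (w' i)) \<Longrightarrow> f w = f w'"
  shows "chiral_fun I f"
  unfolding chiral_fun_def by (intro allI ballI impI assms) (simp add: fun_upd_def)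

text \<open>All that the reduction uses of the generated algebra. That A consists of invariants is
  not assumed here and enters only at the end.\<close>

locale spin_subalgebra =
  fixes A :: "UC41 set"
  assumes subalgebra: "unital_subalgebra A"
    and chir_proj_mem: "1 \<otimes>\<^sub>C chir_proj c \<in> A"
    and gen_X_mem: "gen_X \<in> A"
    and casimir_mem: "casimir c \<otimes>\<^sub>C 1 \<in> A"
begin

abbreviation cong :: "nat \<Rightarrow> UC41 \<Rightarrow> bool" where "cong \<equiv> congruent_to A"

lemma cong_trans:
  assumes "x - y \<in> tensor_filt n" "cong n y"
  shows "cong n x"
  using congruent_to_closed(3)[OF subalgebra congruent_to_closed(1)[OF subalgebra assms(1)] assms(2)] by simp

text \<open>Contracting a free index of the Clifford factor with a letter multiplies a shorter
  contraction by the generator that carries that letter.\<close>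

lemma cong_open:
  assumes IH: "\<And>ms s q t. length ls = Suc (length ms) \<Longrightarrow> distinct (s # q # slot_list ms) \<Longrightarrow>
      spin_inv (set (s # q # slot_list ms)) t \<Longrightarrow> cong (length ms) (contraction s q ms t)"
    and d: "distinct (p # q # slot_list ls)" and j: "j \<in> set (slot_list ls)"
    and \<tau>: "spin_inv (set (p # q # slot_list ls) - {p, j}) \<tau>" "indep \<tau> p" "indep \<tau> j"
  shows "cong (length ls) (contraction p q ls (\<lambda>w. half_form c (w p) (w j) * \<tau> w))"
proof -
  obtain s ms where ms: "length ls = Suc (length ms)" "mset (slot_list ls) = mset (slot_list ((j, s) # ms))"
    and front: "\<And>p q pre t. contraction p q (pre @ ls) t - contraction p q (pre @ (j, s) # ms) t \<in> tensor_filt (length (pre @ ls))"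
    by (rule slot_to_front[OF j]) blast
  let ?t = "\<lambda>w. half_form c (w p) (w j) * \<tau> w"
  have d': "distinct (p # q # slot_list ((j, s) # ms))"
    using d mset_eq_imp_distinct_iff[OF ms(2)] mset_eq_setD[OF ms(2)] by (simp only: distinct.simps list.set) blast
  have "set (p # q # slot_list ls) - {p, j} = set (s # q # slot_list ms)"
    using mset_eq_setD[OF ms(2)] d' by auto
  then have "cong (length ms) (contraction s q ms \<tau>)"
    using d' \<tau>(1) by (intro IH ms) auto
  then have "cong (length ls) ((1 \<otimes>\<^sub>C chir_proj c) * gen_X * contraction s q ms \<tau>)"
    unfolding ms(1)
    by (intro congruent_to_mult[OF subalgebra] unital_subalgebraD(4)[OF subalgebra] chir_proj_mem gen_X_mem tensor_filt_gen_X)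
  then have "cong (length ls) (contraction p q ((j, s) # ms) ?t)"
    unfolding contraction_open[OF d' \<tau>(2,3)] .
  moreover have "contraction p q ls ?t - contraction p q ((j, s) # ms) ?t \<in> tensor_filt (length ls)"
    using front[of p q "[]" ?t] by simp
  ultimately show ?thesis by (rule cong_trans[rotated])
qed

text \<open>The case out of reach of the Pluecker relation: no letter slot has the chirality of the
  pair p, q. The pair is carried along untouched while two letters at a time are replaced by a
  Casimir element.\<close>

lemma cong_closed_opposite:
  assumes IH: "\<And>ms s q t. length ls = Suc (Suc (length ms)) \<Longrightarrow> distinct (s # q # slot_list ms) \<Longrightarrow>
      spin_inv (set (s # q # slot_list ms)) t \<Longrightarrow> cong (length ms) (contraction s q ms t)"
    and d: "distinct (p # q # slot_list ls)"
    and \<tau>: "spin_inv (set (slot_list ls)) \<tau>" "indep \<tau> p" "indep \<tau> q"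
    and supp: "\<And>w i. \<tau> w \<noteq> 0 \<Longrightarrow> i \<in> set (slot_list ls) \<Longrightarrow> fst (w i) \<noteq> c"
  shows "cong (length ls) (contraction p q ls (\<lambda>w. half_form c (w p) (w q) * \<tau> w))"
proof (cases ls)
  case Nil
  have pq: "p \<notin> {q}" "q \<notin> {}" using d by auto
  have \<tau>0: "\<tau> ((\<lambda>_. (False, False))(q := \<beta>, p := \<alpha>)) = \<tau> (\<lambda>_. (False, False))" for \<alpha> \<beta>
    using \<tau>(2,3) by (simp only: indep_def)
  have "contraction p q [] (\<lambda>w. half_form c (w p) (w q) * \<tau> w) =
     (\<Sum>\<alpha>\<in>UNIV. \<Sum>\<beta>\<in>UNIV. (half_form c \<alpha> \<beta> * \<tau> (\<lambda>_. (False, False))) *\<^sub>C (1 \<otimes>\<^sub>C cmat \<alpha> \<beta>))"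
    unfolding contraction_def slot_list_simps list.set(1) sum_assignments_insert[OF pq(1)]
      sum_assignments_insert[OF pq(2)] assignments_empty
    using pq by (intro sum.cong refl) (simp add: \<tau>0)
  \<comment> \<open>Without letters only the form contracted with the matrix units is left, which is
    minus the chirality projection.\<close>
  also have "\<dots> = (- \<tau> (\<lambda>_. (False, False))) *\<^sub>C (1 \<otimes>\<^sub>C chir_proj c)"
    by (cases c) (simp_all add: sum_spinor half_form_def eps_def chir_proj_cmat tensor_diff_right
        complex_space.scale_right_diff_distrib)
  also have "\<dots> \<in> A"
    by (rule unital_subalgebraD(5)[OF subalgebra chir_proj_mem])
  finally show ?thesis using Nil congruent_to_closed(2)[OF subalgebra] by simp
next
  case (Cons rs ls')
  obtain r s where ls: "ls = (r, s) # ls'" using Cons by (cases rs) auto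
  define S where "S = set (slot_list ls)"
  have S: "finite S" "s \<in> S" by (auto simp: S_def ls)
  define c' where "c' = (\<not> c)"
  have supp': "fst (w i) = c'" if "\<tau> w \<noteq> 0" "i \<in> S" for w i
    using supp[OF that(1)] that(2) by (auto simp: S_def c'_def)
  obtain \<sigma> where \<sigma>: "\<And>h. h \<in> S - {s} \<Longrightarrow> spin_inv (S - {s, h}) (\<sigma> h)"
    "\<And>w. (if fst (w s) = c' then \<tau> w else 0) = (\<Sum>h\<in>S - {s}. half_form c' (w s) (w h) * \<sigma> h w)"
    "\<And>h w x. h \<noteq> s \<Longrightarrow> \<sigma> h (w(s := x)) = \<sigma> h w" "\<And>h w x. \<sigma> h (w(h := x)) = \<sigma> h w"
    "\<And>h k w x. (\<And>w x. \<tau> (w(k := x)) = \<tau> w) \<Longrightarrow> k \<notin> S \<Longrightarrow> \<sigma> h (w(k := x)) = \<sigma> h w"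
    by (rule spin_inv_first_fundamental[OF \<tau>(1)[folded S_def] S, where c = c']) blast
  \<comment> \<open>The coefficients \<sigma> need not inherit the support of \<tau>, which
    \<open>contraction_pair\<close> requires. The indicator f restores it; it ignores s and h, and
    it does not change the expansion, because the form is nonzero only if s and h have chirality c'
    as well.\<close>
  define f where "f h w = (if \<forall>i\<in>S - {s, h}. fst (w i :: spinor) = c' then 1 else 0 :: complex)" for h w
  define \<rho> where "\<rho> h w = f h w * \<sigma> h w" for h w
  have pS: "p \<notin> S" "q \<notin> S" "p \<noteq> q" using d by (auto simp: S_def)
  have \<rho>_inv: "spin_inv (S - {s, h}) (\<rho> h)" if "h \<in> S - {s}" for h
    unfolding \<rho>_def[abs_def] by (rule spin_inv_chiral_mult[OF \<sigma>(1)[OF that]]) (rule chiral_funI, simp add: f_def)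
  have \<rho>_indep: "indep (\<rho> h) s" "indep (\<rho> h) h" "indep (\<rho> h) p" "indep (\<rho> h) q" if "h \<in> S - {s}" for h
    using that pS \<sigma>(3,4) \<sigma>(5)[of p] \<sigma>(5)[of q] \<tau>(2,3) by (auto simp: indep_def \<rho>_def f_def)
  have \<tau>_sum: "\<tau> w = (\<Sum>h\<in>S - {s}. half_form c' (w s) (w h) * \<rho> h w)" for w
  proof -
    have "(\<Sum>h\<in>S - {s}. half_form c' (w s) (w h) * \<rho> h w) =
       (if \<forall>i\<in>S. fst (w i) = c' then 1 else 0) * (\<Sum>h\<in>S - {s}. half_form c' (w s) (w h) * \<sigma> h w)"
      unfolding sum_distrib_left
      by (rule sum.cong) (use S in \<open>auto simp: half_form_def \<rho>_def f_def\<close>)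
    also have "\<dots> = \<tau> w"
      unfolding \<sigma>(2)[symmetric] using supp' S(2) by auto
    finally show ?thesis by simp
  qed
  have summand: "cong (length ls) (contraction p q ls (\<lambda>w. half_form c' (w s) (w h) * (half_form c (w p) (w q) * \<rho> h w)))"
    if h: "h \<in> S - {s}" for h
  proof (cases "h = r")
    case True
    have "contraction p q ls (\<lambda>w. half_form c' (w s) (w h) * (half_form c (w p) (w q) * \<rho> h w)) = 0"
      unfolding ls True using d \<rho>_indep[OF h] True
      by (intro contraction_self indep_half_form) (auto simp: ls)
    then show ?thesis using congruent_to_closed(2)[OF subalgebra unital_subalgebraD(2)[OF subalgebra]] by simp
  next
    case False
    let ?u = "\<lambda>w. half_form c (w p) (w q) * \<rho> h w"
    have hls: "h \<in> set (slot_list ls')" using h False by (auto simp: S_def ls)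
    obtain u ms where ms: "length ls' = Suc (length ms)" "mset (slot_list ls') = mset (slot_list ((h, u) # ms))"
      and front: "\<And>p q pre t. contraction p q (pre @ ls') t - contraction p q (pre @ (h, u) # ms) t \<in> tensor_filt (length (pre @ ls'))"
      by (rule slot_to_front[OF hls]) blast
    have set: "set (slot_list ls') = {h, u} \<union> set (slot_list ms)"
      using mset_eq_setD[OF ms(2)] by auto
    have "distinct (slot_list ((h, u) # ms))"
      using d ms(2) mset_eq_imp_distinct_iff[OF ms(2)] by (simp add: ls)
    then have d': "distinct (p # q # slot_list ((r, s) # (h, u) # ms))"
      using d set by (auto simp: ls)
    have S': "S = {r, s, h, u} \<union> set (slot_list ms)" using set by (auto simp: S_def ls)
    have "\<rho> h w \<noteq> 0 \<Longrightarrow> fst (w r) = c' \<and> fst (w u) = c'" for w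
      using d' by (auto simp: \<rho>_def f_def S' split: if_splits)
    then have pair: "contraction p q ((r, s) # (h, u) # ms) (\<lambda>w. half_form c' (w s) (w h) * ?u w)
       - (-4) *\<^sub>C ((casimir c' \<otimes>\<^sub>C 1) * contraction p q ms (contract c' r u ?u)) \<in> tensor_filt (Suc (Suc (length ms)))"
      using d' \<rho>_indep[OF h] by (intro contraction_pair indep_half_form) auto
    \<comment> \<open>The form on p and q passes through the contraction, as r and u are other
      slots, so the induction hypothesis meets an invariant on p, q and the remaining
      letters.\<close>
    have "contract c' r u ?u = (\<lambda>w. half_form c (w p) (w q) * contract c' r u (\<rho> h) w)"
      using d' by (auto simp: contract_def right_diff_distrib)
    moreover have "spin_inv (set (p # q # slot_list ms)) (\<lambda>w. half_form c (w p) (w q) * contract c' r u (\<rho> h) w)"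
    proof -
      have "spin_inv (S - {s, h} - {r, u}) (contract c' r u (\<rho> h))"
        using h d' S by (intro spin_inv_contract \<rho>_inv) (auto simp: S')
      moreover have "S - {s, h} - {r, u} = set (slot_list ms)" using d' by (auto simp: S')
      ultimately have "spin_inv (set (slot_list ms)) (contract c' r u (\<rho> h))" by simp
      moreover have "\<rho> h (w(k := x)) = \<rho> h w" if "k \<in> {p, q}" for w x k
        using \<rho>_indep(3,4)[OF h] that unfolding indep_def by blast
      ultimately show ?thesis
        using d' by (simp, intro spin_inv_half_form_mult) (auto intro!: contract_indep_other)
    qed
    ultimately have "cong (length ms) (contraction p q ms (contract c' r u ?u))"
      using d' ms(1) ls by (intro IH) auto
    then have "cong (Suc (Suc (length ms))) ((-4) *\<^sub>C ((casimir c' \<otimes>\<^sub>C 1) * contraction p q ms (contract c' r u ?u)))"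
      by (intro congruent_to_closed(5)[OF subalgebra] congruent_to_mult[OF subalgebra] casimir_mem tensor_filt_casimir)
    then have "cong (Suc (Suc (length ms))) (contraction p q ((r, s) # (h, u) # ms) (\<lambda>w. half_form c' (w s) (w h) * ?u w))"
      by (rule cong_trans[OF pair])
    moreover have "contraction p q ls (\<lambda>w. half_form c' (w s) (w h) * ?u w) -
       contraction p q ((r, s) # (h, u) # ms) (\<lambda>w. half_form c' (w s) (w h) * ?u w) \<in> tensor_filt (Suc (Suc (length ms)))"
      using front[of p q "[(r, s)]" "\<lambda>w. half_form c' (w s) (w h) * ?u w"] ms(1) by (simp add: ls)
    ultimately show ?thesis using cong_trans ms(1) by (simp add: ls)
  qed
  have "(\<lambda>w. half_form c (w p) (w q) * \<tau> w) =
     (\<lambda>w. \<Sum>h\<in>S - {s}. half_form c' (w s) (w h) * (half_form c (w p) (w q) * \<rho> h w))"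
    by (subst \<tau>_sum) (simp add: sum_distrib_left mult.left_commute)
  then show ?thesis
    by (simp only: contraction_sum) (rule congruent_to_sum[OF subalgebra summand])
qed

text \<open>If the Clifford factor is contracted with itself, the two-term Pluecker relation for the
  symplectic form on the spinors of one chirality reconnects it to any slot of that chirality.\<close>

lemma cong_closed:
  assumes IH1: "\<And>ms s q t. length ls = Suc (length ms) \<Longrightarrow> distinct (s # q # slot_list ms) \<Longrightarrow>
      spin_inv (set (s # q # slot_list ms)) t \<Longrightarrow> cong (length ms) (contraction s q ms t)"
    and IH2: "\<And>ms s q t. length ls = Suc (Suc (length ms)) \<Longrightarrow> distinct (s # q # slot_list ms) \<Longrightarrow>
      spin_inv (set (s # q # slot_list ms)) t \<Longrightarrow> cong (length ms) (contraction s q ms t)"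
    and d: "distinct (p # q # slot_list ls)"
    and "spin_inv (set (slot_list ls)) \<tau>" "indep \<tau> p" "indep \<tau> q"
  shows "cong (length ls) (contraction p q ls (\<lambda>w. half_form c (w p) (w q) * \<tau> w))"
proof -
  define S where "S = set (slot_list ls)"
  have pS: "p \<notin> S" "q \<notin> S" "p \<noteq> q" "finite S" using d by (auto simp: S_def)
  \<comment> \<open>Induction on the set T of slots in which \<tau> may still have chirality c. The
    empty set is the case just settled; T = S imposes no condition.\<close>
  have gen: "cong (length ls) (contraction p q ls (\<lambda>w. half_form c (w p) (w q) * \<tau> w))"
    if "finite T" "T \<subseteq> S" "spin_inv S \<tau>" "indep \<tau> p" "indep \<tau> q"
      "\<And>w i. \<tau> w \<noteq> 0 \<Longrightarrow> i \<in> S - T \<Longrightarrow> fst (w i) \<noteq> c" for T \<tau>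
    using that
  proof (induction T arbitrary: \<tau> rule: finite_induct)
    case empty
    then show ?case by (intro cong_closed_opposite[OF IH2 d]) (auto simp: S_def)
  next
    case (insert i T)
    then have i: "i \<in> S" by auto
    have ip: "i \<noteq> p" "i \<noteq> q" using i pS by auto
    \<comment> \<open>Splits \<tau> by the chirality of slot i. The part away from c only needs the
      smaller T; the other part is expanded at i, which is where the Pluecker relation finds its
      second form.\<close>
    let ?f = "\<lambda>w. if fst (w i) = c then 0 else 1 :: complex"
    have 1: "cong (length ls) (contraction p q ls (\<lambda>w. half_form c (w p) (w q) * (?f w * \<tau> w)))"
    proof (rule insert.IH)
      show "spin_inv S (\<lambda>w. ?f w * \<tau> w)"
        by (rule spin_inv_chiral_mult[OF insert.prems(2)]) (rule chiral_funI, simp)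
      show "indep (\<lambda>w. ?f w * \<tau> w) p" "indep (\<lambda>w. ?f w * \<tau> w) q"
        using insert.prems(3,4) ip by (auto simp: indep_def)
      show "fst (w k) \<noteq> c" if "?f w * \<tau> w \<noteq> 0" "k \<in> S - T" for w k
        using insert.prems(5)[of w k] that by (cases "k = i") (auto split: if_splits)
    qed (use insert.prems in auto)
    obtain \<sigma> where \<sigma>: "\<And>h. h \<in> S - {i} \<Longrightarrow> spin_inv (S - {i, h}) (\<sigma> h)"
      "\<And>w. (if fst (w i) = c then \<tau> w else 0) = (\<Sum>h\<in>S - {i}. half_form c (w i) (w h) * \<sigma> h w)"
      "\<And>h w x. h \<noteq> i \<Longrightarrow> \<sigma> h (w(i := x)) = \<sigma> h w" "\<And>h w x. \<sigma> h (w(h := x)) = \<sigma> h w"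
      "\<And>h k w x. (\<And>w x. \<tau> (w(k := x)) = \<tau> w) \<Longrightarrow> k \<notin> S \<Longrightarrow> \<sigma> h (w(k := x)) = \<sigma> h w"
      by (rule spin_inv_first_fundamental[OF insert.prems(2) pS(4) i, where c = c]) blast
    have \<sigma>_indep: "indep (\<sigma> h) i" "indep (\<sigma> h) h" "indep (\<sigma> h) p" "indep (\<sigma> h) q" if "h \<in> S - {i}" for h
      using that pS \<sigma>(3,4) \<sigma>(5)[of p] \<sigma>(5)[of q] insert.prems(3,4) by (auto simp: indep_def)
    have 2: "cong (length ls) (contraction p q ls (\<lambda>w. half_form c (w p) (w i) * (half_form c (w q) (w h) * \<sigma> h w)))"
      "cong (length ls) (contraction p q ls (\<lambda>w. half_form c (w p) (w h) * (half_form c (w q) (w i) * \<sigma> h w)))"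
      if h: "h \<in> S - {i}" for h
    proof -
      have inv: "spin_inv (insert q (insert k (S - {i, h}))) (\<lambda>w. half_form c (w q) (w k) * \<sigma> h w)" if "k \<in> {i, h}" for k
        using that h pS ip \<sigma>_indep[OF h] \<sigma>(1)[OF h] by (intro spin_inv_half_form_mult) (auto simp: indep_def)
      have "insert q (insert h (S - {i, h})) = set (p # q # slot_list ls) - {p, i}"
        "insert q (insert i (S - {i, h})) = set (p # q # slot_list ls) - {p, h}"
        using h i pS by (auto simp: S_def)
      then have inv': "spin_inv (set (p # q # slot_list ls) - {p, i}) (\<lambda>w. half_form c (w q) (w h) * \<sigma> h w)"
        "spin_inv (set (p # q # slot_list ls) - {p, h}) (\<lambda>w. half_form c (w q) (w i) * \<sigma> h w)"
        using inv[of h] inv[of i] by simp_all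
      show "cong (length ls) (contraction p q ls (\<lambda>w. half_form c (w p) (w i) * (half_form c (w q) (w h) * \<sigma> h w)))"
        using h i pS ip \<sigma>_indep[OF h]
        by (intro cong_open[OF IH1 d _ inv'(1)] indep_half_form) (auto simp: S_def)
      show "cong (length ls) (contraction p q ls (\<lambda>w. half_form c (w p) (w h) * (half_form c (w q) (w i) * \<sigma> h w)))"
        using h i pS ip \<sigma>_indep[OF h]
        by (intro cong_open[OF IH1 d _ inv'(2)] indep_half_form) (auto simp: S_def)
    qed
    have "half_form c (w p) (w q) * \<tau> w = half_form c (w p) (w q) * (?f w * \<tau> w) + (\<Sum>h\<in>S - {i}.
        half_form c (w p) (w i) * (half_form c (w q) (w h) * \<sigma> h w)
        - half_form c (w p) (w h) * (half_form c (w q) (w i) * \<sigma> h w))" for w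
    proof -
      have "\<tau> w = ?f w * \<tau> w + (\<Sum>h\<in>S - {i}. half_form c (w i) (w h) * \<sigma> h w)"
        unfolding \<sigma>(2)[symmetric] by simp
      then have "half_form c (w p) (w q) * \<tau> w = half_form c (w p) (w q) * (?f w * \<tau> w)
          + (\<Sum>h\<in>S - {i}. (half_form c (w p) (w q) * half_form c (w i) (w h)) * \<sigma> h w)"
        by (metis (no_types, lifting) distrib_left mult.assoc sum.cong sum_distrib_left)
      then show ?thesis unfolding half_form_plucker[of c "w p" "w q" "w i"] by (simp add: left_diff_distrib mult.assoc)
    qed
    then have "contraction p q ls (\<lambda>w. half_form c (w p) (w q) * \<tau> w) =
      contraction p q ls (\<lambda>w. half_form c (w p) (w q) * (?f w * \<tau> w)) + (\<Sum>h\<in>S - {i}.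
        contraction p q ls (\<lambda>w. half_form c (w p) (w i) * (half_form c (w q) (w h) * \<sigma> h w))
        - contraction p q ls (\<lambda>w. half_form c (w p) (w h) * (half_form c (w q) (w i) * \<sigma> h w)))"
      by (simp only: contraction_linear contraction_sum)
    also have "cong (length ls) \<dots>"
      by (intro congruent_to_closed(3,4)[OF subalgebra] congruent_to_sum[OF subalgebra] 1 2)
    finally show ?case .
  qed
  show ?thesis by (rule gen[of S]) (use assms pS in \<open>auto simp: S_def\<close>)
qed

lemma cong_contraction:
  assumes "distinct (p # q # slot_list ls)" "spin_inv (set (p # q # slot_list ls)) t"
  shows "cong (length ls) (contraction p q ls t)"
  using assms
proof (induction "length ls" arbitrary: p q ls t rule: less_induct)
  case less
  have IH1: "cong (length ms) (contraction s q ms t)" if "length ls = Suc (length ms)"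
    "distinct (s # q # slot_list ms)" "spin_inv (set (s # q # slot_list ms)) t" for ms s q t
    using that by (intro less.hyps) auto
  have IH2: "cong (length ms) (contraction s q ms t)" if "length ls = Suc (Suc (length ms))"
    "distinct (s # q # slot_list ms)" "spin_inv (set (s # q # slot_list ms)) t" for ms s q t
    using that by (intro less.hyps) auto
  let ?I = "set (p # q # slot_list ls)"
  \<comment> \<open>The first fundamental theorem expands one chirality of slot p at a time; the two
    halves add up to t.\<close>
  have half: "cong (length ls) (contraction p q ls (\<lambda>w. if fst (w p) = c then t w else 0))" for c
  proof -
    obtain \<sigma> where \<sigma>: "\<And>h. h \<in> ?I - {p} \<Longrightarrow> spin_inv (?I - {p, h}) (\<sigma> h)"
      "\<And>w. (if fst (w p) = c then t w else 0) = (\<Sum>h\<in>?I - {p}. half_form c (w p) (w h) * \<sigma> h w)"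
      "\<And>h w x. h \<noteq> p \<Longrightarrow> \<sigma> h (w(p := x)) = \<sigma> h w" "\<And>h w x. \<sigma> h (w(h := x)) = \<sigma> h w"
      by (rule spin_inv_first_fundamental[OF less.prems(2), of p, where c = c]) auto
    have "cong (length ls) (contraction p q ls (\<lambda>w. half_form c (w p) (w h) * \<sigma> h w))" if h: "h \<in> ?I - {p}" for h
    proof (cases "h = q")
      case True
      have "?I - {p, q} = set (slot_list ls)" using less.prems(1) by auto
      then have "spin_inv (set (slot_list ls)) (\<sigma> q)" using \<sigma>(1)[OF h] True by simp
      then show ?thesis
        unfolding True using \<sigma>(3)[of q] \<sigma>(4)[of q] less.prems(1)
        by (intro cong_closed[OF IH1 IH2 less.prems(1)]) (auto simp: indep_def)
    next
      case False
      then show ?thesis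
        using h \<sigma>(3,4) by (intro cong_open[OF IH1 less.prems(1) _ \<sigma>(1)[OF h]]) (auto simp: indep_def)
    qed
    then show ?thesis
      unfolding \<sigma>(2) contraction_sum by (rule congruent_to_sum[OF subalgebra])
  qed
  have t: "(\<lambda>w. (if fst (w p) = True then t w else 0) + (if fst (w p) = False then t w else 0)) = t" by auto
  have "contraction p q ls (\<lambda>w. (if fst (w p) = True then t w else 0) + (if fst (w p) = False then t w else 0)) =
      contraction p q ls (\<lambda>w. if fst (w p) = True then t w else 0)
      + contraction p q ls (\<lambda>w. if fst (w p) = False then t w else 0)"
    by (rule contraction_linear(1))
  then have "contraction p q ls t = \<dots>" unfolding t .
  also have "cong (length ls) \<dots>" by (rule congruent_to_closed(3)[OF subalgebra half half])
  finally show ?case .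
qed

end

section \<open>The group \<open>K\<close>\<close>

lemma K41_orthogonal:
  assumes "k \<in> K41"
  shows "orthogonal_matrix k" "matrix_inv k = transpose k" "i \<noteq> 5 \<Longrightarrow> k $ i $ 5 = 0" "i \<noteq> 5 \<Longrightarrow> k $ 5 $ i = 0"
proof -
  show o: "orthogonal_matrix k" and "i \<noteq> 5 \<Longrightarrow> k $ i $ 5 = 0" "i \<noteq> 5 \<Longrightarrow> k $ 5 $ i = 0"
    using assms K41_subset by (auto simp: SO4xO1_def)
  show "matrix_inv k = transpose k"
    using o unfolding orthogonal_matrix_def matrix_inv_def
    by (intro some_equality) (auto intro: matrix_inverse_unique)
qed

lemma K41_sum_rows:
  assumes "k \<in> K41"
  shows "(\<Sum>j\<in>UNIV. k $ a $ j * k $ b $ j) = (if a = b then 1 else 0)"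
proof -
  have "(k ** transpose k) $ a $ b = (mat 1 :: real^5^5) $ a $ b"
    using K41_orthogonal(1)[OF assms] by (simp add: orthogonal_matrix_def)
  then show ?thesis by (simp add: matrix_matrix_mult_def transpose_def mat_def)
qed

text \<open>On the connected group \<open>K\<close> a continuous function with values in \<open>\<plusminus>1\<close> is constant.\<close>

lemma K41_sign_constant:
  fixes f :: "real^5^5 \<Rightarrow> real"
  assumes "continuous_on K41 f" "\<And>k. k \<in> K41 \<Longrightarrow> f k = 1 \<or> f k = - 1" "f (mat 1) = 1" "k \<in> K41"
  shows "f k = 1"
proof -
  have "connected (f ` K41)"
    by (rule connected_continuous_image[OF assms(1)]) (simp add: K41_def connected_connected_component)
  moreover have "finite (f ` K41)"
    by (rule finite_subset[of _ "{1, - 1}"]) (use assms(2) in auto)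
  ultimately have "f ` K41 = {} \<or> (\<exists>x. f ` K41 = {x})"
    using connected_finite_iff_sing by blast
  moreover have "mat 1 \<in> K41"
  proof -
    have "(mat 1 :: real^5^5) $ i $ 5 = 0 \<and> (mat 1 :: real^5^5) $ 5 $ i = 0" if "i \<noteq> 5" for i
      using that by (simp add: mat_def)
    then have "mat 1 \<in> SO4xO1" by (simp add: SO4xO1_def orthogonal_matrix_id)
    then show ?thesis by (simp add: K41_def)
  qed
  ultimately show ?thesis using assms(3,4) by (metis empty_iff image_eqI singletonD)
qed

lemma continuous_on_entry: "continuous_on S (\<lambda>k :: real^5^5. k $ i $ j)"
  by (intro continuous_intros)

lemma K41_corner:
  assumes "k \<in> K41"
  shows "k $ 5 $ 5 = 1"
proof (rule K41_sign_constant[OF continuous_on_entry _ _ assms])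
  fix k assume k: "k \<in> K41"
  then have "(k $ 5 $ 5)\<^sup>2 = 1"
    using K41_sum_rows[OF k, of 5 5] K41_orthogonal(4)[OF k] by (simp add: sum_5 power2_eq_square)
  then show "k $ 5 $ 5 = 1 \<or> k $ 5 $ 5 = - 1" by (simp add: power2_eq_1_iff)
qed (simp add: mat_def)

section \<open>The action of K on p in real orthogonal coordinates\<close>

definition z_mat :: "5 \<Rightarrow> complex^5^5" where
  "z_mat j = (\<chi> a b. if a = j \<and> b = 5 \<or> a = 5 \<and> b = j then 1 else 0)"

definition z_vec :: "5 \<Rightarrow> p41" where
  "z_vec j = Abs_p41 (Abs_so41C (z_mat j))"

lemma Rep_z_vec:
  assumes "j \<noteq> 5"
  shows "Rep_so41C (Rep_p41 (z_vec j)) = z_mat j"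
proof -
  have 1: "Rep_so41C (Abs_so41C (z_mat j)) = z_mat j"
    by (rule Abs_so41C_inverse) (use assms in \<open>auto simp: so41_complexified_nth z_mat_def\<close>)
  have "cartan_inv (Abs_so41C (z_mat j)) = - Abs_so41C (z_mat j)"
    unfolding Rep_so41C_inject[symmetric] cartan_inv.rep_eq uminus_so41C.rep_eq 1
    by (auto simp: vec_eq_iff transpose_def z_mat_def)
  then show ?thesis unfolding z_vec_def by (subst Abs_p41_inverse) (simp_all add: 1)
qed

lemma five_neq: "(1::5) \<noteq> 5" "(2::5) \<noteq> 5" "(3::5) \<noteq> 5" "(4::5) \<noteq> 5"
  by simp_all

lemma p41_eqI:
  assumes "\<And>i. i \<noteq> 5 \<Longrightarrow> Rep_so41C (Rep_p41 v) $ i $ 5 = Rep_so41C (Rep_p41 w) $ i $ 5"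
  shows "v = w"
proof -
  have "Rep_so41C (Rep_p41 v) $ i $ j = Rep_so41C (Rep_p41 w) $ i $ j" for i j
    using assms[of i] assms[of j] p41_entries(1)[of i j v] p41_entries(1)[of i j w]
      p41_entries(2)[of v i j] p41_entries(2)[of w i j]
    by (cases "i = 5"; cases "j = 5") auto
  then show ?thesis by (simp add: Rep_p41_inject[symmetric] so41C_eq_iff)
qed

lemma Rep_p41_entry_simps:
  "Rep_so41C (Rep_p41 (v + w)) $ i $ j = Rep_so41C (Rep_p41 v) $ i $ j + Rep_so41C (Rep_p41 w) $ i $ j"
  "Rep_so41C (Rep_p41 (v - w)) $ i $ j = Rep_so41C (Rep_p41 v) $ i $ j - Rep_so41C (Rep_p41 w) $ i $ j"
  "Rep_so41C (Rep_p41 (- v)) $ i $ j = - Rep_so41C (Rep_p41 v) $ i $ j"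
  "Rep_so41C (Rep_p41 (c *\<^sub>C v)) $ i $ j = c * Rep_so41C (Rep_p41 v) $ i $ j"
  by (simp_all add: plus_p41.rep_eq minus_p41.rep_eq uminus_p41.rep_eq scaleC_p41.rep_eq
      plus_so41C.rep_eq minus_so41C.rep_eq uminus_so41C.rep_eq scaleC_so41C.rep_eq)

lemma p_basis_z_vec:
  "p_basis False False = z_vec 1 - \<i> *\<^sub>C z_vec 2" "p_basis False True = z_vec 3 - \<i> *\<^sub>C z_vec 4"
  "p_basis True True = z_vec 1 + \<i> *\<^sub>C z_vec 2" "p_basis True False = - z_vec 3 - \<i> *\<^sub>C z_vec 4"
  by (rule p41_eqI; simp add: Rep_p41_entry_simps Rep_z_vec Rep_p_basis p_vec_def uminus_so41C.rep_eq p_entries z_mat_def)+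

lemma Ad_z_vec:
  assumes k: "k \<in> K41" and j: "j \<noteq> 5"
  shows "Ad_p41 k (z_vec j) = of_real (k $ 1 $ j) *\<^sub>C z_vec 1 + of_real (k $ 2 $ j) *\<^sub>C z_vec 2
     + of_real (k $ 3 $ j) *\<^sub>C z_vec 3 + of_real (k $ 4 $ j) *\<^sub>C z_vec 4"
proof (rule p41_eqI)
  fix i :: 5 assume i: "i \<noteq> 5"
  have "Rep_so41C (Rep_p41 (Ad_p41 k (z_vec j))) $ i $ 5 =
      (complex_matrix k ** z_mat j ** complex_matrix (transpose k)) $ i $ 5"
    by (simp add: Rep_Ad_p41[OF k] Rep_Ad41[OF K41_SO41[OF k]] K41_orthogonal(2)[OF k] Rep_z_vec[OF j])
  also have "\<dots> = (\<Sum>m\<in>UNIV. (\<Sum>l\<in>UNIV. of_real (k $ i $ l) * z_mat j $ l $ m) * of_real (k $ 5 $ m))"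
    by (simp add: matrix_matrix_mult_def transpose_def)
  also have "\<dots> = (\<Sum>l\<in>UNIV. of_real (k $ i $ l) * z_mat j $ l $ 5)"
    unfolding sum_5[of "\<lambda>m. _ m * of_real (k $ 5 $ m)"] K41_orthogonal(4)[OF k five_neq(1)] K41_orthogonal(4)[OF k five_neq(2)]
      K41_orthogonal(4)[OF k five_neq(3)] K41_orthogonal(4)[OF k five_neq(4)] K41_corner[OF k]
    by simp
  also have "\<dots> = (\<Sum>l\<in>UNIV. if l = j then of_real (k $ i $ j) else 0)"
    by (rule sum.cong) (use j in \<open>auto simp: z_mat_def\<close>)
  also have "\<dots> = of_real (k $ i $ j)" by simp
  finally have l: "Rep_so41C (Rep_p41 (Ad_p41 k (z_vec j))) $ i $ 5 = of_real (k $ i $ j)" .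
  have "i = 1 \<or> i = 2 \<or> i = 3 \<or> i = 4"
    using i all_5[of "\<lambda>i. i \<noteq> 5 \<longrightarrow> i = 1 \<or> i = 2 \<or> i = 3 \<or> i = 4"] by auto
  then show "Rep_so41C (Rep_p41 (Ad_p41 k (z_vec j))) $ i $ 5 = Rep_so41C (Rep_p41
      (of_real (k $ 1 $ j) *\<^sub>C z_vec 1 + of_real (k $ 2 $ j) *\<^sub>C z_vec 2 + of_real (k $ 3 $ j) *\<^sub>C z_vec 3 + of_real (k $ 4 $ j) *\<^sub>C z_vec 4)) $ i $ 5"
    unfolding l by (auto simp: Rep_p41_entry_simps Rep_z_vec z_mat_def)
qed

definition bilin :: "(p41 \<Rightarrow> p41 \<Rightarrow> 'a::complex_space) \<Rightarrow> bool" where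
  "bilin f \<longleftrightarrow> (\<forall>y. clinear (\<lambda>x. f x y)) \<and> (\<forall>x. clinear (\<lambda>y. f x y))"

lemma clinear_uminus: "clinear f \<Longrightarrow> f (- x) = - f x"
  using clinear_scaleC[of f "-1" x] by simp

lemma clinear_diff: "clinear f \<Longrightarrow> f (x - y) = f x - f y"
  using clinear_add[of f x "- y"] by (simp add: clinear_uminus)

lemma bilinD:
  assumes "bilin f"
  shows "f (x + x') y = f x y + f x' y" "f x (y + y') = f x y + f x y'"
    "f (c *\<^sub>C x) y = c *\<^sub>C f x y" "f x (c *\<^sub>C y) = c *\<^sub>C f x y"
    "f (x - x') y = f x y - f x' y" "f x (y - y') = f x y - f x y'"
    "f (- x) y = - f x y" "f x (- y) = - f x y"
  using assms clinear_add[of "\<lambda>x. f x y"] clinear_add[of "\<lambda>y. f x y"] clinear_scaleC[of "\<lambda>x. f x y"]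
    clinear_scaleC[of "\<lambda>y. f x y"] clinear_diff[of "\<lambda>x. f x y"] clinear_diff[of "\<lambda>y. f x y"]
    clinear_uminus[of "\<lambda>x. f x y"] clinear_uminus[of "\<lambda>y. f x y"]
  by (simp_all add: bilin_def)

lemma dual_sum_z_vec:
  assumes "bilin f"
  shows "dual_sum f = 2 *\<^sub>C (f (z_vec 1) (z_vec 1) + f (z_vec 2) (z_vec 2) + f (z_vec 3) (z_vec 3) + f (z_vec 4) (z_vec 4))"
proof -
  have two: "2 *\<^sub>C x = x + x" for x :: 'a using scaleC_add_left[of 1 1 x] by simp
  show ?thesis
    unfolding dual_sum_def p_basis_z_vec two
    by (simp add: bilinD[OF assms] scaleC_scaleC complex_space.scale_right_diff_distrib scaleC_add_right algebra_simps)
qed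

text \<open>In the basis \<open>z_vec\<close> the contraction is twice a sum of squares, which the
  orthogonal block of k preserves.\<close>

lemma dual_sum_invariant:
  assumes k: "k \<in> K41" and f: "bilin f"
  shows "dual_sum (\<lambda>x y. f (Ad_p41 k x) (Ad_p41 k y)) = dual_sum f"
proof -
  have lin: "clinear (Ad_p41 k)" by (rule clinear_Ad_p41[OF k])
  have fk: "bilin (\<lambda>x y. f (Ad_p41 k x) (Ad_p41 k y))"
    using f by (auto simp: bilin_def intro!: clinear_compose[where g = "Ad_p41 k", OF _ lin])
  define F where "F a b = f (z_vec a) (z_vec b)" for a b
  define N :: "5 set" where "N = {1, 2, 3, 4}"
  have N: "finite N" "j \<in> N \<longleftrightarrow> j \<noteq> 5" for j
    using all_5[of "\<lambda>j. j \<in> {1, 2, 3, 4} \<longleftrightarrow> j \<noteq> 5"] by (auto simp: N_def)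
  have sumN: "(\<Sum>j\<in>N. h j) = h 1 + h 2 + h 3 + h 4" for h :: "5 \<Rightarrow> 'a"
    by (simp add: N_def add.assoc)
  have Ad: "Ad_p41 k (z_vec j) = (\<Sum>a\<in>N. of_real (k $ a $ j) *\<^sub>C z_vec a)" if "j \<in> N" for j
    using Ad_z_vec[OF k, of j] that N(2) by (simp add: N_def add.assoc)
  have lf: "clinear (\<lambda>x. f x y)" "clinear (f x)" for x y using f by (simp_all add: bilin_def)
  have "(\<Sum>j\<in>N. f (Ad_p41 k (z_vec j)) (Ad_p41 k (z_vec j))) =
     (\<Sum>j\<in>N. \<Sum>a\<in>N. \<Sum>b\<in>N. of_real (k $ a $ j * k $ b $ j) *\<^sub>C F a b)"
    by (intro sum.cong refl) (simp add: Ad clinear_sum[OF lf(1)] clinear_sum[OF lf(2)] bilinD[OF f] F_def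
        complex_space.scale_sum_right scaleC_scaleC, subst sum.swap, simp add: mult.commute)
  also have "\<dots> = (\<Sum>a\<in>N. \<Sum>b\<in>N. \<Sum>j\<in>N. of_real (k $ a $ j * k $ b $ j) *\<^sub>C F a b)"
    by (rule trans[OF sum.swap], rule sum.cong[OF refl], rule sum.swap)
  also have "\<dots> = (\<Sum>a\<in>N. \<Sum>b\<in>N. (if a = b then F a b else 0))"
  proof (intro sum.cong refl)
    fix a b assume ab: "a \<in> N" "b \<in> N"
    have "(\<Sum>j\<in>UNIV. k $ a $ j * k $ b $ j) = (\<Sum>j\<in>N. k $ a $ j * k $ b $ j)"
      using K41_orthogonal(3)[OF k, of a] ab(1) N(2) by (intro sum.mono_neutral_right) auto
    then have s: "(\<Sum>j\<in>N. k $ a $ j * k $ b $ j) = (if a = b then 1 else 0)"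
      using K41_sum_rows[OF k, of a b] by simp
    have "(\<Sum>j\<in>N. of_real (k $ a $ j * k $ b $ j) *\<^sub>C F a b) = of_real (\<Sum>j\<in>N. k $ a $ j * k $ b $ j) *\<^sub>C F a b"
      by (simp only: of_real_sum complex_space.scale_sum_left)
    then show "(\<Sum>j\<in>N. of_real (k $ a $ j * k $ b $ j) *\<^sub>C F a b) = (if a = b then F a b else 0)"
      by (simp add: s)
  qed
  also have "\<dots> = (\<Sum>a\<in>N. F a a)" using N(1) by simp
  finally show ?thesis
    unfolding dual_sum_z_vec[OF f] dual_sum_z_vec[OF fk] sumN F_def by simp
qed

section \<open>Invariance of the generators under K\<close>

lemma K41_action_alg_hom:
  assumes "k \<in> K41"
  shows "alg_hom (K41_action k)"
  unfolding K41_action_def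
  by (intro alg_hom_tensor_map alg_hom_uea_map alg_hom_clifford_map clinear_Ad41 Ad41_bracket clinear_Ad_p41 Ad_p41_bform K41_SO41 assms)

lemma K41_uea_map:
  assumes "k \<in> K41"
  shows "alg_hom (uea_map (Ad41 k))" "uea_map (Ad41 k) (uea_of x) = uea_of (Ad41 k x)"
    "alg_hom (clifford_map (Ad_p41 k))" "clifford_map (Ad_p41 k) (clifford_of v) = clifford_of (Ad_p41 k v)"
  by (intro alg_hom_uea_map alg_hom_clifford_map clinear_Ad41 Ad41_bracket clinear_Ad_p41 Ad_p41_bform K41_SO41 assms)+

lemma alg_hom_dual_sum: "alg_hom g \<Longrightarrow> g (dual_sum f) = dual_sum (\<lambda>x y. g (f x y))"
  by (simp add: dual_sum_def alg_homD)

lemma unital_subalgebra_invariants: "unital_subalgebra K41_invariants"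
  unfolding unital_subalgebra_def K41_invariants_def
  by (auto simp: alg_homD(2)[OF K41_action_alg_hom] alg_homD(3)[OF K41_action_alg_hom]
      alg_homD(4)[OF K41_action_alg_hom] alg_homD(5)[OF K41_action_alg_hom])

lemma Dirac_dual_sum: "Dirac = dual_sum (\<lambda>x y. uea_of (Rep_p41 x) \<otimes>\<^sub>C clifford_of y)"
proof -
  have "clifford_of (Abs_p41 F\<^sub>4) = - clifford_of (p_basis True False)"
    using clinear_uminus[OF clinear_clifford_of, of "Abs_p41 F\<^sub>4"] by (simp add: p_basis_Abs)
  then show ?thesis
    unfolding Dirac_def dual_sum_def Rep_p_basis
    by (simp add: p_basis_Abs(1-3)[symmetric] p_vec_def tensor_minus uea_of_minus)
qed

lemma Dirac_invariant: "Dirac \<in> K41_invariants"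
proof -
  have "K41_action k Dirac = Dirac" if k: "k \<in> K41" for k
  proof -
    let ?f = "\<lambda>x y. uea_of (Rep_p41 x) \<otimes>\<^sub>C clifford_of y"
    have lin: "clinear Rep_p41" by (rule clinearI) (simp_all add: plus_p41.rep_eq scaleC_p41.rep_eq)
    have "bilin ?f"
      unfolding bilin_def by (intro conjI allI clinear_intros clinear_clifford_of clinear_compose[OF clinear_uea_of lin])
    then show ?thesis
      unfolding Dirac_dual_sum alg_hom_dual_sum[OF K41_action_alg_hom[OF k]] K41_action_tensor[OF k] K41_uea_map(2,4)[OF k]
        Rep_Ad_p41[OF k, symmetric]
      by (rule dual_sum_invariant[OF k])
  qed
  then show ?thesis by (simp add: K41_invariants_def)
qed

text \<open>In dual bases of p for the trace form, D_k is the sum of [e_i, e_j] tensor e^i e^j, and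
  each \<open>dual_sum\<close> brings a factor 4. Since \<open>spin_map\<close> no longer occurs,
  invariance follows from two uses of \<open>dual_sum_invariant\<close>.\<close>

lemma k_Dirac_dual_sum: "16 *\<^sub>C k_Dirac =
  dual_sum (\<lambda>x x'. dual_sum (\<lambda>y y'. uea_of (lie_bracket (Rep_p41 x) (Rep_p41 y)) \<otimes>\<^sub>C (clifford_of x' * clifford_of y')))"
proof -
  have num': "num1' = 1 - num1" "num2' = 1 - num2" using num_add by (simp_all add: eq_diff_eq add.commute)
  have four: "4 *\<^sub>C x = 2 *\<^sub>C x + 2 *\<^sub>C x" for x :: UC41 using scaleC_add_left[of 2 2 x] by simp
  show ?thesis
    unfolding k_Dirac_cmat dual_sum_def Rep_p_basis gam_def[symmetric]
    by (simp add: p_vec_def bracket_minus brackets_p brackets_p' uea_of_diff clinear_add[OF clinear_uea_of]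
        tensor_add_left tensor_diff_left tensor_add_right tensor_diff_right mult.assoc fock_simps lie_bracket_self
        clinear_scaleC[OF clinear_uea_of] clinear_zero[OF clinear_uea_of] tensor_zero uea_of_minus tensor_minus
        tensor_scaleC_left tensor_scaleC_right cmat_values fock scaleC_scaleC scaleC_add_right complex_space.scale_right_diff_distrib)
      (simp add: num' four right_diff_distrib left_diff_distrib tensor_diff_right tensor_add_right scaleC_add_right complex_space.scale_right_diff_distrib algebra_simps)
qed

lemma k_Dirac_invariant: "k_Dirac \<in> K41_invariants"
proof -
  have lin: "clinear Rep_p41" by (rule clinearI) (simp_all add: plus_p41.rep_eq scaleC_p41.rep_eq)
  have br: "clinear (\<lambda>x. lie_bracket (Rep_p41 x) y)" "clinear (\<lambda>x. lie_bracket y (Rep_p41 x))" for y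
    by (rule clinearI, simp_all add: clinear_add[OF lin] clinear_scaleC[OF lin] lie_bracket_add_left
        lie_bracket_add_right lie_bracket_scaleC_left lie_bracket_scaleC_right)+
  define f where "f x x' y y' = uea_of (lie_bracket (Rep_p41 x) (Rep_p41 y)) \<otimes>\<^sub>C (clifford_of x' * clifford_of y')" for x x' y y' :: p41
  have f: "clinear (\<lambda>x. f x x' y y')" "clinear (\<lambda>x'. f x x' y y')" "clinear (\<lambda>y. f x x' y y')" "clinear (\<lambda>y'. f x x' y y')" for x x' y y'
    unfolding f_def
    by (intro clinear_intros clinear_clifford_of clinear_compose[OF clinear_uea_of] br)+
  have b1: "bilin (f x x')" for x x' using f(3,4) by (simp add: bilin_def)
  have b2: "bilin (\<lambda>x x'. dual_sum (f x x'))"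
    unfolding bilin_def dual_sum_def by (intro conjI allI clinear_plus clinear_minus f)
  have "K41_action k (16 *\<^sub>C k_Dirac) = 16 *\<^sub>C k_Dirac" if k: "k \<in> K41" for k
  proof -
    let ?A = "Ad_p41 k"
    have "K41_action k (f x x' y y') = f (?A x) (?A x') (?A y) (?A y')" for x x' y y'
      by (simp add: f_def K41_action_tensor[OF k] K41_uea_map[OF k] alg_homD[OF K41_uea_map(3)[OF k]]
          Ad41_bracket[OF K41_SO41[OF k]] Rep_Ad_p41[OF k])
    then have "K41_action k (16 *\<^sub>C k_Dirac) = dual_sum (\<lambda>x x'. dual_sum (\<lambda>y y'. f (?A x) (?A x') (?A y) (?A y')))"
      unfolding k_Dirac_dual_sum f_def[symmetric] by (simp add: alg_hom_dual_sum[OF K41_action_alg_hom[OF k]])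
    also have "\<dots> = dual_sum (\<lambda>x x'. dual_sum (f (?A x) (?A x')))"
      by (simp only: dual_sum_invariant[OF k b1])
    also have "\<dots> = dual_sum (\<lambda>x x'. dual_sum (f x x'))"
      by (rule dual_sum_invariant[OF k b2])
    finally show ?thesis unfolding k_Dirac_dual_sum f_def[symmetric] .
  qed
  then show ?thesis
    by (simp add: K41_invariants_def alg_homD(5)[OF K41_action_alg_hom])
qed

text \<open>Vectors exchange the two chirality projections, so this carries an invariant supported
  on one chirality over to the other.\<close>

lemma dual_sum_gam_invariant:
  assumes y: "y \<in> K41_invariants"
  shows "dual_sum (\<lambda>v w. (1 \<otimes>\<^sub>C clifford_of v) * y * (1 \<otimes>\<^sub>C clifford_of w)) \<in> K41_invariants"
proof -
  let ?f = "\<lambda>v w. (1 \<otimes>\<^sub>C clifford_of v) * y * (1 \<otimes>\<^sub>C clifford_of w)"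
  have f: "bilin ?f"
    unfolding bilin_def by (intro conjI allI clinear_intros clinear_clifford_of)
  have "K41_action k (dual_sum ?f) = dual_sum ?f" if k: "k \<in> K41" for k
  proof -
    have "K41_action k (?f v w) = ?f (Ad_p41 k v) (Ad_p41 k w)" for v w
      using y k by (simp add: alg_homD(3)[OF K41_action_alg_hom[OF k]] K41_action_tensor[OF k] K41_uea_map[OF k]
          alg_homD(2)[OF K41_uea_map(1)[OF k]] K41_invariants_def)
    then show ?thesis
      using dual_sum_invariant[OF k f] by (simp add: alg_hom_dual_sum[OF K41_action_alg_hom[OF k]])
  qed
  then show ?thesis by (simp add: K41_invariants_def)
qed

text \<open>On one half-spin space D_k is a two by two matrix over the enveloping algebra of sl2;
  this is its quadratic equation. It expresses the Casimir element on that half by elements whose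
  invariance is already accessible.\<close>

lemma half_k_Dirac_square:
  "((1 \<otimes>\<^sub>C chir_proj c) * k_Dirac) * ((1 \<otimes>\<^sub>C chir_proj c) * k_Dirac) =
    casimir c \<otimes>\<^sub>C chir_proj c - 2 *\<^sub>C ((1 \<otimes>\<^sub>C chir_proj c) * k_Dirac)"
proof -
  obtain H E F :: so41C where sl2: "lie_bracket H E = 2 *\<^sub>C E" "lie_bracket H F = (-2) *\<^sub>C F" "lie_bracket E F = H"
    and cas: "casimir c = uea_of H * uea_of H + 2 *\<^sub>C (uea_of E * uea_of F + uea_of F * uea_of E)"
    and Q: "(1 \<otimes>\<^sub>C chir_proj c) * k_Dirac = 2 *\<^sub>C (uea_of E \<otimes>\<^sub>C cmat (c, True) (c, True))
      - 2 *\<^sub>C (uea_of F \<otimes>\<^sub>C cmat (c, False) (c, False)) - uea_of H \<otimes>\<^sub>C (cmat (c, False) (c, True) + cmat (c, True) (c, False))"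
  proof (cases c)
    case True
    show ?thesis
    proof (rule that[of "H\<^sub>1 + H\<^sub>2" E\<^sub>1 F\<^sub>1])
      show "casimir c = uea_of (H\<^sub>1 + H\<^sub>2) * uea_of (H\<^sub>1 + H\<^sub>2) + 2 *\<^sub>C (uea_of E\<^sub>1 * uea_of F\<^sub>1 + uea_of F\<^sub>1 * uea_of E\<^sub>1)"
        using True by (simp add: casimir_def)
    qed (simp_all add: True brackets_k k_Dirac_cmat distrib_left right_diff_distrib tensor_mult scaleC_mult_right chir_proj_cmat_mult tensor_zero)
  next
    case False
    show ?thesis
    \<comment> \<open>The signs of \<open>- E\<^sub>2\<close> and \<open>- F\<^sub>2\<close> give
      this chirality the same expression as the other, so that one computation serves both.\<close>
    proof (rule that[of "H\<^sub>1 - H\<^sub>2" "- E\<^sub>2" "- F\<^sub>2"])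
      show "casimir c = uea_of (H\<^sub>1 - H\<^sub>2) * uea_of (H\<^sub>1 - H\<^sub>2) + 2 *\<^sub>C (uea_of (- E\<^sub>2) * uea_of (- F\<^sub>2) + uea_of (- F\<^sub>2) * uea_of (- E\<^sub>2))"
        using False by (simp add: casimir_def uea_of_minus)
    qed (simp_all add: False brackets_k bracket_minus k_Dirac_cmat distrib_left right_diff_distrib tensor_mult scaleC_mult_right
        chir_proj_cmat_mult tensor_zero uea_of_minus tensor_minus)
  qed
  have comm: "uea_of H * uea_of E = uea_of E * uea_of H + 2 *\<^sub>C uea_of E"
    "uea_of H * uea_of F = uea_of F * uea_of H - 2 *\<^sub>C uea_of F"
    "uea_of E * uea_of F = uea_of F * uea_of E + uea_of H"
    using uea_of_bracket[of H E] uea_of_bracket[of H F] uea_of_bracket[of E F]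
    by (simp_all add: sl2 clinear_scaleC[OF clinear_uea_of] uea_of_minus algebra_simps)
  have four: "4 *\<^sub>C x = 2 *\<^sub>C x + 2 *\<^sub>C x" for x :: UC41 using scaleC_add_left[of 2 2 x] by simp
  show ?thesis
    unfolding Q unfolding cas chir_proj_cmat
    by (simp add: distrib_left distrib_right right_diff_distrib left_diff_distrib tensor_mult scaleC_mult_left scaleC_mult_right
        cmat_mult spin_form_def eps_def tensor_zero tensor_add_right tensor_diff_right tensor_minus scaleC_scaleC comm
        tensor_add_left tensor_diff_left tensor_scaleC_left scaleC_add_right complex_space.scale_right_diff_distrib four)
qed

text \<open>The quadratic equation gives the Casimir element on its own chirality; sandwiching by
  dual vectors, which yields a factor -16, gives it on the other. The two sum to the Casimir element
  tensor 1.\<close>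

lemma casimir_invariant:
  assumes P: "\<And>c. 1 \<otimes>\<^sub>C chir_proj c \<in> K41_invariants"
  shows "casimir c \<otimes>\<^sub>C 1 \<in> K41_invariants"
proof -
  note A = unital_subalgebraD[OF unital_subalgebra_invariants]
  let ?Q = "(1 \<otimes>\<^sub>C chir_proj c) * k_Dirac"
  have Q: "?Q \<in> K41_invariants" by (intro A P k_Dirac_invariant)
  have "?Q * ?Q + 2 *\<^sub>C ?Q \<in> K41_invariants" by (intro A Q)
  then have 1: "casimir c \<otimes>\<^sub>C chir_proj c \<in> K41_invariants"
    unfolding half_k_Dirac_square by simp
  have comm: "clifford_of (p_basis a b) * chir_proj c = chir_proj (\<not> c) * clifford_of (p_basis a b)" for a b
    using chir_proj_gam by (simp add: gam_def)
  have "dual_sum (\<lambda>v w. (1 \<otimes>\<^sub>C clifford_of v) * (casimir c \<otimes>\<^sub>C chir_proj c) * (1 \<otimes>\<^sub>C clifford_of w)) =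
     casimir c \<otimes>\<^sub>C (chir_proj (\<not> c) * dual_sum (\<lambda>v w. clifford_of v * clifford_of w))"
    by (simp add: dual_sum_def tensor_mult distrib_left right_diff_distrib tensor_add_right tensor_diff_right mult.assoc
        comm[THEN assoc_rule])
  also have "\<dots> = (-16) *\<^sub>C (casimir c \<otimes>\<^sub>C chir_proj (\<not> c))"
    by (simp add: dual_sum_clifford scaleC_mult_right tensor_scaleC_right tensor_minus)
  finally have "(-16) *\<^sub>C (casimir c \<otimes>\<^sub>C chir_proj (\<not> c)) \<in> K41_invariants"
    using dual_sum_gam_invariant[OF 1] by simp
  then have "(-1/16) *\<^sub>C (-16) *\<^sub>C (casimir c \<otimes>\<^sub>C chir_proj (\<not> c)) \<in> K41_invariants" by (rule A)
  then have 2: "casimir c \<otimes>\<^sub>C chir_proj (\<not> c) \<in> K41_invariants" by (simp add: scaleC_scaleC)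
  have "casimir c \<otimes>\<^sub>C 1 = casimir c \<otimes>\<^sub>C chir_proj c + casimir c \<otimes>\<^sub>C chir_proj (\<not> c)"
    unfolding chir_proj_add[symmetric] tensor_add_right by (cases c) (simp_all add: add.commute)
  then show ?thesis using A(3)[OF 1 2] by simp
qed

section \<open>The volume form and the chirality operator\<close>

lemma anticommuting_products:
  fixes z1 z2 z3 z4 :: "'a::complex_alg"
  assumes sq: "z1 * z1 = 0" "z2 * z2 = 0" "z3 * z3 = 0" "z4 * z4 = 0"
    and anti: "z2 * z1 = - (z1 * z2)" "z3 * z1 = - (z1 * z3)" "z3 * z2 = - (z2 * z3)"
      "z4 * z1 = - (z1 * z4)" "z4 * z2 = - (z2 * z4)" "z4 * z3 = - (z3 * z4)"
  shows isotropic_product: "(z1 - \<i> *\<^sub>C z2) * (z3 - \<i> *\<^sub>C z4) * (z1 + \<i> *\<^sub>C z2) * (z3 + \<i> *\<^sub>C z4) = 4 *\<^sub>C (z1 * z2 * z3 * z4)"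
    and pair_product: "(a1 *\<^sub>C z1 + a2 *\<^sub>C z2 + a3 *\<^sub>C z3 + a4 *\<^sub>C z4) * (b1 *\<^sub>C z1 + b2 *\<^sub>C z2 + b3 *\<^sub>C z3 + b4 *\<^sub>C z4) =
      (a1 * b2 - a2 * b1) *\<^sub>C (z1 * z2) + (a1 * b3 - a3 * b1) *\<^sub>C (z1 * z3) + (a1 * b4 - a4 * b1) *\<^sub>C (z1 * z4)
      + (a2 * b3 - a3 * b2) *\<^sub>C (z2 * z3) + (a2 * b4 - a4 * b2) *\<^sub>C (z2 * z4) + (a3 * b4 - a4 * b3) *\<^sub>C (z3 * z4)"
    and bivector_product: "(m12 *\<^sub>C (z1 * z2) + m13 *\<^sub>C (z1 * z3) + m14 *\<^sub>C (z1 * z4) + m23 *\<^sub>C (z2 * z3) + m24 *\<^sub>C (z2 * z4) + m34 *\<^sub>C (z3 * z4))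
      * (n12 *\<^sub>C (z1 * z2) + n13 *\<^sub>C (z1 * z3) + n14 *\<^sub>C (z1 * z4) + n23 *\<^sub>C (z2 * z3) + n24 *\<^sub>C (z2 * z4) + n34 *\<^sub>C (z3 * z4))
      = (m12 * n34 - m13 * n24 + m14 * n23 + m23 * n14 - m24 * n13 + m34 * n12) *\<^sub>C (z1 * z2 * z3 * z4)"
proof -
  note rules = sq anti sq[THEN assoc_rule] anti[THEN assoc_rule] mult.assoc scaleC_mult_left scaleC_mult_right
    scaleC_scaleC distrib_left distrib_right left_diff_distrib right_diff_distrib
  have four: "4 *\<^sub>C x = x + x + x + x" for x :: 'a
    using scaleC_add_left[of 2 2 x] scaleC_add_left[of 1 1 x] by (simp add: add.assoc)
  show "(z1 - \<i> *\<^sub>C z2) * (z3 - \<i> *\<^sub>C z4) * (z1 + \<i> *\<^sub>C z2) * (z3 + \<i> *\<^sub>C z4) = 4 *\<^sub>C (z1 * z2 * z3 * z4)"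
    unfolding four by (simp add: rules complex_space.scale_right_diff_distrib scaleC_add_right)
  show "(a1 *\<^sub>C z1 + a2 *\<^sub>C z2 + a3 *\<^sub>C z3 + a4 *\<^sub>C z4) * (b1 *\<^sub>C z1 + b2 *\<^sub>C z2 + b3 *\<^sub>C z3 + b4 *\<^sub>C z4) =
      (a1 * b2 - a2 * b1) *\<^sub>C (z1 * z2) + (a1 * b3 - a3 * b1) *\<^sub>C (z1 * z3) + (a1 * b4 - a4 * b1) *\<^sub>C (z1 * z4)
      + (a2 * b3 - a3 * b2) *\<^sub>C (z2 * z3) + (a2 * b4 - a4 * b2) *\<^sub>C (z2 * z4) + (a3 * b4 - a4 * b3) *\<^sub>C (z3 * z4)"
    by (simp add: rules complex_space.scale_left_diff_distrib mult.commute algebra_simps)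
  show "(m12 *\<^sub>C (z1 * z2) + m13 *\<^sub>C (z1 * z3) + m14 *\<^sub>C (z1 * z4) + m23 *\<^sub>C (z2 * z3) + m24 *\<^sub>C (z2 * z4) + m34 *\<^sub>C (z3 * z4))
      * (n12 *\<^sub>C (z1 * z2) + n13 *\<^sub>C (z1 * z3) + n14 *\<^sub>C (z1 * z4) + n23 *\<^sub>C (z2 * z3) + n24 *\<^sub>C (z2 * z4) + n34 *\<^sub>C (z3 * z4))
      = (m12 * n34 - m13 * n24 + m14 * n23 + m23 * n14 - m24 * n13 + m34 * n12) *\<^sub>C (z1 * z2 * z3 * z4)"
    by (simp add: rules complex_space.scale_left_diff_distrib scaleC_add_left mult.commute)
qed

lemma ext_of_anticommute: "ext_of y * ext_of x = - (ext_of x * ext_of y)"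
proof -
  have "ext_of (x + y) * ext_of (x + y) = 0" by (rule ext_of_square)
  then have "ext_of y * ext_of x + ext_of x * ext_of y = 0"
    by (simp add: clinear_add[OF clinear_ext_of] distrib_left distrib_right ext_of_square add.commute)
  then show ?thesis by (simp add: eq_neg_iff_add_eq_0)
qed

lemma clifford_map_antisymmetrize:
  assumes "alg_hom g" "\<And>v. g (clifford_of v) = clifford_of (f v)"
  shows "g (antisymmetrize vs) = antisymmetrize (map f vs)"
proof -
  have "g (prod_list (map clifford_of us)) = prod_list (map clifford_of (map f us))" for us
    by (induction us) (simp_all add: alg_homD(2,3)[OF assms(1)] assms(2))
  then have "g (prod_list (map clifford_of (permute_list \<alpha> vs))) = prod_list (map clifford_of (permute_list \<alpha> (map f vs)))"
    if "\<alpha> permutes {..<length vs}" for \<alpha>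
    unfolding permute_list_map[OF that] .
  then show ?thesis
    by (auto simp: antisymmetrize_def alg_homD(5,9)[OF assms(1)] intro!: sum.cong)
qed

definition top_list :: "p41 list" where
  "top_list = [p_basis False False, p_basis False True, p_basis True True, - p_basis True False]"

lemma rho_top_form: "rho top_form = 1 \<otimes>\<^sub>C antisymmetrize top_list"
proof -
  have "symmetrization (1 :: so41C sym_alg) = 1"
    using symmetrization_prod_list[of "[] :: so41C list"] by (simp add: symmetrize_def scaleC_one)
  then show ?thesis
    using chevalley_prod_list[of top_list]
    by (simp add: rho_def top_form_def tensor_map_tensor[OF clinear_symmetrization clinear_chevalley]
        top_list_def p_basis_Abs mult.assoc)
qed

text \<open>The volume element of p acts on the two half-spin spaces by opposite scalars, so the
  generator \<open>rho top_form\<close> amounts to the chirality operator.\<close>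

lemma antisymmetrize_top_list: "antisymmetrize top_list = (-16) *\<^sub>C (chir_proj True - chir_proj False)"
proof -
  have set: "{..<length top_list} = {0, 1, 2, 3::nat}" by (auto simp: top_list_def)
  have f: "finite {1, 2, 3::nat}" "0 \<notin> {1, 2, 3::nat}" "finite {2, 3::nat}" "1 \<notin> {2, 3::nat}"
    "finite {3::nat}" "2 \<notin> {3::nat}" by auto
  have minus: "clifford_of (- p_basis True False) = - gam True False"
    by (simp add: gam_def clinear_uminus[OF clinear_clifford_of])
  have upt: "[0..<Suc (Suc (Suc (Suc 0)))] = [0, 1, 2, 3]" by (simp add: upt_rec)
  have list: "prod_list (map clifford_of (permute_list \<alpha> top_list)) =
      clifford_of (top_list ! \<alpha> 0) * clifford_of (top_list ! \<alpha> 1) * clifford_of (top_list ! \<alpha> 2) * clifford_of (top_list ! \<alpha> 3)" for \<alpha>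
    by (simp add: permute_list_def top_list_def upt mult.assoc eval_nat_numeral)
  have nth: "clifford_of (top_list ! 0) = gam False False" "clifford_of (top_list ! 1) = gam False True"
    "clifford_of (top_list ! Suc 0) = gam False True"
    "clifford_of (top_list ! 2) = gam True True" "clifford_of (top_list ! 3) = - gam True False"
    by (simp_all add: top_list_def minus gam_def[symmetric])
  \<comment> \<open>384 = 24 * 16 for the twenty-four permutations, split into multiples of 64 = 8 *
    8, the coefficient of a product of two occupation numbers.\<close>
  have six: "384 *\<^sub>C x = 64 *\<^sub>C x + 64 *\<^sub>C x + 64 *\<^sub>C x + 64 *\<^sub>C x + 64 *\<^sub>C x + 64 *\<^sub>C x" for x :: "p41 clifford"
    by (simp flip: scaleC_add_left)
  have num': "num1' = 1 - num1" "num2' = 1 - num2" using num_add by (simp_all add: eq_diff_eq add.commute)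
  have "(\<Sum>\<alpha> | \<alpha> permutes {..<length top_list}. of_int (sign \<alpha>) *\<^sub>C prod_list (map clifford_of (permute_list \<alpha> top_list)))
     = (-384) *\<^sub>C (chir_proj True - chir_proj False)"
    unfolding set list
    unfolding sum_over_permutations_insert[OF f(1,2)]
    unfolding sum_over_permutations_insert[OF f(3,4)]
    unfolding sum_over_permutations_insert[OF f(5,6)]
    unfolding permutes_sing
    apply (simp add: sign_swap_id permutation_swap_id permutation_compose sign_compose sign_id nth swap_id_eq mult.assoc
        fock_simps scaleC_mult_left scaleC_mult_right scaleC_scaleC)
    by (simp add: chir_proj_def num' six algebra_simps)
  then show ?thesis
    by (simp add: antisymmetrize_def top_list_def scaleC_scaleC fact_numeral)
qed

text \<open>The determinant of the block of \<open>K\<close> on \<open>\<real>\<^sup>4\<close>, expanded along pairs of columns.\<close>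

definition top_det :: "real^5^5 \<Rightarrow> real" where
  "top_det k = (let m = (\<lambda>a b i j. k $ i $ a * k $ j $ b - k $ j $ a * k $ i $ b) in
     m 1 2 1 2 * m 3 4 3 4 - m 1 2 1 3 * m 3 4 2 4 + m 1 2 1 4 * m 3 4 2 3
     + m 1 2 2 3 * m 3 4 1 4 - m 1 2 2 4 * m 3 4 1 3 + m 1 2 3 4 * m 3 4 1 2)"

lemma antisymmetrize_top_list_z:
  assumes "clinear f"
  shows "antisymmetrize (map f top_list) = 4 *\<^sub>C chevalley (ext_of (f (z_vec 1)) * ext_of (f (z_vec 2)) * ext_of (f (z_vec 3)) * ext_of (f (z_vec 4)))"
proof -
  let ?e = "\<lambda>j. ext_of (f (z_vec j))"
  note lin = clinear_compose[OF clinear_ext_of assms]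
  have "prod_list (map ext_of (map f top_list)) = (?e 1 - \<i> *\<^sub>C ?e 2) * (?e 3 - \<i> *\<^sub>C ?e 4) * (?e 1 + \<i> *\<^sub>C ?e 2) * (?e 3 + \<i> *\<^sub>C ?e 4)"
    by (simp add: top_list_def p_basis_z_vec clinear_diff[OF lin] clinear_add[OF lin] clinear_scaleC[OF lin] clinear_uminus[OF lin] mult.assoc add.commute)
  also have "\<dots> = 4 *\<^sub>C (?e 1 * ?e 2 * ?e 3 * ?e 4)"
    by (rule isotropic_product) (rule ext_of_square ext_of_anticommute)+
  finally show ?thesis
    using chevalley_prod_list[of "map f top_list"] by (simp add: clinear_scaleC[OF clinear_chevalley])
qed

text \<open>Antisymmetrization factors through the exterior algebra, where the images of the four
  vectors multiply to the determinant times the volume form.\<close>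

lemma clifford_map_top_list:
  assumes k: "k \<in> K41"
  shows "clifford_map (Ad_p41 k) (antisymmetrize top_list) = of_real (top_det k) *\<^sub>C antisymmetrize top_list"
proof -
  let ?e = "\<lambda>j. ext_of (z_vec j)" and ?k = "\<lambda>i j. complex_of_real (k $ i $ j)"
  have Ad: "ext_of (Ad_p41 k (z_vec j)) = ?k 1 j *\<^sub>C ?e 1 + ?k 2 j *\<^sub>C ?e 2 + ?k 3 j *\<^sub>C ?e 3 + ?k 4 j *\<^sub>C ?e 4" if "j \<noteq> 5" for j
    by (simp add: Ad_z_vec[OF k that] clinear_add[OF clinear_ext_of] clinear_scaleC[OF clinear_ext_of])
  have ac: "ext_of (Ad_p41 k (z_vec 1)) * ext_of (Ad_p41 k (z_vec 2)) * (ext_of (Ad_p41 k (z_vec 3)) * ext_of (Ad_p41 k (z_vec 4)))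
      = of_real (top_det k) *\<^sub>C (?e 1 * ?e 2 * ?e 3 * ?e 4)"
    unfolding Ad[OF five_neq(1)] Ad[OF five_neq(2)] Ad[OF five_neq(3)] Ad[OF five_neq(4)]
    apply (subst pair_product, (rule ext_of_square ext_of_anticommute)+)
    apply (subst pair_product, (rule ext_of_square ext_of_anticommute)+)
    apply (subst bivector_product, (rule ext_of_square ext_of_anticommute)+)
    apply (simp add: top_det_def Let_def)
    done
  have "clifford_map (Ad_p41 k) (antisymmetrize top_list) = antisymmetrize (map (Ad_p41 k) top_list)"
    by (rule clifford_map_antisymmetrize[OF K41_uea_map(3,4)[OF k]])
  also have "\<dots> = of_real (top_det k) *\<^sub>C (4 *\<^sub>C chevalley (?e 1 * ?e 2 * ?e 3 * ?e 4))"
    unfolding antisymmetrize_top_list_z[OF clinear_Ad_p41[OF k]] using ac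
    by (simp add: mult.assoc clinear_scaleC[OF clinear_chevalley] scaleC_scaleC mult.commute)
  also have "4 *\<^sub>C chevalley (?e 1 * ?e 2 * ?e 3 * ?e 4) = antisymmetrize top_list"
    using antisymmetrize_top_list_z[OF clinear_ident] by simp
  finally show ?thesis .
qed

lemma chirality_fixed:
  assumes k: "k \<in> K41"
  shows "clifford_map (Ad_p41 k) (chir_proj True - chir_proj False) = chir_proj True - chir_proj False"
\<comment> \<open>Reading off the determinant cancels a scalar multiple of 1, which presupposes that
  C(p) is not zero; in the zero algebra the claim is trivial.\<close>
proof (cases "(1 :: p41 clifford) = 0")
  case True
  then have "x = 0" for x :: "p41 clifford" by (metis mult_1 mult_zero_left)
  then show ?thesis by metis
next
  case False
  let ?W = "chir_proj True - chir_proj False"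
  have act: "clifford_map (Ad_p41 k) ?W = of_real (top_det k) *\<^sub>C ?W" if k: "k \<in> K41" for k
  proof -
    have "(-1/16) *\<^sub>C clifford_map (Ad_p41 k) (antisymmetrize top_list) = (-1/16) *\<^sub>C of_real (top_det k) *\<^sub>C antisymmetrize top_list"
      by (simp add: clifford_map_top_list[OF k])
    then show ?thesis
      by (simp add: antisymmetrize_top_list alg_homD(5)[OF K41_uea_map(3)[OF k]] alg_homD(7)[OF K41_uea_map(3)[OF k]] scaleC_scaleC mult.commute
          del: complex_space.scale_right_diff_distrib)
  qed
  \<comment> \<open>An automorphism sends an involution to an involution, so the determinant has
    square 1; connectedness of K then excludes -1.\<close>
  have W: "?W * ?W = 1"
    by (simp add: left_diff_distrib right_diff_distrib chir_proj_mult chir_proj_add)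
  have "top_det k = 1"
  proof (rule K41_sign_constant[OF _ _ _ k])
    show "continuous_on K41 top_det"
      unfolding top_det_def Let_def by (intro continuous_intros continuous_on_entry)
    show "top_det (mat 1) = 1" by (simp add: top_det_def mat_def)
    fix k assume k: "k \<in> K41"
    have "1 = clifford_map (Ad_p41 k) (?W * ?W)" by (simp add: W alg_homD(2)[OF K41_uea_map(3)[OF k]])
    also have "\<dots> = clifford_map (Ad_p41 k) ?W * clifford_map (Ad_p41 k) ?W"
      by (rule alg_homD(3)[OF K41_uea_map(3)[OF k]])
    also have "\<dots> = of_real ((top_det k)\<^sup>2) *\<^sub>C 1"
      unfolding act[OF k] scaleC_mult_left scaleC_mult_right W
      by (simp add: scaleC_scaleC power2_eq_square)
    finally have "(1 - of_real ((top_det k)\<^sup>2)) *\<^sub>C (1 :: p41 clifford) = 0"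
      by (simp add: complex_space.scale_left_diff_distrib)
    then have "complex_of_real ((top_det k)\<^sup>2) = 1" using False by simp
    then have "(top_det k)\<^sup>2 = 1" by (metis of_real_eq_1_iff)
    then show "top_det k = 1 \<or> top_det k = - 1" by (simp add: power2_eq_1_iff)
  qed
  then show ?thesis using act[OF k] by (simp del: complex_space.scale_right_diff_distrib)
qed

lemma chir_proj_fixed:
  assumes k: "k \<in> K41"
  shows "clifford_map (Ad_p41 k) (chir_proj c) = chir_proj c"
proof -
  let ?g = "clifford_map (Ad_p41 k)"
  note hom = alg_homD[OF K41_uea_map(3)[OF k]]
  have two: "2 *\<^sub>C x = x + x" for x :: "p41 clifford" using scaleC_add_left[of 1 1 x] by simp
  have "2 *\<^sub>C chir_proj True = 1 + (chir_proj True - chir_proj False)" "2 *\<^sub>C chir_proj False = 1 - (chir_proj True - chir_proj False)"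
    unfolding chir_proj_add[symmetric] two by simp_all
  then have c: "2 *\<^sub>C chir_proj c = 1 + (if c then 1 else - 1) *\<^sub>C (chir_proj True - chir_proj False)"
    by (cases c) simp_all
  have "?g (2 *\<^sub>C chir_proj c) = 2 *\<^sub>C chir_proj c"
    unfolding c hom(2,4,5) chirality_fixed[OF k] ..
  then show ?thesis unfolding hom(5) by simp
qed

lemma chir_proj_invariant: "1 \<otimes>\<^sub>C chir_proj c \<in> K41_invariants"
  by (simp add: K41_invariants_def K41_action_tensor chir_proj_fixed alg_homD(2)[OF K41_uea_map(1)])

section \<open>One-parameter subgroups and equivariance\<close>

definition skew :: "5 \<Rightarrow> 5 \<Rightarrow> real^5^5" where
  "skew a b = (\<chi> i j. if i = a \<and> j = b then 1 else if i = b \<and> j = a then - 1 else 0)"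

text \<open>The complex structures on \<open>\<real>\<^sup>4\<close> by which the unit quaternions act from the left
  and from the right; each acts on the spinors of one chirality only.\<close>

definition quat :: "bool \<Rightarrow> nat \<Rightarrow> real^5^5" where
  "quat c n = (if n = 0 then (if c then skew 2 1 + skew 4 3 else skew 2 1 + skew 3 4)
     else if n = 1 then (if c then skew 1 3 + skew 4 2 else skew 3 1 + skew 4 2)
     else (if c then skew 4 1 + skew 3 2 else skew 4 1 + skew 2 3))"

text \<open>The exponential of \<theta> times \<open>quat c n\<close>, which squares to -1 on the
  first four coordinates and vanishes on the fifth.\<close>

definition rot5 :: "bool \<Rightarrow> nat \<Rightarrow> real \<Rightarrow> real^5^5" where
  "rot5 c n \<theta> = (\<chi> i j. (if i = j then (if i = 5 then 1 else cos \<theta>) else 0) + sin \<theta> * quat c n $ i $ j)"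

lemma rot5_orthogonal: "orthogonal_matrix (rot5 c n \<theta>)"
proof -
  have "sin \<theta> * sin \<theta> + cos \<theta> * cos \<theta> = 1"
    using sin_cos_squared_add[of \<theta>] by (simp add: power2_eq_square)
  then show ?thesis
    unfolding orthogonal_matrix vec_eq_iff all_5 matrix_matrix_mult_def transpose_def vec_lambda_beta sum_5
    by (simp add: rot5_def quat_def skew_def mat_def add.commute)
qed

lemma rot5_double: "rot5 c n \<theta> ** rot5 c n \<theta> = rot5 c n (2 * \<theta>)"
  unfolding vec_eq_iff all_5 matrix_matrix_mult_def vec_lambda_beta sum_5
  by (simp add: rot5_def quat_def skew_def sin_double cos_double power2_eq_square)

text \<open>The determinant is a sign, and it is the square of the determinant at half the
  angle.\<close>

lemma rot5_SO4xO1: "rot5 c n \<theta> \<in> SO4xO1"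
proof -
  have "det (rot5 c n \<theta>) = 1 \<or> det (rot5 c n \<theta>) = - 1"
    by (rule det_orthogonal_matrix[OF rot5_orthogonal])
  moreover have "det (rot5 c n \<theta>) = det (rot5 c n (\<theta> / 2)) * det (rot5 c n (\<theta> / 2))"
    using rot5_double[of c n "\<theta> / 2"] by (simp add: det_mul[symmetric])
  then have "det (rot5 c n \<theta>) \<ge> 0" by simp
  ultimately have "det (rot5 c n \<theta>) = 1" by linarith
  moreover have "\<forall>i. i \<noteq> 5 \<longrightarrow> rot5 c n \<theta> $ i $ 5 = 0 \<and> rot5 c n \<theta> $ 5 $ i = 0"
    unfolding all_5 by (simp add: rot5_def quat_def skew_def)
  ultimately show ?thesis by (simp add: SO4xO1_def rot5_orthogonal)
qed

lemma rot5_K41: "rot5 c n \<theta> \<in> K41"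
proof -
  have "continuous_on UNIV (\<lambda>\<theta>. (if i = j then (if i = (5::5) then 1 else cos \<theta>) else 0) + sin \<theta> * quat c n $ i $ j)" for i j
    by (cases "i = j"; cases "i = 5") (auto intro!: continuous_intros)
  then have "continuous_on UNIV (rot5 c n)"
    unfolding rot5_def[abs_def] by (intro continuous_on_vec_lambda)
  then have "connected (range (rot5 c n))"
    by (intro connected_continuous_image) (simp_all add: connected_UNIV)
  moreover have "mat 1 = rot5 c n 0" by (simp add: rot5_def mat_def vec_eq_iff)
  ultimately show ?thesis
    unfolding K41_def mem_Collect_eq connected_component_def
    using rot5_SO4xO1 by (intro exI[of _ "range (rot5 c n)"]) auto
qed

text \<open>As p is the tensor product of the two spinor planes, a quaternion acting from one side
  moves a single factor. The planes and signs in \<open>quat\<close> are matched here to the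
  matrices \<open>pauli\<close>.\<close>

lemma Ad_rot5_p_basis:
  assumes n: "n \<in> {0, 1, 2}"
  shows "Ad_p41 (rot5 True n \<theta>) (p_basis a b) = (\<Sum>d\<in>UNIV. rotation (pauli n) \<theta> d a *\<^sub>C p_basis d b)" (is ?T)
    and "Ad_p41 (rot5 False n \<theta>) (p_basis a b) = (\<Sum>d\<in>UNIV. rotation (pauli n) \<theta> d b *\<^sub>C p_basis a d)" (is ?F)
proof -
  note lin = clinear_Ad_p41[OF rot5_K41]
  note z = Ad_z_vec[OF rot5_K41 five_neq(1)] Ad_z_vec[OF rot5_K41 five_neq(2)]
    Ad_z_vec[OF rot5_K41 five_neq(3)] Ad_z_vec[OF rot5_K41 five_neq(4)]
  have four: "v = w" if "\<forall>i. i \<noteq> 5 \<longrightarrow> Rep_so41C (Rep_p41 v) $ i $ 5 = Rep_so41C (Rep_p41 w) $ i $ 5" for v w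
    using that by (intro p41_eqI) auto
  show ?T
    by (rule four, unfold all_5, insert n, cases a; cases b)
      (simp_all only: p_basis_z_vec clinear_diff[OF lin] clinear_add[OF lin] clinear_scaleC[OF lin] clinear_uminus[OF lin] z
        UNIV_bool, auto simp: UNIV_bool p_basis_z_vec Rep_p41_entry_simps Rep_z_vec z_mat_def rot5_def quat_def skew_def rotation_def pauli_def algebra_simps)
  show ?F
    by (rule four, unfold all_5, insert n, cases a; cases b)
      (simp_all only: p_basis_z_vec clinear_diff[OF lin] clinear_add[OF lin] clinear_scaleC[OF lin] clinear_uminus[OF lin] z
        UNIV_bool, auto simp: UNIV_bool p_basis_z_vec Rep_p41_entry_simps Rep_z_vec z_mat_def rot5_def quat_def skew_def rotation_def pauli_def algebra_simps)
qed

lemma rotation_det: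
  assumes "n \<in> {0, 1, 2}"
  shows "rotation (pauli n) \<theta> False False * rotation (pauli n) \<theta> True True =
    1 + rotation (pauli n) \<theta> False True * rotation (pauli n) \<theta> True False"
proof -
  have "complex_of_real (cos \<theta>) * complex_of_real (cos \<theta>) + complex_of_real (sin \<theta>) * complex_of_real (sin \<theta>) = 1"
    unfolding of_real_mult[symmetric] of_real_add[symmetric] by simp
  then show ?thesis using assms by (auto simp: rotation_def pauli_def algebra_simps)
qed

text \<open>A letter with indices of equal chirality hides a contraction over the opposite one. The
  rotation preserves it because its determinant is 1, as \<open>rotation_det\<close> states.\<close>

lemma Ad_rot5_letter_vec:
  assumes n: "n \<in> {0, 1, 2}"
  shows "Ad41 (rot5 c n \<theta>) (letter_vec \<alpha> \<beta>) = (\<Sum>\<alpha>'\<in>UNIV. \<Sum>\<beta>'\<in>UNIV.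
    (chiral_matrix c (rotation (pauli n) \<theta>) \<alpha>' \<alpha> * chiral_matrix c (rotation (pauli n) \<theta>) \<beta>' \<beta>) *\<^sub>C letter_vec \<alpha>' \<beta>')"
proof -
  define g where "g = rotation (pauli n) \<theta>"
  have det: "g False False * g True True = 1 + g False True * g True False"
    "g True True * g False False = 1 + g False True * g True False"
    using rotation_det[OF n, of \<theta>] by (simp_all add: g_def mult.commute)
  have lin: "clinear (Ad41 (rot5 c n \<theta>))" for c by (rule clinear_Ad41[OF K41_SO41[OF rot5_K41]])
  have linR: "clinear Rep_p41" by (rule clinearI) (simp_all add: plus_p41.rep_eq scaleC_p41.rep_eq)
  have v: "Ad41 (rot5 c n \<theta>) (p_vec a b) = (if c then g False a *\<^sub>C p_vec False b + g True a *\<^sub>C p_vec True b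
      else g False b *\<^sub>C p_vec a False + g True b *\<^sub>C p_vec a True)" for a b c
    using arg_cong[OF Ad_rot5_p_basis(1)[OF n, of \<theta> a b], of Rep_p41] arg_cong[OF Ad_rot5_p_basis(2)[OF n, of \<theta> a b], of Rep_p41]
    by (cases c) (simp_all add: Rep_Ad_p41[OF rot5_K41] Rep_p_basis UNIV_bool plus_p41.rep_eq scaleC_p41.rep_eq g_def add.commute)
  have anti: "lie_bracket (p_vec True a) (p_vec False b) = - lie_bracket (p_vec False b) (p_vec True a)"
    "lie_bracket (p_vec a True) (p_vec a False) = - lie_bracket (p_vec a False) (p_vec a True)" for a b c
    by (rule bracket_antisym)+
  have br: "Ad41 (rot5 c n \<theta>) (lie_bracket x y) = lie_bracket (Ad41 (rot5 c n \<theta>) x) (Ad41 (rot5 c n \<theta>) y)" for x y c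
    by (rule Ad41_bracket[OF K41_SO41[OF rot5_K41]])
  obtain c1 a c2 b where ab: "\<alpha> = (c1, a)" "\<beta> = (c2, b)" by (cases \<alpha>; cases \<beta>) auto
  show ?thesis
    unfolding ab g_def[symmetric] sum_spinor
    by (cases c; cases c1; cases c2; cases a; cases b)
      (simp_all add: letter_vec_def chiral_matrix_def clinear_diff[OF lin] clinear_add[OF lin] clinear_uminus[OF lin] br v lie_bracket_add_left lie_bracket_add_right
        lie_bracket_scaleC_left lie_bracket_scaleC_right scaleC_add_right complex_space.scale_right_diff_distrib scaleC_scaleC
        bracket_minus lie_bracket_self anti det scaleC_add_left mult.commute algebra_simps)
qed

text \<open>The chirality projections are fixed by K, so only the vectors inside \<open>cmat\<close>
  move; as for letters, a determinant equal to 1 makes the hidden contractions invariant.\<close>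

lemma rot5_cmat:
  assumes n: "n \<in> {0, 1, 2}"
  shows "clifford_map (Ad_p41 (rot5 c n \<theta>)) (cmat \<alpha> \<beta>) = (\<Sum>\<alpha>'\<in>UNIV. \<Sum>\<beta>'\<in>UNIV.
    (chiral_matrix c (rotation (pauli n) \<theta>) \<alpha>' \<alpha> * chiral_matrix c (rotation (pauli n) \<theta>) \<beta>' \<beta>) *\<^sub>C cmat \<alpha>' \<beta>')"
proof -
  let ?f = "\<lambda>c. clifford_map (Ad_p41 (rot5 c n \<theta>))"
  define g where "g = rotation (pauli n) \<theta>"
  have det: "g False False * g True True = 1 + g False True * g True False"
    "g True True * g False False = 1 + g False True * g True False"
    using rotation_det[OF n, of \<theta>] by (simp_all add: g_def mult.commute)
  note hom = alg_homD[OF K41_uea_map(3)[OF rot5_K41]]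
  have v: "?f c (gam a b) = (if c then g False a *\<^sub>C gam False b + g True a *\<^sub>C gam True b
      else g False b *\<^sub>C gam a False + g True b *\<^sub>C gam a True)" for a b c
    unfolding gam_def K41_uea_map(4)[OF rot5_K41]
    using Ad_rot5_p_basis[OF n, of \<theta> a b]
    by (cases c) (simp_all add: UNIV_bool clinear_add[OF clinear_clifford_of] clinear_scaleC[OF clinear_clifford_of] g_def add.commute)
  note P = chir_proj_fixed[OF rot5_K41]
  have 1: "gam a b * chir_proj True = 8 *\<^sub>C cmat (False, b) (True, a)" "gam a b * chir_proj False = cmat (True, a) (False, b)" for a b
    by (simp_all add: cmat_def scaleC_scaleC)
  have def1: "cmat (True, a) (True, b) = (1/8) *\<^sub>C (gam a False * gam b True * chir_proj True)"
    "cmat (True, a) (False, b) = gam a b * chir_proj False"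
    "cmat (False, a) (True, b) = (1/8) *\<^sub>C (gam b a * chir_proj True)"
    "cmat (False, a) (False, b) = (1/8) *\<^sub>C (gam False a * gam True b * chir_proj False)" for a b
    by (simp_all add: cmat_def)
  have act: "?f c (cmat (True, a) (True, b)) = (1/8) *\<^sub>C (?f c (gam a False) * ?f c (gam b True) * chir_proj True)"
    "?f c (cmat (True, a) (False, b)) = ?f c (gam a b) * chir_proj False"
    "?f c (cmat (False, a) (True, b)) = (1/8) *\<^sub>C (?f c (gam b a) * chir_proj True)"
    "?f c (cmat (False, a) (False, b)) = (1/8) *\<^sub>C (?f c (gam False a) * ?f c (gam True b) * chir_proj False)" for a b c
    unfolding def1 by (simp_all add: hom P)
  have gm: "gam a b * cmat (False, d) \<beta> = eps b d *\<^sub>C cmat (True, a) \<beta>"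
    "gam a b * cmat (True, d) \<beta> = (8 * eps a d) *\<^sub>C cmat (False, b) \<beta>" for a b d \<beta>
    by (simp_all add: gam_cmat[of a b] distrib_right scaleC_mult_left cmat_mult spin_form_def scaleC_scaleC)
  obtain c1 a c2 b where ab: "\<alpha> = (c1, a)" "\<beta> = (c2, b)" by (cases \<alpha>; cases \<beta>) auto
  show ?thesis
    unfolding ab g_def[symmetric] sum_spinor
    by (cases c; cases c1; cases c2; cases a; cases b)
      (simp_all only: act v if_True if_False, simp_all add: chiral_matrix_def distrib_left distrib_right scaleC_mult_left scaleC_mult_right mult.assoc gm 1 eps_def
        scaleC_scaleC scaleC_add_right det scaleC_add_left mult.commute algebra_simps)
qed

section \<open>Invariant lifts and the generation theorem\<close>

lemma span_image_sum:
  assumes "finite J" "x \<in> cspan (b ` J)"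
  obtains s where "x = (\<Sum>j\<in>J. s j *\<^sub>C b j)"
proof -
  have "\<exists>s. x = (\<Sum>j\<in>J. s j *\<^sub>C b j)"
    using assms(2)
  proof (induction rule: complex_space.span_induct_alt)
    case base
    then show ?case by (intro exI[of _ "\<lambda>_. 0"]) simp
  next
    case (step c x y)
    then obtain j s where j: "j \<in> J" "x = b j" "y = (\<Sum>j\<in>J. s j *\<^sub>C b j)" by auto
    have "c *\<^sub>C x + y = (\<Sum>i\<in>J. (if i = j then c *\<^sub>C b i else 0) + s i *\<^sub>C b i)"
      using assms(1) j by (simp add: sum.distrib)
    also have "\<dots> = (\<Sum>i\<in>J. ((if i = j then c else 0) + s i) *\<^sub>C b i)"
      by (rule sum.cong) (auto simp: scaleC_add_left)
    finally show ?case by (intro exI[of _ "\<lambda>i. (if i = j then c else 0) + s i"])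
  qed
  then show ?thesis using that by blast
qed

lemma monomial_equivariant:
  assumes f: "alg_hom f"
    and letter: "\<And>\<alpha> \<beta>. f (uea_of (letter_vec \<alpha> \<beta>)) = (\<Sum>\<alpha>'\<in>UNIV. \<Sum>\<beta>'\<in>UNIV. (M \<alpha>' \<alpha> * M \<beta>' \<beta>) *\<^sub>C uea_of (letter_vec \<alpha>' \<beta>'))"
    and d: "distinct (slot_list ls)"
  shows "f (monomial ls w) = (\<Sum>v\<in>assignments (set (slot_list ls)). (\<Prod>i\<in>set (slot_list ls). M (v i) (w i)) *\<^sub>C monomial ls v)"
  using d
proof (induction ls)
  case Nil
  then show ?case by (simp add: alg_homD(2)[OF f] assignments_empty)
next
  case (Cons pq ls)
  obtain p q where pq: "pq = (p, q)" by (cases pq)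
  let ?S = "set (slot_list ls)"
  have notin: "p \<notin> insert q ?S" "q \<notin> ?S" using Cons.prems by (auto simp: pq)
  have set: "set (slot_list (pq # ls)) = insert p (insert q ?S)" by (simp add: pq)
  have prod: "(\<Prod>i\<in>insert p (insert q ?S). M ((v(q := \<beta>, p := \<alpha>)) i) (w i)) = M \<alpha> (w p) * (M \<beta> (w q) * (\<Prod>i\<in>?S. M (v i) (w i)))" for v \<alpha> \<beta>
  proof -
    have "(\<Prod>i\<in>?S. M ((v(q := \<beta>, p := \<alpha>)) i) (w i)) = (\<Prod>i\<in>?S. M (v i) (w i))"
      using notin by (intro prod.cong) auto
    then show ?thesis using notin by simp
  qed
  have "f (monomial (pq # ls) w) = (\<Sum>\<alpha>\<in>UNIV. \<Sum>\<beta>\<in>UNIV. (M \<alpha> (w p) * M \<beta> (w q)) *\<^sub>C uea_of (letter_vec \<alpha> \<beta>)) *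
      (\<Sum>v\<in>assignments ?S. (\<Prod>i\<in>?S. M (v i) (w i)) *\<^sub>C monomial ls v)"
    using Cons by (simp add: pq alg_homD(3)[OF f] letter)
  also have "\<dots> = (\<Sum>\<alpha>\<in>UNIV. \<Sum>\<beta>\<in>UNIV. \<Sum>v\<in>assignments ?S. (M \<alpha> (w p) * (M \<beta> (w q) * (\<Prod>i\<in>?S. M (v i) (w i)))) *\<^sub>C
      (uea_of (letter_vec \<alpha> \<beta>) * monomial ls v))"
    unfolding sum_distrib_right unfolding sum_distrib_left
    by (simp add: scaleC_mult_left scaleC_mult_right scaleC_scaleC mult.assoc mult.left_commute mult.commute)
  also have "\<dots> = (\<Sum>v\<in>assignments (insert p (insert q ?S)). (\<Prod>i\<in>insert p (insert q ?S). M (v i) (w i)) *\<^sub>C monomial (pq # ls) v)"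
    unfolding sum_assignments_insert[OF notin(1)] sum_assignments_insert[OF notin(2)] prod
    using notin by (intro sum.cong refl) (auto simp: pq monomial_upd)
  finally show ?case unfolding set .
qed

text \<open>Slots 0 and 1 are reserved for the Clifford factor, hence the offset 2.\<close>

definition std_slots :: "nat \<Rightarrow> (nat \<times> nat) list" where
  "std_slots m = map (\<lambda>i. (2 * i + 2, 2 * i + 3)) [0..<m]"

lemma std_slots: "length (std_slots m) = m" "slot_list (std_slots m) = [2..<2 * m + 2]"
proof -
  show "length (std_slots m) = m" by (simp add: std_slots_def)
  show "slot_list (std_slots m) = [2..<2 * m + 2]"
    by (induction m) (simp_all add: std_slots_def)
qed

lemma std_slots_set: "set (0 # 1 # slot_list (std_slots m)) = {..<2 * m + 2}"
  by (auto simp: std_slots)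

lemma std_slots_distinct: "distinct (0 # 1 # slot_list (std_slots m))"
  by (simp add: std_slots)

definition std_monomial :: "nat \<Rightarrow> (nat \<Rightarrow> spinor) \<Rightarrow> UC41" where
  "std_monomial m w = monomial (std_slots m) w \<otimes>\<^sub>C cmat (w 0) (w 1)"

lemma std_monomial_filt: "m < n \<Longrightarrow> std_monomial m w \<in> tensor_filt n"
  unfolding std_monomial_def monomial_def by (intro tensor_filt_base uea_filt_base) (simp add: std_slots)

lemma contraction_std: "contraction 0 1 (std_slots m) t = (\<Sum>w\<in>assignments {..<2 * m + 2}. t w *\<^sub>C std_monomial m w)"
  unfolding contraction_def std_monomial_def std_slots_set[symmetric] by simp

lemma std_monomial_equivariant:
  assumes n: "n \<in> {0, 1, 2}"
  shows "K41_action (rot5 c n \<theta>) (std_monomial m w) = (\<Sum>v\<in>assignments {..<2 * m + 2}.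
    (\<Prod>i\<in>{..<2 * m + 2}. chiral_matrix c (rotation (pauli n) \<theta>) (v i) (w i)) *\<^sub>C std_monomial m v)"
proof -
  let ?M = "chiral_matrix c (rotation (pauli n) \<theta>)" and ?k = "rot5 c n \<theta>"
  let ?S = "set (slot_list (std_slots m))"
  have notin: "0 \<notin> insert 1 ?S" "1 \<notin> ?S" using std_slots_distinct[of m] by auto
  have set: "{..<2 * m + 2} = insert 0 (insert 1 ?S)" using std_slots_set[of m] by simp
  have prod: "(\<Prod>i\<in>insert 0 (insert 1 ?S). ?M ((v(1 := \<beta>, 0 := \<alpha>)) i) (w i)) = ?M \<alpha> (w 0) * (?M \<beta> (w 1) * (\<Prod>i\<in>?S. ?M (v i) (w i)))" for v \<alpha> \<beta>
  proof -
    have "(\<Prod>i\<in>?S. ?M ((v(1 := \<beta>, 0 := \<alpha>)) i) (w i)) = (\<Prod>i\<in>?S. ?M (v i) (w i))"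
      using notin by (intro prod.cong refl) (metis fun_upd_other insert_iff)
    then show ?thesis using notin by simp
  qed
  have u: "uea_map (Ad41 ?k) (monomial (std_slots m) w) = (\<Sum>v\<in>assignments ?S. (\<Prod>i\<in>?S. ?M (v i) (w i)) *\<^sub>C monomial (std_slots m) v)"
  proof (rule monomial_equivariant[OF K41_uea_map(1)[OF rot5_K41]])
    show "uea_map (Ad41 ?k) (uea_of (letter_vec \<alpha> \<beta>)) = (\<Sum>\<alpha>'\<in>UNIV. \<Sum>\<beta>'\<in>UNIV. (?M \<alpha>' \<alpha> * ?M \<beta>' \<beta>) *\<^sub>C uea_of (letter_vec \<alpha>' \<beta>'))" for \<alpha> \<beta>
      unfolding K41_uea_map(2)[OF rot5_K41] Ad_rot5_letter_vec[OF n]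
      by (simp add: clinear_sum[OF clinear_uea_of] clinear_scaleC[OF clinear_uea_of])
    show "distinct (slot_list (std_slots m))" by (simp add: std_slots)
  qed
  note linl = clinear_tensor_left[OF clinear_ident] and linr = clinear_tensor_right[OF clinear_ident]
  have "K41_action ?k (std_monomial m w) = (\<Sum>v\<in>assignments ?S. (\<Prod>i\<in>?S. ?M (v i) (w i)) *\<^sub>C monomial (std_slots m) v) \<otimes>\<^sub>C
      (\<Sum>\<alpha>\<in>UNIV. \<Sum>\<beta>\<in>UNIV. (?M \<alpha> (w 0) * ?M \<beta> (w 1)) *\<^sub>C cmat \<alpha> \<beta>)"
    by (simp add: std_monomial_def K41_action_tensor[OF rot5_K41] u rot5_cmat[OF n])
  also have "\<dots> = (\<Sum>\<alpha>\<in>UNIV. \<Sum>\<beta>\<in>UNIV. \<Sum>v\<in>assignments ?S. (?M \<alpha> (w 0) * (?M \<beta> (w 1) * (\<Prod>i\<in>?S. ?M (v i) (w i)))) *\<^sub>C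
      (monomial (std_slots m) v \<otimes>\<^sub>C cmat \<alpha> \<beta>))"
    by (simp add: clinear_sum[OF linl] clinear_sum[OF linr] tensor_scaleC_left tensor_scaleC_right scaleC_scaleC
        complex_space.scale_sum_right mult.assoc)
  also have "\<dots> = (\<Sum>v\<in>assignments (insert 0 (insert 1 ?S)). (\<Prod>i\<in>insert 0 (insert 1 ?S). ?M (v i) (w i)) *\<^sub>C std_monomial m v)"
    unfolding sum_assignments_insert[OF notin(1)] sum_assignments_insert[OF notin(2)] prod
    using notin by (intro sum.cong refl) (auto simp: std_monomial_def monomial_upd)
  finally show ?thesis unfolding set .
qed

text \<open>Step n + 1 of the filtration holds words of at most n letters, so the lengths m \<le> n
  all occur. Arbitrary letters are expanded in \<open>letter_vec\<close>, arbitrary Clifford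
  elements in \<open>cmat\<close>.\<close>

lemma tensor_filt_std_monomials:
  "tensor_filt (Suc n) \<subseteq> cspan ((\<lambda>(m, w). std_monomial m w) ` Sigma {..n} (\<lambda>m. assignments {..<2 * m + 2}))"
proof -
  let ?B = "(\<lambda>(m, w). std_monomial m w) ` Sigma {..n} (\<lambda>m. assignments {..<2 * m + 2})"
  define word :: "(spinor \<times> spinor) list \<Rightarrow> so41C uea" where "word as = prod_list (map (\<lambda>(\<alpha>, \<beta>). uea_of (letter_vec \<alpha> \<beta>)) as)" for as
  have words: "word as \<otimes>\<^sub>C cmat \<gamma> \<delta> \<in> ?B" if "length as \<le> n" for as \<gamma> \<delta>
  proof -
    \<comment> \<open>The assignment w lists the indices of the word: letter k, counted from 0,
      occupies the slots 2 k + 2 and 2 k + 3.\<close>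
    let ?m = "length as"
    define w where "w i = (if i = 0 then \<gamma> else if i = 1 then \<delta> else if i < 2 * ?m + 2
      then (if even i then fst (as ! ((i - 2) div 2)) else snd (as ! ((i - 2) div 2))) else (False, False))" for i
    have w: "w \<in> assignments {..<2 * ?m + 2}" by (auto simp: assignments_def w_def)
    have wi: "w (2 * i + 2) = fst (as ! i)" "w (2 * i + 3) = snd (as ! i)" if "i < ?m" for i
      using that by (auto simp: w_def)
    have "map (\<lambda>i. uea_of (letter_vec (w (2 * i + 2)) (w (2 * i + 3)))) [0..<?m] = map (\<lambda>i. (\<lambda>(\<alpha>, \<beta>). uea_of (letter_vec \<alpha> \<beta>)) (as ! i)) [0..<?m]"
      by (rule map_cong) (auto simp only: wi case_prod_beta set_upt atLeastLessThan_iff)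
    also have "\<dots> = map (\<lambda>(\<alpha>, \<beta>). uea_of (letter_vec \<alpha> \<beta>)) (map ((!) as) [0..<?m])" by simp
    finally have "map (\<lambda>i. uea_of (letter_vec (w (2 * i + 2)) (w (2 * i + 3)))) [0..<?m] = map (\<lambda>(\<alpha>, \<beta>). uea_of (letter_vec \<alpha> \<beta>)) as"
      unfolding map_nth .
    then have "monomial (std_slots ?m) w = word as"
      by (simp add: monomial_def std_slots_def word_def o_def)
    moreover have "w 0 = \<gamma>" "w 1 = \<delta>" by (simp_all add: w_def)
    ultimately have "word as \<otimes>\<^sub>C cmat \<gamma> \<delta> = (\<lambda>(m, w). std_monomial m w) (?m, w)"
      by (simp add: std_monomial_def)
    then show ?thesis using w that by blast
  qed
  have prods: "prod_list (map uea_of xs) \<in> cspan {word as |as. length as = length xs}" for xs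
  proof (induction xs)
    case Nil
    then show ?case by (auto simp: word_def intro!: complex_space.span_base exI[of _ "[]"])
  next
    case (Cons x xs)
    have 1: "uea_of (letter_vec \<alpha> \<beta>) * y \<in> cspan {word as |as. length as = length (x # xs)}"
      if "y \<in> cspan {word as |as. length as = length xs}" for \<alpha> \<beta> y
      using that
    proof (rule clinear_span_image[rotated -1])
      fix y assume "y \<in> {word as |as. length as = length xs}"
      then obtain as where "y = word as" "length as = length xs" by auto
      then show "uea_of (letter_vec \<alpha> \<beta>) * y \<in> cspan {word as |as. length as = length (x # xs)}"
        by (intro complex_space.span_base CollectI exI[of _ "(\<alpha>, \<beta>) # as"]) (simp add: word_def)
    qed (intro clinear_intros)
    have "uea_of x * prod_list (map uea_of xs) \<in> cspan {word as |as. length as = length (x # xs)}"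
      using 1[OF Cons.IH]
      by (intro clinear_span_image[OF clinear_mult_right[OF clinear_uea_of] _ letter_vec_span[of x]]) auto
    then show ?case by simp
  qed
  have uc: "prod_list (map uea_of xs) \<otimes>\<^sub>C c \<in> cspan ?B" if "length xs \<le> n" for xs c
  proof (rule clinear_span_image[OF clinear_tensor_right[OF clinear_ident] _ clifford_cmat_span[of c]])
    fix d assume "d \<in> range (\<lambda>(\<alpha>, \<beta>). cmat \<alpha> \<beta>)"
    then obtain \<gamma> \<delta> where d: "d = cmat \<gamma> \<delta>" by auto
    show "prod_list (map uea_of xs) \<otimes>\<^sub>C d \<in> cspan ?B"
      unfolding d
    proof (rule clinear_span_image[OF clinear_tensor_left[OF clinear_ident] _ prods])
      fix u assume "u \<in> {word as |as. length as = length xs}"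
      then show "u \<otimes>\<^sub>C cmat \<gamma> \<delta> \<in> cspan ?B"
        using that by (intro complex_space.span_base) (clarify, rule words, simp)
    qed
  qed
  have "u \<otimes>\<^sub>C c \<in> cspan ?B" if "u \<in> uea_filt (Suc n)" for u c
    using that unfolding uea_filt_def
    by (rule clinear_span_image[OF clinear_tensor_left[OF clinear_ident], rotated]) (use uc in auto)
  then show ?thesis
    unfolding tensor_filt_def by (intro complex_space.span_minimal complex_space.subspace_span) auto
qed

text \<open>The matrices \<open>pauli\<close> are skew-Hermitian, so the inverse rotation is the
  adjoint; this supplies the unitarity that \<open>invariant_lift\<close> asks for.\<close>

lemma chiral_matrix_adjoint:
  assumes "n \<in> {0, 1, 2}"
  shows "chiral_matrix c (rotation (pauli n) (- \<theta>)) \<alpha> \<beta> = cnj (chiral_matrix c (rotation (pauli n) \<theta>) \<beta> \<alpha>)"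
  using assms by (cases \<alpha>; cases \<beta>) (auto simp: chiral_matrix_def rotation_def pauli_def)

text \<open>Words of different lengths may satisfy relations, so x is lifted to the direct sum of
  the tensor spaces of all ranks 2 m + 2 with m \<le> n. Only the top component of the lift is
  retained.\<close>

lemma invariant_leading_term:
  assumes x: "x \<in> tensor_filt (Suc n)" "x \<in> K41_invariants"
  obtains t where "spin_inv {..<2 * n + 2} t" "x - contraction 0 1 (std_slots n) t \<in> tensor_filt n"
proof -
  define J where "J = Sigma {..n} (\<lambda>m. assignments {..<2 * m + 2})"
  define b where "b = (\<lambda>(m, w). std_monomial m w)"
  define G :: "(bool \<times> nat \<times> real) set" where "G = UNIV \<times> {0, 1, 2} \<times> UNIV"
  define \<kappa> where "\<kappa> = (\<lambda>(c, n, \<theta>). K41_action (rot5 c n \<theta>))"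
  \<comment> \<open>Block diagonal in the degree: rotations act inside each tensor space, so every
    component of an invariant lift is itself invariant.\<close>
  define M where "M = (\<lambda>(c, n, \<theta>) (m', v) (m :: nat, w). if m' = m then
      \<Prod>i\<in>{..<2 * m + 2}. chiral_matrix c (rotation (pauli n) \<theta>) (v i) (w i) else 0)"
  have J: "finite J" by (simp add: J_def finite_assignments)
  have sumJ: "(\<Sum>j\<in>J. f j) = (\<Sum>m\<le>n. \<Sum>w\<in>assignments {..<2 * m + 2}. f (m, w))" for f :: "_ \<Rightarrow> 'z::comm_monoid_add"
    unfolding J_def by (subst sum.Sigma) (simp_all add: finite_assignments)
  have "x \<in> cspan (b ` J)"
    using x(1) tensor_filt_std_monomials[of n] by (auto simp: b_def J_def)
  then obtain s where s: "x = (\<Sum>j\<in>J. s j *\<^sub>C b j)" using span_image_sum[OF J] by blast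
  obtain t where t: "x = (\<Sum>j\<in>J. t j *\<^sub>C b j)" and inv: "\<And>g j. g \<in> G \<Longrightarrow> j \<in> J \<Longrightarrow> (\<Sum>i\<in>J. M g j i * t i) = t j"
  proof (rule invariant_lift[OF J s, where G = G and \<kappa> = \<kappa> and M = M])
    show "clinear (\<kappa> g)" if "g \<in> G" for g
      using alg_homD(1)[OF K41_action_alg_hom[OF rot5_K41]] by (cases g) (auto simp: \<kappa>_def)
    show "\<kappa> g (b j) = (\<Sum>i\<in>J. M g i j *\<^sub>C b i)" if g: "g \<in> G" and j: "j \<in> J" for g j
    proof -
      obtain c n' \<theta> where g': "g = (c, n', \<theta>)" "n' \<in> {0, 1, 2}" using g by (auto simp: G_def)
      obtain m w where j': "j = (m, w)" "m \<le> n" using j by (auto simp: J_def)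
      have "(\<Sum>i\<in>J. M g i j *\<^sub>C b i) = (\<Sum>m'\<le>n. if m' = m then (\<Sum>v\<in>assignments {..<2 * m + 2}.
          (\<Prod>i\<in>{..<2 * m + 2}. chiral_matrix c (rotation (pauli n') \<theta>) (v i) (w i)) *\<^sub>C std_monomial m v) else 0)"
        unfolding sumJ by (rule sum.cong) (auto simp: M_def b_def g' j')
      also have "\<dots> = \<kappa> g (b j)"
        using j' by (simp add: \<kappa>_def b_def g' std_monomial_equivariant[OF g'(2)])
      finally show ?thesis by simp
    qed
    show "\<exists>h\<in>G. \<forall>i\<in>J. \<forall>j\<in>J. M h i j = cnj (M g j i)" if g: "g \<in> G" for g
    proof -
      obtain c n' \<theta> where g': "g = (c, n', \<theta>)" "n' \<in> {0, 1, 2}" using g by (auto simp: G_def)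
      show ?thesis
        using g' by (intro bexI[of _ "(c, n', - \<theta>)"]) (auto simp: M_def G_def chiral_matrix_adjoint)
    qed
    show "\<kappa> g x = x" if "g \<in> G" for g
      using x(2) rot5_K41 by (auto simp: \<kappa>_def K41_invariants_def split: prod.split)
  qed blast
  let ?I = "{..<2 * n + 2}"
  \<comment> \<open>Assignments carry default values outside the slots, whereas
    \<open>spin_inv\<close> speaks of all functions; the restriction to the slots extends u to
    them.\<close>
  define u where "u w = t (n, w)" for w
  have "spin_inv ?I (\<lambda>w. u (restrict_slots ?I w))"
  proof (rule rotation_invariant_spin_inv)
    fix c n' \<theta> w assume n': "n' \<in> {0, 1, 2 :: nat}" and w: "w \<in> assignments ?I"
    have "u w = (\<Sum>i\<in>J. M (c, n', \<theta>) (n, w) i * t i)"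
      using n' w by (subst inv) (auto simp: G_def J_def u_def)
    also have "\<dots> = (\<Sum>m'\<le>n. if m' = n then (\<Sum>v\<in>assignments ?I.
          (\<Prod>i\<in>?I. chiral_matrix c (rotation (pauli n') \<theta>) (w i) (v i)) * u v) else 0)"
      unfolding sumJ by (rule sum.cong) (auto simp: M_def u_def)
    also have "\<dots> = (\<Sum>v\<in>assignments ?I. (\<Prod>i\<in>?I. chiral_matrix c (rotation (pauli n') \<theta>) (w i) (v i)) * u v)"
      by simp
    finally show "(\<Sum>v\<in>assignments ?I. (\<Prod>i\<in>?I. chiral_matrix c (rotation (pauli n') \<theta>) (w i) (v i)) * u v) = u w" ..
  qed simp
  moreover have "x - contraction 0 1 (std_slots n) (\<lambda>w. u (restrict_slots ?I w)) \<in> tensor_filt n"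
  proof -
    have "contraction 0 1 (std_slots n) (\<lambda>w. u (restrict_slots ?I w)) = (\<Sum>w\<in>assignments ?I. u w *\<^sub>C std_monomial n w)"
      unfolding contraction_std
    proof (rule sum.cong[OF refl])
      fix w assume "w \<in> assignments ?I"
      then have "restrict_slots ?I w = w" by (auto simp: restrict_slots_def assignments_def)
      then show "u (restrict_slots ?I w) *\<^sub>C std_monomial n w = u w *\<^sub>C std_monomial n w" by simp
    qed
    moreover have "{..n} = insert n {..<n}" by auto
    ultimately have "x - contraction 0 1 (std_slots n) (\<lambda>w. u (restrict_slots ?I w)) =
        (\<Sum>m<n. \<Sum>w\<in>assignments {..<2 * m + 2}. t (m, w) *\<^sub>C std_monomial m w)"
      unfolding t sumJ b_def u_def by simp
    also have "\<dots> \<in> tensor_filt n"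
      by (intro tensor_filt_sum tensor_filt_closed(4) std_monomial_filt) simp
    finally show ?thesis .
  qed
  ultimately show ?thesis by (rule that)
qed

text \<open>Subtracting an element of A keeps x invariant, because A consists of invariants. The
  reduction can thus be repeated until the filtration reaches the zero space.\<close>

lemma (in spin_subalgebra) invariants_subset:
  assumes "A \<subseteq> K41_invariants"
  shows "K41_invariants \<subseteq> A"
proof -
  have "x \<in> A" if "x \<in> tensor_filt n" "x \<in> K41_invariants" for n x
    using that
  proof (induction n arbitrary: x)
    case 0
    then show ?case using tensor_filt_0 unital_subalgebraD(2)[OF subalgebra] by metis
  next
    case (Suc n)
    obtain t where t: "spin_inv {..<2 * n + 2} t" "x - contraction 0 1 (std_slots n) t \<in> tensor_filt n"
      using invariant_leading_term[OF Suc.prems] by blast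
    have "cong (length (std_slots n)) (contraction 0 1 (std_slots n) t)"
      using t(1) unfolding std_slots_set[symmetric] by (rule cong_contraction[OF std_slots_distinct])
    then obtain a where a: "a \<in> A" "contraction 0 1 (std_slots n) t - a \<in> tensor_filt n"
      by (auto simp: congruent_to_def std_slots)
    have "x - a \<in> tensor_filt n"
      using tensor_filt_closed(2)[OF t(2) a(2)] by simp
    moreover have "x - a \<in> K41_invariants"
      using Suc.prems(2) a(1) assms unital_subalgebraD(7)[OF unital_subalgebra_invariants] by blast
    ultimately have "x - a \<in> A" by (rule Suc.IH)
    then show ?case using unital_subalgebraD(3)[OF subalgebra _ a(1)] by fastforce
  qed
  then show ?thesis using tensor_filt_exhaustive by blast
qed

section \<open>The generators of the theorem in spinor coordinates\<close>

lemma symmetrization_pair: "symmetrization (sym_of v * sym_of w) = (1/2) *\<^sub>C (uea_of v * uea_of w + uea_of w * uea_of v)"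
proof -
  let ?t = "Transposition.transpose 0 (Suc 0)"
  have set: "{..<Suc (Suc 0)} = {0, Suc 0}" by auto
  have "id \<noteq> ?t" by (metis id_apply transpose_apply_first n_not_Suc_n)
  moreover have "permute_list ?t [v, w] = [w, v]" using permute_list_swap[of "[]" v w "[]"] by simp
  moreover have "{\<alpha>. \<alpha> permutes {..<Suc (Suc 0)}} = {id, ?t}"
    unfolding set by (auto simp: permutes_doubleton_iff)
  ultimately have "symmetrize [v, w] = (1/2) *\<^sub>C (uea_of v * uea_of w + uea_of w * uea_of v)"
    by (simp add: symmetrize_def)
  then show ?thesis using symmetrization_prod_list[of "[v, w]"] by simp
qed

lemma rho_casimir: "rho a\<^sub>1 = casimir True \<otimes>\<^sub>C 1" "rho a\<^sub>2 = casimir False \<otimes>\<^sub>C 1"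
proof -
  have one: "chevalley (1 :: p41 ext_alg) = 1"
    using chevalley_prod_list[of "[] :: p41 list"] by (simp add: antisymmetrize_def scaleC_one sign_id)
  note lin = clinear_symmetrization
  have double: "(1/2) *\<^sub>C (x + x) = x" for x :: "so41C uea"
    using scaleC_add_left[of "1/2" "1/2" x] by (simp add: scaleC_add_right)
  have "sym_of H\<^sub>1 - sym_of H\<^sub>2 = sym_of (H\<^sub>1 - H\<^sub>2)" by (simp add: clinear_diff[OF clinear_sym_of])
  then show "rho a\<^sub>1 = casimir True \<otimes>\<^sub>C 1" "rho a\<^sub>2 = casimir False \<otimes>\<^sub>C 1"
    by (simp_all add: rho_def a\<^sub>1_def a\<^sub>2_def tensor_map_tensor[OF clinear_symmetrization clinear_chevalley] one
        power2_eq_square clinear_add[OF clinear_sym_of, symmetric] clinear_add[OF lin] clinear_scaleC[OF lin]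
        symmetrization_pair double casimir_def scaleC_scaleC)
qed

theorem theorem3p2:
  shows "K41_invariants = generated_subalgebra {rho a\<^sub>1, rho a\<^sub>2, rho top_form, Dirac, k_Dirac}"
proof -
  define A where "A = generated_subalgebra {rho a\<^sub>1, rho a\<^sub>2, rho top_form, Dirac, k_Dirac}"
  have subalgebra: "unital_subalgebra A"
    unfolding A_def by (rule hull_in) (auto simp: unital_subalgebra_def)
  note sub = unital_subalgebraD[OF subalgebra]
  have mem: "rho a\<^sub>1 \<in> A" "rho a\<^sub>2 \<in> A" "rho top_form \<in> A" "Dirac \<in> A" "k_Dirac \<in> A"
    unfolding A_def by (rule hull_inc, simp)+
  have top: "rho top_form = (-16) *\<^sub>C (1 \<otimes>\<^sub>C (chir_proj True - chir_proj False))"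
    by (simp add: rho_top_form antisymmetrize_top_list tensor_scaleC_right tensor_minus)
  \<comment> \<open>The volume form divided by -16 is the difference of the chirality projections
    and 1 is their sum, so each projection is half of 1 plus or minus that quotient.\<close>
  have proj: "1 \<otimes>\<^sub>C chir_proj c \<in> A" for c
  proof -
    have two: "2 *\<^sub>C x = x + x" for x :: UC41 using scaleC_add_left[of 1 1 x] by simp
    have W: "(-1/16) *\<^sub>C rho top_form = 1 \<otimes>\<^sub>C chir_proj True - 1 \<otimes>\<^sub>C chir_proj False"
      unfolding top by (simp add: scaleC_scaleC tensor_diff_right)
    have one: "(1 :: UC41) = 1 \<otimes>\<^sub>C chir_proj True + 1 \<otimes>\<^sub>C chir_proj False"
      unfolding tensor_add_right[symmetric] chir_proj_add by (rule tensor_one[symmetric])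
    have "(1/2) *\<^sub>C (1 + (-1/16) *\<^sub>C rho top_form) = 1 \<otimes>\<^sub>C chir_proj True"
      "(1/2) *\<^sub>C (1 - (-1/16) *\<^sub>C rho top_form) = 1 \<otimes>\<^sub>C chir_proj False"
      unfolding W one by (simp_all flip: two add: scaleC_scaleC)
    moreover have "(1/2) *\<^sub>C (1 + (-1/16) *\<^sub>C rho top_form) \<in> A" "(1/2) *\<^sub>C (1 - (-1/16) *\<^sub>C rho top_form) \<in> A"
      by (intro sub mem)+
    ultimately show ?thesis by (cases c) simp_all
  qed
  interpret spin_subalgebra A
  proof
    show "unital_subalgebra A" by (rule subalgebra)
    show "1 \<otimes>\<^sub>C chir_proj c \<in> A" for c by (rule proj)
    show "gen_X \<in> A" unfolding gen_X_eq by (intro sub mem proj)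
    show "casimir c \<otimes>\<^sub>C 1 \<in> A" for c using mem rho_casimir by (cases c) simp_all
  qed
  have "1 \<otimes>\<^sub>C (chir_proj True - chir_proj False) \<in> K41_invariants"
    unfolding tensor_diff_right by (intro unital_subalgebraD[OF unital_subalgebra_invariants] chir_proj_invariant)
  then have "rho top_form \<in> K41_invariants"
    unfolding top by (intro unital_subalgebraD[OF unital_subalgebra_invariants])
  then have "A \<subseteq> K41_invariants"
    unfolding A_def using Dirac_invariant k_Dirac_invariant casimir_invariant[OF chir_proj_invariant]
    by (intro hull_minimal unital_subalgebra_invariants) (simp add: rho_casimir)
  then show ?thesis using invariants_subset unfolding A_def by blast
qed

end
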